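(* Let $\mathrm{Re}(x)>0$ and $\mathrm{Re}(\mu+\lambda)>0$. Let $M>0$ be an integer. If $\mathrm{Re}(z)>-M$, then $$2\sum_{n=1}^\infty\left(\frac{nx}{2}\right)^{z-\lambda}{}_{\mu}K_{z}(nx,\lambda)+\frac{2^{z+\mu+\lambda-1}\Gamma(z)\Gamma\left(\frac{1}{2}+\lambda+\mu\right)}{\Gamma\left(\frac{1}{2}+\lambda-z\right)}-\frac{\sqrt{\pi}\,2^{\mu+z+\lambda}\,\Gamma(\lambda+\mu)\Gamma\left(z+\frac{1}{2}\right)}{x\,\Gamma(\lambda-z)}$$ $$=\frac{2^{\mu+\lambda-z}}{\sqrt{\pi}}\left(\frac{x}{\pi}\right)^{2z}\frac{\Gamma\left(z+\frac{1}{2}\right)\Gamma\left(\frac{1}{2}+\lambda+\mu+z\right)}{\Gamma\left(\frac{1}{2}+\lambda\right)}\sum_{n=1}^\infty\frac{1}{n^{2z+1}}\Bigg\{{}_2F_1\left(\frac{1}{2}+z,\frac{1}{2}+\lambda+\mu+z;\frac{1}{2}+\lambda;-\frac{x^2}{4\pi^2n^2}\right)$$ $$\qquad-\sum_{m=0}^{M-1}\frac{\left(\frac{1}{2}+z\right)_m\left(\frac{1}{2}+\lambda+\mu+z\right)_m}{m!\left(\frac{1}{2}+\lambda\right)_m}\left(-\frac{x^2}{4\pi^2n^2}\right)^{m}\Bigg\}$$ $$\qquad+\frac{2^{\mu+\lambda-z}}{\sqrt{\pi}}\left(\frac{x}{\pi}\right)^{2z}\sum_{m=0}^{M-1}\frac{\Gamma\left(z+\frac{1}{2}+m\right)\Gamma\left(\frac{1}{2}+\lambda+\mu+z+m\right)\zeta(2z+2m+1)}{m!\,\Gamma\left(\frac{1}{2}+\lambda+m\right)}\left(-\frac{x^2}{4\pi^2}\right)^{m},$$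 with limiting values taken at the poles $z=0,-\frac12,-1,-\frac32,\ldots,-M+\frac12$.
   Context: $\zeta$ is the Riemann zeta function and $(a)_m=\Gamma(a+m)/\Gamma(a)$. ${}_1F_2(a;b_1,b_2;\xi)=\sum_{n\ge0}\frac{(a)_n}{(b_1)_n(b_2)_n}\frac{\xi^n}{n!}$. ${}_2F_1(a,b;c;\xi)$ is the Gauss hypergeometric function, given for $\mathrm{Re}(c)>\mathrm{Re}(b)>0$ and $|\arg(1-\xi)|<\pi$ by $\frac{\Gamma(c)}{\Gamma(b)\Gamma(c-b)}\int_0^1t^{b-1}(1-t)^{c-b-1}(1-t\xi)^{-a}\,dt$, and by analytic continuation in the parameters otherwise. For $z\in\mathbb{C}\setminus(\mathbb{Z}\setminus\{0\})$ and $x,\mu,\lambda\in\mathbb{C}$ with $\mu+\lambda\ne-\frac12,-\frac32,-\frac52,\ldots$, the two-parameter generalized modified Bessel function is $${}_{\mu}K_{z}(x,\lambda)=\frac{\pi x^\lambda 2^{\mu+z-1}}{\sin(z\pi)}\Bigg\{\left(\frac{x}{2}\right)^{-z}\frac{\Gamma(\mu+\lambda+\frac12)}{\Gamma(1-z)\Gamma(\lambda+\frac12-z)}\,{}_1F_2\left(\mu+\lambda+\tfrac12;\lambda+\tfrac12-z,1-z;\frac{x^2}{4}\right)$$ $$\qquad-\left(\frac{x}{2}\right)^{z}\frac{\Gamma(\mu+z+\lambda+\frac12)}{\Gamma(1+z)\Gamma(\lambda+\frac12)}\,{}_1F_2\left(\mu+z+\lambda+\tfrac12;\lambda+\tfrac12,1+z;\frac{x^2}{4}\right)\Bigg\},$$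 with ${}_{\mu}K_{0}(x,\lambda)=\lim_{z\to0}{}_{\mu}K_{z}(x,\lambda)$. *)

theory Defs
  imports "HOL-Complex_Analysis.Complex_Analysis" "HOL-Library.Nonpos_Ints"
begin

(* Analytic continuation of the Dirichlet series to the connected set - {1}, hence unique there;
   the value at 1 is left unspecified. *)
definition riemann_zeta :: "complex \<Rightarrow> complex" where
  "riemann_zeta = (SOME f. f holomorphic_on (- {1}) \<and>
     (\<forall>s. Re s > 1 \<longrightarrow> (\<lambda>n. 1 / of_nat (Suc n) powr s) sums f s))"

definition hyp1F2 :: "complex \<Rightarrow> complex \<Rightarrow> complex \<Rightarrow> complex \<Rightarrow> complex" where
  "hyp1F2 a b1 b2 \<xi> =
     (\<Sum>n. pochhammer a n / (pochhammer b1 n * pochhammer b2 n) * (\<xi> ^ n / fact n))"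

(* For 1 - \<xi> off the closed negative real axis, the principal power (1 - t \<xi>) powr (-a)
   is continuous in t \<in> [0,1]. *)
definition euler_2F1 :: "complex \<Rightarrow> complex \<Rightarrow> complex \<Rightarrow> complex \<Rightarrow> complex" where
  "euler_2F1 a b c \<xi> = Gamma c / (Gamma b * Gamma (c - b)) *
     integral {0..1} (\<lambda>t::real. of_real t powr (b - 1) * (1 - of_real t) powr (c - b - 1) *
                               (1 - of_real t * \<xi>) powr (- a))"

(* F is, for fixed a and \<xi>, the continuation of Euler's integral in the parameters (b, c), as a
   separately holomorphic function, from 0 < Re b < Re c to all b and all c that are not
   non-positive integers. *)
definition continues_euler_2F1 ::
    "complex \<Rightarrow> complex \<Rightarrow> (complex \<Rightarrow> complex \<Rightarrow> complex) \<Rightarrow> bool" where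
  "continues_euler_2F1 a \<xi> F \<longleftrightarrow>
     (\<forall>b c. 0 < Re b \<and> Re b < Re c \<longrightarrow> F b c = euler_2F1 a b c \<xi>) \<and>
     (\<forall>c. c \<notin> \<int>\<^sub>\<le>\<^sub>0 \<longrightarrow> (\<lambda>b. F b c) holomorphic_on UNIV) \<and>
     (\<forall>b. (\<lambda>c. F b c) holomorphic_on (- \<int>\<^sub>\<le>\<^sub>0))"

(* Meaningful for 1 - \<xi> \<notin> \<real>\<^sub>\<le>\<^sub>0 and c \<notin> \<int>\<^sub>\<le>\<^sub>0. The continuation is unique there: for Re c > 0 it is
   determined in b by its values for 0 < Re b < Re c, and then, for every b, in c by its values
   for Re c > 0. *)
definition hyp2F1 :: "complex \<Rightarrow> complex \<Rightarrow> complex \<Rightarrow> complex \<Rightarrow> complex" where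
  "hyp2F1 a b c \<xi> = (SOME F. continues_euler_2F1 a \<xi> F) b c"

definition gen_bessel_K_formula ::
    "complex \<Rightarrow> complex \<Rightarrow> complex \<Rightarrow> complex \<Rightarrow> complex" where
  "gen_bessel_K_formula \<mu> z x l =
     of_real pi * x powr l * 2 powr (\<mu> + z - 1) / sin (z * of_real pi) *
       ((x / 2) powr (- z) * Gamma (\<mu> + l + 1/2) / (Gamma (1 - z) * Gamma (l + 1/2 - z)) *
          hyp1F2 (\<mu> + l + 1/2) (l + 1/2 - z) (1 - z) (x ^ 2 / 4)
        - (x / 2) powr z * Gamma (\<mu> + z + l + 1/2) / (Gamma (1 + z) * Gamma (l + 1/2)) *
          hyp1F2 (\<mu> + z + l + 1/2) (l + 1/2) (1 + z) (x ^ 2 / 4))"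

(* The function usually written with \<mu> and z as left and right subscripts of K, and arguments
   (x, \<lambda>); here l stands for \<lambda>.
   The formula has removable singularities in z at every integer (not only at 0), and, because
   1F2(a; b1, b2; \<xi>) / Gamma b1 is entire in b1, also where l + 1/2 - z is a non-positive
   integer. At all of these z the value is the limit. For l + 1/2 a non-positive integer the
   formula, taken literally, is not meaningful, and no convention is made. *)
definition gen_bessel_K :: "complex \<Rightarrow> complex \<Rightarrow> complex \<Rightarrow> complex \<Rightarrow> complex" where
  "gen_bessel_K \<mu> z x l =
     (if z \<in> \<int> \<or> l + 1/2 - z \<in> \<int>\<^sub>\<le>\<^sub>0
      then Lim (at z) (\<lambda>w. gen_bessel_K_formula \<mu> w x l)
      else gen_bessel_K_formula \<mu> z x l)"

end

(* The left side is reduced to the sum over n of a function Phi of n x that is, up to an elementary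
   factor, the generalized Bessel function. For Re (c) > Re (a) > 0 it is a Beta average over y of
   the modified Bessel kernel at n x sqrt(y), so the classical formula (a partial fraction
   expansion of coth, integrated) for sums of Bessel functions can be averaged term by term. The
   average of (1 + y x^2 / (4 pi^2 k^2))^(-z-1/2) is Euler's integral for the 2F1 on the right.
   This gives the identity for 0 < Re z < 1/2 when Re (l) is large. Contiguous relations in the
   lower parameter, which pair the identities for (z, d) and (z + 1, d + 1), then reach every
   admissible l, and analytic continuation in z reaches Re z > -M: subtracting the first M Taylor
   terms of the 2F1 makes the sum over n converge there, and for Re z > 0 the subtracted terms sum
   to zeta values. *)
theory Submission
  imports Defs
begin

section \<open>Integrals over the unit interval depending on parameters\<close>

text \<open>Write a = 1/2 + \<lambda> + \<mu> and d = 1/2 + \<lambda>. Averaging over y samples the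
  Bessel kernel near 0 and thereby destroys its exponential decay; what remains is n^(-2 \<sigma>)
  with \<sigma> < Re a, and Re (\<mu> + \<lambda>) > 0 is what leaves room for 1/2 < \<sigma>. The
  kernel itself is taken as a Beta integral of exp (- u / sqrt s): n enters only through the
  exponential, so the sum over n is geometric and coth appears. The strip comes from this integral:
  Re z < 1/2 is convergence at s = 1, and Re z > 0 makes the terms split off from coth separately
  integrable. The lower parameter of \<open>Phi\<close> is c = d - z. A contiguous relation that
  keeps c while z grows by 1 raises d by 1, which forces the pairing of identities. At integers z,
  and where d - z is a non-positive integer, the Bessel function is only a limit. Reciprocal Gamma
  factors make the 1F2 entire in its lower parameters, so these limits become values of holomorphic
  functions with locally uniform majorants. The choices that define zeta and the 2F1 are pinned down
  by constructing the continuations.\<close>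

lemma LINT_has_field_derivative:
  fixes f :: "complex \<Rightarrow> 'a \<Rightarrow> complex"
  assumes U: "open U" and z: "z \<in> U"
    and meas: "\<And>z. z \<in> U \<Longrightarrow> f z \<in> borel_measurable M"
    and hol: "\<And>t. t \<in> space M \<Longrightarrow> (\<lambda>z. f z t) holomorphic_on U"
    and dom: "\<exists>r>0. \<exists>g. integrable M g \<and> (\<forall>w\<in>ball z r \<inter> U. \<forall>t\<in>space M. norm (f w t) \<le> g t)"
  shows "((\<lambda>z. LINT t|M. f z t) has_field_derivative (LINT t|M. deriv (\<lambda>z. f z t) z)) (at z)"
proof -
  from dom obtain r0 g where r0: "r0 > 0" and g: "integrable M g"
    and bd0: "\<And>w t. w \<in> ball z r0 \<inter> U \<Longrightarrow> t \<in> space M \<Longrightarrow> norm (f w t) \<le> g t" by blast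
  from U z obtain r1 where r1: "r1 > 0" "ball z r1 \<subseteq> U" using open_contains_ball by blast
  define r where "r = min r0 r1"
  have r: "r > 0" "ball z r \<subseteq> U" "ball z r \<subseteq> ball z r0 \<inter> U" using r0 r1 by (auto simp: r_def)
  have bd: "norm (f w t) \<le> g t" if "w \<in> ball z r" "t \<in> space M" for w t
    using bd0 r that by blast
  have inte: "integrable M (f w)" if "w \<in> ball z r" for w
    using that r bd by (intro Bochner_Integration.integrable_bound[OF g] meas AE_I2) fastforce+
  \<comment> \<open>Cauchy's estimate on discs of radius r/4 about points of the half-radius ball
    turns domination of \<open>f\<close> into domination of its derivative; the mean value bound
    \<open>lip\<close> then dominates the difference quotients.\<close>
  have db: "norm (deriv (\<lambda>z. f z t) w) \<le> g t / (r/4)" if w: "w \<in> ball z (r/2)" and t: "t \<in> space M" for w t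
  proof -
    have sub: "cball w (r/4) \<subseteq> ball z r"
    proof
      fix y assume "y \<in> cball w (r/4)"
      thus "y \<in> ball z r" using w dist_triangle[of z y w] r by (auto simp: dist_commute)
    qed
    have h: "(\<lambda>z. f z t) holomorphic_on ball z r" using hol[OF t] r(2) holomorphic_on_subset by blast
    have "norm ((deriv ^^ 1) (\<lambda>z. f z t) w) \<le> fact 1 * g t / (r/4)^1"
    proof (rule Cauchy_inequality)
      show "(\<lambda>z. f z t) holomorphic_on ball w (r/4)" using h sub by (meson ball_subset_cball holomorphic_on_subset)
      show "continuous_on (cball w (r/4)) (\<lambda>z. f z t)" using h sub by (meson holomorphic_on_imp_continuous_on holomorphic_on_subset)
      show "0 < r/4" using r by simp
      fix y assume "norm (w - y) = r/4"
      hence "y \<in> cball w (r/4)" by (simp add: dist_norm)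
      thus "norm (f y t) \<le> g t" using sub bd t by blast
    qed
    thus ?thesis by simp
  qed
  have lip: "norm (f (z+h) t - f z t) \<le> g t / (r/4) * norm h" if h: "h \<in> ball 0 (r/2)" and t: "t \<in> space M" for h t
  proof -
    have "norm (f (z+h) t - f z t) \<le> g t / (r/4) * norm (z + h - z)"
    proof (rule field_differentiable_bound[of "ball z (r/2)" _ "deriv (\<lambda>z. f z t)"])
      fix w assume w: "w \<in> ball z (r/2)"
      hence "w \<in> U" using r by auto
      hence "((\<lambda>z. f z t) has_field_derivative deriv (\<lambda>z. f z t) w) (at w)"
        using holomorphic_derivI[OF hol[OF t] U] by blast
      thus "((\<lambda>z. f z t) has_field_derivative deriv (\<lambda>z. f z t) w) (at w within ball z (r/2))"
        by (rule has_field_derivative_at_within)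
      show "norm (deriv (\<lambda>z. f z t) w) \<le> g t / (r/4)" by (rule db[OF w t])
    qed (use h r in \<open>auto simp: dist_norm\<close>)
    thus ?thesis by simp
  qed
  \<comment> \<open>Dominated convergence speaks of sequences, so the limit of the difference
    quotient is tested along arbitrary null sequences in the punctured ball.\<close>
  have "((\<lambda>h. ((LINT t|M. f (z+h) t) - (LINT t|M. f z t)) / h) \<longlongrightarrow> (LINT t|M. deriv (\<lambda>z. f z t) z)) (at 0 within ball 0 (r/2))"
    unfolding tendsto_at_iff_sequentially
  proof (intro allI impI)
    fix X :: "nat \<Rightarrow> complex" assume X: "\<forall>i. X i \<in> ball 0 (r/2) - {0}" and lim: "X \<longlonglongrightarrow> 0"
    have inz: "z + X n \<in> ball z r" for n using X r by (auto simp: dist_norm dest!: spec[of _ n])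
    have Xn: "X n \<in> ball 0 (r/2)" "X n \<noteq> 0" for n using X by auto
    have q: "(LINT t|M. (f (z + X n) t - f z t) / X n) = ((LINT t|M. f (z + X n) t) - (LINT t|M. f z t)) / X n" for n
      using inte[OF inz] inte[of z] r by simp
    have ptw: "(\<lambda>n. (f (z + X n) t - f z t) / X n) \<longlonglongrightarrow> deriv (\<lambda>z. f z t) z" if t: "t \<in> space M" for t
    proof -
      have "((\<lambda>z. f z t) has_field_derivative deriv (\<lambda>z. f z t) z) (at z)"
        using holomorphic_derivI[OF hol[OF t] U z] by blast
      hence "((\<lambda>h. (f (z + h) t - f z t) / h) \<longlongrightarrow> deriv (\<lambda>z. f z t) z) (at 0)"
        by (simp add: DERIV_def)
      thus ?thesis unfolding tendsto_at_iff_sequentially using Xn lim by (auto simp: o_def)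
    qed
    have m: "(\<lambda>t. (f (z + X n) t - f z t) / X n) \<in> borel_measurable M" for n
      using inte[OF inz] inte[of z] r by (intro borel_measurable_divide borel_measurable_diff) auto
    have "(\<lambda>n. LINT t|M. (f (z + X n) t - f z t) / X n) \<longlonglongrightarrow> (LINT t|M. deriv (\<lambda>z. f z t) z)"
    proof (rule integral_dominated_convergence[where w = "\<lambda>t. g t / (r/4)"])
      show "(\<lambda>t. deriv (\<lambda>z. f z t) z) \<in> borel_measurable M"
        by (rule borel_measurable_LIMSEQ_metric[OF m ptw])
      show "integrable M (\<lambda>t. g t / (r/4))" using g by simp
      show "AE t in M. (\<lambda>n. (f (z + X n) t - f z t) / X n) \<longlonglongrightarrow> deriv (\<lambda>z. f z t) z"
        using ptw by (intro AE_I2)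
      show "AE t in M. norm ((f (z + X n) t - f z t) / X n) \<le> g t / (r/4)" for n
      proof (rule AE_I2)
        fix t assume t: "t \<in> space M"
        show "norm ((f (z + X n) t - f z t) / X n) \<le> g t / (r/4)"
          using lip[OF Xn(1) t, of n] Xn(2)[of n] by (simp add: norm_divide field_simps)
      qed
    qed (rule m)
    thus "((\<lambda>h. ((LINT t|M. f (z+h) t) - (LINT t|M. f z t)) / h) \<circ> X) \<longlonglongrightarrow> (LINT t|M. deriv (\<lambda>z. f z t) z)"
      unfolding o_def q .
  qed
  hence "((\<lambda>h. ((LINT t|M. f (z+h) t) - (LINT t|M. f z t)) / h) \<longlongrightarrow> (LINT t|M. deriv (\<lambda>z. f z t) z)) (at 0)"
    using r by (simp add: at_within_open[of 0 "ball 0 (r/2)"])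
  thus ?thesis by (simp add: DERIV_def)
qed

lemma LINT_holomorphic_on:
  fixes f :: "complex \<Rightarrow> 'a \<Rightarrow> complex"
  assumes "open U"
    and "\<And>z. z \<in> U \<Longrightarrow> f z \<in> borel_measurable M"
    and "\<And>t. t \<in> space M \<Longrightarrow> (\<lambda>z. f z t) holomorphic_on U"
    and "\<And>z. z \<in> U \<Longrightarrow> \<exists>r>0. \<exists>g. integrable M g \<and> (\<forall>w\<in>ball z r \<inter> U. \<forall>t\<in>space M. norm (f w t) \<le> g t)"
  shows "(\<lambda>z. LINT t|M. f z t) holomorphic_on U"
proof (rule holomorphic_onI)
  fix z assume z: "z \<in> U"
  have "((\<lambda>z. LINT t|M. f z t) has_field_derivative (LINT t|M. deriv (\<lambda>z. f z t) z)) (at z)"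
    by (rule LINT_has_field_derivative[OF assms(1) z assms(2,3) assms(4)[OF z]])
  thus "(\<lambda>z. LINT t|M. f z t) field_differentiable at z within U"
    using field_differentiable_at_within field_differentiable_def by blast
qed

text \<open>A series is an integral over the counting measure, so a summable majorant plays the part
  of the integrable one.\<close>

lemma suminf_holomorphic_on:
  fixes f :: "complex \<Rightarrow> nat \<Rightarrow> complex"
  assumes U: "open U"
    and hol: "\<And>n. (\<lambda>z. f z n) holomorphic_on U"
    and dom: "\<And>z. z \<in> U \<Longrightarrow> \<exists>r>0. \<exists>g. summable g \<and> (\<forall>w\<in>ball z r \<inter> U. \<forall>n. norm (f w n) \<le> g n)"
  shows "(\<lambda>z. \<Sum>n. f z n) holomorphic_on U"
proof -
  have s: "integrable (count_space UNIV) g" if "summable g" "\<And>n. g n \<ge> (0::real)" for g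
    using that by (subst integrable_count_space_nat_iff) (simp)
  have dom': "\<exists>r>0. \<exists>g. integrable (count_space UNIV) g \<and> (\<forall>w\<in>ball z r \<inter> U. \<forall>n\<in>space (count_space UNIV). norm (f w n) \<le> g n)" if z: "z \<in> U" for z
  proof -
    from dom[OF z] obtain r g where rg: "r > 0" "summable g" "\<forall>w\<in>ball z r \<inter> U. \<forall>n. norm (f w n) \<le> g n" by blast
    have "g n \<ge> 0" for n using rg(1,3) z by (meson IntI centre_in_ball norm_ge_zero order_trans)
    hence "integrable (count_space UNIV) g" using s rg by blast
    thus ?thesis using rg by auto
  qed
  have "(\<lambda>z. LINT n|count_space UNIV. f z n) holomorphic_on U"
    by (rule LINT_holomorphic_on[OF U _ hol dom']) auto
  moreover have "(LINT n|count_space UNIV. f z n) = (\<Sum>n. f z n)" if z: "z \<in> U" for z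
  proof (rule integral_count_space_nat)
    from dom[OF z] obtain r g where rg: "r > 0" "summable g" "\<forall>w\<in>ball z r \<inter> U. \<forall>n. norm (f w n) \<le> g n" by blast
    have "summable (\<lambda>n. norm (f z n))"
      by (rule summable_comparison_test'[OF rg(2), of 0]) (use rg z in auto)
    thus "integrable (count_space UNIV) (f z)" by (simp add: integrable_count_space_nat_iff)
  qed
  ultimately show ?thesis by (rule holomorphic_transform)
qed

text \<open>Working in the restricted space makes the integrands of this theory meaningful on the
  whole space of the measure: their end points $0$ and $1$ may be singular.\<close>

abbreviation I01 :: "real measure" where
  "I01 \<equiv> restrict_space lborel {0<..<1}"

lemma space_I01 [simp]: "space I01 = {0<..<1}"
  by (simp add: space_restrict_space)

lemma measurable_I01_continuous:
  fixes f :: "real \<Rightarrow> 'a :: topological_space"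
  assumes "continuous_on {0<..<1} f"
  shows "f \<in> borel_measurable I01"
  using borel_measurable_continuous_on_restrict[OF assms]
  by (simp add: measurable_def sets_restrict_space space_restrict_space)

section \<open>Beta integrals with complex exponents\<close>

definition beta_kernel :: "real \<Rightarrow> real \<Rightarrow> real \<Rightarrow> real" where
  "beta_kernel p q t = t powr (p - 1) * (1 - t) powr (q - 1)"

lemma beta_kernel_nonneg [simp]: "beta_kernel p q t \<ge> 0"
  by (simp add: beta_kernel_def)

lemma integrable_I01_iff:
  fixes f :: "real \<Rightarrow> 'a :: {banach, second_countable_topology}"
  shows "integrable I01 f \<longleftrightarrow> set_integrable lborel {0<..<1} f"
  by (subst integrable_restrict_space) (auto simp: set_integrable_def)

lemma LINT_I01_eq:
  fixes f :: "real \<Rightarrow> 'a :: {banach, second_countable_topology}"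
  shows "integral\<^sup>L I01 f = (LINT t:{0<..<1}|lborel. f t)"
  by (subst integral_restrict_space) (auto simp: set_lebesgue_integral_def)

lemma has_integral_I01:
  fixes f :: "real \<Rightarrow> complex"
  assumes "integrable I01 f"
  shows "(f has_integral (LINT t|I01. f t)) {0..1}"
proof -
  have "set_integrable lborel {0<..<1} f" using assms by (simp add: integrable_I01_iff)
  from set_borel_integral_eq_integral[OF this] have "(f has_integral (LINT t|I01. f t)) {0<..<1}"
    by (simp add: LINT_I01_eq has_integral_integral[symmetric])
  thus ?thesis by (simp add: has_integral_Icc_iff_Ioo)
qed

lemma has_integral_I01_real:
  fixes f :: "real \<Rightarrow> real"
  assumes "integrable I01 f"
  shows "(f has_integral (LINT t|I01. f t)) {0..1}"
proof -
  have "set_integrable lborel {0<..<1} f" using assms by (simp add: integrable_I01_iff)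
  from set_borel_integral_eq_integral[OF this] have "(f has_integral (LINT t|I01. f t)) {0<..<1}"
    by (simp add: LINT_I01_eq has_integral_integral[symmetric])
  thus ?thesis by (simp add: has_integral_Icc_iff_Ioo)
qed

lemma integrable_beta_kernel:
  assumes "p > 0" "q > 0"
  shows "integrable I01 (beta_kernel p q)"
proof -
  have "set_integrable lborel {0..1} (beta_kernel p q)"
    using integrable_Beta[OF assms] by (simp add: beta_kernel_def [abs_def])
  thus ?thesis unfolding integrable_I01_iff by (rule set_integrable_subset) auto
qed

lemma LINT_beta_kernel:
  assumes "p > 0" "q > 0"
  shows "(LINT t|I01. beta_kernel p q t) = Beta p q"
  using has_integral_I01_real[OF integrable_beta_kernel[OF assms]] has_integral_Beta_real[OF assms]
    has_integral_unique unfolding beta_kernel_def by blast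

definition cbeta_kernel :: "complex \<Rightarrow> complex \<Rightarrow> real \<Rightarrow> complex" where
  "cbeta_kernel p q t = of_real t powr (p - 1) * (1 - of_real t) powr (q - 1)"

lemma norm_cbeta_kernel:
  assumes "t \<in> {0<..<1}"
  shows "norm (cbeta_kernel p q t) = beta_kernel (Re p) (Re q) t"
proof -
  have "norm (of_real (1 - t) powr (q - 1) :: complex) = (1 - t) powr (Re q - 1)"
    using assms by (subst norm_powr_real_powr) auto
  moreover have "norm (of_real t powr (p - 1) :: complex) = t powr (Re p - 1)"
    using assms by (subst norm_powr_real_powr) auto
  ultimately show ?thesis by (simp add: cbeta_kernel_def beta_kernel_def norm_mult)
qed

lemma continuous_on_cbeta_kernel: "continuous_on {0<..<1} (cbeta_kernel p q)"
proof -
  have "continuous_on {0<..<1} (\<lambda>t::real. of_real t powr (p - 1) * of_real (1 - t) powr (q - 1) :: complex)"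
    by (intro continuous_intros) (auto simp del: of_real_diff)
  thus ?thesis by (simp add: cbeta_kernel_def [abs_def])
qed

lemma measurable_cbeta_kernel [measurable]: "cbeta_kernel p q \<in> borel_measurable I01"
  by (rule measurable_I01_continuous[OF continuous_on_cbeta_kernel])

lemma integrable_cbeta_kernel:
  assumes "Re p > 0" "Re q > 0"
  shows "integrable I01 (cbeta_kernel p q)"
  by (rule Bochner_Integration.integrable_bound[OF integrable_beta_kernel[OF assms] measurable_cbeta_kernel])
     (auto intro!: AE_I2 simp: norm_cbeta_kernel)

lemma powr_le_sum:
  fixes t :: real
  assumes "t > 0" "a \<le> s" "s \<le> b"
  shows "t powr s \<le> t powr a + t powr b"
proof (cases "t \<le> 1")
  case True
  hence "t powr s \<le> t powr a" using assms by (intro powr_mono') auto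
  thus ?thesis by (simp add: add_increasing2)
next
  case False
  hence "t powr s \<le> t powr b" using assms by (intro powr_mono) auto
  thus ?thesis by (simp add: add_increasing)
qed

lemma beta_kernel_mono:
  assumes "t \<in> {0<..<1}" "p \<le> p'" "q \<le> q'"
  shows "beta_kernel p' q' t \<le> beta_kernel p q t"
  using assms unfolding beta_kernel_def by (intro mult_mono powr_mono') auto

lemma cbeta_kernel_holomorphic:
  assumes "t \<in> {0<..<1}" "f holomorphic_on U" "g holomorphic_on U"
  shows "(\<lambda>z. cbeta_kernel (f z) (g z) t) holomorphic_on U"
proof -
  have "1 - complex_of_real t \<noteq> 0" using assms
    by (metis eq_iff_diff_eq_0 greaterThanLessThan_iff less_irrefl of_real_eq_1_iff)
  thus ?thesis
  using assms unfolding cbeta_kernel_def by (intro holomorphic_intros) auto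
qed

lemma continuous_Re_near:
  assumes "open U" "f holomorphic_on U" "z \<in> U" "Re (f z) > c"
  obtains r where "r > 0" "ball z r \<subseteq> U" "\<And>w. w \<in> ball z r \<Longrightarrow> Re (f w) > c"
proof -
  have "open (U \<inter> (f -` {w. Re w > c}))"
    by (rule continuous_open_preimage) (use assms in \<open>auto intro: holomorphic_on_imp_continuous_on open_halfspace_Re_gt\<close>)
  moreover have "z \<in> U \<inter> (f -` {w. Re w > c})" using assms by auto
  ultimately obtain r where "r > 0" "ball z r \<subseteq> U \<inter> (f -` {w. Re w > c})" using open_contains_ball by blast
  thus ?thesis using that[of r] by blast
qed

lemma LINT_cbeta_kernel_holomorphic:
  assumes U: "open U" and pq: "p holomorphic_on U" "q holomorphic_on U"
    and pos: "\<And>z. z \<in> U \<Longrightarrow> Re (p z) > 0 \<and> Re (q z) > 0"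
    and meas: "\<And>z. z \<in> U \<Longrightarrow> f z \<in> borel_measurable I01"
    and hol: "\<And>t. t \<in> {0<..<1} \<Longrightarrow> (\<lambda>z. f z t) holomorphic_on U"
    and bd: "\<And>z. z \<in> U \<Longrightarrow> \<exists>r>0. \<exists>B. \<forall>w\<in>ball z r \<inter> U. \<forall>t\<in>{0<..<1}. norm (f w t) \<le> B"
  shows "(\<lambda>z. LINT t|I01. cbeta_kernel (p z) (q z) t * f z t) holomorphic_on U"
proof (rule LINT_holomorphic_on[OF U])
  show "(\<lambda>t. cbeta_kernel (p z) (q z) t * f z t) \<in> borel_measurable I01" if "z \<in> U" for z
    using meas[OF that] by measurable
  show "(\<lambda>z. cbeta_kernel (p z) (q z) t * f z t) holomorphic_on U" if "t \<in> space I01" for t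
    using that by (intro holomorphic_intros cbeta_kernel_holomorphic hol pq) auto
  fix z assume z: "z \<in> U"
  obtain r B where rB: "r > 0" "\<forall>w\<in>ball z r \<inter> U. \<forall>t\<in>{0<..<1}. norm (f w t) \<le> B" using bd[OF z] by blast
  \<comment> \<open>Half of the real parts at \<open>z\<close> still gives an integrable Beta
    kernel, and on (0,1) it dominates every kernel with larger exponents, in particular those of a
    whole neighbourhood.\<close>
  have "Re (p z) > Re (p z) / 2" "Re (q z) > Re (q z) / 2" using pos[OF z] by auto
  then obtain r1 r2 where r1: "r1 > 0" "\<And>w. w \<in> ball z r1 \<Longrightarrow> Re (p w) > Re (p z) / 2"
    and r2: "r2 > 0" "\<And>w. w \<in> ball z r2 \<Longrightarrow> Re (q w) > Re (q z) / 2"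
    using continuous_Re_near[OF U pq(1) z] continuous_Re_near[OF U pq(2) z] by metis
  show "\<exists>r>0. \<exists>g. integrable I01 g \<and> (\<forall>w\<in>ball z r \<inter> U. \<forall>t\<in>space I01. norm (cbeta_kernel (p w) (q w) t * f w t) \<le> g t)"
  proof (intro exI[of _ "min r (min r1 r2)"] exI[of _ "\<lambda>t. beta_kernel (Re (p z) / 2) (Re (q z) / 2) t * B"] conjI ballI)
    show "integrable I01 (\<lambda>t. beta_kernel (Re (p z) / 2) (Re (q z) / 2) t * B)"
      using pos[OF z] by (intro integrable_mult_left integrable_beta_kernel) auto
    fix w t assume w: "w \<in> ball z (min r (min r1 r2)) \<inter> U" and t: "t \<in> space I01"
    have t': "t \<in> {0<..<1}" using t by simp
    have "Re (p w) > Re (p z) / 2" "Re (q w) > Re (q z) / 2" using r1(2)[of w] r2(2)[of w] w by auto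
    hence "beta_kernel (Re (p w)) (Re (q w)) t \<le> beta_kernel (Re (p z) / 2) (Re (q z) / 2) t"
      by (intro beta_kernel_mono[OF t']) auto
    moreover have "norm (f w t) \<le> B" using rB w t' by auto
    ultimately show "norm (cbeta_kernel (p w) (q w) t * f w t) \<le> beta_kernel (Re (p z) / 2) (Re (q z) / 2) t * B"
      by (simp only: norm_mult norm_cbeta_kernel[OF t']) (intro mult_mono, auto)
  qed (use rB r1 r2 in auto)
qed

text \<open>The positive reals have a limit point in the right half-plane, so holomorphic identities
  there may be checked on them.\<close>

lemma islimpt_pos_reals: "(1::complex) islimpt (of_real ` {0<..})"
proof -
  have "(1::real) islimpt {0<..}" by (rule interior_limit_point) (simp add: interior_open)
  hence "\<exists>x'\<in>{0<..}. x' \<noteq> 1 \<and> dist x' (1::real) < e" if "e > 0" for e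
    using that by (auto simp: islimpt_approachable)
  thus ?thesis unfolding islimpt_approachable
    by (metis (no_types, lifting) dist_of_real imageI of_real_1 of_real_eq_iff)
qed

text \<open>Both sides are holomorphic in each exponent, and the real Beta integral settles positive
  real exponents; the identity theorem frees first \<open>p\<close> and then
  \<open>q\<close>.\<close>

lemma LINT_cbeta_kernel:
  assumes p: "Re p > 0" and q: "Re q > 0"
  shows "(LINT t|I01. cbeta_kernel p q t) = Gamma p * Gamma q / Gamma (p + q)"
proof -
  let ?U = "{z. Re z > 0}"
  have Uprops: "open ?U" "connected ?U" by (auto simp: open_halfspace_Re_gt convex_halfspace_Re_gt intro: convex_connected)
  have np: "z \<notin> \<int>\<^sub>\<le>\<^sub>0" if "Re z > 0" for z using that by (auto elim!: nonpos_Ints_cases)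
  have L: "(\<lambda>z. LINT t|I01. cbeta_kernel (f z) (g z) t * 1) holomorphic_on ?U"
    if "f holomorphic_on ?U" "g holomorphic_on ?U" "\<And>z. z \<in> ?U \<Longrightarrow> Re (f z) > 0 \<and> Re (g z) > 0" for f g
    by (rule LINT_cbeta_kernel_holomorphic[OF Uprops(1) that]) (auto intro: exI[of _ 1])
  have rr: "(LINT t|I01. cbeta_kernel (of_real a) (of_real b) t) = Gamma (of_real a) * Gamma (of_real b) / Gamma (of_real a + of_real b)"
    if ab: "a > 0" "b > 0" for a b :: real
  proof -
    have "(LINT t|I01. cbeta_kernel (of_real a) (of_real b) t) = (LINT t|I01. complex_of_real (beta_kernel a b t))"
    proof (rule Bochner_Integration.integral_cong[OF refl])
      fix t assume "t \<in> space I01"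
      hence t: "0 < t" "t < 1" by auto
      have "(1 - of_real t) powr (of_real b - 1) = complex_of_real ((1 - t) powr (b - 1))"
        using powr_of_real[of "1 - t" "b - 1"] t by simp
      moreover have "of_real t powr (of_real a - 1) = complex_of_real (t powr (a - 1))"
        using powr_of_real[of "t" "a - 1"] t by simp
      ultimately show "cbeta_kernel (of_real a) (of_real b) t = complex_of_real (beta_kernel a b t)"
        by (simp add: cbeta_kernel_def beta_kernel_def)
    qed
    also have "\<dots> = of_real (Beta a b)" by (simp add: LINT_beta_kernel[OF ab])
    also have "\<dots> = Gamma (of_real a) * Gamma (of_real b) / Gamma (of_real a + of_real b)"
      by (simp add: Beta_def Gamma_complex_of_real[symmetric])
    finally show ?thesis .
  qed
  have one: "(LINT t|I01. cbeta_kernel p (of_real b) t) = Gamma p * Gamma (of_real b) / Gamma (p + of_real b)"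
    if b: "b > 0" and p: "Re p > 0" for b :: real and p
  proof -
    have "(LINT t|I01. cbeta_kernel p (of_real b) t * 1) - Gamma p * Gamma (of_real b) / Gamma (p + of_real b) = 0"
    proof (rule analytic_continuation[where S = ?U and U = "of_real ` {0<..}" and \<xi> = 1 and w = p,
          of "\<lambda>p. (LINT t|I01. cbeta_kernel p (of_real b) t * 1) - Gamma p * Gamma (of_real b) / Gamma (p + of_real b)"])
      show "(\<lambda>p. (LINT t|I01. cbeta_kernel p (of_real b) t * 1) - Gamma p * Gamma (of_real b) / Gamma (p + of_real b)) holomorphic_on ?U"
        using b by (intro holomorphic_intros L) (auto dest: np simp: Gamma_eq_zero_iff intro: np[THEN notE, rotated])
    qed (use Uprops islimpt_pos_reals rr b p in auto)
    thus ?thesis by simp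
  qed
  have "(LINT t|I01. cbeta_kernel p q t * 1) - Gamma p * Gamma q / Gamma (p + q) = 0"
  proof (rule analytic_continuation[where S = ?U and U = "of_real ` {0<..}" and \<xi> = 1 and w = q,
        of "\<lambda>q. (LINT t|I01. cbeta_kernel p q t * 1) - Gamma p * Gamma q / Gamma (p + q)"])
    show "(\<lambda>q. (LINT t|I01. cbeta_kernel p q t * 1) - Gamma p * Gamma q / Gamma (p + q)) holomorphic_on ?U"
      using p by (intro holomorphic_intros L) (auto dest: np simp: Gamma_eq_zero_iff intro: np[THEN notE, rotated])
  qed (use Uprops islimpt_pos_reals one p q in auto)
  thus ?thesis by simp
qed


section \<open>The Gauss hypergeometric function on the slit plane\<close>

lemma nonpos_Ints_plus_one: "c \<notin> \<int>\<^sub>\<le>\<^sub>0 \<Longrightarrow> c + 1 \<notin> \<int>\<^sub>\<le>\<^sub>0" for c :: complex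
  by (metis nonpos_Ints_diff_Nats Nats_1 add_diff_cancel_right')

lemma Re_pos_not_nonpos_Int: "Re z > 0 \<Longrightarrow> z \<notin> \<int>\<^sub>\<le>\<^sub>0"
  by (auto elim!: nonpos_Ints_cases)

lemma cbeta_kernel_times_power:
  assumes "t \<in> {0<..<1}"
  shows "cbeta_kernel p q t * of_real t ^ n = cbeta_kernel (p + of_nat n) q t"
proof -
  have "complex_of_real t powr (p - 1) * of_real t ^ n = of_real t powr (p + of_nat n - 1)"
  proof -
    have "p + of_nat n - 1 = (p - 1) + of_nat n" by simp
    hence "complex_of_real t powr (p + of_nat n - 1) = of_real t powr (p - 1) * of_real t powr (of_nat n)"
      by (simp only: powr_add)
    thus ?thesis using assms by (simp only: powr_nat) auto
  qed
  thus ?thesis by (simp add: cbeta_kernel_def mult_ac)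
qed

text \<open>Powers of t only raise the first exponent and are at most 1, so absolute convergence at
  t = 1 suffices for termwise integration up to the singular end points. It serves both Euler's
  integral and the 1F2 as an average of Bessel series.\<close>

lemma LINT_cbeta_kernel_power_series:
  fixes a :: "nat \<Rightarrow> complex"
  assumes pq: "Re p > 0" "Re q > 0" and a: "summable (\<lambda>n. norm (a n))"
  shows "(\<lambda>n. a n * (Gamma (p + of_nat n) * Gamma q / Gamma (p + q + of_nat n))) sums
           (LINT t|I01. cbeta_kernel p q t * (\<Sum>n. a n * of_real t ^ n))"
proof -
  define f where "f n t = cbeta_kernel p q t * (a n * of_real t ^ n)" for n t
  have f_eq: "f n t = a n * cbeta_kernel (p + of_nat n) q t" if "t \<in> {0<..<1}" for n t
    using cbeta_kernel_times_power[OF that, of p q n] by (simp add: f_def mult_ac)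
  have nf: "norm (f n t) \<le> norm (a n) * beta_kernel (Re p) (Re q) t" if t: "t \<in> {0<..<1}" for n t
  proof -
    have "norm (f n t) = norm (a n) * beta_kernel (Re (p + of_nat n)) (Re q) t"
      by (simp add: f_eq[OF t] norm_mult norm_cbeta_kernel[OF t])
    also have "\<dots> \<le> norm (a n) * beta_kernel (Re p) (Re q) t"
      by (intro mult_left_mono beta_kernel_mono[OF t]) auto
    finally show ?thesis .
  qed
  have intf: "integrable I01 (f n)" for n
  proof -
    have "integrable I01 (\<lambda>t. a n * cbeta_kernel (p + of_nat n) q t)"
      using pq by (intro integrable_mult_right integrable_cbeta_kernel) auto
    thus ?thesis by (subst Bochner_Integration.integrable_cong[OF refl f_eq]) auto
  qed
  have "(\<lambda>n. LINT t|I01. f n t) sums (LINT t|I01. (\<Sum>n. f n t))"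
  proof (rule sums_integral[OF intf])
    show "AE t in I01. summable (\<lambda>n. norm (f n t))"
    proof (rule AE_I2)
      fix t assume "t \<in> space I01"
      hence t: "t \<in> {0<..<1}" by simp
      show "summable (\<lambda>n. norm (f n t))"
        by (rule summable_comparison_test'[OF summable_mult2[OF a], of 0]) (use nf[OF t] in auto)
    qed
    show "summable (\<lambda>n. LINT t|I01. norm (f n t))"
    proof (rule summable_comparison_test'[OF summable_mult2[OF a], of 0])
      fix n :: nat
      have "(LINT t|I01. norm (f n t)) \<le> (LINT t|I01. norm (a n) * beta_kernel (Re p) (Re q) t)"
      proof (rule integral_mono)
        show "integrable I01 (\<lambda>t. norm (f n t))" by (rule integrable_norm[OF intf])
        show "integrable I01 (\<lambda>t. norm (a n) * beta_kernel (Re p) (Re q) t)"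
          by (rule integrable_mult_right[OF integrable_beta_kernel[OF pq]])
      qed (use nf in simp)
      thus "norm (LINT t|I01. norm (f n t)) \<le> norm (a n) * (LINT t|I01. beta_kernel (Re p) (Re q) t)"
        by (simp add: integral_nonneg_AE)
    qed
  qed
  also have "(\<lambda>n. LINT t|I01. f n t) = (\<lambda>n. a n * (Gamma (p + of_nat n) * Gamma q / Gamma (p + q + of_nat n)))"
  proof
    fix n
    have "(LINT t|I01. f n t) = (LINT t|I01. a n * cbeta_kernel (p + of_nat n) q t)"
      by (rule Bochner_Integration.integral_cong[OF refl f_eq]) auto
    also have "\<dots> = a n * (Gamma (p + of_nat n) * Gamma q / Gamma (p + q + of_nat n))"
      using pq by (simp add: LINT_cbeta_kernel add_ac)
    finally show "(LINT t|I01. f n t) = a n * (Gamma (p + of_nat n) * Gamma q / Gamma (p + q + of_nat n))" .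
  qed
  also have "(LINT t|I01. (\<Sum>n. f n t)) = (LINT t|I01. cbeta_kernel p q t * (\<Sum>n. a n * of_real t ^ n))"
  proof (rule Bochner_Integration.integral_cong[OF refl])
    fix t assume "t \<in> space I01"
    hence t: "t \<in> {0<..<1}" by simp
    have "summable (\<lambda>n. norm (a n * of_real t ^ n))"
      by (rule summable_comparison_test'[OF a, of 0])
         (use t in \<open>simp add: norm_mult norm_power mult_left_le power_le_one\<close>)
    from suminf_mult[OF summable_norm_cancel[OF this]]
    show "(\<Sum>n. f n t) = cbeta_kernel p q t * (\<Sum>n. a n * of_real t ^ n)"
      unfolding f_def .
  qed
  finally show ?thesis .
qed

section \<open>The slit plane and the continuation of the Gauss series\<close>

definition slit_plane :: "complex set" where
  "slit_plane = {\<xi>. 1 - \<xi> \<notin> \<real>\<^sub>\<le>\<^sub>0}"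

text \<open>The slit plane is star-shaped about 0. This keeps 1 - t \<xi> off the branch cut along
  the whole path of Euler's integral, and it also yields connectedness.\<close>

lemma slit_plane_scale:
  assumes "\<xi> \<in> slit_plane" "0 \<le> t" "t \<le> 1"
  shows "1 - of_real t * \<xi> \<notin> \<real>\<^sub>\<le>\<^sub>0"
proof
  assume "1 - of_real t * \<xi> \<in> \<real>\<^sub>\<le>\<^sub>0"
  hence h: "1 \<le> t * Re \<xi>" "t * Im \<xi> = 0" by (auto simp: complex_nonpos_Reals_iff)
  hence t: "t > 0" using assms by (cases "t = 0") auto
  hence "Im \<xi> = 0" using h by simp
  moreover have "Re \<xi> \<ge> 1"
  proof (rule ccontr)
    assume "\<not> Re \<xi> \<ge> 1"
    hence "t * Re \<xi> < t * 1" using t by (intro mult_strict_left_mono) auto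
    thus False using h assms by simp
  qed
  ultimately show False using assms(1) by (auto simp: slit_plane_def complex_nonpos_Reals_iff)
qed

lemma open_slit_plane: "open slit_plane"
proof -
  have "open ((\<lambda>\<xi>::complex. 1 - \<xi>) -` (- \<real>\<^sub>\<le>\<^sub>0))"
    by (intro open_vimage continuous_intros) (auto simp: open_Compl)
  thus ?thesis by (simp add: slit_plane_def vimage_def Compl_eq)
qed

lemma connected_slit_plane: "connected slit_plane"
proof (rule starlike_imp_connected)
  show "starlike slit_plane"
    unfolding starlike_def
  proof (intro bexI[of _ 0] ballI subsetI)
    fix \<xi> y assume \<xi>: "\<xi> \<in> slit_plane" and "y \<in> closed_segment 0 \<xi>"
    then obtain t where t: "0 \<le> t" "t \<le> 1" "y = of_real t * \<xi>"
      by (auto simp: closed_segment_def scaleR_conv_of_real)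
    thus "y \<in> slit_plane" using slit_plane_scale[OF \<xi> t(1,2)] by (simp add: slit_plane_def)
  qed (auto simp: slit_plane_def)
qed

lemma ball_subset_slit_plane: "ball 0 1 \<subseteq> slit_plane"
proof
  fix \<xi> :: complex assume "\<xi> \<in> ball 0 1"
  hence "Re \<xi> < 1" using complex_Re_le_cmod[of \<xi>] by simp
  thus "\<xi> \<in> slit_plane" by (simp add: slit_plane_def complex_nonpos_Reals_iff)
qed

definition hyp_coeff :: "complex \<Rightarrow> complex \<Rightarrow> complex \<Rightarrow> nat \<Rightarrow> complex" where
  "hyp_coeff \<alpha> b c n = pochhammer \<alpha> n * pochhammer b n / (pochhammer c n * fact n)"

text \<open>A characterization by holomorphy and Taylor coefficients at 0: with
  \<open>is_hyp_unique\<close>, identities on the slit plane reduce to comparing coefficients in the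
  unit disc.\<close>

definition is_hyp :: "complex \<Rightarrow> complex \<Rightarrow> complex \<Rightarrow> (complex \<Rightarrow> complex) \<Rightarrow> bool" where
  "is_hyp \<alpha> b c f \<longleftrightarrow> f holomorphic_on slit_plane \<and>
     (\<forall>\<xi>. norm \<xi> < 1 \<longrightarrow> (\<lambda>n. hyp_coeff \<alpha> b c n * \<xi> ^ n) sums f \<xi>)"

definition hyp :: "complex \<Rightarrow> complex \<Rightarrow> complex \<Rightarrow> complex \<Rightarrow> complex" where
  "hyp \<alpha> b c = (SOME f. is_hyp \<alpha> b c f)"

lemma holomorphic_unique_on_slit_plane:
  assumes "f holomorphic_on slit_plane" "g holomorphic_on slit_plane"
    and "\<And>\<xi>. norm \<xi> < 1 \<Longrightarrow> f \<xi> = g \<xi>" "\<xi> \<in> slit_plane"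
  shows "f \<xi> = g \<xi>"
  by (rule analytic_continuation_open[of "ball 0 1" slit_plane f g])
     (use assms open_slit_plane connected_slit_plane ball_subset_slit_plane in auto)

lemma is_hyp_unique:
  assumes "is_hyp \<alpha> b c f" "is_hyp \<alpha> b c g" "\<xi> \<in> slit_plane"
  shows "f \<xi> = g \<xi>"
proof (rule holomorphic_unique_on_slit_plane[OF _ _ _ assms(3)])
  fix \<zeta> :: complex assume "norm \<zeta> < 1"
  hence "(\<lambda>n. hyp_coeff \<alpha> b c n * \<zeta> ^ n) sums f \<zeta>" "(\<lambda>n. hyp_coeff \<alpha> b c n * \<zeta> ^ n) sums g \<zeta>"
    using assms(1,2) by (simp_all add: is_hyp_def)
  thus "f \<zeta> = g \<zeta>" by (rule sums_unique2)
qed (use assms(1,2) in \<open>simp_all add: is_hyp_def\<close>)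

lemma hyp_eqI: "is_hyp \<alpha> b c f \<Longrightarrow> \<xi> \<in> slit_plane \<Longrightarrow> hyp \<alpha> b c \<xi> = f \<xi>"
  unfolding hyp_def by (rule is_hyp_unique[OF someI[of "is_hyp \<alpha> b c"]])

text \<open>Holomorphic families of parameters, so that one induction along the contiguity relations
  yields both the continuation in \<open>\<xi>\<close> and its holomorphic dependence on the parameters.\<close>

definition is_hyp_family ::
  "complex set \<Rightarrow> (complex \<Rightarrow> complex) \<Rightarrow> (complex \<Rightarrow> complex) \<Rightarrow> (complex \<Rightarrow> complex) \<Rightarrow>
     (complex \<Rightarrow> complex \<Rightarrow> complex) \<Rightarrow> bool" where
  "is_hyp_family U \<alpha> b c G \<longleftrightarrow> (\<forall>\<xi>\<in>slit_plane. (\<lambda>p. G p \<xi>) holomorphic_on U) \<and>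
     (\<forall>p\<in>U. is_hyp (\<alpha> p) (b p) (c p) (G p))"

lemma bounded_on_compact_times_Icc:
  fixes f :: "'a :: metric_space \<Rightarrow> real \<Rightarrow> complex"
  assumes "compact K" "continuous_on (K \<times> {0..1}) (\<lambda>(w, t). f w t)"
  obtains B where "\<And>w t. w \<in> K \<Longrightarrow> t \<in> {0..1} \<Longrightarrow> norm (f w t) \<le> B"
proof -
  have "bounded ((\<lambda>(w, t). f w t) ` (K \<times> {0..1}))"
    by (intro compact_imp_bounded compact_continuous_image assms compact_Times) auto
  then obtain B where "\<forall>x\<in>(\<lambda>(w, t). f w t) ` (K \<times> {0..1}). norm x \<le> B" unfolding bounded_iff by blast
  thus ?thesis using that by force
qed

lemma continuous_on_euler_factor:
  fixes f g :: "'a :: topological_space \<Rightarrow> complex" and t :: "'a \<Rightarrow> real"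
  assumes "continuous_on S f" "continuous_on S g" "continuous_on S t"
    and "\<And>x. x \<in> S \<Longrightarrow> f x \<in> slit_plane" "\<And>x. x \<in> S \<Longrightarrow> 0 \<le> t x \<and> t x \<le> 1"
  shows "continuous_on S (\<lambda>x. (1 - of_real (t x) * f x) powr g x)"
proof (rule continuous_on_powr_complex)
  show "continuous_on S (\<lambda>x. 1 - of_real (t x) * f x)" by (intro continuous_intros assms)
  have nr: "1 - of_real (t x) * f x \<notin> \<real>\<^sub>\<le>\<^sub>0" if "x \<in> S" for x
    using slit_plane_scale assms(4,5) that by blast
  show "S \<subseteq> {z. 0 \<le> Re (1 - of_real (t z) * f z) \<or> Im (1 - of_real (t z) * f z) \<noteq> 0}"
    using nr by (fastforce simp: complex_nonpos_Reals_iff)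
  show "0 < Re (g z)" if "z \<in> S" "1 - of_real (t z) * f z = 0" for z
    using nr[OF that(1)] that(2) by simp
qed (rule assms)

section \<open>Euler's integral as a continuation of the series\<close>

definition euler_fun :: "complex \<Rightarrow> complex \<Rightarrow> complex \<Rightarrow> complex \<Rightarrow> complex" where
  "euler_fun \<alpha> b c \<xi> = Gamma c / (Gamma b * Gamma (c - b)) *
     (LINT t|I01. cbeta_kernel b (c - b) t * (1 - of_real t * \<xi>) powr (- \<alpha>))"

lemma measurable_euler_factor:
  assumes "\<xi> \<in> slit_plane"
  shows "(\<lambda>t. (1 - of_real t * \<xi>) powr (- \<alpha>)) \<in> borel_measurable I01"
  by (intro measurable_I01_continuous continuous_on_euler_factor continuous_intros)
     (use assms in auto)

lemma euler_factor_bounded: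
  assumes "\<xi> \<in> slit_plane"
  obtains B where "\<And>t. t \<in> {0..1} \<Longrightarrow> norm ((1 - of_real t * \<xi>) powr (- \<alpha>)) \<le> B"
proof -
  have "continuous_on ({\<xi>} \<times> {0..1}) (\<lambda>(w, t::real). (1 - of_real t * w) powr (- \<alpha>))"
    unfolding case_prod_unfold using assms by (intro continuous_on_euler_factor continuous_intros) auto
  from bounded_on_compact_times_Icc[OF _ this] obtain B
    where "\<And>w t. w \<in> {\<xi>} \<Longrightarrow> t \<in> {0..1} \<Longrightarrow> norm ((1 - of_real t * w) powr (- \<alpha>)) \<le> B" by auto
  thus ?thesis using that[of B] by blast
qed

lemma integrable_euler:
  assumes "Re b > 0" "Re c > Re b" "\<xi> \<in> slit_plane"
  shows "integrable I01 (\<lambda>t. cbeta_kernel b (c - b) t * (1 - of_real t * \<xi>) powr (- \<alpha>))"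
proof -
  obtain B where B: "\<And>t. t \<in> {0..1} \<Longrightarrow> norm ((1 - of_real t * \<xi>) powr (- \<alpha>)) \<le> B"
    using euler_factor_bounded[OF assms(3), of \<alpha>] by metis
  show ?thesis
  proof (rule Bochner_Integration.integrable_bound)
    show "integrable I01 (\<lambda>t. cbeta_kernel b (c - b) t * of_real B)"
      using assms by (intro integrable_mult_left integrable_cbeta_kernel) auto
    show "(\<lambda>t. cbeta_kernel b (c - b) t * (1 - of_real t * \<xi>) powr (- \<alpha>)) \<in> borel_measurable I01"
      using measurable_euler_factor[OF assms(3)] by measurable
    show "AE t in I01. norm (cbeta_kernel b (c - b) t * (1 - of_real t * \<xi>) powr (- \<alpha>))
            \<le> norm (cbeta_kernel b (c - b) t * of_real B)"
    proof (rule AE_I2)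
      fix t assume "t \<in> space I01"
      hence "norm ((1 - of_real t * \<xi>) powr (- \<alpha>)) \<le> \<bar>B\<bar>" using B[of t] by fastforce
      thus "norm (cbeta_kernel b (c - b) t * (1 - of_real t * \<xi>) powr (- \<alpha>))
            \<le> norm (cbeta_kernel b (c - b) t * of_real B)"
        by (simp add: norm_mult mult_left_mono)
    qed
  qed
qed

lemma euler_2F1_eq:
  assumes "Re b > 0" "Re c > Re b" "\<xi> \<in> slit_plane"
  shows "euler_2F1 \<alpha> b c \<xi> = euler_fun \<alpha> b c \<xi>"
  using has_integral_I01[OF integrable_euler[OF assms, of \<alpha>]]
  by (simp add: euler_2F1_def euler_fun_def cbeta_kernel_def integral_unique)

text \<open>Expanding (1 - t \<xi>)^(-\<alpha>) by the binomial series and integrating termwise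
  against the Beta kernel produces Gamma quotients, which are the Pochhammer symbols of
  \<open>b\<close> and \<open>c\<close>.\<close>

lemma euler_fun_is_hyp:
  assumes bc: "Re b > 0" "Re c > Re b"
  shows "is_hyp \<alpha> b c (euler_fun \<alpha> b c)"
  unfolding is_hyp_def
proof (intro conjI allI impI)
  have np: "b \<notin> \<int>\<^sub>\<le>\<^sub>0" "c \<notin> \<int>\<^sub>\<le>\<^sub>0" "c - b \<notin> \<int>\<^sub>\<le>\<^sub>0"
    using bc by (auto intro!: Re_pos_not_nonpos_Int)
  have G: "Gamma b \<noteq> 0" "Gamma c \<noteq> 0" "Gamma (c - b) \<noteq> 0"
    using np by (simp_all add: Gamma_eq_zero_iff)
  have "(\<lambda>\<xi>. LINT t|I01. cbeta_kernel b (c - b) t * (1 - of_real t * \<xi>) powr (- \<alpha>)) holomorphic_on slit_plane"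
  proof (rule LINT_cbeta_kernel_holomorphic[OF open_slit_plane])
    show "(\<lambda>\<xi>. (1 - of_real t * \<xi>) powr (- \<alpha>)) holomorphic_on slit_plane" if "t \<in> {0<..<1}" for t
      using that slit_plane_scale[of _ t] by (intro holomorphic_on_powr holomorphic_intros) (simp del: complex_nonpos_Reals_iff)
    fix \<xi> assume \<xi>: "\<xi> \<in> slit_plane"
    obtain r where r: "r > 0" "cball \<xi> r \<subseteq> slit_plane" using open_slit_plane \<xi> open_contains_cball by blast
    have "continuous_on (cball \<xi> r \<times> {0..1}) (\<lambda>(w, t::real). (1 - of_real t * w) powr (- \<alpha>))"
      unfolding case_prod_unfold using r by (intro continuous_on_euler_factor continuous_intros) auto
    from bounded_on_compact_times_Icc[OF _ this] obtain B where
      B: "\<And>w t. w \<in> cball \<xi> r \<Longrightarrow> t \<in> {0..1} \<Longrightarrow> norm ((1 - of_real t * w) powr (- \<alpha>)) \<le> B" by auto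
    show "\<exists>r>0. \<exists>B. \<forall>w\<in>ball \<xi> r \<inter> slit_plane. \<forall>t\<in>{0<..<1}. norm ((1 - of_real t * w) powr (- \<alpha>)) \<le> B"
      using r B by (intro exI[of _ r] exI[of _ B] conjI) auto
  qed (use bc measurable_euler_factor in auto)
  thus "euler_fun \<alpha> b c holomorphic_on slit_plane"
    unfolding euler_fun_def [abs_def] by (intro holomorphic_intros)
  fix \<xi> :: complex assume \<xi>: "norm \<xi> < 1"
  have bin: "(\<lambda>n. pochhammer \<alpha> n / fact n * \<zeta> ^ n) sums ((1 - \<zeta>) powr (- \<alpha>))" if "norm \<zeta> < 1" for \<zeta>
  proof -
    have "(- \<alpha> gchoose n) * (- \<zeta>) ^ n = pochhammer \<alpha> n / fact n * \<zeta> ^ n" for n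
    proof -
      have "((-1) ^ n * (-1) ^ n :: complex) = 1" by (simp flip: power_mult_distrib)
      thus ?thesis by (simp add: gbinomial_pochhammer power_minus[of \<zeta>] mult_ac)
    qed
    thus ?thesis using gen_binomial_complex[of "- \<zeta>" "- \<alpha>"] that by simp
  qed
  \<comment> \<open>Convergence at a radius strictly between |\<xi>| and 1 gives the absolute
    convergence at \<xi> that termwise integration asks for.\<close>
  obtain \<rho> where \<rho>: "norm \<xi> < \<rho>" "\<rho> < 1" using \<xi> dense by blast
  have "summable (\<lambda>n. pochhammer \<alpha> n / fact n * complex_of_real \<rho> ^ n)"
    using \<rho> order_trans[OF norm_ge_zero[of \<xi>] less_imp_le[OF \<rho>(1)]] by (intro sums_summable[OF bin]) simp
  hence "summable (\<lambda>n. norm (pochhammer \<alpha> n / fact n * \<xi> ^ n))"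
    by (rule powser_insidea) (use \<rho> order_trans[OF norm_ge_zero[of \<xi>] less_imp_le[OF \<rho>(1)]] in simp)
  from LINT_cbeta_kernel_power_series[OF _ _ this, of b "c - b"] bc
  have "(\<lambda>n. pochhammer \<alpha> n / fact n * \<xi> ^ n * (Gamma (b + of_nat n) * Gamma (c - b) / Gamma (c + of_nat n))) sums
      (LINT t|I01. cbeta_kernel b (c - b) t * (\<Sum>n. pochhammer \<alpha> n / fact n * \<xi> ^ n * of_real t ^ n))"
    by simp
  also have "(LINT t|I01. cbeta_kernel b (c - b) t * (\<Sum>n. pochhammer \<alpha> n / fact n * \<xi> ^ n * of_real t ^ n))
     = (LINT t|I01. cbeta_kernel b (c - b) t * (1 - of_real t * \<xi>) powr (- \<alpha>))"
  proof (rule Bochner_Integration.integral_cong[OF refl])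
    fix t assume "t \<in> space I01"
    hence t: "0 < t" "t < 1" by auto
    have "norm (of_real t * \<xi>) \<le> norm \<xi>" using t by (simp add: norm_mult mult_left_le_one_le)
    with \<xi> have "norm (of_real t * \<xi>) < 1" by simp
    from sums_unique[OF bin[OF this]]
    show "cbeta_kernel b (c - b) t * (\<Sum>n. pochhammer \<alpha> n / fact n * \<xi> ^ n * of_real t ^ n) =
          cbeta_kernel b (c - b) t * (1 - of_real t * \<xi>) powr (- \<alpha>)"
      by (simp add: power_mult_distrib mult_ac)
  qed
  finally have "(\<lambda>n. Gamma c / (Gamma b * Gamma (c - b)) * (pochhammer \<alpha> n / fact n * \<xi> ^ n * (Gamma (b + of_nat n) * Gamma (c - b) / Gamma (c + of_nat n)))) sums
     euler_fun \<alpha> b c \<xi>" unfolding euler_fun_def by (rule sums_mult)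
  moreover have "Gamma c / (Gamma b * Gamma (c - b)) * (pochhammer \<alpha> n / fact n * \<xi> ^ n * (Gamma (b + of_nat n) * Gamma (c - b) / Gamma (c + of_nat n)))
     = hyp_coeff \<alpha> b c n * \<xi> ^ n" for n
    unfolding hyp_coeff_def pochhammer_Gamma[OF np(1)] pochhammer_Gamma[OF np(2)]
    using G by (simp add: field_simps)
  ultimately show "(\<lambda>n. hyp_coeff \<alpha> b c n * \<xi> ^ n) sums euler_fun \<alpha> b c \<xi>" by simp
qed

lemma euler_fun_family:
  assumes U: "open U" and hol: "\<alpha> holomorphic_on U" "b holomorphic_on U" "c holomorphic_on U"
    and bc: "\<And>p. p \<in> U \<Longrightarrow> Re (b p) > 0 \<and> Re (c p) > Re (b p)"
  shows "is_hyp_family U \<alpha> b c (\<lambda>p. euler_fun (\<alpha> p) (b p) (c p))"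
  unfolding is_hyp_family_def
proof (intro conjI ballI)
  show "is_hyp (\<alpha> p) (b p) (c p) (euler_fun (\<alpha> p) (b p) (c p))" if "p \<in> U" for p
    using euler_fun_is_hyp bc[OF that] by blast
  have np: "b p \<notin> \<int>\<^sub>\<le>\<^sub>0" "c p \<notin> \<int>\<^sub>\<le>\<^sub>0" "c p - b p \<notin> \<int>\<^sub>\<le>\<^sub>0" if "p \<in> U" for p
    using bc[OF that] by (auto intro!: Re_pos_not_nonpos_Int)
  fix \<xi> assume \<xi>: "\<xi> \<in> slit_plane"
  have "(\<lambda>p. LINT t|I01. cbeta_kernel (b p) (c p - b p) t * (1 - of_real t * \<xi>) powr (- \<alpha> p)) holomorphic_on U"
  proof (rule LINT_cbeta_kernel_holomorphic[OF U])
    show "(\<lambda>p. (1 - of_real t * \<xi>) powr (- \<alpha> p)) holomorphic_on U" if "t \<in> {0<..<1}" for t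
    proof -
      have "1 - of_real t * \<xi> \<notin> \<real>\<^sub>\<le>\<^sub>0" using slit_plane_scale[OF \<xi>, of t] that by simp
      hence "1 - of_real t * \<xi> \<noteq> 0" by (auto)
      thus ?thesis by (intro holomorphic_intros hol)
    qed
    fix p assume p: "p \<in> U"
    obtain r where r: "r > 0" "cball p r \<subseteq> U" using U p open_contains_cball by blast
    have ca: "continuous_on (cball p r) \<alpha>" using hol(1) r holomorphic_on_imp_continuous_on continuous_on_subset by blast
    have "continuous_on (cball p r \<times> {0..1}) (\<lambda>x. \<alpha> (fst x))"
      by (rule continuous_on_compose2[OF ca]) (auto intro: continuous_intros)
    hence "continuous_on (cball p r \<times> {0..1}) (\<lambda>(w, t::real). (1 - of_real t * \<xi>) powr (- \<alpha> w))"
      unfolding case_prod_unfold using \<xi> by (intro continuous_on_euler_factor continuous_intros) auto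
    from bounded_on_compact_times_Icc[OF _ this] obtain B where
      B: "\<And>w t. w \<in> cball p r \<Longrightarrow> t \<in> {0..1} \<Longrightarrow> norm ((1 - of_real t * \<xi>) powr (- \<alpha> w)) \<le> B" by auto
    show "\<exists>r>0. \<exists>B. \<forall>w\<in>ball p r \<inter> U. \<forall>t\<in>{0<..<1}. norm ((1 - of_real t * \<xi>) powr (- \<alpha> w)) \<le> B"
      using r B by (intro exI[of _ r] exI[of _ B] conjI) auto
  qed (use bc hol measurable_euler_factor[OF \<xi>] in \<open>auto intro!: holomorphic_intros\<close>)
  thus "(\<lambda>p. euler_fun (\<alpha> p) (b p) (c p) \<xi>) holomorphic_on U"
    unfolding euler_fun_def
    by (intro holomorphic_intros hol)
       (use np in \<open>simp_all add: Gamma_eq_zero_iff\<close>)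
qed

section \<open>Contiguous relations and the continuation for all parameters\<close>

lemma hyp_coeff_contiguous1:
  assumes c: "c \<notin> \<int>\<^sub>\<le>\<^sub>0"
  shows "hyp_coeff \<alpha> b c n = ((c - \<alpha>) * hyp_coeff \<alpha> b (c + 1) n + \<alpha> * hyp_coeff (\<alpha> + 1) b (c + 1) n) / c"
proof -
  have cn: "c + of_nat n \<noteq> 0" "c \<noteq> 0" "pochhammer c n \<noteq> 0"
    using c by (auto simp: add_eq_0_iff2 pochhammer_eq_0_iff)
  have e: "pochhammer x n * (x + of_nat n) = x * pochhammer (x + 1) n" for x :: complex
    by (metis pochhammer_Suc pochhammer_rec)
  have c1: "pochhammer (c + 1) n = pochhammer c n * (c + of_nat n) / c"
    using e[of c] cn by (simp add: field_simps)
  have "(c - \<alpha>) * hyp_coeff \<alpha> b (c + 1) n + \<alpha> * hyp_coeff (\<alpha> + 1) b (c + 1) n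
     = ((c - \<alpha>) * pochhammer \<alpha> n + \<alpha> * pochhammer (\<alpha> + 1) n) * pochhammer b n / (pochhammer (c + 1) n * fact n)"
    by (simp add: hyp_coeff_def add_divide_distrib ring_distribs mult_ac)
  \<comment> \<open>This splitting of (\<alpha>)_n (c + n) is the whole relation; it trades
    \<open>c\<close> for \<open>c + 1\<close> at the price of also using \<alpha> + 1, while
    \<open>b\<close> stays.\<close>
  also have "(c - \<alpha>) * pochhammer \<alpha> n + \<alpha> * pochhammer (\<alpha> + 1) n = pochhammer \<alpha> n * (c + of_nat n)"
    unfolding e[of \<alpha>, symmetric] by (simp add: algebra_simps)
  also have "pochhammer \<alpha> n * (c + of_nat n) * pochhammer b n / (pochhammer (c + 1) n * fact n) = c * hyp_coeff \<alpha> b c n"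
  proof -
    have "A * k * B / (C * k / c * F) = c * (A * B / (C * F))" if "k \<noteq> 0" for A B C F k :: complex
      using that cn(2) by simp
    from this[OF cn(1)] show ?thesis unfolding c1 hyp_coeff_def .
  qed
  finally show ?thesis using cn by simp
qed

text \<open>This relation raises \<open>b\<close>. The last function will carry a factor \<xi>,
  hence the pairing of coefficient \<open>Suc n\<close> with coefficient \<open>n\<close>; the
  constant terms of the other two series are both 1.\<close>

lemma hyp_coeff_contiguous2:
  assumes c: "c \<notin> \<int>\<^sub>\<le>\<^sub>0"
  shows "hyp_coeff \<alpha> b c (Suc n) = hyp_coeff \<alpha> (b + 1) c (Suc n) - \<alpha> / c * hyp_coeff (\<alpha> + 1) (b + 1) (c + 1) n"
proof -
  have aux: "\<alpha> * A * (b * B) / (c * C * (k * F)) =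
      \<alpha> * A * (B * (b + k)) / (c * C * (k * F)) - \<alpha> / c * (A * B / (C * F))"
    if "c \<noteq> 0" "C \<noteq> 0" "k \<noteq> 0" "F \<noteq> 0" for A B C k F :: complex
    using that by (simp add: field_simps)
  have "c \<noteq> 0" "pochhammer (c + 1) n \<noteq> 0"
    using c nonpos_Ints_plus_one[OF c] by (auto simp: pochhammer_eq_0_iff)
  moreover have "(of_nat (Suc n) :: complex) \<noteq> 0" by (rule of_nat_neq_0)
  moreover have "pochhammer (b + 1) (Suc n) = pochhammer (b + 1) n * (b + of_nat (Suc n))"
    by (simp add: pochhammer_Suc add_ac)
  ultimately show ?thesis
    using aux[of "pochhammer (c + 1) n" "of_nat (Suc n)" "fact n" "pochhammer (\<alpha> + 1) n" "pochhammer (b + 1) n"]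
    unfolding hyp_coeff_def fact_Suc by (simp only: pochhammer_rec[of \<alpha>] pochhammer_rec[of b] pochhammer_rec[of c] of_nat_fact fact_nonzero not_False_eq_True simp_thms)
qed

lemma hyp_contiguous1_fun:
  assumes "c \<notin> \<int>\<^sub>\<le>\<^sub>0" "is_hyp \<alpha> b (c + 1) f" "is_hyp (\<alpha> + 1) b (c + 1) g"
  shows "is_hyp \<alpha> b c (\<lambda>\<xi>. ((c - \<alpha>) * f \<xi> + \<alpha> * g \<xi>) / c)"
  unfolding is_hyp_def
proof (intro conjI allI impI)
  show "(\<lambda>\<xi>. ((c - \<alpha>) * f \<xi> + \<alpha> * g \<xi>) / c) holomorphic_on slit_plane"
    using assms unfolding is_hyp_def by (intro holomorphic_intros) auto
  fix \<xi> :: complex assume "norm \<xi> < 1"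
  hence "(\<lambda>n. ((c - \<alpha>) * (hyp_coeff \<alpha> b (c + 1) n * \<xi> ^ n) + \<alpha> * (hyp_coeff (\<alpha> + 1) b (c + 1) n * \<xi> ^ n)) / c)
    sums (((c - \<alpha>) * f \<xi> + \<alpha> * g \<xi>) / c)"
    using assms unfolding is_hyp_def by (intro sums_divide sums_add sums_mult) auto
  moreover have "((c - \<alpha>) * (hyp_coeff \<alpha> b (c + 1) n * \<xi> ^ n) + \<alpha> * (hyp_coeff (\<alpha> + 1) b (c + 1) n * \<xi> ^ n)) / c
     = hyp_coeff \<alpha> b c n * \<xi> ^ n" for n
    unfolding hyp_coeff_contiguous1[OF assms(1)] by (simp add: ring_distribs)
  ultimately show "(\<lambda>n. hyp_coeff \<alpha> b c n * \<xi> ^ n) sums (((c - \<alpha>) * f \<xi> + \<alpha> * g \<xi>) / c)" by simp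
qed

lemma hyp_contiguous2_fun:
  assumes "c \<notin> \<int>\<^sub>\<le>\<^sub>0" "is_hyp \<alpha> (b + 1) c f" "is_hyp (\<alpha> + 1) (b + 1) (c + 1) g"
  shows "is_hyp \<alpha> b c (\<lambda>\<xi>. f \<xi> - \<xi> * (\<alpha> / c) * g \<xi>)"
  unfolding is_hyp_def
proof (intro conjI allI impI)
  show "(\<lambda>\<xi>. f \<xi> - \<xi> * (\<alpha> / c) * g \<xi>) holomorphic_on slit_plane"
    using assms unfolding is_hyp_def by (intro holomorphic_intros) auto
  fix \<xi> :: complex assume \<xi>: "norm \<xi> < 1"
  have f: "(\<lambda>n. hyp_coeff \<alpha> (b + 1) c (Suc n) * \<xi> ^ Suc n) sums (f \<xi> - 1)"
    using assms(2) \<xi> unfolding is_hyp_def by (subst sums_Suc_iff) (auto simp: hyp_coeff_def)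
  have g: "(\<lambda>n. hyp_coeff (\<alpha> + 1) (b + 1) (c + 1) n * \<xi> ^ n) sums g \<xi>"
    using assms(3) \<xi> unfolding is_hyp_def by auto
  have "(\<lambda>n. hyp_coeff \<alpha> (b + 1) c (Suc n) * \<xi> ^ Suc n - \<xi> * (\<alpha> / c) * (hyp_coeff (\<alpha> + 1) (b + 1) (c + 1) n * \<xi> ^ n))
     sums (f \<xi> - 1 - \<xi> * (\<alpha> / c) * g \<xi>)"
    by (intro sums_diff sums_mult f g)
  moreover have "hyp_coeff \<alpha> (b + 1) c (Suc n) * \<xi> ^ Suc n - \<xi> * (\<alpha> / c) * (hyp_coeff (\<alpha> + 1) (b + 1) (c + 1) n * \<xi> ^ n)
     = hyp_coeff \<alpha> b c (Suc n) * \<xi> ^ Suc n" for n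
    by (subst hyp_coeff_contiguous2[OF assms(1), of \<alpha> b n]) (simp add: algebra_simps)
  ultimately have "(\<lambda>n. hyp_coeff \<alpha> b c (Suc n) * \<xi> ^ Suc n) sums (f \<xi> - \<xi> * (\<alpha> / c) * g \<xi> - 1)" by (simp add: algebra_simps)
  thus "(\<lambda>n. hyp_coeff \<alpha> b c n * \<xi> ^ n) sums (f \<xi> - \<xi> * (\<alpha> / c) * g \<xi>)"
    by (subst (asm) sums_Suc_iff) (auto simp: hyp_coeff_def)
qed

text \<open>Here \<open>m\<close> counts how often \<open>c\<close> is raised until Re b < Re c,
  where Euler's integral applies. The relation also moves \<alpha>, on which Euler's integral puts
  no condition; hence \<alpha> is generalized in the induction.\<close>

lemma hyp_family_exists1:
  assumes "open U" "\<alpha> holomorphic_on U" "b holomorphic_on U" "c holomorphic_on U"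
    and "\<And>p. p \<in> U \<Longrightarrow> c p \<notin> \<int>\<^sub>\<le>\<^sub>0"
    and "\<And>p. p \<in> U \<Longrightarrow> Re (b p) > 0 \<and> Re (c p) + real m > Re (b p)"
  shows "\<exists>G. is_hyp_family U \<alpha> b c G"
  using assms(2-)
proof (induction m arbitrary: \<alpha> c)
  case 0
  thus ?case using euler_fun_family[OF assms(1), of \<alpha> b c] by auto
next
  case (Suc m)
  have "\<exists>G. is_hyp_family U \<alpha> b (\<lambda>p. c p + 1) G" "\<exists>G. is_hyp_family U (\<lambda>p. \<alpha> p + 1) b (\<lambda>p. c p + 1) G"
    using Suc.prems by (auto intro!: Suc.IH holomorphic_intros nonpos_Ints_plus_one simp: add.assoc)
  then obtain F G where FG: "is_hyp_family U \<alpha> b (\<lambda>p. c p + 1) F" "is_hyp_family U (\<lambda>p. \<alpha> p + 1) b (\<lambda>p. c p + 1) G" by blast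
  have "is_hyp_family U \<alpha> b c (\<lambda>p \<xi>. ((c p - \<alpha> p) * F p \<xi> + \<alpha> p * G p \<xi>) / c p)"
    unfolding is_hyp_family_def
  proof (intro conjI ballI)
    show "(\<lambda>p. ((c p - \<alpha> p) * F p \<xi> + \<alpha> p * G p \<xi>) / c p) holomorphic_on U" if "\<xi> \<in> slit_plane" for \<xi>
      using FG that Suc.prems unfolding is_hyp_family_def by (intro holomorphic_intros) force+
    show "is_hyp (\<alpha> p) (b p) (c p) (\<lambda>\<xi>. ((c p - \<alpha> p) * F p \<xi> + \<alpha> p * G p \<xi>) / c p)" if "p \<in> U" for p
      using FG that Suc.prems unfolding is_hyp_family_def by (intro hyp_contiguous1_fun) auto
  qed
  thus ?case by blast
qed

lemma hyp_family_exists: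
  assumes "open U" "\<alpha> holomorphic_on U" "b holomorphic_on U" "c holomorphic_on U"
    and "\<And>p. p \<in> U \<Longrightarrow> c p \<notin> \<int>\<^sub>\<le>\<^sub>0"
    and "\<And>p. p \<in> U \<Longrightarrow> Re (b p) + real k > 0 \<and> Re (c p) + real m > Re (b p)"
  shows "\<exists>G. is_hyp_family U \<alpha> b c G"
  using assms(2-)
proof (induction k arbitrary: \<alpha> b c m)
  case 0
  thus ?case using hyp_family_exists1[OF assms(1), of \<alpha> b c m] by auto
next
  case (Suc k)
  \<comment> \<open>Raising \<open>b\<close> alone costs one unit of the distance to
    \<open>c\<close>, so \<open>m\<close> becomes \<open>Suc m\<close>; raising both keeps it at
    \<open>m\<close>.\<close>
  have "\<exists>G. is_hyp_family U \<alpha> (\<lambda>p. b p + 1) c G"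
    using Suc.prems by (intro Suc.IH[of _ _ _ "Suc m"] holomorphic_intros) (auto simp: add.assoc)
  moreover have "\<exists>G. is_hyp_family U (\<lambda>p. \<alpha> p + 1) (\<lambda>p. b p + 1) (\<lambda>p. c p + 1) G"
    using Suc.prems by (intro Suc.IH[of _ _ _ m] holomorphic_intros nonpos_Ints_plus_one) (auto simp: add.assoc)
  ultimately obtain F G where FG: "is_hyp_family U \<alpha> (\<lambda>p. b p + 1) c F"
    "is_hyp_family U (\<lambda>p. \<alpha> p + 1) (\<lambda>p. b p + 1) (\<lambda>p. c p + 1) G" by blast
  have "is_hyp_family U \<alpha> b c (\<lambda>p \<xi>. F p \<xi> - \<xi> * (\<alpha> p / c p) * G p \<xi>)"
    unfolding is_hyp_family_def
  proof (intro conjI ballI)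
    show "(\<lambda>p. F p \<xi> - \<xi> * (\<alpha> p / c p) * G p \<xi>) holomorphic_on U" if "\<xi> \<in> slit_plane" for \<xi>
      using FG that Suc.prems unfolding is_hyp_family_def by (intro holomorphic_intros) force+
    show "is_hyp (\<alpha> p) (b p) (c p) (\<lambda>\<xi>. F p \<xi> - \<xi> * (\<alpha> p / c p) * G p \<xi>)" if "p \<in> U" for p
      using FG that Suc.prems unfolding is_hyp_family_def by (intro hyp_contiguous2_fun) auto
  qed
  thus ?case by blast
qed

lemma hyp_is_hyp:
  assumes "c \<notin> \<int>\<^sub>\<le>\<^sub>0"
  shows "is_hyp \<alpha> b c (hyp \<alpha> b c)"
proof -
  obtain k where k: "real k > - Re b" using reals_Archimedean2 by blast
  obtain m where m: "real m > Re b - Re c" using reals_Archimedean2 by blast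
  have "\<exists>G. is_hyp_family UNIV (\<lambda>_. \<alpha>) (\<lambda>_. b) (\<lambda>_. c) G"
    using assms k m by (intro hyp_family_exists[of _ _ _ _ k m]) auto
  hence "\<exists>f. is_hyp \<alpha> b c f" unfolding is_hyp_family_def by blast
  thus ?thesis unfolding hyp_def by (rule someI_ex)
qed

text \<open>Holomorphy is local, and near a point a fixed number of raisings suffices; the family
  built there agrees with \<open>hyp\<close> by uniqueness of the continuation in \<xi>.\<close>

lemma hyp_holomorphic_params:
  assumes U: "open U" and hol: "\<alpha> holomorphic_on U" "b holomorphic_on U" "c holomorphic_on U"
    and c: "\<And>p. p \<in> U \<Longrightarrow> c p \<notin> \<int>\<^sub>\<le>\<^sub>0" and \<xi>: "\<xi> \<in> slit_plane"
  shows "(\<lambda>p. hyp (\<alpha> p) (b p) (c p) \<xi>) holomorphic_on U"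
proof (rule holomorphic_onI)
  fix p assume p: "p \<in> U"
  obtain k where k: "real k > - Re (b p)" using reals_Archimedean2 by blast
  obtain m where m: "real m > Re (b p) - Re (c p)" using reals_Archimedean2 by blast
  have cb: "(\<lambda>p. c p - b p) holomorphic_on U" by (intro holomorphic_intros hol)
  from continuous_Re_near[OF U hol(2) p, of "- real k"] k
  obtain r1 where r1: "r1 > 0" "ball p r1 \<subseteq> U" "\<And>w. w \<in> ball p r1 \<Longrightarrow> Re (b w) > - real k" by auto
  from continuous_Re_near[OF U cb p, of "- real m"] m
  obtain r2 where r2: "r2 > 0" "ball p r2 \<subseteq> U" "\<And>w. w \<in> ball p r2 \<Longrightarrow> Re (c w - b w) > - real m" by auto
  define V where "V = ball p (min r1 r2)"
  have V: "open V" "V \<subseteq> U" "p \<in> V" using r1 r2 by (auto simp: V_def)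
  have "\<exists>G. is_hyp_family V \<alpha> b c G"
  proof (rule hyp_family_exists[of _ _ _ _ k m])
    fix w assume w: "w \<in> V"
    thus "c w \<notin> \<int>\<^sub>\<le>\<^sub>0" using V c by blast
    show "Re (b w) + real k > 0 \<and> Re (c w) + real m > Re (b w)"
      using w r1(3)[of w] r2(3)[of w] by (auto simp: V_def)
  qed (use V hol in \<open>auto intro: holomorphic_on_subset\<close>)
  then obtain G where G: "is_hyp_family V \<alpha> b c G" by blast
  have "(\<lambda>w. G w \<xi>) holomorphic_on V" using G \<xi> unfolding is_hyp_family_def by blast
  moreover have "G w \<xi> = hyp (\<alpha> w) (b w) (c w) \<xi>" if "w \<in> V" for w
    using hyp_eqI[OF _ \<xi>] G that unfolding is_hyp_family_def by metis
  ultimately have "(\<lambda>p. hyp (\<alpha> p) (b p) (c p) \<xi>) holomorphic_on V" by (rule holomorphic_transform)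
  hence "(\<lambda>p. hyp (\<alpha> p) (b p) (c p) \<xi>) field_differentiable at p"
    using V by (simp add: holomorphic_on_imp_differentiable_at)
  thus "(\<lambda>p. hyp (\<alpha> p) (b p) (c p) \<xi>) field_differentiable at p within U"
    by (rule field_differentiable_at_within)
qed

lemma hyp_sums: "c \<notin> \<int>\<^sub>\<le>\<^sub>0 \<Longrightarrow> norm \<xi> < 1 \<Longrightarrow> (\<lambda>n. hyp_coeff \<alpha> b c n * \<xi> ^ n) sums hyp \<alpha> b c \<xi>"
  using hyp_is_hyp unfolding is_hyp_def by blast

lemma hyp_eq_euler_fun:
  "Re b > 0 \<Longrightarrow> Re c > Re b \<Longrightarrow> \<xi> \<in> slit_plane \<Longrightarrow> hyp \<alpha> b c \<xi> = euler_fun \<alpha> b c \<xi>"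
  by (intro hyp_eqI euler_fun_is_hyp)

section \<open>Agreement with the continuation of Euler's integral in (b, c)\<close>

lemma open_compl_nonpos_Ints: "open (- \<int>\<^sub>\<le>\<^sub>0 :: complex set)"
  by (simp add: open_Compl)

lemma countable_nonpos_Ints: "countable (\<int>\<^sub>\<le>\<^sub>0 :: complex set)"
proof -
  have "(\<int>\<^sub>\<le>\<^sub>0 :: complex set) \<subseteq> range of_int" by (auto elim!: nonpos_Ints_cases)
  thus ?thesis by (rule countable_subset) simp
qed

lemma connected_compl_nonpos_Ints: "connected (- \<int>\<^sub>\<le>\<^sub>0 :: complex set)"
  by (intro path_connected_imp_connected path_connected_complement_countable countable_nonpos_Ints) simp

lemma hyp_continues_euler_2F1:
  assumes \<xi>: "\<xi> \<in> slit_plane"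
  shows "continues_euler_2F1 \<alpha> \<xi> (\<lambda>b c. hyp \<alpha> b c \<xi>)"
  unfolding continues_euler_2F1_def
proof (intro conjI allI impI)
  show "hyp \<alpha> b c \<xi> = euler_2F1 \<alpha> b c \<xi>" if "0 < Re b \<and> Re b < Re c" for b c
    using that \<xi> by (simp add: euler_2F1_eq hyp_eq_euler_fun)
  show "(\<lambda>b. hyp \<alpha> b c \<xi>) holomorphic_on UNIV" if "c \<notin> \<int>\<^sub>\<le>\<^sub>0" for c
    by (rule hyp_holomorphic_params) (use that \<xi> in auto)
  show "(\<lambda>c. hyp \<alpha> b c \<xi>) holomorphic_on (- \<int>\<^sub>\<le>\<^sub>0)" for b
    by (rule hyp_holomorphic_params) (use \<xi> open_compl_nonpos_Ints in auto)
qed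

text \<open>Whatever function the choice operator returns is forced: for Re c > 0 the open strip 0 <
  Re b < Re c determines an entire function of \<open>b\<close>, and for each \<open>b\<close> the
  half-plane Re c > 0 then determines the function of \<open>c\<close>, the non-positive integers
  being countable and so not disconnecting the plane.\<close>

lemma hyp2F1_eq_hyp:
  assumes \<xi>: "\<xi> \<in> slit_plane" and c: "c \<notin> \<int>\<^sub>\<le>\<^sub>0"
  shows "hyp2F1 \<alpha> b c \<xi> = hyp \<alpha> b c \<xi>"
proof -
  define F where "F = (SOME F. continues_euler_2F1 \<alpha> \<xi> F)"
  have "continues_euler_2F1 \<alpha> \<xi> F"
    unfolding F_def by (rule someI[of "continues_euler_2F1 \<alpha> \<xi>", OF hyp_continues_euler_2F1[OF \<xi>]])
  hence F: "\<And>b c. 0 < Re b \<Longrightarrow> Re b < Re c \<Longrightarrow> F b c = euler_2F1 \<alpha> b c \<xi>"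
    "\<And>c. c \<notin> \<int>\<^sub>\<le>\<^sub>0 \<Longrightarrow> (\<lambda>b. F b c) holomorphic_on UNIV"
    "\<And>b. (\<lambda>c. F b c) holomorphic_on (- \<int>\<^sub>\<le>\<^sub>0)"
    by (auto simp: continues_euler_2F1_def)
  note H = hyp_continues_euler_2F1[OF \<xi>, of \<alpha>, unfolded continues_euler_2F1_def]
  have 1: "F b c = hyp \<alpha> b c \<xi>" if c: "Re c > 0" for b c
  proof (rule analytic_continuation_open[of "{b. Re b > 0} \<inter> {b. Re b < Re c}" UNIV "\<lambda>b. F b c" "\<lambda>b. hyp \<alpha> b c \<xi>"])
    show "open ({b. Re b > 0} \<inter> {b. Re b < Re c})"
      by (intro open_Int open_halfspace_Re_gt open_halfspace_Re_lt)
    have "of_real (Re c / 2) \<in> {b. Re b > 0} \<inter> {b. Re b < Re c}" using c by simp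
    thus "{b. Re b > 0} \<inter> {b. Re b < Re c} \<noteq> {}" by blast
    have c': "c \<notin> \<int>\<^sub>\<le>\<^sub>0" using c by (rule Re_pos_not_nonpos_Int)
    show "(\<lambda>b. F b c) holomorphic_on UNIV" by (rule F(2)[OF c'])
    show "(\<lambda>b. hyp \<alpha> b c \<xi>) holomorphic_on UNIV" using H c' by blast
    show "F b c = hyp \<alpha> b c \<xi>" if "b \<in> {b. Re b > 0} \<inter> {b. Re b < Re c}" for b
      using F(1)[of b c] H that by auto
  qed auto
  have "F b c = hyp \<alpha> b c \<xi>"
  proof (rule analytic_continuation_open[of "{c. Re c > 0}" "- \<int>\<^sub>\<le>\<^sub>0" "\<lambda>c. F b c" "\<lambda>c. hyp \<alpha> b c \<xi>"])
    have "1 \<in> {c. Re c > 0}" by simp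
    thus "{c. Re c > 0} \<noteq> {}" by blast
    show "{c. Re c > 0} \<subseteq> - \<int>\<^sub>\<le>\<^sub>0" using Re_pos_not_nonpos_Int by blast
    show "(\<lambda>c. hyp \<alpha> b c \<xi>) holomorphic_on - \<int>\<^sub>\<le>\<^sub>0" using H by blast
    show "F b c = hyp \<alpha> b c \<xi>" if "c \<in> {c. Re c > 0}" for c using 1 that by blast
  qed (use F(3) c open_compl_nonpos_Ints connected_compl_nonpos_Ints open_halfspace_Re_gt in blast)+
  thus ?thesis by (simp add: hyp2F1_def F_def)
qed


section \<open>The modified Bessel kernel\<close>

lemma powr_times_exp_bounded:
  fixes r :: real
  assumes "r \<ge> 0"
  obtains C where "C > 0" "\<And>x. x > 0 \<Longrightarrow> x powr r * exp (- x) \<le> C"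
proof -
  define n where "n = nat \<lceil>r\<rceil>"
  have n: "r \<le> real n" using assms by (simp add: n_def)
  have "x powr r * exp (- x) \<le> 1 + fact n" if x: "x > 0" for x
  proof -
    have "x powr r \<le> x powr 0 + x powr real n" using assms n x by (intro powr_le_sum) auto
    also have "\<dots> = 1 + x ^ n" using x by (simp add: powr_realpow)
    also have "x ^ n / fact n \<le> exp x"
    proof -
      have "sum (\<lambda>k. x ^ k /\<^sub>R fact k) {n} \<le> (\<Sum>k. x ^ k /\<^sub>R fact k)"
        by (rule sum_le_suminf[OF summable_exp_generic]) (use x in simp_all)
      thus ?thesis by (simp add: exp_def divide_inverse mult.commute)
    qed
    hence "1 + x ^ n \<le> exp x + fact n * exp x"
      using x by (intro add_mono) (auto simp: field_simps)
    finally show ?thesis by (simp add: exp_minus field_simps)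
  qed
  moreover have "1 + fact n > (0::real)" by (simp add: add_pos_pos)
  ultimately show ?thesis using that by blast
qed

text \<open>The bound e^(-v) \<le> C v^(-2 \<sigma>) at v = Re u / sqrt s buys two things at once: a
  factor s^\<sigma> that repairs a singularity at s = 0, and the decay Re u^(-2 \<sigma>).\<close>

lemma exp_sqrt_bound:
  fixes \<sigma> :: real
  assumes "\<sigma> \<ge> 0"
  obtains C where "C > 0" "\<And>u s. Re u > 0 \<Longrightarrow> s \<in> {0<..<1} \<Longrightarrow>
    norm (exp (- u / of_real (sqrt s))) \<le> C * Re u powr (- 2 * \<sigma>) * s powr \<sigma>"
proof -
  obtain C where C: "C > 0" "\<And>x. x > 0 \<Longrightarrow> x powr (2 * \<sigma>) * exp (- x) \<le> C"
    using powr_times_exp_bounded[of "2 * \<sigma>"] assms by auto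
  have "norm (exp (- u / of_real (sqrt s))) \<le> C * Re u powr (- 2 * \<sigma>) * s powr \<sigma>"
    if u: "Re u > 0" and s: "s \<in> {0<..<1}" for u s
  proof -
    have "sqrt s = s powr (1/2)" using s by (simp add: powr_half_sqrt)
    hence "sqrt s powr (2 * \<sigma>) = s powr \<sigma>" by (simp only: powr_powr) simp
    hence "(Re u / sqrt s) powr (2 * \<sigma>) = Re u powr (2 * \<sigma>) / s powr \<sigma>"
      using u s by (simp add: powr_divide)
    hence "Re u powr (2 * \<sigma>) / s powr \<sigma> * exp (- (Re u / sqrt s)) \<le> C"
      using C(2)[of "Re u / sqrt s"] u s by simp
    hence "exp (- (Re u / sqrt s)) \<le> C * Re u powr (- 2 * \<sigma>) * s powr \<sigma>"
      using u s by (simp add: powr_minus field_simps)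
    thus ?thesis by simp
  qed
  thus ?thesis using C(1) that by blast
qed

lemma of_real_powr_neg_half:
  assumes "s > 0"
  shows "complex_of_real s powr (- (1/2)) = 1 / of_real (sqrt s)"
proof -
  have "complex_of_real s powr (- (1/2)) = complex_of_real (s powr (- (1/2)))"
    using powr_of_real[of s "- (1/2)"] assms by simp
  also have "s powr (- (1/2)) = 1 / sqrt s"
    using assms powr_half_sqrt[of s] powr_minus[of s "1/2"] by (simp only: divide_inverse mult_1)
  finally show ?thesis by simp
qed

text \<open>With s = t^(-2) and \<alpha> + \<beta> = 1/2 this is twice the integral of e^(-u t) (t^2
  - 1)^(\<beta> - 1) over t > 1, the classical integral for the Bessel function K. Over (0,1) the
  Beta kernel estimates apply. Other values of \<alpha> arise from differentiation in
  \<open>u\<close>.\<close>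

definition J_int :: "complex \<Rightarrow> complex \<Rightarrow> complex \<Rightarrow> complex" where
  "J_int \<alpha> \<beta> u = (LINT s|I01. cbeta_kernel \<alpha> \<beta> s * exp (- u / of_real (sqrt s)))"

lemma measurable_exp_sqrt [measurable]:
  "(\<lambda>s. exp (- u / of_real (sqrt s)) :: complex) \<in> borel_measurable I01"
  by (intro measurable_I01_continuous continuous_intros) auto

lemma J_integrand_bound:
  assumes "\<sigma> \<ge> 0"
  obtains C where "C > 0" "\<And>\<alpha> \<beta> u s. Re u > 0 \<Longrightarrow> s \<in> {0<..<1} \<Longrightarrow>
    norm (cbeta_kernel \<alpha> \<beta> s * exp (- u / of_real (sqrt s))) \<le>
      C * Re u powr (- 2 * \<sigma>) * beta_kernel (Re \<alpha> + \<sigma>) (Re \<beta>) s"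
proof -
  obtain C where C: "C > 0" "\<And>u s. Re u > 0 \<Longrightarrow> s \<in> {0<..<1} \<Longrightarrow>
    norm (exp (- u / of_real (sqrt s))) \<le> C * Re u powr (- 2 * \<sigma>) * s powr \<sigma>"
    using exp_sqrt_bound[OF assms] by blast
  have "norm (cbeta_kernel \<alpha> \<beta> s * exp (- u / of_real (sqrt s))) \<le>
      C * Re u powr (- 2 * \<sigma>) * beta_kernel (Re \<alpha> + \<sigma>) (Re \<beta>) s"
    if u: "Re u > 0" and s: "s \<in> {0<..<1}" for \<alpha> \<beta> u s
  proof -
    have "norm (cbeta_kernel \<alpha> \<beta> s * exp (- u / of_real (sqrt s))) \<le>
      beta_kernel (Re \<alpha>) (Re \<beta>) s * (C * Re u powr (- 2 * \<sigma>) * s powr \<sigma>)"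
      unfolding norm_mult norm_cbeta_kernel[OF s] by (intro mult_left_mono C(2) u s beta_kernel_nonneg)
    also have "s powr (Re \<alpha> - 1) * s powr \<sigma> = s powr (Re \<alpha> + \<sigma> - 1)"
      by (simp add: powr_add[symmetric] algebra_simps)
    hence "beta_kernel (Re \<alpha>) (Re \<beta>) s * (C * Re u powr (- 2 * \<sigma>) * s powr \<sigma>) =
       C * Re u powr (- 2 * \<sigma>) * beta_kernel (Re \<alpha> + \<sigma>) (Re \<beta>) s"
      by (simp add: beta_kernel_def mult_ac)
    finally show ?thesis .
  qed
  thus ?thesis using C(1) that by blast
qed

lemma integrable_J:
  assumes "Re u > 0" "Re \<beta> > 0"
  shows "integrable I01 (\<lambda>s. cbeta_kernel \<alpha> \<beta> s * exp (- u / of_real (sqrt s)))"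
proof -
  \<comment> \<open>This makes Re \<alpha> + \<sigma> at least 1 whatever the sign of Re
    \<alpha>.\<close>
  define \<sigma> where "\<sigma> = \<bar>Re \<alpha>\<bar> + 1"
  obtain C where C: "C > 0" "\<And>\<alpha> \<beta> u s. Re u > 0 \<Longrightarrow> s \<in> {0<..<1} \<Longrightarrow>
    norm (cbeta_kernel \<alpha> \<beta> s * exp (- u / of_real (sqrt s))) \<le>
      C * Re u powr (- 2 * \<sigma>) * beta_kernel (Re \<alpha> + \<sigma>) (Re \<beta>) s"
    using J_integrand_bound[of \<sigma>] by (auto simp: \<sigma>_def)
  show ?thesis
  proof (rule Bochner_Integration.integrable_bound)
    show "integrable I01 (\<lambda>s. C * Re u powr (- 2 * \<sigma>) * beta_kernel (Re \<alpha> + \<sigma>) (Re \<beta>) s)"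
      using assms by (intro integrable_mult_right integrable_beta_kernel) (auto simp: \<sigma>_def)
    show "AE s in I01. norm (cbeta_kernel \<alpha> \<beta> s * exp (- u / of_real (sqrt s))) \<le>
       norm (C * Re u powr (- 2 * \<sigma>) * beta_kernel (Re \<alpha> + \<sigma>) (Re \<beta>) s)"
      using C assms by (intro AE_I2) (simp add: abs_mult del: mult_minus_left)
  qed measurable
qed

text \<open>The constant is uniform in \<alpha>, \<beta> and \<open>u\<close>. The free \<sigma>
  fixes the rate of decay and decides how negative Re \<alpha> may be.\<close>

lemma J_int_bound:
  assumes \<sigma>: "\<sigma> \<ge> 0" and pq: "p + \<sigma> > 0" "q > 0"
  obtains C where "C \<ge> 0" "\<And>\<alpha> \<beta> u. Re \<alpha> \<ge> p \<Longrightarrow> Re \<beta> \<ge> q \<Longrightarrow> Re u > 0 \<Longrightarrow>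
     norm (J_int \<alpha> \<beta> u) \<le> C * Re u powr (- 2 * \<sigma>)"
proof -
  obtain C where C: "C > 0" "\<And>\<alpha> \<beta> u s. Re u > 0 \<Longrightarrow> s \<in> {0<..<1} \<Longrightarrow>
    norm (cbeta_kernel \<alpha> \<beta> s * exp (- u / of_real (sqrt s))) \<le>
      C * Re u powr (- 2 * \<sigma>) * beta_kernel (Re \<alpha> + \<sigma>) (Re \<beta>) s"
    using J_integrand_bound[OF \<sigma>] by blast
  have "norm (J_int \<alpha> \<beta> u) \<le> C * Beta (p + \<sigma>) q * Re u powr (- 2 * \<sigma>)"
    if ab: "Re \<alpha> \<ge> p" "Re \<beta> \<ge> q" and u: "Re u > 0" for \<alpha> \<beta> u
  proof -
    have "norm (J_int \<alpha> \<beta> u) \<le> (LINT s|I01. C * Re u powr (- 2 * \<sigma>) * beta_kernel (p + \<sigma>) q s)"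
      unfolding J_int_def
    proof (rule order_trans[OF integral_norm_bound integral_mono])
      show "integrable I01 (\<lambda>s. norm (cbeta_kernel \<alpha> \<beta> s * exp (- u / of_real (sqrt s))))"
        using ab u pq by (intro integrable_norm integrable_J) auto
      show "integrable I01 (\<lambda>s. C * Re u powr (- 2 * \<sigma>) * beta_kernel (p + \<sigma>) q s)"
        using pq by (intro integrable_mult_right integrable_beta_kernel)
      fix s assume "s \<in> space I01"
      hence s: "s \<in> {0<..<1}" by simp
      have "beta_kernel (Re \<alpha> + \<sigma>) (Re \<beta>) s \<le> beta_kernel (p + \<sigma>) q s"
        using ab by (intro beta_kernel_mono s) auto
      hence "C * Re u powr (- 2 * \<sigma>) * beta_kernel (Re \<alpha> + \<sigma>) (Re \<beta>) s \<le> C * Re u powr (- 2 * \<sigma>) * beta_kernel (p + \<sigma>) q s"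
        using C(1) by (intro mult_left_mono) auto
      thus "norm (cbeta_kernel \<alpha> \<beta> s * exp (- u / of_real (sqrt s))) \<le> C * Re u powr (- 2 * \<sigma>) * beta_kernel (p + \<sigma>) q s"
        using C(2)[OF u s, of \<alpha> \<beta>] by linarith
    qed
    also have "\<dots> = C * Beta (p + \<sigma>) q * Re u powr (- 2 * \<sigma>)"
      using pq by (simp add: LINT_beta_kernel)
    finally show ?thesis .
  qed
  moreover have "C * Beta (p + \<sigma>) q \<ge> 0"
    using C(1) pq by (intro mult_nonneg_nonneg) (auto simp: Beta_def)
  ultimately show ?thesis using that by blast
qed

lemma cbeta_kernel_over_sqrt:
  assumes "s \<in> {0<..<1}"
  shows "cbeta_kernel \<alpha> \<beta> s / of_real (sqrt s) = cbeta_kernel (\<alpha> - 1/2) \<beta> s"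
proof -
  have "of_real s powr (\<alpha> - 1) * (1 / of_real (sqrt s)) = complex_of_real s powr (\<alpha> - 1/2 - 1)"
    using assms by (subst of_real_powr_neg_half[symmetric]) (auto simp: powr_add[symmetric] algebra_simps)
  thus ?thesis unfolding cbeta_kernel_def by (metis (no_types, opaque_lifting) mult.commute mult.left_commute mult.right_neutral times_divide_eq_right)
qed

lemma J_int_has_field_derivative:
  assumes u: "Re u > 0" and \<beta>: "Re \<beta> > 0"
  shows "(J_int \<alpha> \<beta> has_field_derivative - J_int (\<alpha> - 1/2) \<beta> u) (at u)"
proof -
  define \<sigma> where "\<sigma> = \<bar>Re \<alpha>\<bar> + 1"
  obtain C where C: "C > 0" "\<And>\<alpha> \<beta> u s. Re u > 0 \<Longrightarrow> s \<in> {0<..<1} \<Longrightarrow>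
    norm (cbeta_kernel \<alpha> \<beta> s * exp (- u / of_real (sqrt s))) \<le>
      C * Re u powr (- 2 * \<sigma>) * beta_kernel (Re \<alpha> + \<sigma>) (Re \<beta>) s"
    using J_integrand_bound[of \<sigma>] by (auto simp: \<sigma>_def)
  have "((\<lambda>u. LINT s|I01. cbeta_kernel \<alpha> \<beta> s * exp (- u / of_real (sqrt s))) has_field_derivative
     (LINT s|I01. deriv (\<lambda>u. cbeta_kernel \<alpha> \<beta> s * exp (- u / of_real (sqrt s))) u)) (at u)"
  \<comment> \<open>In this set comprehension the bound variable shadows the point \<open>u\<close>:
    the condition Re u > Re u / 2 describes the open right half-plane.\<close>
  proof (rule LINT_has_field_derivative[of "{u. Re u > Re u / 2}"] )
    show "open {w. Re w > Re w / 2}"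
    proof -
      have "{w. Re w > Re w / 2} = {w. Re w > 0}" by auto
      thus ?thesis by (simp add: open_halfspace_Re_gt)
    qed
    show "(\<lambda>z. cbeta_kernel \<alpha> \<beta> t * exp (- z / of_real (sqrt t))) holomorphic_on {w. Re w > Re w / 2}"
      if "t \<in> space I01" for t using that by (intro holomorphic_intros) auto
    show "\<exists>r>0. \<exists>g. integrable I01 g \<and> (\<forall>w\<in>ball u r \<inter> {w. Re w > Re w / 2}. \<forall>t\<in>space I01.
        norm (cbeta_kernel \<alpha> \<beta> t * exp (- w / of_real (sqrt t))) \<le> g t)"
    proof (intro exI[of _ "Re u / 2"] exI[of _ "\<lambda>t. C * (Re u / 2) powr (- 2 * \<sigma>) * beta_kernel (Re \<alpha> + \<sigma>) (Re \<beta>) t"] conjI ballI)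
      show "integrable I01 (\<lambda>t. C * (Re u / 2) powr (- 2 * \<sigma>) * beta_kernel (Re \<alpha> + \<sigma>) (Re \<beta>) t)"
        using \<beta> by (intro integrable_mult_right integrable_beta_kernel) (auto simp: \<sigma>_def)
      fix w t assume w: "w \<in> ball u (Re u / 2) \<inter> {w. Re w > Re w / 2}" and "t \<in> space I01"
      hence t: "t \<in> {0<..<1}" by simp
      have "\<bar>Re (u - w)\<bar> < Re u / 2"
        using w abs_Re_le_cmod[of "u - w"] by (auto simp: dist_norm)
      hence w': "Re w > Re u / 2" by (simp add: abs_if split: if_splits)
      have "Re w powr (- 2 * \<sigma>) \<le> (Re u / 2) powr (- 2 * \<sigma>)"
        using w' u by (intro powr_mono2') (auto simp: \<sigma>_def)
      hence "C * Re w powr (- 2 * \<sigma>) * beta_kernel (Re \<alpha> + \<sigma>) (Re \<beta>) t \<le> C * (Re u / 2) powr (- 2 * \<sigma>) * beta_kernel (Re \<alpha> + \<sigma>) (Re \<beta>) t"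
        using C(1) by (intro mult_right_mono mult_left_mono) auto
      thus "norm (cbeta_kernel \<alpha> \<beta> t * exp (- w / of_real (sqrt t))) \<le> C * (Re u / 2) powr (- 2 * \<sigma>) * beta_kernel (Re \<alpha> + \<sigma>) (Re \<beta>) t"
        using C(2)[of w t \<alpha> \<beta>] w' u t by simp
    qed (use u in auto)
    show "u \<in> {w. Re w > Re w / 2}" using u by simp
  qed measurable
  also have "(\<lambda>u. LINT s|I01. cbeta_kernel \<alpha> \<beta> s * exp (- u / of_real (sqrt s))) = J_int \<alpha> \<beta>"
    by (simp add: J_int_def fun_eq_iff)
  also have "(LINT s|I01. deriv (\<lambda>u. cbeta_kernel \<alpha> \<beta> s * exp (- u / of_real (sqrt s))) u) =
     (LINT s|I01. - (cbeta_kernel (\<alpha> - 1/2) \<beta> s * exp (- u / of_real (sqrt s))))"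
  proof (rule Bochner_Integration.integral_cong[OF refl])
    fix s assume "s \<in> space I01"
    hence s: "s \<in> {0<..<1}" by simp
    have "((\<lambda>u. cbeta_kernel \<alpha> \<beta> s * exp (- u / of_real (sqrt s))) has_field_derivative
       - (cbeta_kernel \<alpha> \<beta> s / of_real (sqrt s) * exp (- u / of_real (sqrt s)))) (at u)"
      using s by (auto intro!: derivative_eq_intros)
    thus "deriv (\<lambda>u. cbeta_kernel \<alpha> \<beta> s * exp (- u / of_real (sqrt s))) u = - (cbeta_kernel (\<alpha> - 1/2) \<beta> s * exp (- u / of_real (sqrt s)))"
      unfolding cbeta_kernel_over_sqrt[OF s] by (rule DERIV_imp_deriv)
  qed
  also have "\<dots> = - J_int (\<alpha> - 1/2) \<beta> u" by (simp add: J_int_def)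
  finally show ?thesis .
qed

lemma J_int_holomorphic_params:
  assumes U: "open U" and hol: "\<alpha> holomorphic_on U" "\<beta> holomorphic_on U"
    and \<beta>: "\<And>p. p \<in> U \<Longrightarrow> Re (\<beta> p) > 0" and u: "Re u > 0"
  shows "(\<lambda>p. J_int (\<alpha> p) (\<beta> p) u) holomorphic_on U"
  unfolding J_int_def
proof (rule LINT_holomorphic_on[OF U])
  show "(\<lambda>p. cbeta_kernel (\<alpha> p) (\<beta> p) t * exp (- u / of_real (sqrt t))) holomorphic_on U" if "t \<in> space I01" for t
    using that by (intro holomorphic_intros cbeta_kernel_holomorphic hol) auto
  fix z assume z: "z \<in> U"
  \<comment> \<open>On the chosen neighbourhood Re \<alpha> may drop by 1, and the dominating kernel
    has first exponent 1; together this explains the summand 2.\<close>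
  define \<sigma> where "\<sigma> = \<bar>Re (\<alpha> z)\<bar> + 2"
  obtain C where C: "C > 0" "\<And>\<alpha> \<beta> u s. Re u > 0 \<Longrightarrow> s \<in> {0<..<1} \<Longrightarrow>
    norm (cbeta_kernel \<alpha> \<beta> s * exp (- u / of_real (sqrt s))) \<le>
      C * Re u powr (- 2 * \<sigma>) * beta_kernel (Re \<alpha> + \<sigma>) (Re \<beta>) s"
    using J_integrand_bound[of \<sigma>] by (auto simp: \<sigma>_def)
  have "Re (\<alpha> z) > Re (\<alpha> z) - 1" "Re (\<beta> z) > Re (\<beta> z) / 2" using \<beta>[OF z] by auto
  then obtain r1 r2 where r1: "r1 > 0" "\<And>w. w \<in> ball z r1 \<Longrightarrow> Re (\<alpha> w) > Re (\<alpha> z) - 1"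
    and r2: "r2 > 0" "\<And>w. w \<in> ball z r2 \<Longrightarrow> Re (\<beta> w) > Re (\<beta> z) / 2"
    using continuous_Re_near[OF U hol(1) z] continuous_Re_near[OF U hol(2) z] by metis
  show "\<exists>r>0. \<exists>g. integrable I01 g \<and> (\<forall>w\<in>ball z r \<inter> U. \<forall>t\<in>space I01. norm (cbeta_kernel (\<alpha> w) (\<beta> w) t * exp (- u / of_real (sqrt t))) \<le> g t)"
  proof (intro exI[of _ "min r1 r2"] exI[of _ "\<lambda>t. C * Re u powr (- 2 * \<sigma>) * beta_kernel 1 (Re (\<beta> z) / 2) t"] conjI ballI)
    show "integrable I01 (\<lambda>t. C * Re u powr (- 2 * \<sigma>) * beta_kernel 1 (Re (\<beta> z) / 2) t)"
      using \<beta>[OF z] by (intro integrable_mult_right integrable_beta_kernel) auto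
    fix w t assume w: "w \<in> ball z (min r1 r2) \<inter> U" and "t \<in> space I01"
    hence t: "t \<in> {0<..<1}" by simp
    have "Re (\<alpha> w) > Re (\<alpha> z) - 1" "Re (\<beta> w) > Re (\<beta> z) / 2" using r1(2)[of w] r2(2)[of w] w by auto
    hence "beta_kernel (Re (\<alpha> w) + \<sigma>) (Re (\<beta> w)) t \<le> beta_kernel 1 (Re (\<beta> z) / 2) t"
      by (intro beta_kernel_mono[OF t]) (auto simp: \<sigma>_def)
    hence "C * Re u powr (- 2 * \<sigma>) * beta_kernel (Re (\<alpha> w) + \<sigma>) (Re (\<beta> w)) t \<le> C * Re u powr (- 2 * \<sigma>) * beta_kernel 1 (Re (\<beta> z) / 2) t"
      using C(1) by (intro mult_left_mono) auto
    thus "norm (cbeta_kernel (\<alpha> w) (\<beta> w) t * exp (- u / of_real (sqrt t))) \<le> C * Re u powr (- 2 * \<sigma>) * beta_kernel 1 (Re (\<beta> z) / 2) t"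
      using C(2)[OF u t, of "\<alpha> w" "\<beta> w"] by linarith
  qed (use r1 r2 in auto)
qed measurable

lemma cbeta_kernel_times_compl:
  assumes "s \<in> {0<..<1}"
  shows "cbeta_kernel \<alpha> (\<beta> + 1) s = cbeta_kernel \<alpha> \<beta> s * (1 - of_real s)"
    and "cbeta_kernel (\<alpha> + 1) \<beta> s = cbeta_kernel \<alpha> \<beta> s * of_real s"
proof -
  have "1 - complex_of_real s \<noteq> 0" using assms by (metis eq_iff_diff_eq_0 greaterThanLessThan_iff less_irrefl of_real_eq_1_iff)
  hence "(1 - complex_of_real s) powr (\<beta> + 1 - 1) = (1 - of_real s) powr (\<beta> - 1) * (1 - of_real s)"
    using powr_add[of "1 - complex_of_real s" "\<beta> - 1" 1] by simp
  thus "cbeta_kernel \<alpha> (\<beta> + 1) s = cbeta_kernel \<alpha> \<beta> s * (1 - of_real s)"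
    by (simp add: cbeta_kernel_def mult_ac)
  show "cbeta_kernel (\<alpha> + 1) \<beta> s = cbeta_kernel \<alpha> \<beta> s * of_real s"
    using cbeta_kernel_times_power[OF assms, of \<alpha> \<beta> 1] by simp
qed

text \<open>The partition 1 = (1 - s) + s of the kernel.\<close>

lemma J_int_split:
  assumes "Re u > 0" "Re \<beta> > 0"
  shows "J_int \<alpha> \<beta> u = J_int \<alpha> (\<beta> + 1) u + J_int (\<alpha> + 1) \<beta> u"
proof -
  have "J_int \<alpha> \<beta> u = (LINT s|I01. cbeta_kernel \<alpha> (\<beta> + 1) s * exp (- u / of_real (sqrt s)) +
      cbeta_kernel (\<alpha> + 1) \<beta> s * exp (- u / of_real (sqrt s)))"
    unfolding J_int_def
    by (rule Bochner_Integration.integral_cong[OF refl]) (simp add: cbeta_kernel_times_compl ring_distribs)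
  also have "\<dots> = J_int \<alpha> (\<beta> + 1) u + J_int (\<alpha> + 1) \<beta> u"
    unfolding J_int_def using assms by (intro Bochner_Integration.integral_add integrable_J) auto
  finally show ?thesis .
qed

text \<open>The difference of the two integrands is the derivative of s^(-\<beta>) (1 - s)^\<beta>
  exp (- u / sqrt s), which vanishes at both ends: at 0 through the exponential, at 1 because Re
  \<beta> > 0.\<close>

lemma J_int_by_parts:
  assumes u: "Re u > 0" and \<beta>: "Re \<beta> > 0"
  shows "u / 2 * J_int (- \<beta> - 1/2) (\<beta> + 1) u = \<beta> * J_int (- \<beta>) \<beta> u"
proof -
  define F where "F s = (if s \<in> {0<..<1} then cbeta_kernel (1 - \<beta>) (\<beta> + 1) s * exp (- u / of_real (sqrt s)) else 0)" for s
  define F' where "F' s = u / 2 * (cbeta_kernel (- \<beta> - 1/2) (\<beta> + 1) s * exp (- u / of_real (sqrt s)))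
     - \<beta> * (cbeta_kernel (- \<beta>) \<beta> s * exp (- u / of_real (sqrt s)))" for s
  have intF': "integrable I01 F'" unfolding F'_def
    using u \<beta> by (intro Bochner_Integration.integrable_diff integrable_mult_right integrable_J) auto
  have der0: "((\<lambda>s. cbeta_kernel (1 - \<beta>) (\<beta> + 1) s * exp (- u / of_real (sqrt s))) has_vector_derivative F' s) (at s)"
    if s: "s \<in> {0<..<1}" for s
  proof -
    have s': "s > 0" "s < 1" using s by auto
    have n1: "1 - complex_of_real s \<notin> \<real>\<^sub>\<le>\<^sub>0" using s' by (simp add: complex_nonpos_Reals_iff)
    have ds: "((\<lambda>s. complex_of_real (sqrt s)) has_vector_derivative of_real (1 / (2 * sqrt s))) (at s)"
      by (rule has_vector_derivative_of_real) (use s' in \<open>auto intro!: derivative_eq_intros simp: field_simps\<close>)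
    have d1: "((\<lambda>w. w powr (- \<beta>)) has_field_derivative - \<beta> * of_real s powr (- \<beta> - 1)) (at (complex_of_real s))"
      using s' by (auto intro!: derivative_eq_intros)
    have d2: "((\<lambda>w. (1 - w) powr \<beta>) has_field_derivative - \<beta> * (1 - of_real s) powr (\<beta> - 1)) (at (complex_of_real s))"
      using n1 by (auto intro!: derivative_eq_intros)
    have r: "((\<lambda>s. of_real s) has_vector_derivative (1::complex)) (at s)"
      using has_vector_derivative_of_real[OF DERIV_ident, of "at s"] by simp
    have v1: "((\<lambda>s. complex_of_real s powr (- \<beta>)) has_vector_derivative (- \<beta> * of_real s powr (- \<beta> - 1))) (at s)"
      using field_vector_diff_chain_at[OF r d1] by (simp add: o_def)
    have v2: "((\<lambda>s. (1 - complex_of_real s) powr \<beta>) has_vector_derivative (- \<beta> * (1 - of_real s) powr (\<beta> - 1))) (at s)"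
      using field_vector_diff_chain_at[OF r d2] by (simp add: o_def)
    have d3: "((\<lambda>w. exp (- u / w)) has_field_derivative (u / (of_real (sqrt s))^2 * exp (- u / of_real (sqrt s)))) (at (complex_of_real (sqrt s)))"
      using s' by (auto intro!: derivative_eq_intros simp: power2_eq_square simp del: of_real_sqrt)
    have v3: "((\<lambda>s. exp (- u / of_real (sqrt s))) has_vector_derivative (of_real (1 / (2 * sqrt s)) * (u / (of_real (sqrt s))^2 * exp (- u / of_real (sqrt s))))) (at s)"
      using field_vector_diff_chain_at[OF ds d3] by (simp add: o_def)
    let ?e = "exp (- u / complex_of_real (sqrt s))"
    have "((\<lambda>s. complex_of_real s powr (- \<beta>) * (1 - complex_of_real s) powr \<beta> * exp (- u / of_real (sqrt s))) has_vector_derivative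
       (complex_of_real s powr (- \<beta>) * (1 - complex_of_real s) powr \<beta> * (of_real (1 / (2 * sqrt s)) * (u / (of_real (sqrt s))^2 * ?e)) +
       (complex_of_real s powr (- \<beta>) * (- \<beta> * (1 - of_real s) powr (\<beta> - 1)) + - \<beta> * of_real s powr (- \<beta> - 1) * (1 - complex_of_real s) powr \<beta>) * ?e)) (at s)"
      by (intro has_vector_derivative_mult v1 v2 v3)
    also have "(complex_of_real s powr (- \<beta>) * (1 - complex_of_real s) powr \<beta> * (of_real (1 / (2 * sqrt s)) * (u / (of_real (sqrt s))^2 * ?e)) +
       (complex_of_real s powr (- \<beta>) * (- \<beta> * (1 - of_real s) powr (\<beta> - 1)) + - \<beta> * of_real s powr (- \<beta> - 1) * (1 - complex_of_real s) powr \<beta>) * ?e) = F' s"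
    proof -
      have sq: "(complex_of_real (sqrt s))^2 = of_real s" using s' by (simp flip: of_real_power)
      have a1: "complex_of_real s powr (- \<beta>) * (of_real (1 / (2 * sqrt s)) / of_real s) = 1/2 * of_real s powr (- \<beta> - 1/2 - 1)"
      proof -
        have "complex_of_real s powr (- \<beta> - 1/2 - 1) = of_real s powr (- \<beta>) * of_real s powr (-(1/2)) * of_real s powr (-1)"
          by (simp add: powr_add[symmetric] algebra_simps)
        also have "of_real s powr (-1) = 1 / complex_of_real s" using s' by (simp add: powr_minus_divide)
        finally show ?thesis using s' by (simp add: of_real_powr_neg_half del: of_real_sqrt)
      qed
      have a2: "(1 - complex_of_real s) powr \<beta> = (1 - of_real s) powr (\<beta> - 1) * (1 - of_real s)"
        using powr_add[of "1 - complex_of_real s" "\<beta> - 1" 1] n1 by (auto simp: powr_one')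
      have a3: "complex_of_real s powr (- \<beta>) = of_real s powr (- \<beta> - 1) * of_real s"
        using powr_add[of "complex_of_real s" "- \<beta> - 1" 1] s' by simp
      have "complex_of_real s powr (- \<beta>) * (1 - complex_of_real s) powr \<beta> * (of_real (1 / (2 * sqrt s)) * (u / (of_real (sqrt s))^2 * ?e))
        = u / 2 * (cbeta_kernel (- \<beta> - 1/2) (\<beta> + 1) s * ?e)"
      proof -
        have "complex_of_real s powr (- \<beta>) * (1 - complex_of_real s) powr \<beta> * (of_real (1 / (2 * sqrt s)) * (u / (of_real (sqrt s))^2 * ?e))
          = (complex_of_real s powr (- \<beta>) * (of_real (1 / (2 * sqrt s)) / of_real s)) * (1 - complex_of_real s) powr \<beta> * u * ?e"
          unfolding sq by (simp add: field_simps del: of_real_sqrt)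
        thus ?thesis unfolding a1 by (simp add: cbeta_kernel_def)
      qed
      moreover have "(complex_of_real s powr (- \<beta>) * (- \<beta> * (1 - of_real s) powr (\<beta> - 1)) + - \<beta> * of_real s powr (- \<beta> - 1) * (1 - complex_of_real s) powr \<beta>) = - \<beta> * cbeta_kernel (- \<beta>) \<beta> s"
        unfolding a2 a3 cbeta_kernel_def by (simp add: algebra_simps)
      ultimately show ?thesis by (simp add: F'_def)
    qed
    finally show ?thesis by (simp add: cbeta_kernel_def)
  qed
  have "(F' has_integral (F 1 - F 0)) {0..1}"
  proof (rule fundamental_theorem_of_calculus_interior)
    show "(F has_vector_derivative F' s) (at s)" if s: "s \<in> {0<..<1}" for s
    proof (rule has_vector_derivative_transform_within_open[OF der0[OF s] _ s])
      show "cbeta_kernel (1 - \<beta>) (\<beta> + 1) x * exp (- u / of_real (sqrt x)) = F x" if "x \<in> {0<..<1}" for x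
        using that by (simp add: F_def)
    qed simp
    \<comment> \<open>With \<sigma> = Re \<beta> + 1 the general estimate becomes a multiple of s (1
      - s)^(Re \<beta>), continuous on [0,1] and zero at both ends; this squeezes \<open>F\<close>
      to 0 there.\<close>
    obtain C where C: "C > 0" "\<And>\<alpha> \<beta>' u s. Re u > 0 \<Longrightarrow> s \<in> {0<..<1} \<Longrightarrow>
      norm (cbeta_kernel \<alpha> \<beta>' s * exp (- u / of_real (sqrt s))) \<le>
        C * Re u powr (- 2 * (Re \<beta> + 1)) * beta_kernel (Re \<alpha> + (Re \<beta> + 1)) (Re \<beta>') s"
      using J_integrand_bound[of "Re \<beta> + 1"] \<beta> by (metis add_nonneg_nonneg less_imp_le zero_le_one)
    define D where "D = C * Re u powr (- 2 * (Re \<beta> + 1))"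
    have Fb: "norm (F s) \<le> D * (s * (1 - s) powr Re \<beta>)" if "s \<in> {0..1}" for s
    proof (cases "s \<in> {0<..<1}")
      case True
      have "norm (F s) \<le> D * beta_kernel 2 (Re \<beta> + 1) s"
        using C(2)[OF u True, of "1 - \<beta>" "\<beta> + 1"] True by (simp add: F_def D_def)
      also have "beta_kernel 2 (Re \<beta> + 1) s = s * (1 - s) powr Re \<beta>" using True by (simp add: beta_kernel_def)
      finally show ?thesis .
    next
      case False
      thus ?thesis using that C(1) by (auto simp: F_def D_def)
    qed
    have cg: "continuous_on {0..1} (\<lambda>s. D * (s * (1 - s) powr Re \<beta>))"
      using \<beta> by (intro continuous_on_mult continuous_on_powr' continuous_intros) auto
    show "continuous_on {0..1} F"
      unfolding continuous_on_def
    proof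
      fix s :: real assume s: "s \<in> {0..1}"
      show "(F \<longlongrightarrow> F s) (at s within {0..1})"
      proof (cases "s \<in> {0<..<1}")
        case True
        have "isCont (\<lambda>s. cbeta_kernel (1 - \<beta>) (\<beta> + 1) s * exp (- u / of_real (sqrt s))) s"
          using has_vector_derivative_continuous[OF der0[OF True]] by simp
        hence "((\<lambda>s. cbeta_kernel (1 - \<beta>) (\<beta> + 1) s * exp (- u / of_real (sqrt s))) \<longlongrightarrow> F s) (at s)"
          using True by (simp add: F_def isCont_def)
        hence "(F \<longlongrightarrow> F s) (at s)"
          by (rule Lim_transform_within_open[of _ _ _ _ "{0<..<1}"]) (use True in \<open>auto simp: F_def\<close>)
        thus ?thesis by (rule tendsto_within_subset) auto
      next
        case False
        hence Fs: "F s = 0" "D * (s * (1 - s) powr Re \<beta>) = 0" using s by (auto simp: F_def)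
        have "((\<lambda>s. D * (s * (1 - s) powr Re \<beta>)) \<longlongrightarrow> 0) (at s within {0..1})"
          using cg s Fs(2) unfolding continuous_on_def by metis
        moreover have "eventually (\<lambda>s. norm (F s) \<le> D * (s * (1 - s) powr Re \<beta>)) (at s within {0..1})"
          using Fb by (auto simp: eventually_at_filter)
        ultimately show ?thesis unfolding Fs(1) by (rule Lim_null_comparison[rotated])
      qed
    qed
  qed simp
  moreover have "F 1 - F 0 = 0" by (simp add: F_def)
  ultimately have "(LINT s|I01. F' s) = 0" using has_integral_unique[OF has_integral_I01[OF intF']] by simp
  moreover have "(LINT s|I01. F' s) = u / 2 * J_int (- \<beta> - 1/2) (\<beta> + 1) u - \<beta> * J_int (- \<beta>) \<beta> u"
  proof -
    have "integrable I01 (\<lambda>s. u / 2 * (cbeta_kernel (- \<beta> - 1/2) (\<beta> + 1) s * exp (- u / of_real (sqrt s))))"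
      "integrable I01 (\<lambda>s. \<beta> * (cbeta_kernel (- \<beta>) \<beta> s * exp (- u / of_real (sqrt s))))"
      using u \<beta> by (intro integrable_mult_right integrable_J; simp)+
    from Bochner_Integration.integral_diff[OF this] show ?thesis
      unfolding F'_def J_int_def by (simp only: integral_mult_right_zero)
  qed
  ultimately show ?thesis by simp
qed


section \<open>The power series of the modified Bessel function I\<close>

lemma rGamma_bounded_on_compact:
  fixes K :: "complex set"
  assumes "compact K"
  obtains B where "B \<ge> 0" "\<And>b n. b \<in> K \<Longrightarrow> norm (rGamma (b + of_nat n)) \<le> B"
proof -
  obtain R where R: "\<And>b. b \<in> K \<Longrightarrow> norm b \<le> R"
    using compact_imp_bounded[OF assms] unfolding bounded_iff by blast
  obtain N where N: "real N \<ge> R + 1" using real_arch_simple by blast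
  have "\<exists>B. \<forall>b\<in>K. norm (rGamma (b + of_nat n)) \<le> B" for n
  proof -
    have "compact ((\<lambda>b. rGamma (b + of_nat n)) ` K)"
      by (intro compact_continuous_image assms holomorphic_on_imp_continuous_on[where f = "\<lambda>b. rGamma (b + of_nat n)"] holomorphic_intros)
    from compact_imp_bounded[OF this] obtain B where "\<forall>x\<in>(\<lambda>b. rGamma (b + of_nat n)) ` K. norm x \<le> B"
      unfolding bounded_iff by blast
    thus ?thesis by (intro exI[of _ B]) simp
  qed
  then obtain B where B: "\<And>n b. b \<in> K \<Longrightarrow> norm (rGamma (b + of_nat n)) \<le> B n" by metis
  define B' where "B' = (\<Sum>n\<le>N. \<bar>B n\<bar>)"
  have le: "norm (rGamma (b + of_nat n)) \<le> B'" if "b \<in> K" "n \<le> N" for b n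
  proof -
    have "norm (rGamma (b + of_nat n)) \<le> \<bar>B n\<bar>" using B[OF that(1), of n] by linarith
    also have "\<dots> \<le> B'" unfolding B'_def using that by (intro member_le_sum) auto
    finally show ?thesis .
  qed
  \<comment> \<open>Where |z| \<ge> 1, the relation rGamma z = z rGamma (z + 1) shows that raising
    the argument does not increase the norm, so the bound for the finitely many n \<le> N propagates
    to all n.\<close>
  have ge: "norm (rGamma (b + of_nat (N + k))) \<le> B'" if b: "b \<in> K" for b k
  proof (induction k)
    case 0
    show ?case using le[OF b, of N] by simp
  next
    case (Suc k)
    let ?z = "b + of_nat (N + k)"
    have "real (N + k) - norm b \<le> norm ?z"
      using norm_triangle_ineq2[of "of_nat (N + k)" "- b"]
      by (simp only: norm_of_nat norm_minus_cancel diff_minus_eq_add add.commute[of b])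
    hence z: "norm ?z \<ge> 1" using R[OF b] N by simp
    have "norm (rGamma ?z) = norm ?z * norm (rGamma (?z + 1))"
      by (subst rGamma_plus1[symmetric]) (rule norm_mult)
    moreover have "1 * norm (rGamma (?z + 1)) \<le> norm ?z * norm (rGamma (?z + 1))"
      using z by (intro mult_right_mono) auto
    ultimately have "norm (rGamma (?z + 1)) \<le> norm (rGamma ?z)" by simp
    thus ?case using Suc.IH by (simp add: add_ac)
  qed
  have "norm (rGamma (b + of_nat n)) \<le> B'" if "b \<in> K" for b n
    using le[OF that, of n] ge[OF that, of "n - N"] by (cases "n \<le> N") auto
  moreover have "B' \<ge> 0" by (simp add: B'_def sum_nonneg)
  ultimately show ?thesis using that by blast
qed

text \<open>For b = 1 + \<nu> and w = u^2 / 4 this is (u / 2)^(-\<nu>) I_\<nu>(u). Using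
  \<open>rGamma\<close> keeps it entire in \<open>b\<close>.\<close>

definition bser :: "complex \<Rightarrow> complex \<Rightarrow> complex" where
  "bser b w = (\<Sum>n. rGamma (b + of_nat n) / fact n * w ^ n)"

lemma bser_summable_norm:
  fixes b w :: complex
  shows "summable (\<lambda>n. norm (rGamma (b + of_nat n) / fact n * w ^ n))"
proof -
  obtain B where B: "B \<ge> 0" "\<And>b' n. b' \<in> {b} \<Longrightarrow> norm (rGamma (b' + of_nat n)) \<le> B"
    using rGamma_bounded_on_compact[of "{b}"] by auto
  show ?thesis
  proof (rule summable_comparison_test'[OF summable_mult[OF summable_norm_exp[of w], of B], of 0])
    show "norm (norm (rGamma (b + of_nat n) / fact n * w ^ n)) \<le> B * norm (w ^ n /\<^sub>R fact n)" for n
      using B(2)[of b n] by (simp add: norm_mult norm_divide norm_power divide_simps mult_right_mono)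
  qed
qed

lemma bser_summable:
  fixes b w :: complex
  shows "summable (\<lambda>n. rGamma (b + of_nat n) / fact n * w ^ n)"
  using bser_summable_norm by (rule summable_norm_cancel)

lemma bser_has_field_derivative: "(bser b has_field_derivative bser (b + 1) w) (at w)"
proof -
  have "((\<lambda>w. \<Sum>n. rGamma (b + of_nat n) / fact n * w ^ n) has_field_derivative
     (\<Sum>n. diffs (\<lambda>n. rGamma (b + of_nat n) / fact n) n * w ^ n)) (at w)"
    by (rule termdiffs_strong_converges_everywhere) (rule bser_summable)
  moreover have "diffs (\<lambda>n. rGamma (b + of_nat n) / fact n) n = rGamma (b + 1 + of_nat n) / fact n" for n
  proof -
    have "of_nat (Suc n) * (X / fact (Suc n)) = X / fact n" for X :: complex
      unfolding fact_Suc using of_nat_neq_0[of n, where ?'a = complex] by (simp del: of_nat_Suc)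
    thus ?thesis by (simp add: diffs_def add_ac del: fact_Suc)
  qed
  ultimately show ?thesis by (simp add: bser_def [abs_def])
qed

lemma bser_holomorphic: "f holomorphic_on U \<Longrightarrow> open U \<Longrightarrow> (\<lambda>p. bser (f p) w) holomorphic_on U"
  unfolding bser_def
proof (rule suminf_holomorphic_on)
  assume f: "f holomorphic_on U" and U: "open U"
  show "(\<lambda>p. rGamma (f p + of_nat n) / fact n * w ^ n) holomorphic_on U" for n
    by (intro holomorphic_intros f) auto
  fix z assume z: "z \<in> U"
  obtain r where r: "r > 0" "cball z r \<subseteq> U" using U z open_contains_cball by blast
  have "continuous_on (cball z r) f" using f r holomorphic_on_imp_continuous_on continuous_on_subset by blast
  hence "compact (f ` cball z r)" by (intro compact_continuous_image) auto
  then obtain B where B: "B \<ge> 0" "\<And>b n. b \<in> f ` cball z r \<Longrightarrow> norm (rGamma (b + of_nat n)) \<le> B"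
    using rGamma_bounded_on_compact by blast
  show "\<exists>r>0. \<exists>g. summable g \<and> (\<forall>x\<in>ball z r \<inter> U. \<forall>n. norm (rGamma (f x + of_nat n) / fact n * w ^ n) \<le> g n)"
  proof (intro exI[of _ r] exI[of _ "\<lambda>n. B * norm (w ^ n /\<^sub>R fact n)"] conjI ballI allI)
    show "summable (\<lambda>n. B * norm (w ^ n /\<^sub>R fact n))" by (rule summable_mult[OF summable_norm_exp])
    fix x n assume "x \<in> ball z r \<inter> U"
    hence "norm (rGamma (f x + of_nat n)) \<le> B" by (intro B(2)) auto
    thus "norm (rGamma (f x + of_nat n) / fact n * w ^ n) \<le> B * norm (w ^ n /\<^sub>R fact n)"
      by (simp add: norm_mult norm_divide norm_power divide_simps mult_right_mono)
  qed (rule r)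
qed

text \<open>Coefficientwise this is rGamma (b + n) = (b + n) rGamma (b + n + 1), the part with the
  factor n being shifted by one index; classically, the three-term recurrence of I_\<nu>.\<close>

lemma bser_recurrence: "bser b w = b * bser (b + 1) w + w * bser (b + 2) w"
proof -
  let ?c = "\<lambda>b n. rGamma (b + of_nat n) / fact n * w ^ n"
  have head: "bser b w = rGamma b + (\<Sum>n. ?c b (Suc n))" for b
    unfolding bser_def using suminf_split_head[OF bser_summable, of b w] by simp
  have sS: "summable (\<lambda>n. ?c b (Suc n))" for b by (subst summable_Suc_iff) (rule bser_summable)
  have "?c b (Suc n) = b * ?c (b + 1) (Suc n) + w * ?c (b + 2) n" for n
  proof -
    define k :: complex where "k = of_nat (Suc n)"
    have k: "k \<noteq> 0" unfolding k_def by (rule of_nat_neq_0)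
    have r: "rGamma (b + k) = (b + k) * rGamma (b + k + 1)" by (simp add: rGamma_plus1)
    have e: "b + 2 + of_nat n = b + k + 1" "b + 1 + k = b + k + 1" by (simp_all add: k_def)
    have "(b + k) * X / (k * F) * (w * W) = b * (X / (k * F) * (w * W)) + w * (X / F * W)"
      if "F \<noteq> 0" for X F W using that k by (simp add: field_simps)
    from this[of "fact n" "rGamma (b + k + 1)" "w ^ n"] show ?thesis
      unfolding fact_Suc power_Suc k_def[symmetric] e r by simp
  qed
  hence "(\<Sum>n. ?c b (Suc n)) = (\<Sum>n. b * ?c (b + 1) (Suc n) + w * ?c (b + 2) n)" by simp
  also have "\<dots> = (\<Sum>n. b * ?c (b + 1) (Suc n)) + (\<Sum>n. w * ?c (b + 2) n)"
    by (intro suminf_add[symmetric] summable_mult sS bser_summable)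
  also have "(\<Sum>n. b * ?c (b + 1) (Suc n)) = b * (\<Sum>n. ?c (b + 1) (Suc n))" by (rule suminf_mult[OF sS])
  also have "(\<Sum>n. w * ?c (b + 2) n) = w * bser (b + 2) w" unfolding bser_def by (rule suminf_mult[OF bser_summable])
  finally show ?thesis unfolding head[of b] head[of "b + 1"] by (simp add: ring_distribs rGamma_plus1)
qed

section \<open>The modified Bessel equation on the right half-plane and three solutions of
  it\<close>

definition right_half :: "complex set" where "right_half = {u. Re u > 0}"

lemma right_half_props: "open right_half" "convex right_half" "connected right_half"
  unfolding right_half_def
  by (auto simp: open_halfspace_Re_gt convex_halfspace_Re_gt intro: convex_connected)

lemma right_half_nonpos: "Re u > 0 \<Longrightarrow> u / 2 \<notin> \<real>\<^sub>\<le>\<^sub>0" "Re u > 0 \<Longrightarrow> u \<noteq> 0" "Re u > 0 \<Longrightarrow> u \<notin> \<real>\<^sub>\<le>\<^sub>0"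
  by (auto simp: complex_nonpos_Reals_iff)

lemma bser_even_derivative:
  "((\<lambda>u. bser b (u ^ 2 / 4)) has_field_derivative (u / 2 * bser (b + 1) (u ^ 2 / 4))) (at u)"
proof -
  have "((\<lambda>u. u ^ 2 / 4) has_field_derivative u / 2) (at u)"
    by (auto intro!: derivative_eq_intros simp: power2_eq_square)
  from DERIV_chain[OF bser_has_field_derivative this] show ?thesis by (simp add: o_def mult_ac)
qed

lemma bser_powr_derivative:
  assumes "Re u > 0"
  shows "((\<lambda>u. (u / 2) powr (2 * b) * bser (1 + b) (u ^ 2 / 4)) has_field_derivative
    ((u / 2) powr (2 * b - 1) * bser b (u ^ 2 / 4))) (at u)"
proof -
  have p: "(u / 2) powr (2 * b) = (u / 2) powr (2 * b - 1) * (u / 2)"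
    using powr_add[of "u / 2" "2 * b - 1" 1] assms by (auto simp: powr_one')
  have "((\<lambda>u. (u / 2) powr (2 * b)) has_field_derivative b * (u / 2) powr (2 * b - 1)) (at u)"
    using right_half_nonpos(1)[OF assms] by (auto intro!: derivative_eq_intros)
  from DERIV_mult[OF this bser_even_derivative[of "1 + b" u]]
  have "((\<lambda>u. (u / 2) powr (2 * b) * bser (1 + b) (u ^ 2 / 4)) has_field_derivative
      (b * (u / 2) powr (2 * b - 1) * bser (1 + b) (u ^ 2 / 4) + (u / 2 * bser (1 + b + 1) (u ^ 2 / 4)) * (u / 2) powr (2 * b))) (at u)" .
  also have "(b * (u / 2) powr (2 * b - 1) * bser (1 + b) (u ^ 2 / 4) + (u / 2 * bser (1 + b + 1) (u ^ 2 / 4)) * (u / 2) powr (2 * b))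
     = (u / 2) powr (2 * b - 1) * (b * bser (b + 1) (u ^ 2 / 4) + (u ^ 2 / 4) * bser (b + 2) (u ^ 2 / 4))"
    unfolding p by (simp add: algebra_simps power2_eq_square)
  also have "b * bser (b + 1) (u ^ 2 / 4) + (u ^ 2 / 4) * bser (b + 2) (u ^ 2 / 4) = bser b (u ^ 2 / 4)"
    by (rule bser_recurrence[symmetric])
  finally show ?thesis .
qed

text \<open>The modified Bessel equation in Sturm--Liouville form, as a first order system for a solution
  \<open>f\<close> and its quasi-derivative \<open>Q\<close>; the Wronskian of two solutions is then constant.\<close>

definition bessel_pair :: "complex \<Rightarrow> (complex \<Rightarrow> complex) \<Rightarrow> (complex \<Rightarrow> complex) \<Rightarrow> bool" where
  "bessel_pair \<beta> f Q \<longleftrightarrow> (\<forall>u\<in>right_half.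
     (f has_field_derivative ((u / 2) powr (- (2 * \<beta>)) * Q u)) (at u) \<and>
     (Q has_field_derivative ((u / 2) powr (2 * \<beta>) * f u)) (at u))"

text \<open>The value of the constant Wronskian can be read off along a single sequence; in the
  applications this is 1/(k + 1), tending to the singular point 0.\<close>

lemma bessel_wronskian_limit:
  assumes fP: "bessel_pair \<beta> f P" and gQ: "bessel_pair \<beta> g Q"
    and X: "\<And>k. X k \<in> right_half" and lim: "(\<lambda>k. f (X k) * Q (X k) - P (X k) * g (X k)) \<longlonglongrightarrow> L"
    and u: "u \<in> right_half"
  shows "f u * Q u - P u * g u = L"
proof -
  have "\<exists>c. \<forall>u\<in>right_half. f u * Q u - P u * g u = c"
  proof (rule has_field_derivative_zero_constant[OF right_half_props(2)])
    fix v assume v: "v \<in> right_half"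
    have f: "(f has_field_derivative ((v / 2) powr (- (2 * \<beta>)) * P v)) (at v)"
      "(P has_field_derivative ((v / 2) powr (2 * \<beta>) * f v)) (at v)"
      "(g has_field_derivative ((v / 2) powr (- (2 * \<beta>)) * Q v)) (at v)"
      "(Q has_field_derivative ((v / 2) powr (2 * \<beta>) * g v)) (at v)"
      using fP gQ v unfolding bessel_pair_def by auto
    have "((\<lambda>u. f u * Q u - P u * g u) has_field_derivative
      ((v / 2) powr (- (2 * \<beta>)) * P v * Q v + (v / 2) powr (2 * \<beta>) * g v * f v -
      ((v / 2) powr (2 * \<beta>) * f v * g v + (v / 2) powr (- (2 * \<beta>)) * Q v * P v))) (at v)"
      by (intro DERIV_diff DERIV_mult f)
    hence "((\<lambda>u. f u * Q u - P u * g u) has_field_derivative 0) (at v)" by (simp add: mult_ac)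
    thus "((\<lambda>u. f u * Q u - P u * g u) has_field_derivative 0) (at v within right_half)"
      by (rule has_field_derivative_at_within)
  qed
  then obtain c where c: "\<And>u. u \<in> right_half \<Longrightarrow> f u * Q u - P u * g u = c" by blast
  have "(\<lambda>k. f (X k) * Q (X k) - P (X k) * g (X k)) = (\<lambda>k. c)" using c X by auto
  hence "L = c" using lim LIMSEQ_unique tendsto_const by metis
  thus ?thesis using c u by simp
qed

lemma bessel_pair_series1:
  assumes "\<beta> = 1/2 - z"
  shows "bessel_pair \<beta> (\<lambda>u. bser (1 - z) (u ^ 2 / 4)) (\<lambda>u. (u / 2) powr (2 * (1 - z)) * bser (1 + (1 - z)) (u ^ 2 / 4))"
  unfolding bessel_pair_def
proof (intro ballI conjI)
  fix u assume "u \<in> right_half"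
  hence u: "Re u > 0" by (simp add: right_half_def)
  have "(u / 2) powr (- (2 * \<beta>)) * ((u / 2) powr (2 * (1 - z)) * bser (1 + (1 - z)) (u ^ 2 / 4)) = u / 2 * bser (1 - z + 1) (u ^ 2 / 4)"
  proof -
    have "(u / 2) powr (- (2 * \<beta>)) * (u / 2) powr (2 * (1 - z)) = (u / 2) powr (- (2 * \<beta>) + 2 * (1 - z))"
      by (rule powr_add[symmetric])
    also have "- (2 * \<beta>) + 2 * (1 - z) = 1" by (simp add: assms algebra_simps)
    also have "(u / 2) powr 1 = u / 2" using right_half_nonpos[OF u] by (simp add: powr_one')
    finally have "(u / 2) powr (- (2 * \<beta>)) * (u / 2) powr (2 * (1 - z)) = u / 2" .
    moreover have "1 + (1 - z) = 1 - z + 1" by simp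
    ultimately show ?thesis by (simp only: mult.assoc[symmetric])
  qed
  from bser_even_derivative[of "1 - z" u, folded this]
  show "((\<lambda>u. bser (1 - z) (u ^ 2 / 4)) has_field_derivative
      (u / 2) powr (- (2 * \<beta>)) * ((u / 2) powr (2 * (1 - z)) * bser (1 + (1 - z)) (u ^ 2 / 4))) (at u)" .
  have "2 * (1 - z) - 1 = 2 * \<beta>" by (simp add: assms)
  thus "((\<lambda>u. (u / 2) powr (2 * (1 - z)) * bser (1 + (1 - z)) (u ^ 2 / 4)) has_field_derivative
       (u / 2) powr (2 * \<beta>) * bser (1 - z) (u ^ 2 / 4)) (at u)"
    using bser_powr_derivative[OF u, of "1 - z"] by metis
qed

lemma bessel_pair_series2:
  assumes "\<beta> = 1/2 - z"
  shows "bessel_pair \<beta> (\<lambda>u. (u / 2) powr (2 * z) * bser (1 + z) (u ^ 2 / 4)) (\<lambda>u. bser z (u ^ 2 / 4))"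
  unfolding bessel_pair_def
proof (intro ballI conjI)
  fix u assume "u \<in> right_half"
  hence u: "Re u > 0" by (simp add: right_half_def)
  have "2 * z - 1 = - (2 * \<beta>)" by (simp add: assms)
  thus "((\<lambda>u. (u / 2) powr (2 * z) * bser (1 + z) (u ^ 2 / 4)) has_field_derivative
       (u / 2) powr (- (2 * \<beta>)) * bser z (u ^ 2 / 4)) (at u)"
    using bser_powr_derivative[OF u, of z] by metis
  have "(u / 2) powr (2 * \<beta>) * ((u / 2) powr (2 * z) * bser (1 + z) (u ^ 2 / 4)) = u / 2 * bser (z + 1) (u ^ 2 / 4)"
  proof -
    have "(u / 2) powr (2 * \<beta>) * (u / 2) powr (2 * z) = (u / 2) powr (2 * \<beta> + 2 * z)"
      by (rule powr_add[symmetric])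
    also have "2 * \<beta> + 2 * z = 1" by (simp add: assms algebra_simps)
    also have "(u / 2) powr 1 = u / 2" using right_half_nonpos[OF u] by (simp add: powr_one')
    finally have "(u / 2) powr (2 * \<beta>) * (u / 2) powr (2 * z) = u / 2" .
    thus ?thesis by (simp only: mult.assoc[symmetric] add.commute[of 1 z])
  qed
  from bser_even_derivative[of z u, folded this]
  show "((\<lambda>u. bser z (u ^ 2 / 4)) has_field_derivative (u / 2) powr (2 * \<beta>) * ((u / 2) powr (2 * z) * bser (1 + z) (u ^ 2 / 4))) (at u)" .
qed

text \<open>Differentiation in \<open>u\<close> lowers \<alpha> by 1/2; integration by parts and the
  splitting 1 = (1 - s) + s bring the result back to the original integral.\<close>

lemma bessel_pair_J:
  assumes "Re \<beta> > 0"
  shows "bessel_pair \<beta> (J_int (1/2 - \<beta>) \<beta>) (\<lambda>u. - ((u / 2) powr (2 * \<beta>) * J_int (- \<beta>) \<beta> u))"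
  unfolding bessel_pair_def
proof (intro ballI conjI)
  fix u assume "u \<in> right_half"
  hence u: "Re u > 0" by (simp add: right_half_def)
  have nz: "(u / 2) powr (2 * \<beta>) \<noteq> 0" using right_half_nonpos[OF u] by simp
  show "(J_int (1/2 - \<beta>) \<beta> has_field_derivative (u / 2) powr (- (2 * \<beta>)) * - ((u / 2) powr (2 * \<beta>) * J_int (- \<beta>) \<beta> u)) (at u)"
    using J_int_has_field_derivative[OF u assms, of "1/2 - \<beta>"] nz by (simp add: powr_minus field_simps)
  have p: "(u / 2) powr (2 * \<beta>) = (u / 2) powr (2 * \<beta> - 1) * (u / 2)"
    using powr_add[of "u / 2" "2 * \<beta> - 1" 1] right_half_nonpos[OF u] by (auto simp: powr_one')
  have "((\<lambda>u. (u / 2) powr (2 * \<beta>)) has_field_derivative \<beta> * (u / 2) powr (2 * \<beta> - 1)) (at u)"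
    using right_half_nonpos(1)[OF u] by (auto intro!: derivative_eq_intros)
  from DERIV_minus[OF DERIV_mult[OF this J_int_has_field_derivative[OF u assms, of "- \<beta>"]]]
  have "((\<lambda>u. - ((u / 2) powr (2 * \<beta>) * J_int (- \<beta>) \<beta> u)) has_field_derivative
     - (\<beta> * (u / 2) powr (2 * \<beta> - 1) * J_int (- \<beta>) \<beta> u + - J_int (- \<beta> - 1/2) \<beta> u * (u / 2) powr (2 * \<beta>))) (at u)" .
  also have "- (\<beta> * (u / 2) powr (2 * \<beta> - 1) * J_int (- \<beta>) \<beta> u + - J_int (- \<beta> - 1/2) \<beta> u * (u / 2) powr (2 * \<beta>))
    = (u / 2) powr (2 * \<beta> - 1) * (u / 2 * J_int (- \<beta> - 1/2) \<beta> u - \<beta> * J_int (- \<beta>) \<beta> u)"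
    unfolding p by (simp add: algebra_simps)
  also have "\<beta> * J_int (- \<beta>) \<beta> u = u / 2 * J_int (- \<beta> - 1/2) (\<beta> + 1) u" by (rule J_int_by_parts[OF u assms, symmetric])
  also have "u / 2 * J_int (- \<beta> - 1/2) \<beta> u - u / 2 * J_int (- \<beta> - 1/2) (\<beta> + 1) u = u / 2 * J_int (1/2 - \<beta>) \<beta> u"
    unfolding J_int_split[OF u assms, of "- \<beta> - 1/2"] by (simp add: ring_distribs)
  also have "(u / 2) powr (2 * \<beta> - 1) * (u / 2 * J_int (1/2 - \<beta>) \<beta> u) = (u / 2) powr (2 * \<beta>) * J_int (1/2 - \<beta>) \<beta> u"
    unfolding p by simp
  finally show "((\<lambda>u. - ((u / 2) powr (2 * \<beta>) * J_int (- \<beta>) \<beta> u)) has_field_derivative (u / 2) powr (2 * \<beta>) * J_int (1/2 - \<beta>) \<beta> u) (at u)" .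
qed


section \<open>Behaviour of the integral solution at the origin\<close>

lemma J_int_substitution:
  fixes u :: real
  assumes u: "u > 0" and \<beta>: "Re \<beta> > 0"
  defines "h \<equiv> (\<lambda>r. 2 * of_real r powr (2 * \<beta> - 1) * (1 - of_real ((u / r)\<^sup>2)) powr \<beta> * exp (- of_real r) :: complex)"
  shows "h integrable_on {u<..}"
    and "integral {u<..} h = of_real u powr (2 * \<beta>) * J_int (- \<beta>) (\<beta> + 1) (of_real u)"
proof -
  define f where "f s = cbeta_kernel (- \<beta>) (\<beta> + 1) s * exp (- of_real u / of_real (sqrt s))" for s
  define g where "g r = (u / r)\<^sup>2" for r
  define g' where "g' r = - 2 * u\<^sup>2 / r ^ 3" for r
  have img: "g ` {u<..} = {0<..<1}"
  proof (intro equalityI subsetI)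
    fix s assume s: "s \<in> {0<..<(1::real)}"
    hence "sqrt s < 1" by simp
    hence "u / sqrt s \<in> {u<..}" using s u by (simp add: field_simps)
    moreover have "g (u / sqrt s) = s" using s u by (simp add: g_def)
    ultimately show "s \<in> g ` {u<..}" by (metis image_eqI)
  next
    fix s assume "s \<in> g ` {u<..}"
    then obtain r where r: "r > u" "s = (u / r)\<^sup>2" by (auto simp: g_def)
    hence "0 < u / r" "u / r < 1" using u by auto
    moreover from this have "(u / r)\<^sup>2 < 1\<^sup>2" by (intro power_strict_mono) auto
    ultimately show "s \<in> {0<..<1}" unfolding r(2) by (metis greaterThanLessThan_iff one_power2 zero_less_power)
  qed
  have inj: "inj_on g {u<..}"
  proof (rule inj_onI)
    fix x y assume xy: "x \<in> {u<..}" "y \<in> {u<..}" "g x = g y"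
    hence "u / x = u / y" using u unfolding g_def by (subst (asm) power2_eq_iff_nonneg) auto
    thus "x = y" using u xy by (simp add: field_simps)
  qed
  have der: "(g has_field_derivative g' r) (at r within {u<..})" if "r \<in> {u<..}" for r
  proof -
    have "((\<lambda>r. (u / r)\<^sup>2) has_field_derivative (- 2 * u\<^sup>2 / r ^ 3)) (at r within {u<..})"
      using that u by (auto intro!: derivative_eq_intros simp: power2_eq_square power3_eq_cube mult_ac)
    thus ?thesis by (simp add: g_def [abs_def] g'_def)
  qed
  have intf: "integrable I01 f" unfolding f_def using u \<beta> by (intro integrable_J) auto
  have "set_integrable lborel {0<..<1} f" using intf by (simp add: integrable_I01_iff)
  hence abs: "f absolutely_integrable_on {0<..<1}"
    unfolding set_integrable_def by (subst integrable_completion) (auto dest: borel_measurable_integrable)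
  have val: "integral {0<..<1} f = J_int (- \<beta>) (\<beta> + 1) (of_real u)"
    using has_integral_I01[OF intf] by (simp add: J_int_def f_def has_integral_Icc_iff_Ioo integral_unique)
  have "(\<lambda>r. \<bar>g' r\<bar> *\<^sub>R f (g r)) absolutely_integrable_on {u<..} \<and>
      integral {u<..} (\<lambda>r. \<bar>g' r\<bar> *\<^sub>R f (g r)) = J_int (- \<beta>) (\<beta> + 1) (of_real u)"
    by (subst has_absolute_integral_change_of_variables_real[OF _ der inj]) (use img abs val in auto)
  hence A: "(\<lambda>r. \<bar>g' r\<bar> *\<^sub>R f (g r)) integrable_on {u<..}"
    "integral {u<..} (\<lambda>r. \<bar>g' r\<bar> *\<^sub>R f (g r)) = J_int (- \<beta>) (\<beta> + 1) (of_real u)"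
    using set_lebesgue_integral_eq_integral(1) by auto
  have eq: "of_real u powr (2 * \<beta>) * (\<bar>g' r\<bar> *\<^sub>R f (g r)) = h r" if r: "r \<in> {u<..}" for r
  proof -
    have r': "r > 0" "r > u" using r u by auto
    \<comment> \<open>All powers become exponentials of the two real logarithms, which reduces the
      Jacobian and the branches to one identity of exponents.\<close>
    define L K where "L = complex_of_real (ln u)" and "K = complex_of_real (ln r)"
    have Lu: "Ln (complex_of_real u) = L" "Ln (complex_of_real r) = K" using u r' by (simp_all add: L_def K_def Ln_of_real)
    have Lg: "Ln (complex_of_real (g r)) = 2 * (L - K)"
      using u r' by (subst Ln_of_real) (auto simp: g_def L_def K_def ln_realpow ln_div)
    have gp: "complex_of_real (\<bar>g' r\<bar>) = 2 * exp (2 * L - 3 * K)"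
    proof -
      have "exp (2 * ln u - 3 * ln r) = u\<^sup>2 / r ^ 3"
        using u r' by (simp add: exp_diff exp_of_nat_mult[of 2, simplified] exp_of_nat_mult[of 3, simplified])
      moreover have "2 * exp (2 * L - 3 * K) = complex_of_real (2 * exp (2 * ln u - 3 * ln r))"
        by (simp add: L_def K_def exp_of_real[symmetric])
      ultimately show ?thesis using u r' by (simp add: g'_def abs_if)
    qed
    have "complex_of_real u powr (2 * \<beta>) * of_real (\<bar>g' r\<bar>) * of_real (g r) powr (- \<beta> - 1) = 2 * of_real r powr (2 * \<beta> - 1)"
    proof -
      have nz: "complex_of_real u \<noteq> 0" "complex_of_real r \<noteq> 0" "complex_of_real (g r) \<noteq> 0" using u r' by (auto simp: g_def)
      have e: "2 * \<beta> * L + (2 * L - 3 * K) + (- \<beta> - 1) * (2 * (L - K)) = (2 * \<beta> - 1) * K" by (simp add: algebra_simps)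
      show ?thesis unfolding gp using nz by (simp add: powr_def Lu Lg e[symmetric] exp_add)
    qed
    moreover have "sqrt (g r) = u / r" using u r' by (simp add: g_def)
    ultimately show ?thesis
      using u r' by (simp add: h_def f_def cbeta_kernel_def scaleR_conv_of_real mult_ac g_def[symmetric] del: of_real_divide)
         (simp add: mult.assoc[symmetric])
  qed
  have "((\<lambda>r. of_real u powr (2 * \<beta>) * (\<bar>g' r\<bar> *\<^sub>R f (g r))) has_integral of_real u powr (2 * \<beta>) * J_int (- \<beta>) (\<beta> + 1) (of_real u)) {u<..}"
    using A by (intro has_integral_mult_right) (simp add: has_integral_integral[symmetric] has_integral_iff)
  hence "(h has_integral of_real u powr (2 * \<beta>) * J_int (- \<beta>) (\<beta> + 1) (of_real u)) {u<..}"
    by (subst has_integral_cong[OF eq[symmetric]]) auto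
  thus "h integrable_on {u<..}" "integral {u<..} h = of_real u powr (2 * \<beta>) * J_int (- \<beta>) (\<beta> + 1) (of_real u)"
    by (auto simp: has_integral_iff)
qed

text \<open>The integral blows up at u = 0. The substitution s = (u / r)^2 extracts u^(-2 \<beta>)
  and leaves an integral over r > u, dominated by twice the Gamma integrand of 2 \<beta>.\<close>

lemma J_int_limit_at_zero:
  assumes \<beta>: "Re \<beta> > 0"
  shows "(\<lambda>k. of_real (1 / real (Suc k)) powr (2 * \<beta>) * J_int (- \<beta>) (\<beta> + 1) (of_real (1 / real (Suc k)))) \<longlonglongrightarrow> 2 * Gamma (2 * \<beta>)"
proof -
  define u where "u k = 1 / real (Suc k)" for k
  have u: "u k > 0" for k by (simp add: u_def)
  have ulim: "u \<longlonglongrightarrow> 0" unfolding u_def using LIMSEQ_inverse_real_of_nat by (simp add: inverse_eq_divide)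
  define G where "G r = (2 * (of_real r powr (2 * \<beta> - 1) / of_real (exp r)) :: complex)" for r
  define h where "h k r = (2 * of_real r powr (2 * \<beta> - 1) * (1 - of_real ((u k / r)\<^sup>2)) powr \<beta> * exp (- of_real r) :: complex)" for k r
  define f where "f k r = (if r \<in> {u k<..} then h k r else 0)" for k r
  have Gi: "(G has_integral 2 * Gamma (2 * \<beta>)) {0<..}"
    unfolding G_def by (intro has_integral_mult_right Gamma_integral_complex') (use \<beta> in auto)
  have Gabs: "(\<lambda>r. norm (G r)) integrable_on {0<..}"
  proof -
    have "G absolutely_integrable_on {0<..}"
      unfolding G_def using absolutely_integrable_Gamma_integral'[of "2 * \<beta>"] \<beta> by (intro set_integrable_mult_right) auto
    thus ?thesis using absolutely_integrable_on_def by blast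
  qed
  have fi: "f k integrable_on {0<..}" "integral {0<..} (f k) = of_real (u k) powr (2 * \<beta>) * J_int (- \<beta>) (\<beta> + 1) (of_real (u k))" for k
  proof -
    have sub: "{u k<..} \<subseteq> {0<..}" using u[of k] by auto
    have "(h k has_integral of_real (u k) powr (2 * \<beta>) * J_int (- \<beta>) (\<beta> + 1) (of_real (u k))) {u k<..}"
      unfolding has_integral_iff using J_int_substitution[OF u[of k] \<beta>] by (simp add: h_def [abs_def])
    hence "(f k has_integral of_real (u k) powr (2 * \<beta>) * J_int (- \<beta>) (\<beta> + 1) (of_real (u k))) {0<..}"
      unfolding f_def by (subst has_integral_restrict[OF sub])
    thus "f k integrable_on {0<..}" "integral {0<..} (f k) = of_real (u k) powr (2 * \<beta>) * J_int (- \<beta>) (\<beta> + 1) (of_real (u k))"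
      by (auto simp: has_integral_iff)
  qed
  have le: "norm (f k r) \<le> norm (G r)" if r: "r \<in> {0<..}" for k r
  proof (cases "r > u k")
    case True
    define q where "q = (u k / r)\<^sup>2"
    have "0 < u k / r" "u k / r < 1" using True u[of k] by auto
    hence q: "0 \<le> q" "q < 1" unfolding q_def using abs_square_less_1[of "u k / r"] by simp_all
    have "norm ((1 - complex_of_real q) powr \<beta>) = (1 - q) powr Re \<beta>"
      using norm_powr_real_powr[of "of_real (1 - q)" \<beta>] q by simp
    also have "\<dots> \<le> 1" using q \<beta> by (intro powr_le1) auto
    finally have "norm (2 * complex_of_real r powr (2 * \<beta> - 1)) * norm ((1 - complex_of_real q) powr \<beta>) * exp (- r) \<le> norm (2 * complex_of_real r powr (2 * \<beta> - 1)) * 1 * exp (- r)"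
      by (intro mult_right_mono mult_left_mono) auto
    thus ?thesis using True by (simp add: f_def h_def G_def q_def norm_mult norm_divide exp_minus divide_inverse norm_inverse norm_exp_eq_Re)
  qed (simp add: f_def)
  have conv: "(\<lambda>k. f k r) \<longlonglongrightarrow> G r" if r: "r \<in> {0<..}" for r
  proof -
    have "(\<lambda>k. 1 - complex_of_real ((u k / r)\<^sup>2)) \<longlonglongrightarrow> 1 - complex_of_real ((0 / r)\<^sup>2)"
      using r by (intro tendsto_intros ulim) auto
    hence "(\<lambda>k. 1 - complex_of_real ((u k / r)\<^sup>2)) \<longlonglongrightarrow> 1" by simp
    hence "(\<lambda>k. (1 - complex_of_real ((u k / r)\<^sup>2)) powr \<beta>) \<longlonglongrightarrow> 1 powr \<beta>"
      by (rule tendsto_powr_complex[rotated]) auto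
    hence "(\<lambda>k. h k r) \<longlonglongrightarrow> 2 * of_real r powr (2 * \<beta> - 1) * 1 powr \<beta> * exp (- of_real r)"
      unfolding h_def by (intro tendsto_mult tendsto_const)
    also have "2 * of_real r powr (2 * \<beta> - 1) * 1 powr \<beta> * exp (- of_real r) = G r"
      by (simp add: G_def exp_minus divide_inverse exp_of_real)
    finally have "(\<lambda>k. h k r) \<longlonglongrightarrow> G r" .
    moreover have "eventually (\<lambda>k. u k < r) sequentially" using order_tendstoD(2)[OF ulim, of r] r by simp
    hence "eventually (\<lambda>k. h k r = f k r) sequentially" by eventually_elim (simp add: f_def)
    ultimately show ?thesis by (rule Lim_transform_eventually)
  qed
  have "(\<lambda>k. integral {0<..} (f k)) \<longlonglongrightarrow> integral {0<..} G"
    by (rule dominated_convergence(2)[OF fi(1) Gabs le conv])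
  thus ?thesis unfolding fi(2) using Gi by (simp add: u_def integral_unique)
qed


section \<open>The connection formula for K and its integral form\<close>

lemma sin_pi_nonzero:
  fixes z :: complex
  assumes "z \<notin> \<int>"
  shows "sin (of_real pi * z) \<noteq> 0"
proof
  assume "sin (of_real pi * z) = 0"
  then obtain n where "of_real pi * z = of_real (real_of_int n * pi)" by (auto simp: sin_eq_0)
  hence "z = of_int n" by simp
  thus False using assms by simp
qed

text \<open>For non-integer z this is 2 (u / 2)^z K_z(u), written through the difference of I_(-z)
  and I_z.\<close>

definition kser :: "complex \<Rightarrow> complex \<Rightarrow> complex" where
  "kser z u = of_real pi / sin (of_real pi * z) *
     (bser (1 - z) (u ^ 2 / 4) - (u / 2) powr (2 * z) * bser (1 + z) (u ^ 2 / 4))"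

lemma tendsto_inverse_Suc_powr:
  assumes "Re c > 0"
  shows "(\<lambda>k. complex_of_real (1 / real (Suc k)) powr c) \<longlonglongrightarrow> 0"
proof (rule tendsto_norm_zero_cancel)
  have "(\<lambda>k. (1 / real (Suc k)) powr Re c) \<longlonglongrightarrow> 0"
  proof (rule tendsto_zero_powrI)
    show "(\<lambda>k. 1 / real (Suc k)) \<longlonglongrightarrow> 0"
      using LIMSEQ_inverse_real_of_nat by (simp add: inverse_eq_divide)
  qed (use assms in auto)
  moreover have "norm (complex_of_real (1 / real (Suc k)) powr c) = (1 / real (Suc k)) powr Re c" for k
    by (subst norm_powr_real_powr) auto
  ultimately show "(\<lambda>k. norm (complex_of_real (1 / real (Suc k)) powr c)) \<longlonglongrightarrow> 0" by simp
qed

lemma of_real_half_powr: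
  assumes "r \<ge> 0"
  shows "(of_real r / 2) powr c = of_real r powr c * (1/2 :: complex) powr c"
  using powr_times_real[of "of_real r" "1/2" c] assms by simp

lemma bser_zero: "bser b 0 = rGamma b"
  unfolding bser_def by (rule trans[OF powser_zero]) simp

lemma tendsto_bser_inverse_Suc:
  "(\<lambda>k. bser b (complex_of_real (1 / real (Suc k)) ^ 2 / 4)) \<longlonglongrightarrow> rGamma b"
proof -
  have lim: "(\<lambda>k. complex_of_real (1 / real (Suc k))) \<longlonglongrightarrow> of_real 0"
    using LIMSEQ_inverse_real_of_nat by (intro tendsto_of_real) (simp add: inverse_eq_divide)
  have "isCont (\<lambda>u. bser b (u ^ 2 / 4)) 0" using bser_even_derivative DERIV_isCont by blast
  hence "((\<lambda>u. bser b (u ^ 2 / 4)) \<longlongrightarrow> rGamma b) (at 0)" by (simp add: isCont_def bser_zero)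
  moreover have "filterlim (\<lambda>k. complex_of_real (1 / real (Suc k))) (at 0) sequentially"
    using lim by (intro filterlim_atI) (simp_all del: of_nat_Suc)
  ultimately show ?thesis by (rule filterlim_compose)
qed

lemma J_int_tendsto_zero:
  assumes "Re \<alpha> > 0" "Re \<beta> > 0"
  shows "(\<lambda>k. J_int \<alpha> \<beta> (of_real (1 / real (Suc k)))) \<longlonglongrightarrow> Gamma \<alpha> * Gamma \<beta> / Gamma (\<alpha> + \<beta>)"
proof -
  have "(\<lambda>k. J_int \<alpha> \<beta> (of_real (1 / real (Suc k)))) \<longlonglongrightarrow> (LINT s|I01. cbeta_kernel \<alpha> \<beta> s)"
    unfolding J_int_def
  proof (rule integral_dominated_convergence[where w = "beta_kernel (Re \<alpha>) (Re \<beta>)"])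
    show "integrable I01 (beta_kernel (Re \<alpha>) (Re \<beta>))" by (rule integrable_beta_kernel[OF assms])
    show "AE s in I01. norm (cbeta_kernel \<alpha> \<beta> s * exp (- of_real (1 / real (Suc k)) / of_real (sqrt s))) \<le> beta_kernel (Re \<alpha>) (Re \<beta>) s" for k
    proof (rule AE_I2)
      fix s assume "s \<in> space I01"
      hence s: "s \<in> {0<..<1}" by simp
      have "norm (exp (- of_real (1 / real (Suc k)) / complex_of_real (sqrt s))) \<le> 1"
        using s by (simp add: norm_exp_eq_Re)
      hence "beta_kernel (Re \<alpha>) (Re \<beta>) s * norm (exp (- of_real (1 / real (Suc k)) / complex_of_real (sqrt s))) \<le> beta_kernel (Re \<alpha>) (Re \<beta>) s * 1"
        by (intro mult_left_mono) auto
      thus "norm (cbeta_kernel \<alpha> \<beta> s * exp (- of_real (1 / real (Suc k)) / of_real (sqrt s))) \<le> beta_kernel (Re \<alpha>) (Re \<beta>) s"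
        by (simp only: norm_mult norm_cbeta_kernel[OF s] mult_1_right)
    qed
    show "AE s in I01. (\<lambda>k. cbeta_kernel \<alpha> \<beta> s * exp (- of_real (1 / real (Suc k)) / of_real (sqrt s))) \<longlonglongrightarrow> cbeta_kernel \<alpha> \<beta> s"
    proof (rule AE_I2)
      fix s assume "s \<in> space I01"
      hence s: "s \<in> {0<..<1}" by simp
      have "(\<lambda>k. 1 / real (Suc k)) \<longlonglongrightarrow> 0" using LIMSEQ_inverse_real_of_nat by (simp add: inverse_eq_divide)
      hence *: "(\<lambda>k. complex_of_real (1 / real (Suc k))) \<longlonglongrightarrow> of_real 0" by (rule tendsto_of_real)
      hence "(\<lambda>k. cbeta_kernel \<alpha> \<beta> s * exp (- of_real (1 / real (Suc k)) / of_real (sqrt s))) \<longlonglongrightarrow> cbeta_kernel \<alpha> \<beta> s * exp (- of_real 0 / of_real (sqrt s))"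
        using s by (intro tendsto_mult tendsto_const tendsto_exp tendsto_divide tendsto_minus *) auto
      thus "(\<lambda>k. cbeta_kernel \<alpha> \<beta> s * exp (- of_real (1 / real (Suc k)) / of_real (sqrt s))) \<longlonglongrightarrow> cbeta_kernel \<alpha> \<beta> s" by simp
    qed
  qed measurable
  thus ?thesis using LINT_cbeta_kernel[OF assms] by simp
qed

text \<open>The integral is compared with the one whose second parameter is \<beta> + 1, with known
  limit. The rest has first parameter 1 - \<beta> and stays bounded because Re \<beta> < 1, so the
  power of \<open>u\<close> kills it.\<close>

lemma J_int_quasi_derivative_limit:
  assumes "Re \<beta> > 0" "Re \<beta> < 1"
  shows "(\<lambda>k. - ((of_real (1 / real (Suc k)) / 2) powr (2 * \<beta>) * J_int (- \<beta>) \<beta> (of_real (1 / real (Suc k)))))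
            \<longlonglongrightarrow> - ((1/2) powr (2 * \<beta>) * (2 * Gamma (2 * \<beta>)))"
proof -
  define x where "x k = complex_of_real (1 / real (Suc k))" for k
  have x: "Re (x k) > 0" for k by (simp add: x_def)
  have "(\<lambda>k. x k powr (2 * \<beta>) * J_int (1 - \<beta>) \<beta> (x k)) \<longlonglongrightarrow> 0 * (Gamma (1 - \<beta>) * Gamma \<beta> / Gamma (1 - \<beta> + \<beta>))"
    unfolding x_def using assms by (intro tendsto_mult tendsto_inverse_Suc_powr J_int_tendsto_zero) auto
  moreover have "(\<lambda>k. x k powr (2 * \<beta>) * J_int (- \<beta>) (\<beta> + 1) (x k)) \<longlonglongrightarrow> 2 * Gamma (2 * \<beta>)"
    unfolding x_def by (rule J_int_limit_at_zero[OF assms(1)])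
  ultimately have "(\<lambda>k. x k powr (2 * \<beta>) * J_int (- \<beta>) (\<beta> + 1) (x k) + x k powr (2 * \<beta>) * J_int (1 - \<beta>) \<beta> (x k)) \<longlonglongrightarrow> 2 * Gamma (2 * \<beta>) + 0"
    by (intro tendsto_add) auto
  moreover have "x k powr (2 * \<beta>) * J_int (- \<beta>) (\<beta> + 1) (x k) + x k powr (2 * \<beta>) * J_int (1 - \<beta>) \<beta> (x k) = x k powr (2 * \<beta>) * J_int (- \<beta>) \<beta> (x k)" for k
    using J_int_split[OF x assms(1), of "- \<beta>" k] by (simp add: ring_distribs)
  ultimately have "(\<lambda>k. x k powr (2 * \<beta>) * J_int (- \<beta>) \<beta> (x k)) \<longlonglongrightarrow> 2 * Gamma (2 * \<beta>)" by simp
  from tendsto_minus[OF tendsto_mult_left[OF this]]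
  have "(\<lambda>k. - ((1/2) powr (2 * \<beta>) * (x k powr (2 * \<beta>) * J_int (- \<beta>) \<beta> (x k)))) \<longlonglongrightarrow> - ((1/2) powr (2 * \<beta>) * (2 * Gamma (2 * \<beta>)))" .
  moreover have "(x k / 2) powr (2 * \<beta>) = x k powr (2 * \<beta>) * (1/2) powr (2 * \<beta>)" for k
    unfolding x_def by (rule of_real_half_powr) simp
  ultimately show ?thesis by (simp add: x_def mult_ac)
qed

text \<open>The integral and the two series solve one second order equation, so the integral is a
  combination of the series with ratios of Wronskians as coefficients, all evaluated at the origin.
  In the strip the integral itself has a finite limit there, a Beta value.\<close>

lemma kser_eq_J_int_strip:
  assumes z: "0 < Re z" "Re z < 1/2" and u: "Re u > 0"
  shows "kser z u = of_real (sqrt pi) * rGamma (1/2 - z) * J_int z (1/2 - z) u"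
proof -
  define \<beta> where "\<beta> = 1/2 - z"
  have \<beta>: "Re \<beta> > 0" "Re \<beta> < 1" "z = 1/2 - \<beta>" using z by (auto simp: \<beta>_def)
  define f where "f = J_int z \<beta>"
  define P where "P u = - ((u / 2) powr (2 * \<beta>) * J_int (- \<beta>) \<beta> u)" for u
  define g1 where "g1 u = bser (1 - z) (u ^ 2 / 4)" for u
  define Q1 where "Q1 u = (u / 2) powr (2 * (1 - z)) * bser (1 + (1 - z)) (u ^ 2 / 4)" for u
  define g2 where "g2 u = (u / 2) powr (2 * z) * bser (1 + z) (u ^ 2 / 4)" for u
  define Q2 where "Q2 u = bser z (u ^ 2 / 4)" for u
  define x where "x k = complex_of_real (1 / real (Suc k))" for k
  have x: "x k \<in> right_half" for k by (simp add: x_def right_half_def)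
  have u': "u \<in> right_half" using u by (simp add: right_half_def)
  have bp: "bessel_pair \<beta> f P" "bessel_pair \<beta> g1 Q1" "bessel_pair \<beta> g2 Q2"
    using bessel_pair_J[OF \<beta>(1)] bessel_pair_series1[OF \<beta>_def] bessel_pair_series2[OF \<beta>_def] \<beta>(3)
    by (simp_all add: f_def P_def [abs_def] g1_def [abs_def] Q1_def [abs_def] g2_def [abs_def] Q2_def [abs_def])
  define f0 where "f0 = Gamma z * Gamma \<beta> / Gamma (z + \<beta>)"
  define q0 where "q0 = - ((1/2) powr (2 * \<beta>) * (2 * Gamma (2 * \<beta>)))"
  have hp: "(\<lambda>k. (x k / 2) powr c) \<longlonglongrightarrow> 0" if "Re c > 0" for c
  proof -
    have "(\<lambda>k. x k powr c * (1/2) powr c) \<longlonglongrightarrow> 0 * (1/2) powr c"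
      unfolding x_def using that by (intro tendsto_mult tendsto_inverse_Suc_powr tendsto_const)
    moreover have "x k powr c * (1/2) powr c = (x k / 2) powr c" for k
      unfolding x_def by (rule of_real_half_powr[symmetric]) simp
    ultimately show ?thesis by simp
  qed
  have lims: "(\<lambda>k. f (x k)) \<longlonglongrightarrow> f0" "(\<lambda>k. P (x k)) \<longlonglongrightarrow> q0"
    "(\<lambda>k. g1 (x k)) \<longlonglongrightarrow> rGamma (1 - z)" "(\<lambda>k. Q1 (x k)) \<longlonglongrightarrow> 0 * rGamma (1 + (1 - z))"
    "(\<lambda>k. g2 (x k)) \<longlonglongrightarrow> 0 * rGamma (1 + z)" "(\<lambda>k. Q2 (x k)) \<longlonglongrightarrow> rGamma z"
    unfolding f_def f0_def P_def q0_def g1_def Q1_def g2_def Q2_def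
    using z \<beta>(1,2)
    by (intro tendsto_mult hp tendsto_bser_inverse_Suc[folded x_def] J_int_tendsto_zero[folded x_def] J_int_quasi_derivative_limit[folded x_def]; simp)+
  have "(\<lambda>k. g1 (x k) * Q2 (x k) - Q1 (x k) * g2 (x k)) \<longlonglongrightarrow> rGamma (1 - z) * rGamma z - 0 * rGamma (1 + (1 - z)) * (0 * rGamma (1 + z))"
    by (intro tendsto_diff tendsto_mult lims)
  from bessel_wronskian_limit[OF bp(2,3) x this u'] have W12: "g1 u * Q2 u - Q1 u * g2 u = rGamma (1 - z) * rGamma z" by simp
  have "(\<lambda>k. f (x k) * Q1 (x k) - P (x k) * g1 (x k)) \<longlonglongrightarrow> f0 * (0 * rGamma (1 + (1 - z))) - q0 * rGamma (1 - z)"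
    by (intro tendsto_diff tendsto_mult lims)
  from bessel_wronskian_limit[OF bp(1,2) x this u'] have Wf1: "f u * Q1 u - P u * g1 u = - q0 * rGamma (1 - z)" by simp
  have "(\<lambda>k. f (x k) * Q2 (x k) - P (x k) * g2 (x k)) \<longlonglongrightarrow> f0 * rGamma z - q0 * (0 * rGamma (1 + z))"
    by (intro tendsto_diff tendsto_mult lims)
  from bessel_wronskian_limit[OF bp(1,3) x this u'] have Wf2: "f u * Q2 u - P u * g2 u = f0 * rGamma z" by simp
  \<comment> \<open>Cramer's rule: \<open>f\<close> expanded in the basis \<open>g1\<close>,
    \<open>g2\<close>, with Wronskians as determinants.\<close>
  have id: "f u * (g1 u * Q2 u - Q1 u * g2 u) = g1 u * (f u * Q2 u - P u * g2 u) - g2 u * (f u * Q1 u - P u * g1 u)"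
    by (simp add: algebra_simps)
  have main: "f u * (rGamma (1 - z) * rGamma z) = g1 u * (f0 * rGamma z) + g2 u * (q0 * rGamma (1 - z))"
    using id unfolding W12 Wf1 Wf2 by simp
  have np: "z \<notin> \<int>\<^sub>\<le>\<^sub>0" "1 - z \<notin> \<int>\<^sub>\<le>\<^sub>0" "\<beta> \<notin> \<int>\<^sub>\<le>\<^sub>0" "\<beta> + 1/2 \<notin> \<int>\<^sub>\<le>\<^sub>0" "2 * \<beta> \<notin> \<int>\<^sub>\<le>\<^sub>0"
    using z \<beta>(1) by (auto intro!: Re_pos_not_nonpos_Int simp: \<beta>_def)
  have G: "Gamma z \<noteq> 0" "Gamma (1 - z) \<noteq> 0" "Gamma \<beta> \<noteq> 0" using np by (simp_all add: Gamma_eq_zero_iff)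
  have sp: "complex_of_real (sqrt pi) \<noteq> 0" by simp
  have c1: "of_real (sqrt pi) * rGamma \<beta> * (f0 * rGamma z) = 1"
    using G sp by (simp add: f0_def \<beta>_def rGamma_inverse_Gamma Gamma_one_half_complex field_simps del: of_real_sqrt)
  \<comment> \<open>Since 1 - z = \<beta> + 1/2, Legendre's duplication formula applies; its power
    of 2 is absorbed by the one that the variable u / 2 contributes to \<open>q0\<close>.\<close>
  have c2: "of_real (sqrt pi) * rGamma \<beta> * (q0 * rGamma (1 - z)) = -1"
  proof -
    have "Gamma \<beta> * Gamma (1 - z) = exp ((1 - 2 * \<beta>) * of_real (ln 2)) * of_real (sqrt pi) * Gamma (2 * \<beta>)"
      using Gamma_legendre_duplication[OF np(3,4)] by (simp add: \<beta>_def)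
    also have "exp ((1 - 2 * \<beta>) * of_real (ln 2)) = (1/2) powr (2 * \<beta>) * 2"
    proof -
      have "Ln (1/2 :: complex) = - of_real (ln 2)"
        using Ln_of_real[of "1/2"] by (simp add: ln_div)
      moreover have "exp (complex_of_real (ln 2)) = 2" by (subst exp_of_real) simp
      ultimately show ?thesis by (simp add: powr_def ring_distribs exp_diff exp_minus field_simps)
    qed
    finally have "Gamma \<beta> * Gamma (1 - z) = - of_real (sqrt pi) * q0" by (simp add: q0_def mult_ac)
    hence e: "of_real (sqrt pi) * q0 = - (Gamma \<beta> * Gamma (1 - z))" by (simp del: of_real_sqrt)
    have "of_real (sqrt pi) * rGamma \<beta> * (q0 * rGamma (1 - z)) = (of_real (sqrt pi) * q0) * (rGamma \<beta> * rGamma (1 - z))"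
      by (simp only: mult_ac)
    thus ?thesis unfolding e using G by (simp only: rGamma_inverse_Gamma) (simp add: field_simps)
  qed
  have refl: "rGamma (1 - z) * rGamma z = sin (of_real pi * z) / of_real pi"
    using rGamma_reflection_complex[of z] by (simp add: mult_ac)
  have "z \<notin> \<int>" using z by (auto elim!: Ints_cases)
  hence s0: "sin (of_real pi * z) \<noteq> 0" by (rule sin_pi_nonzero)
  have "of_real (sqrt pi) * rGamma \<beta> * f u * (sin (of_real pi * z) / of_real pi) =
     g1 u * (of_real (sqrt pi) * rGamma \<beta> * (f0 * rGamma z)) + g2 u * (of_real (sqrt pi) * rGamma \<beta> * (q0 * rGamma (1 - z)))"
    using arg_cong[OF main, of "\<lambda>t. of_real (sqrt pi) * rGamma \<beta> * t"] unfolding refl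
    by (simp only: ring_distribs mult_ac)
  hence "of_real (sqrt pi) * rGamma \<beta> * f u * (sin (of_real pi * z) / of_real pi) = g1 u - g2 u"
    unfolding c1 c2 by simp
  hence "of_real (sqrt pi) * rGamma \<beta> * f u = of_real pi / sin (of_real pi * z) * (g1 u - g2 u)"
    using s0 by (simp add: field_simps del: of_real_sqrt)
  thus ?thesis by (simp add: kser_def g1_def g2_def f_def \<beta>_def)
qed

lemma open_diff_Ints: "open U \<Longrightarrow> open (U - \<int> :: complex set)"
  by (intro open_Diff) auto

lemma countable_Ints_complex: "countable (\<int> :: complex set)"
  unfolding Ints_def by simp

lemma connected_open_diff_Ints:
  fixes U :: "complex set"
  assumes "open U" "connected U"
  shows "connected (U - \<int>)"
  by (rule connected_open_diff_countable[OF _ assms countable_Ints_complex]) simp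

text \<open>The exponential frees the first parameter of the integral, so holomorphy in z only asks
  for Re z < 1/2; removing the integers, where the sine vanishes, leaves a connected domain.\<close>

lemma kser_eq_J_int:
  assumes z: "Re z < 1/2" "z \<notin> \<int>" and u: "Re u > 0"
  shows "kser z u = of_real (sqrt pi) * rGamma (1/2 - z) * J_int z (1/2 - z) u"
proof (rule analytic_continuation_open[of "{z. 0 < Re z} \<inter> {z. Re z < 1/2}" "{z. Re z < 1/2} - \<int>"
      "\<lambda>z. kser z u" "\<lambda>z. of_real (sqrt pi) * rGamma (1/2 - z) * J_int z (1/2 - z) u"])
  show o: "open ({z. Re z < 1/2} - \<int>)" by (intro open_diff_Ints open_halfspace_Re_lt)
  show "connected ({z. Re z < 1/2} - \<int>)"
    by (intro connected_open_diff_Ints open_halfspace_Re_lt convex_connected convex_halfspace_Re_lt)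
  have "1/4 \<in> {z. 0 < Re z} \<inter> {z. Re z < 1/2}" by simp
  thus "{z. 0 < Re z} \<inter> {z. Re z < 1/2} \<noteq> {}" by blast
  show "{z. 0 < Re z} \<inter> {z. Re z < 1/2} \<subseteq> {z. Re z < 1/2} - \<int>" by (auto elim!: Ints_cases)
  show "(\<lambda>z. kser z u) holomorphic_on {z. Re z < 1/2} - \<int>"
    unfolding kser_def using sin_pi_nonzero
    by (intro holomorphic_intros bser_holomorphic o) auto
  show "(\<lambda>z. of_real (sqrt pi) * rGamma (1/2 - z) * J_int z (1/2 - z) u) holomorphic_on {z. Re z < 1/2} - \<int>"
    by (intro holomorphic_intros J_int_holomorphic_params o u) auto
  show "open ({z. 0 < Re z} \<inter> {z. Re z < 1/2})"
    by (intro open_Int open_halfspace_Re_gt open_halfspace_Re_lt)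
qed (use kser_eq_J_int_strip u z in auto)

text \<open>The evenness K_(-z) = K_z; the power comes from the normalization 2 (u / 2)^z
  K_z(u).\<close>

lemma kser_uminus:
  assumes "Re u > 0" "z \<notin> \<int>"
  shows "kser z u = (u / 2) powr (2 * z) * kser (- z) u"
proof -
  have "P * (c * (Y - Q * X)) = - c * (X - P * Y)" if "P * Q = 1" for P Q X Y c :: complex
  proof -
    have "P * (c * (Y - Q * X)) = c * (P * Y - (P * Q) * X)" by (simp add: algebra_simps)
    thus ?thesis unfolding that by (simp add: algebra_simps)
  qed
  moreover have "(u / 2) powr (2 * z) * (u / 2) powr (2 * (- z)) = 1"
    using right_half_nonpos(2)[OF assms(1)] by (simp add: powr_minus)
  ultimately show ?thesis unfolding kser_def by simp
qed

text \<open>The continuation of \<open>kser\<close> across the integers, given by the integral for \<open>Re z < 1/2\<close> and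
  by reflection otherwise; classically it is \<open>2 (u/2)^z K_z(u)\<close>.\<close>

definition kfun :: "complex \<Rightarrow> complex \<Rightarrow> complex" where
  "kfun z u = (if Re z < 1/2 then of_real (sqrt pi) * rGamma (1/2 - z) * J_int z (1/2 - z) u
     else (u / 2) powr (2 * z) * (of_real (sqrt pi) * rGamma (1/2 + z) * J_int (- z) (1/2 + z) u))"

lemma kfun_eq_reflected:
  assumes "Re z > - (1/2)" "Re u > 0"
  shows "kfun z u = (u / 2) powr (2 * z) * (of_real (sqrt pi) * rGamma (1/2 + z) * J_int (- z) (1/2 + z) u)"
proof (cases "Re z < 1/2 \<and> z \<noteq> 0")
  case True
  have zi: "z \<notin> \<int>" "- z \<notin> \<int>"
  proof -
    show "z \<notin> \<int>" using True assms by (auto elim!: Ints_cases)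
    thus "- z \<notin> \<int>" by simp
  qed
  have "kfun z u = kser z u" using True kser_eq_J_int[OF _ zi(1) assms(2)] by (simp add: kfun_def)
  also have "\<dots> = (u / 2) powr (2 * z) * kser (- z) u" by (rule kser_uminus[OF assms(2) zi(1)])
  finally show ?thesis using kser_eq_J_int[OF _ zi(2) assms(2)] assms by simp
next
  case False
  thus ?thesis using assms by (auto simp: kfun_def)
qed

lemma kfun_eq_kser:
  assumes "z \<notin> \<int>" "Re u > 0"
  shows "kfun z u = kser z u"
proof (cases "Re z < 1/2")
  case True
  thus ?thesis using kser_eq_J_int[OF _ assms] by (simp add: kfun_def)
next
  case False
  have "- z \<notin> \<int>" using assms(1) by simp
  thus ?thesis using False kser_eq_J_int[of "- z" u] kser_uminus[OF assms(2,1)] assms by (simp add: kfun_def)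
qed

text \<open>The half-planes Re z < 1/2 and Re z > -1/2 cover the plane, and on each of them a single
  formula describes \<open>kfun\<close>.\<close>

lemma kfun_holomorphic:
  assumes u: "Re u > 0"
  shows "(\<lambda>z. kfun z u) holomorphic_on UNIV"
proof -
  have 1: "(\<lambda>z. kfun z u) holomorphic_on {z. Re z < 1/2}"
  proof (rule holomorphic_transform)
    show "(\<lambda>z. of_real (sqrt pi) * rGamma (1/2 - z) * J_int z (1/2 - z) u) holomorphic_on {z. Re z < 1/2}"
      by (intro holomorphic_intros J_int_holomorphic_params open_halfspace_Re_lt u) auto
  qed (simp add: kfun_def)
  have 2: "(\<lambda>z. kfun z u) holomorphic_on {z. Re z > - (1/2)}"
  proof (rule holomorphic_transform)
    show "(\<lambda>z. (u / 2) powr (2 * z) * (of_real (sqrt pi) * rGamma (1/2 + z) * J_int (- z) (1/2 + z) u)) holomorphic_on {z. Re z > - (1/2)}"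
      using u right_half_nonpos(1)[OF u] by (intro holomorphic_intros J_int_holomorphic_params open_halfspace_Re_gt) auto
  qed (use u in \<open>simp add: kfun_eq_reflected\<close>)
  have "(\<lambda>z. kfun z u) holomorphic_on {z. Re z < 1/2} \<union> {z. Re z > - (1/2)}"
    by (intro holomorphic_on_Un 1 2 open_halfspace_Re_gt open_halfspace_Re_lt)
  moreover have "{z. Re z < 1/2} \<union> {z. Re z > - (1/2)} = UNIV" by auto
  ultimately show ?thesis by simp
qed

lemma J_int_holomorphic:
  assumes "Re \<beta> > 0"
  shows "J_int \<alpha> \<beta> holomorphic_on right_half"
  unfolding holomorphic_on_def right_half_def
  using J_int_has_field_derivative[OF _ assms] field_differentiable_at_within field_differentiable_def by blast

lemma in_right_half: "u \<in> right_half \<longleftrightarrow> Re u > 0"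
  by (simp add: right_half_def)

lemma kfun_holomorphic_arg: "kfun z holomorphic_on right_half"
proof (cases "Re z < 1/2")
  case True
  hence "kfun z = (\<lambda>u. of_real (sqrt pi) * rGamma (1/2 - z) * J_int z (1/2 - z) u)" by (auto simp: kfun_def)
  thus ?thesis using True by (auto intro!: holomorphic_intros J_int_holomorphic)
next
  case False
  hence "kfun z = (\<lambda>u. (u / 2) powr (2 * z) * (of_real (sqrt pi) * rGamma (1/2 + z) * J_int (- z) (1/2 + z) u))"
    by (auto simp: kfun_def)
  thus ?thesis using False by (auto intro!: holomorphic_intros J_int_holomorphic dest!: right_half_nonpos(1) simp: right_half_def[symmetric] in_right_half)
qed

text \<open>The bound must hold for all r > 0, because the kernel will be averaged at sqrt y times r
  x with y near 0. Up to a logarithm, \<open>kfun\<close> is there of the size of 1 or of r^(2 Re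
  z), and the two conditions on \<sigma> let r^(-2 \<sigma>) dominate both; at infinity every power
  suffices.\<close>

lemma kfun_bound:
  assumes x: "Re x > 0" and \<sigma>: "\<sigma> > 0" "\<sigma> + Re z0 > 0"
  obtains C \<delta> where "\<delta> > 0" "C \<ge> 0"
    "\<And>z r. z \<in> ball z0 \<delta> \<Longrightarrow> r > 0 \<Longrightarrow> norm (kfun z (of_real r * x)) \<le> C * r powr (- 2 * \<sigma>)"
proof (cases "Re z0 < 1/2")
  case True
  define \<delta> where "\<delta> = min ((\<sigma> + Re z0) / 2) ((1/2 - Re z0) / 2)"
  have \<delta>: "\<delta> > 0" using True \<sigma> by (simp add: \<delta>_def)
  have \<delta>2: "\<delta> \<le> (1/2 - Re z0) / 2" unfolding \<delta>_def by (rule min.cobounded2)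
  have near: "\<bar>Re z - Re z0\<bar> < \<delta>" if "z \<in> ball z0 \<delta>" for z
    using that abs_Re_le_cmod[of "z0 - z"] by (auto simp: dist_norm abs_minus_commute)
  obtain C where C: "C \<ge> 0" "\<And>\<alpha> \<beta> u. Re \<alpha> \<ge> Re z0 - \<delta> \<Longrightarrow> Re \<beta> \<ge> 1/2 - Re z0 - \<delta> \<Longrightarrow> Re u > 0 \<Longrightarrow>
     norm (J_int \<alpha> \<beta> u) \<le> C * Re u powr (- 2 * \<sigma>)"
  proof (rule J_int_bound[of \<sigma> "Re z0 - \<delta>" "1/2 - Re z0 - \<delta>"])
    show "Re z0 - \<delta> + \<sigma> > 0" "1/2 - Re z0 - \<delta> > 0" using True \<sigma> by (auto simp: \<delta>_def min_def field_simps)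
  qed (use \<sigma> in auto)
  obtain B where B: "B \<ge> 0" "\<And>b n. b \<in> (\<lambda>z. 1/2 - z) ` cball z0 \<delta> \<Longrightarrow> norm (rGamma (b + of_nat n)) \<le> B"
  proof -
    have "compact ((\<lambda>z. 1/2 - z) ` cball z0 \<delta>)" by (intro compact_continuous_image continuous_intros) auto
    thus ?thesis using rGamma_bounded_on_compact that by blast
  qed
  have "norm (kfun z (of_real r * x)) \<le> sqrt pi * B * C * Re x powr (- 2 * \<sigma>) * r powr (- 2 * \<sigma>)"
    if z: "z \<in> ball z0 \<delta>" and r: "r > 0" for z r
  proof -
    have "Re z < 1/2" "Re z \<ge> Re z0 - \<delta>" "Re (1/2 - z) \<ge> 1/2 - Re z0 - \<delta>"
      using near[OF z] \<delta>2 True by (auto simp: abs_if split: if_splits)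
    moreover have "norm (rGamma (1/2 - z)) \<le> B" using B(2)[of "1/2 - z" 0] z by auto
    moreover have "Re (of_real r * x) powr (- 2 * \<sigma>) = Re x powr (- 2 * \<sigma>) * r powr (- 2 * \<sigma>)"
      using r x by (simp add: powr_mult)
    ultimately have "norm (kfun z (of_real r * x)) \<le> sqrt pi * B * (C * (Re x powr (- 2 * \<sigma>) * r powr (- 2 * \<sigma>)))"
      using C(2)[of z "1/2 - z" "of_real r * x"] r x B(1) C(1)
      by (auto simp: kfun_def norm_mult intro!: mult_mono)
    thus ?thesis by (simp add: mult_ac)
  qed
  thus ?thesis using that[of \<delta> "sqrt pi * B * C * Re x powr (- 2 * \<sigma>)"] \<delta> B C by simp
next
  case False
  define \<delta> where "\<delta> = min (\<sigma> / 4) (1/4)"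
  have \<delta>: "\<delta> > 0" "\<delta> \<le> \<sigma> / 4" "\<delta> \<le> 1/4" using \<sigma> by (auto simp: \<delta>_def)
  \<comment> \<open>The factor r^(2 Re z) of the reflected formula shifts the required exponent to
    \<sigma> + Re z, which varies with \<open>z\<close>. Estimates at both ends of its range are
    combined, one for small and one for large Re u.\<close>
  define \<sigma>1 \<sigma>2 where "\<sigma>1 = \<sigma> + Re z0 - \<delta>" and "\<sigma>2 = \<sigma> + Re z0 + \<delta>"
  have near: "\<bar>Re z - Re z0\<bar> < \<delta>" if "z \<in> ball z0 \<delta>" for z
    using that abs_Re_le_cmod[of "z0 - z"] by (auto simp: dist_norm abs_minus_commute)
  have s12: "\<sigma>1 \<ge> 0" "\<sigma>2 \<ge> 0" "- Re z0 - \<delta> + \<sigma>1 > 0" "- Re z0 - \<delta> + \<sigma>2 > 0" "1/2 + Re z0 - \<delta> > 0"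
    using False \<sigma> \<delta> by (auto simp: \<sigma>1_def \<sigma>2_def)
  obtain C1 where C1: "C1 \<ge> 0" "\<And>\<alpha> \<beta> u. Re \<alpha> \<ge> - Re z0 - \<delta> \<Longrightarrow> Re \<beta> \<ge> 1/2 + Re z0 - \<delta> \<Longrightarrow> Re u > 0 \<Longrightarrow>
     norm (J_int \<alpha> \<beta> u) \<le> C1 * Re u powr (- 2 * \<sigma>1)"
    using J_int_bound[OF s12(1,3,5)] by blast
  obtain C2 where C2: "C2 \<ge> 0" "\<And>\<alpha> \<beta> u. Re \<alpha> \<ge> - Re z0 - \<delta> \<Longrightarrow> Re \<beta> \<ge> 1/2 + Re z0 - \<delta> \<Longrightarrow> Re u > 0 \<Longrightarrow>
     norm (J_int \<alpha> \<beta> u) \<le> C2 * Re u powr (- 2 * \<sigma>2)"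
    using J_int_bound[OF s12(2,4,5)] by blast
  define C where "C = max C1 C2"
  have C: "C \<ge> 0" "C1 \<le> C" "C2 \<le> C" using C1 C2 by (auto simp: C_def)
  have interp: "norm (J_int \<alpha> \<beta> u) \<le> C * Re u powr (- 2 * c)"
    if ab: "Re \<alpha> \<ge> - Re z0 - \<delta>" "Re \<beta> \<ge> 1/2 + Re z0 - \<delta>" "Re u > 0" and c: "\<sigma>1 \<le> c" "c \<le> \<sigma>2" for \<alpha> \<beta> u c
  proof (cases "Re u \<ge> 1")
    case True
    have "norm (J_int \<alpha> \<beta> u) \<le> C2 * Re u powr (- 2 * \<sigma>2)" by (rule C2(2)[OF ab])
    also have "\<dots> \<le> C * Re u powr (- 2 * c)" by (rule mult_mono[OF C(3) powr_mono]) (use True c C in auto)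
    finally show ?thesis .
  next
    case False
    have "norm (J_int \<alpha> \<beta> u) \<le> C1 * Re u powr (- 2 * \<sigma>1)" by (rule C1(2)[OF ab])
    also have "\<dots> \<le> C * Re u powr (- 2 * c)" by (rule mult_mono[OF C(2) powr_mono']) (use False ab c C in auto)
    finally show ?thesis .
  qed
  have "compact ((\<lambda>z. 1/2 + z) ` cball z0 \<delta>)" by (intro compact_continuous_image continuous_intros) auto
  then obtain B where B: "B \<ge> 0" "\<And>b n. b \<in> (\<lambda>z. 1/2 + z) ` cball z0 \<delta> \<Longrightarrow> norm (rGamma (b + of_nat n)) \<le> B"
    using rGamma_bounded_on_compact by blast
  have "compact ((\<lambda>z. (x / 2) powr (2 * z)) ` cball z0 \<delta>)"
    using right_half_nonpos(1)[OF x]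
    by (intro compact_continuous_image holomorphic_on_imp_continuous_on holomorphic_intros) auto
  from compact_imp_bounded[OF this] obtain N where N: "\<And>z. z \<in> cball z0 \<delta> \<Longrightarrow> norm ((x / 2) powr (2 * z)) \<le> N"
    unfolding bounded_iff by blast
  have "norm ((x / 2) powr (2 * z0)) \<le> N" using N[of z0] \<delta> by simp
  hence N0: "N \<ge> 0" using norm_ge_zero order_trans by blast
  define R where "R = Re x powr (- 2 * \<sigma>2) + Re x powr (- 2 * \<sigma>1)"
  have "norm (kfun z (of_real r * x)) \<le> N * (sqrt pi * B * (C * R)) * r powr (- 2 * \<sigma>)"
    if z: "z \<in> ball z0 \<delta>" and r: "r > 0" for z r
  proof -
    have nz: "Re z > - (1/2)" "Re (- z) \<ge> - Re z0 - \<delta>" "Re (1/2 + z) \<ge> 1/2 + Re z0 - \<delta>" "\<sigma>1 \<le> \<sigma> + Re z" "\<sigma> + Re z \<le> \<sigma>2"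
      using near[OF z] False \<delta> by (auto simp: \<sigma>1_def \<sigma>2_def abs_if split: if_splits)
    have ru: "Re (of_real r * x) > 0" using r x by simp
    have "(of_real r * x / 2) powr (2 * z) = of_real r powr (2 * z) * (x / 2) powr (2 * z)"
      using powr_times_real_left[of "of_real r" "x / 2" "2 * z"] r by simp
    hence n1: "norm ((of_real r * x / 2) powr (2 * z)) \<le> r powr (2 * Re z) * N"
      using N[of z] z r by (simp add: norm_mult norm_powr_real_powr mult_left_mono)
    have "1/2 + z \<in> (\<lambda>z. 1/2 + z) ` cball z0 \<delta>" using z by (intro imageI) auto
    from B(2)[OF this, of 0] have n2: "norm (rGamma (1/2 + z)) \<le> B" by simp
    have "norm (J_int (- z) (1/2 + z) (of_real r * x)) \<le> C * Re (of_real r * x) powr (- 2 * (\<sigma> + Re z))"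
      by (rule interp[OF nz(2,3) ru nz(4,5)])
    also have "Re (of_real r * x) powr (- 2 * (\<sigma> + Re z)) = r powr (- 2 * (\<sigma> + Re z)) * Re x powr (- 2 * (\<sigma> + Re z))"
      using r x by (simp add: powr_mult)
    also have "\<dots> \<le> r powr (- 2 * (\<sigma> + Re z)) * R"
      unfolding R_def by (rule mult_left_mono[OF powr_le_sum]) (use nz x in auto)
    finally have n3: "norm (J_int (- z) (1/2 + z) (of_real r * x)) \<le> C * (r powr (- 2 * (\<sigma> + Re z)) * R)"
      using C(1) by (simp add: mult_left_mono)
    have "norm (kfun z (of_real r * x)) = norm ((of_real r * x / 2) powr (2 * z)) * (sqrt pi * norm (rGamma (1/2 + z)) * norm (J_int (- z) (1/2 + z) (of_real r * x)))"
      unfolding kfun_eq_reflected[OF nz(1) ru] by (simp add: norm_mult)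
    also have "\<dots> \<le> (r powr (2 * Re z) * N) * (sqrt pi * B * (C * (r powr (- 2 * (\<sigma> + Re z)) * R)))"
      using N0 B(1) n1 n2 n3 by (intro mult_mono mult_nonneg_nonneg) auto
    also have "\<dots> = N * (sqrt pi * B * (C * R)) * (r powr (2 * Re z) * r powr (- 2 * (\<sigma> + Re z)))" by (simp add: mult_ac)
    also have "r powr (2 * Re z) * r powr (- 2 * (\<sigma> + Re z)) = r powr (- 2 * \<sigma>)"
      by (simp add: powr_add[symmetric] algebra_simps)
    finally show ?thesis .
  qed
  moreover have "N * (sqrt pi * B * (C * R)) \<ge> 0" using N0 B C by (simp add: R_def)
  ultimately show ?thesis using that[of \<delta> "N * (sqrt pi * B * (C * R))"] \<delta> by blast
qed


section \<open>Sums of the modified Bessel kernel\<close>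

lemma Digamma_reflection_complex:
  fixes z :: complex
  assumes z: "z \<notin> \<int>"
  shows "Digamma (1 - z) - Digamma z = of_real pi * cot (of_real pi * z)"
proof -
  have np: "z \<notin> \<int>\<^sub>\<le>\<^sub>0" "1 - z \<notin> \<int>\<^sub>\<le>\<^sub>0"
    using z by (auto elim!: nonpos_Ints_cases simp: diff_eq_eq) (metis Ints_1 Ints_add Ints_diff Ints_of_int add_diff_cancel_left')
  have s: "sin (of_real pi * z) \<noteq> 0" by (rule sin_pi_nonzero[OF z])
  have G: "Gamma z \<noteq> 0" "Gamma (1 - z) \<noteq> 0" using np by (simp_all add: Gamma_eq_zero_iff)
  \<comment> \<open>The derivative of Gamma z Gamma (1 - z) is computed twice, by the product rule
    and through the reflection formula.\<close>
  have "((\<lambda>z. Gamma z * Gamma (1 - z)) has_field_derivative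
      Gamma z * Digamma z * Gamma (1 - z) + (- (Gamma (1 - z) * Digamma (1 - z))) * Gamma z) (at z)"
    using np by (auto intro!: derivative_eq_intros)
  moreover have "((\<lambda>z. Gamma z * Gamma (1 - z)) has_field_derivative
      - (of_real pi * (of_real pi * cos (of_real pi * z))) / (sin (of_real pi * z))\<^sup>2) (at z)"
    unfolding Gamma_reflection_complex using s
    by (auto intro!: derivative_eq_intros simp: power2_eq_square)
  ultimately have "Gamma z * Digamma z * Gamma (1 - z) + (- (Gamma (1 - z) * Digamma (1 - z))) * Gamma z =
     - (of_real pi * (of_real pi * cos (of_real pi * z))) / (sin (of_real pi * z))\<^sup>2"
    by (rule DERIV_unique)
  hence "(Digamma (1 - z) - Digamma z) * (Gamma z * Gamma (1 - z)) = (of_real pi * (of_real pi * cos (of_real pi * z))) / (sin (of_real pi * z))\<^sup>2"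
    by (simp add: algebra_simps)
  moreover have "D = of_real pi * (C / S)"
    if "D * (of_real pi / S) = of_real pi * (of_real pi * C) / S\<^sup>2" "S \<noteq> 0" for D C S :: complex
    using that by (simp add: field_simps power2_eq_square)
  ultimately show ?thesis unfolding Gamma_reflection_complex cot_def using s by blast
qed

text \<open>The Digamma series pair 1/(z + n) from n = 0 with 1/(z - n) from n = 1. Adding a
  telescoping series shifts the former by one index, which splits off 1/z and makes the terms
  symmetric.\<close>

lemma cot_partial_fractions:
  fixes z :: complex
  assumes z: "z \<notin> \<int>"
  shows "(\<lambda>n. 2 * z / (z\<^sup>2 - (of_nat (Suc n))\<^sup>2)) sums (of_real pi * cot (of_real pi * z) - 1 / z)"
proof -
  have z0: "z \<noteq> 0" "1 - z \<noteq> 0" "\<And>n. z + of_nat n \<noteq> 0" "\<And>n. z - of_nat n \<noteq> 0"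
    using z by (auto simp: add_eq_0_iff2)
  define a where "a w n = inverse (of_nat (Suc n)) - inverse (w + of_nat n)" for w :: complex and n
  have "(\<lambda>n. a (1 - z) n - a z n) sums (Digamma (1 - z) - Digamma z)"
    using sums_diff[OF summable_sums[OF summable_Digamma[OF z0(2)]] summable_sums[OF summable_Digamma[OF z0(1)]]]
    by (simp add: Digamma_def a_def)
  also have "(\<lambda>n. a (1 - z) n - a z n) = (\<lambda>n. 1 / (z + of_nat n) + 1 / (z - of_nat (Suc n)))"
  proof
    fix n
    have "inverse (1 - z + of_nat n) = - (1 / (z - of_nat (Suc n)))"
      using z0(4)[of "Suc n"] by (simp add: divide_inverse algebra_simps flip: inverse_minus_eq)
    thus "a (1 - z) n - a z n = 1 / (z + of_nat n) + 1 / (z - of_nat (Suc n))"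
      unfolding a_def by (simp add: divide_inverse)
  qed
  finally have S: "(\<lambda>n. 1 / (z + of_nat n) + 1 / (z - of_nat (Suc n))) sums (of_real pi * cot (of_real pi * z))"
    by (simp add: Digamma_reflection_complex[OF z])
  have lim: "(\<lambda>n. 1 / (z + of_nat n)) \<longlonglongrightarrow> 0"
    using tendsto_inverse_0 tendsto_add_filterlim_at_infinity'
    by (intro tendsto_divide_0[OF tendsto_const] tendsto_add_filterlim_at_infinity[OF tendsto_const] tendsto_of_nat)
  have "(\<lambda>n. 1 / (z + of_nat (Suc n)) - 1 / (z + of_nat n)) sums (0 - 1 / (z + of_nat 0))"
    by (rule telescope_sums[OF lim])
  from sums_add[OF S this]
  have "(\<lambda>n. 1 / (z - of_nat (Suc n)) + 1 / (z + of_nat (Suc n))) sums (of_real pi * cot (of_real pi * z) - 1 / z)"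
    by (simp add: algebra_simps)
  also have "(\<lambda>n. 1 / (z - of_nat (Suc n)) + 1 / (z + of_nat (Suc n))) = (\<lambda>n. 2 * z / (z\<^sup>2 - (of_nat (Suc n))\<^sup>2))"
  proof
    fix n
    have "1 / (z - k) + 1 / (z + k) = 2 * z / (z\<^sup>2 - k\<^sup>2)" if "z - k \<noteq> 0" "z + k \<noteq> 0" for k
    proof -
      have "z\<^sup>2 - k\<^sup>2 = (z - k) * (z + k)" by (simp add: power2_eq_square algebra_simps)
      thus ?thesis using that by (simp add: add_frac_eq)
    qed
    thus "1 / (z - of_nat (Suc n)) + 1 / (z + of_nat (Suc n)) = 2 * z / (z\<^sup>2 - (of_nat (Suc n))\<^sup>2)"
      using z0(3,4) by blast
  qed
  finally show ?thesis .
qed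

lemma coth_partial_fractions:
  fixes X :: complex
  assumes X: "Re X > 0"
  shows "(\<lambda>n. 4 * X / (X\<^sup>2 + 4 * of_real pi ^ 2 * of_nat (Suc n) ^ 2)) sums (2 / (exp X - 1) + 1 - 2 / X)"
proof -
  \<comment> \<open>This rotation carries the poles 2 pi i n of coth (X / 2) = 2 / (exp X - 1) + 1
    to the integers, and the right half-plane to the upper one, which contains no integer.\<close>
  define z where "z = \<i> * X / (2 * of_real pi)"
  have X0: "X \<noteq> 0" using X by auto
  have "z = of_real (1 / (2 * pi)) * (\<i> * X)" by (simp add: z_def)
  hence "Im z = 1 / (2 * pi) * Re X" by (simp only: times_complex.sel Re_complex_of_real Im_complex_of_real imaginary_unit.sel) simp
  hence Imz: "Im z > 0" using X by simp
  have zi: "z \<notin> \<int>" using Imz by (auto elim!: Ints_cases)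
  have e1: "exp X \<noteq> 1"
  proof
    assume "exp X = 1"
    hence "norm (exp X) = 1" by simp
    thus False using X by (simp add: norm_exp_eq_Re)
  qed
  have piz: "of_real pi * z = \<i> * X / 2" by (simp add: z_def)
  have zz: "z\<^sup>2 = - X\<^sup>2 / (4 * of_real pi ^ 2)" by (simp add: z_def power_divide power_mult_distrib)
  have "(\<lambda>n. \<i> / of_real pi * (2 * z / (z\<^sup>2 - (of_nat (Suc n))\<^sup>2))) sums (\<i> / of_real pi * (of_real pi * cot (of_real pi * z) - 1 / z))"
    by (rule sums_mult[OF cot_partial_fractions[OF zi]])
  also have "(\<lambda>n. \<i> / of_real pi * (2 * z / (z\<^sup>2 - (of_nat (Suc n))\<^sup>2))) = (\<lambda>n. 4 * X / (X\<^sup>2 + 4 * of_real pi ^ 2 * of_nat (Suc n) ^ 2))"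
  proof
    fix n
    define k :: complex where "k = of_nat (Suc n)"
    have e: "z\<^sup>2 - k\<^sup>2 = - (X\<^sup>2 + 4 * of_real pi ^ 2 * k\<^sup>2) / (4 * of_real pi ^ 2)"
      unfolding zz by (simp add: add_divide_distrib diff_divide_distrib)
    have "\<i> / of_real pi * (2 * z / (- D / (4 * of_real pi ^ 2))) = 4 * X / D" for D
      by (simp add: z_def power2_eq_square)
    hence "\<i> / of_real pi * (2 * z / (z\<^sup>2 - k\<^sup>2)) = 4 * X / (X\<^sup>2 + 4 * of_real pi ^ 2 * k\<^sup>2)"
      unfolding e .
    thus "\<i> / of_real pi * (2 * z / (z\<^sup>2 - (of_nat (Suc n))\<^sup>2)) = 4 * X / (X\<^sup>2 + 4 * of_real pi ^ 2 * of_nat (Suc n) ^ 2)"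
      by (simp only: k_def)
  qed
  also have "\<i> / of_real pi * (of_real pi * cot (of_real pi * z) - 1 / z) = 2 / (exp X - 1) + 1 - 2 / X"
  proof -
    define E where "E = exp (X / 2)"
    have "exp (X / 2 + X / 2) = E * E" unfolding E_def by (rule exp_add)
    hence E: "E \<noteq> 0" "exp X = E * E" unfolding E_def by simp_all
    have E': "exp (- (X / 2)) = 1 / E" by (simp only: E_def exp_minus inverse_eq_divide)
    have i1: "\<i> * (\<i> * X / 2) = - (X / 2)" "- (- (X / 2)) = X / 2" by simp_all
    have EE: "E * E - 1 \<noteq> 0" using e1 unfolding E(2) by (simp only: right_minus_eq not_False_eq_True)
    have sE: "sin (\<i> * X / 2) = (1 / E - E) / (2 * \<i>)"
      by (simp only: sin_exp_eq i1 E' E_def[symmetric])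
    have cE: "cos (\<i> * X / 2) = (1 / E + E) / 2"
      by (simp only: cos_exp_eq i1 E' E_def[symmetric])
    have "cot (\<i> * X / 2) = \<i> * (1 + E * E) / (1 - E * E)"
    proof -
      have r: "1 / E + E = (1 + E * E) / E" "1 / E - E = (1 - E * E) / E" using E(1) by (simp_all add: add_divide_distrib diff_divide_distrib)
      have A: "(p / 2) / (q / (2 * \<i>)) = \<i> * p / q" for p q :: complex
      proof -
        have "(p / 2) / (q / (2 * \<i>)) = (p / 2 * (2 * \<i>)) / q" by (rule divide_divide_eq_right)
        also have "p / 2 * (2 * \<i>) = \<i> * p" by simp
        finally show ?thesis .
      qed
      have B: "\<i> * (p / E) / (q / E) = \<i> * p / q" for p q
        using E(1) by (cases "q = 0") (simp_all add: divide_simps)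
      have "cot (\<i> * X / 2) = ((1 + E * E) / E / 2) / ((1 - E * E) / E / (2 * \<i>))"
        unfolding cot_def sE cE r ..
      thus ?thesis unfolding A B .
    qed
    moreover have "\<i> / of_real pi * (of_real pi * cot (of_real pi * z) - 1 / z) = \<i> * cot (\<i> * X / 2) - 2 / X"
    proof -
      have "\<i> / of_real pi * (of_real pi * c - 1 / z) = \<i> * c - 2 / X" for c
      proof -
        have "\<i> / of_real pi * (1 / z) = 2 / X" using X0 by (simp add: z_def)
        thus ?thesis by (simp add: right_diff_distrib)
      qed
      thus ?thesis unfolding piz .
    qed
    ultimately have "\<i> / of_real pi * (of_real pi * cot (of_real pi * z) - 1 / z) = \<i> * (\<i> * (1 + E * E) / (1 - E * E)) - 2 / X" by simp
    also have "\<i> * (\<i> * (1 + E * E) / (1 - E * E)) = (1 + E * E) / (E * E - 1)"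
    proof -
      have "\<i> * (\<i> * p / q) = p / (- q)" for p q by simp
      from this[of "1 + E * E" "1 - E * E"] show ?thesis by (simp only: minus_diff_eq)
    qed
    also have "\<dots> = 2 / (E * E - 1) + 1"
    proof -
      have "(1 + t) / (t - 1) = 2 / (t - 1) + 1" if "t - 1 \<noteq> 0" for t :: complex
        using that by (simp add: field_simps)
      from this[OF EE] show ?thesis .
    qed
    finally show ?thesis unfolding E(2) .
  qed
  finally show ?thesis .
qed

section \<open>Estimates and branch identities for complex powers\<close>

lemma norm_sq_plus_ge:
  fixes x :: complex
  assumes x: "Re x > 0" and A: "A \<ge> 0" and B: "B \<ge> 0"
  shows "norm (of_real A * x\<^sup>2 + of_real B) \<ge> Re x / norm x * (A * (norm x)\<^sup>2 + B)"
proof -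
  define a b N where "a = Re x" and "b = Im x" and "N = a\<^sup>2 + b\<^sup>2"
  have N: "(norm x)\<^sup>2 = N" by (simp add: N_def a_def b_def cmod_power2)
  have N0: "N > 0" using x by (simp add: N_def a_def add_pos_nonneg)
  have re: "Re (of_real A * x\<^sup>2 + of_real B) = A * (a\<^sup>2 - b\<^sup>2) + B" and im: "Im (of_real A * x\<^sup>2 + of_real B) = A * (2 * a * b)"
    by (simp_all add: a_def b_def power2_eq_square algebra_simps)
  have L: "(norm (of_real A * x\<^sup>2 + of_real B))\<^sup>2 = (A * (a\<^sup>2 - b\<^sup>2) + B)\<^sup>2 + (A * (2 * a * b))\<^sup>2"
    by (simp only: cmod_power2 re im)
  \<comment> \<open>The squared sides differ by a perfect square. Geometrically, Re x / |x| is the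
    cosine of arg x, which is half the angle between x^2 and the positive axis.\<close>
  have key: "N * ((A * (a\<^sup>2 - b\<^sup>2) + B)\<^sup>2 + (A * (2 * a * b))\<^sup>2) - a\<^sup>2 * (A * N + B)\<^sup>2 = b\<^sup>2 * (A * N - B)\<^sup>2"
    unfolding N_def by (simp add: power2_eq_square algebra_simps)
  hence "a\<^sup>2 * (A * N + B)\<^sup>2 \<le> N * ((A * (a\<^sup>2 - b\<^sup>2) + B)\<^sup>2 + (A * (2 * a * b))\<^sup>2)"
  proof -
    have "0 \<le> b\<^sup>2 * (A * N - B)\<^sup>2" by simp
    with key show ?thesis by linarith
  qed
  hence "a\<^sup>2 / N * (A * N + B)\<^sup>2 \<le> (norm (of_real A * x\<^sup>2 + of_real B))\<^sup>2"
    unfolding L using N0 by (simp add: field_simps)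
  also have "a\<^sup>2 / N * (A * N + B)\<^sup>2 = (Re x / norm x * (A * (norm x)\<^sup>2 + B))\<^sup>2"
    unfolding N by (simp add: power_mult_distrib power_divide N a_def)
  finally show ?thesis by (rule power2_le_imp_le) simp
qed

text \<open>Doubling an argument of size below pi/2 stays within the principal branch.\<close>

lemma powr_square:
  assumes "Re y > 0"
  shows "(y\<^sup>2) powr c = y powr (2 * c)"
proof -
  have y: "y \<noteq> 0" using assms by auto
  have "Ln (y * y) = Ln y + Ln y"
    using Re_Ln_pos_lt_imp[OF assms] y by (intro Ln_times_simple) auto
  thus ?thesis using y by (simp add: powr_def power2_eq_square algebra_simps)
qed

lemma inverse_square_plus_one_nonpos:
  assumes "Re y > 0"
  shows "1 + y\<^sup>2 \<notin> \<real>\<^sub>\<le>\<^sub>0"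
proof
  assume "1 + y\<^sup>2 \<in> \<real>\<^sub>\<le>\<^sub>0"
  hence "1 + ((Re y)\<^sup>2 - (Im y)\<^sup>2) \<le> 0" "2 * Re y * Im y = 0"
    by (auto simp: complex_nonpos_Reals_iff power2_eq_square)
  hence "Im y = 0" "1 + (Re y)\<^sup>2 \<le> 0" using assms by auto
  thus False by (smt (verit) zero_le_power2)
qed

text \<open>The principal logarithms add because the arguments of y^(-2) and 1 + y^2 have opposite
  signs and size at most pi; hence the cases on the sign of Im y.\<close>

lemma powr_one_plus_inverse_square:
  assumes y: "Re y > 0"
  shows "(1 + 1 / y\<^sup>2) powr c = y powr (- (2 * c)) * (1 + y\<^sup>2) powr c"
proof -
  have y0: "y \<noteq> 0" using y by auto
  have iy: "Re (inverse y) > 0" using y y0 by (simp add: add_pos_nonneg)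
  have v0: "1 + y\<^sup>2 \<noteq> 0" using inverse_square_plus_one_nonpos[OF y] by auto
  have q0: "1 / y\<^sup>2 \<noteq> 0" using y0 by simp
  have Lq: "Ln (1 / y\<^sup>2) = - (2 * Ln y)"
  proof -
    have "Ln (1 / y\<^sup>2) = Ln (inverse y * inverse y)" by (simp add: power2_eq_square divide_inverse)
    also have "\<dots> = Ln (inverse y) + Ln (inverse y)"
    proof (rule Ln_times_simple)
      show "inverse y \<noteq> 0" "inverse y \<noteq> 0" using y0 by simp_all
      show "- pi < Im (Ln (inverse y)) + Im (Ln (inverse y))" "Im (Ln (inverse y)) + Im (Ln (inverse y)) \<le> pi"
        using Re_Ln_pos_lt_imp[OF iy] by linarith+
    qed
    also have "Ln (inverse y) = - Ln y" using right_half_nonpos(3)[OF y] by (intro Ln_inverse)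
    finally show ?thesis by simp
  qed
  have imy: "\<bar>Im (Ln y)\<bar> < pi / 2" using Re_Ln_pos_lt_imp[OF y] .
  have bounds: "- pi < Im (Ln (1 / y\<^sup>2)) + Im (Ln (1 + y\<^sup>2)) \<and> Im (Ln (1 / y\<^sup>2)) + Im (Ln (1 + y\<^sup>2)) \<le> pi"
  proof -
    have L1: "Im (Ln (1 / y\<^sup>2)) = - (2 * Im (Ln y))" by (simp add: Lq)
    have ry: "- pi < Im (Ln (1 + y\<^sup>2))" "Im (Ln (1 + y\<^sup>2)) \<le> pi" using v0 mpi_less_Im_Ln Im_Ln_le_pi by auto
    have imv: "Im (1 + y\<^sup>2) = 2 * Re y * Im y" by (simp add: power2_eq_square)
    consider "Im y > 0" | "Im y = 0" | "Im y < 0" by linarith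
    thus ?thesis
    proof cases
      case 1
      hence "Im (Ln (1 + y\<^sup>2)) > 0" "Im (Ln y) > 0" using Im_Ln_pos_lt_imp[of "1 + y\<^sup>2"] Im_Ln_pos_lt_imp[of y] imv y by auto
      thus ?thesis unfolding L1 using ry imy by (auto simp: abs_if split: if_splits)
    next
      case 2
      hence "Im (Ln y) = 0" using Im_Ln_eq_0[OF y0] y by simp
      thus ?thesis unfolding L1 using ry by simp
    next
      case 3
      hence "Im (1 + y\<^sup>2) < 0" using imv y by (simp add: mult_pos_neg)
      hence "Im (Ln (1 + y\<^sup>2)) < 0" using Im_Ln_pos_le[OF v0] ry by linarith
      moreover have "Im (Ln y) < 0" using Im_Ln_pos_le[OF y0] 3 imy pi_gt_zero by (smt (verit) field_sum_of_halves)
      ultimately show ?thesis unfolding L1 using ry imy by (auto simp: abs_if split: if_splits)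
    qed
  qed
  have "Ln (1 / y\<^sup>2 * (1 + y\<^sup>2)) = Ln (1 / y\<^sup>2) + Ln (1 + y\<^sup>2)"
    using bounds q0 v0 by (intro Ln_times_simple) auto
  moreover have "1 / y\<^sup>2 * (1 + y\<^sup>2) = 1 + 1 / y\<^sup>2" using y0 by (simp add: field_simps)
  ultimately have L: "Ln (1 + 1 / y\<^sup>2) = - (2 * Ln y) + Ln (1 + y\<^sup>2)" by (simp add: Lq)
  have "1 + 1 / y\<^sup>2 \<noteq> 0" using \<open>1 / y\<^sup>2 * (1 + y\<^sup>2) = 1 + 1 / y\<^sup>2\<close> q0 v0 by (metis mult_eq_0_iff)
  thus ?thesis using y0 v0 by (simp add: powr_def L exp_add[symmetric] algebra_simps)
qed

text \<open>2F1(1, b; 1) is a binomial series. Read as an integral, this evaluates the Beta average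
  of 1 / (1 - t \<xi>), the shape of a single partial fraction.\<close>

lemma euler_fun_binomial:
  assumes b: "0 < Re b" "Re b < 1" and \<xi>: "\<xi> \<in> slit_plane"
  shows "euler_fun 1 b 1 \<xi> = (1 - \<xi>) powr (- b)"
proof (rule is_hyp_unique[OF _ _ \<xi>])
  show "is_hyp 1 b 1 (euler_fun 1 b 1)" by (rule euler_fun_is_hyp) (use b in auto)
  show "is_hyp 1 b 1 (\<lambda>\<xi>. (1 - \<xi>) powr (- b))"
    unfolding is_hyp_def
  proof (intro conjI allI impI)
    show "(\<lambda>\<xi>. (1 - \<xi>) powr (- b)) holomorphic_on slit_plane"
      by (intro holomorphic_intros) (auto simp: slit_plane_def)
    fix \<zeta> :: complex assume "norm \<zeta> < 1"
    moreover have "((- b) gchoose n) * (- \<zeta>) ^ n = hyp_coeff 1 b 1 n * \<zeta> ^ n" for n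
    proof -
      have "((-1) ^ n * (-1) ^ n :: complex) = 1" by (simp flip: power_mult_distrib)
      thus ?thesis by (simp add: gbinomial_pochhammer power_minus[of \<zeta>] hyp_coeff_def pochhammer_fact[symmetric] mult_ac)
    qed
    ultimately show "(\<lambda>n. hyp_coeff 1 b 1 n * \<zeta> ^ n) sums ((1 - \<zeta>) powr (- b))"
      using gen_binomial_complex[of "- \<zeta>" "- b"] by simp
  qed
qed


text \<open>A weighted geometric mean is at most the maximum. The weight later splits the growth of
  a denominator between summability in k and integrability in s.\<close>

lemma powr_interpolation_le_add:
  fixes A B \<theta> :: real
  assumes "A > 0" "B > 0" "0 \<le> \<theta>" "\<theta> \<le> 1"
  shows "A powr (1 - \<theta>) * B powr \<theta> \<le> A + B"
proof -
  define C where "C = max A B"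
  have "A powr (1 - \<theta>) * B powr \<theta> \<le> C powr (1 - \<theta>) * C powr \<theta>"
    using assms by (intro mult_mono powr_mono2) (auto simp: C_def)
  also have "\<dots> = C" using assms by (simp add: powr_add[symmetric] C_def)
  also have "\<dots> \<le> A + B" using assms by (simp add: C_def)
  finally show ?thesis .
qed

lemma of_real_inverse_powr:
  assumes "k > 0"
  shows "complex_of_real (1 / real k) powr c = 1 / of_nat k powr c"
proof -
  have "Ln (complex_of_real (1 / real k)) = - Ln (of_nat k)"
    using assms Ln_of_real[of "1 / real k"] Ln_of_real[of "real k"] by (simp add: ln_div)
  hence "complex_of_real (1 / real k) powr c = exp (- (c * Ln (of_nat k)))"
    using assms by (simp only: powr_def) simp
  thus ?thesis using assms by (simp add: powr_def exp_minus inverse_eq_divide)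
qed

lemma geometric_exp_sums:
  fixes X :: complex
  assumes "Re X > 0"
  shows "(\<lambda>n. exp (- (of_nat (Suc n) * X))) sums (1 / (exp X - 1))"
    and "summable (\<lambda>n. norm (exp (- (of_nat (Suc n) * X))))"
proof -
  define c where "c = exp (- X)"
  have c: "norm c < 1" "c \<noteq> 0" using assms by (simp_all add: c_def norm_exp_eq_Re)
  have e: "exp (- (of_nat (Suc n) * X)) = c * c ^ n" for n
  proof -
    have "exp (- (of_nat (Suc n) * X)) = exp (of_nat (Suc n) * (- X))" by simp
    also have "\<dots> = c ^ Suc n" unfolding c_def by (rule exp_of_nat_mult)
    finally show ?thesis by simp
  qed
  have "(\<lambda>n. c * c ^ n) sums (c * (1 / (1 - c)))" by (intro sums_mult geometric_sums c)
  moreover have "c * (1 / (1 - c)) = 1 / (exp X - 1)"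
  proof -
    have ce: "c * exp X = 1" by (simp add: c_def exp_minus)
    have "1 - c \<noteq> 0" using c by auto
    moreover have "exp X - 1 \<noteq> 0"
    proof
      assume "exp X - 1 = 0" hence "exp X = 1" by simp
      with ce show False using c by simp
    qed
    moreover have "c * (exp X - 1) = 1 - c" using ce by (simp add: right_diff_distrib)
    ultimately show ?thesis by (simp add: frac_eq_eq) 
  qed
  ultimately show "(\<lambda>n. exp (- (of_nat (Suc n) * X))) sums (1 / (exp X - 1))" unfolding e by simp
  have "summable (\<lambda>n. norm c * norm c ^ n)" using c by (intro summable_mult summable_geometric) simp
  thus "summable (\<lambda>n. norm (exp (- (of_nat (Suc n) * X))))" unfolding e by (simp only: norm_mult norm_power)
qed

section \<open>The classical sum formula in the strip\<close>

lemma summable_Suc_powr: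
  fixes c :: real
  assumes "c < -1"
  shows "summable (\<lambda>n. real (Suc n) powr c)"
  using assms by (subst summable_Suc_iff[of "\<lambda>n. real n powr c"]) (simp add: summable_real_powr_iff)

lemma slit_plane_neg_inverse_square:
  assumes "Re y > 0"
  shows "- (1 / y\<^sup>2) \<in> slit_plane"
proof -
  have "Re (1 / y) > 0" using assms by (simp add: Re_divide power2_eq_square[symmetric] add_pos_nonneg)
  from inverse_square_plus_one_nonpos[OF this] show ?thesis by (simp add: slit_plane_def power_divide)
qed

text \<open>The index enters the integrand only through the exponential, so the sum under the
  integral is geometric. Taking \<sigma> = 1 in the kernel estimate gives the majorant n^(-2) with
  an integrable kernel.\<close>

lemma sum_J_int:
  assumes x: "Re x > 0" and \<beta>: "Re \<beta> > 0" and z: "Re z > 0"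
  shows "integrable I01 (\<lambda>s. cbeta_kernel z \<beta> s * (1 / (exp (x / of_real (sqrt s)) - 1)))"
    and "(\<lambda>n. J_int z \<beta> (of_nat (Suc n) * x)) sums (LINT s|I01. cbeta_kernel z \<beta> s * (1 / (exp (x / of_real (sqrt s)) - 1)))"
proof -
  define f where "f n s = cbeta_kernel z \<beta> s * exp (- (of_nat (Suc n) * x) / of_real (sqrt s))" for n s
  have Rn: "Re (of_nat (Suc n) * x) > 0" for n using x by (simp del: of_nat_Suc)
  have intf: "integrable I01 (f n)" for n unfolding f_def by (intro integrable_J Rn \<beta>)
  obtain C where C: "C > 0" "\<And>\<alpha> \<beta> u s. Re u > 0 \<Longrightarrow> s \<in> {0<..<1} \<Longrightarrow>
    norm (cbeta_kernel \<alpha> \<beta> s * exp (- u / of_real (sqrt s))) \<le> C * Re u powr (- 2 * 1) * beta_kernel (Re \<alpha> + 1) (Re \<beta>) s"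
    using J_integrand_bound[of 1] by (metis zero_le_one)
  have fe: "f n s = cbeta_kernel z \<beta> s * exp (- (of_nat (Suc n) * (x / of_real (sqrt s))))" for n s
    by (simp add: f_def)
  have RX: "Re (x / of_real (sqrt s)) > 0" if "s \<in> {0<..<1}" for s using x that by simp
  have A1: "AE s in I01. summable (\<lambda>n. norm (f n s))"
  proof (rule AE_I2)
    fix s assume "s \<in> space I01"
    hence s: "s \<in> {0<..<1}" by simp
    show "summable (\<lambda>n. norm (f n s))"
      unfolding fe norm_mult[of "cbeta_kernel z \<beta> s"] by (intro summable_mult geometric_exp_sums(2) RX s)
  qed
  have A2: "summable (\<lambda>n. LINT s|I01. norm (f n s))"
  proof (rule summable_comparison_test'[of "\<lambda>n. C * Re x powr (- 2) * (LINT s|I01. beta_kernel (Re z + 1) (Re \<beta>) s) * real (Suc n) powr (- 2)" 0])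
    show "summable (\<lambda>n. C * Re x powr (- 2) * (LINT s|I01. beta_kernel (Re z + 1) (Re \<beta>) s) * real (Suc n) powr (- 2))"
      by (intro summable_mult summable_Suc_powr) simp
    fix n :: nat
    have p: "Re (of_nat (Suc n) * x) powr (- 2 * 1) = real (Suc n) powr (- 2) * Re x powr (- 2)"
      using x by (simp add: powr_mult del: of_nat_Suc)
    have "(LINT s|I01. norm (f n s)) \<le> (LINT s|I01. C * (real (Suc n) powr (- 2) * Re x powr (- 2)) * beta_kernel (Re z + 1) (Re \<beta>) s)"
    proof (rule integral_mono)
      show "integrable I01 (\<lambda>s. norm (f n s))" by (rule integrable_norm[OF intf])
      show "integrable I01 (\<lambda>s. C * (real (Suc n) powr (- 2) * Re x powr (- 2)) * beta_kernel (Re z + 1) (Re \<beta>) s)"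
        using z \<beta> by (intro integrable_mult_right integrable_beta_kernel) auto
      fix s assume "s \<in> space I01"
      hence s: "s \<in> {0<..<1}" by simp
      show "norm (f n s) \<le> C * (real (Suc n) powr (- 2) * Re x powr (- 2)) * beta_kernel (Re z + 1) (Re \<beta>) s"
        using C(2)[OF Rn s, of z \<beta> n] unfolding f_def p .
    qed
    also have "\<dots> = C * Re x powr (- 2) * (LINT s|I01. beta_kernel (Re z + 1) (Re \<beta>) s) * real (Suc n) powr (- 2)" by simp
    finally show "norm (LINT s|I01. norm (f n s)) \<le> C * Re x powr (- 2) * (LINT s|I01. beta_kernel (Re z + 1) (Re \<beta>) s) * real (Suc n) powr (- 2)"
      by (simp only: real_norm_def abs_of_nonneg integral_nonneg_AE norm_ge_zero AE_I2)
  qed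
  have S: "(\<Sum>n. f n s) = cbeta_kernel z \<beta> s * (1 / (exp (x / of_real (sqrt s)) - 1))" if s: "s \<in> space I01" for s
    unfolding fe using s by (intro sums_unique[symmetric] sums_mult geometric_exp_sums(1) RX) simp
  show "integrable I01 (\<lambda>s. cbeta_kernel z \<beta> s * (1 / (exp (x / of_real (sqrt s)) - 1)))"
    using integrable_suminf[OF intf A1 A2] by (subst Bochner_Integration.integrable_cong[OF refl S[symmetric]])
  show "(\<lambda>n. J_int z \<beta> (of_nat (Suc n) * x)) sums (LINT s|I01. cbeta_kernel z \<beta> s * (1 / (exp (x / of_real (sqrt s)) - 1)))"
  proof -
    have "(LINT s|I01. (\<Sum>n. f n s)) = (LINT s|I01. cbeta_kernel z \<beta> s * (1 / (exp (x / of_real (sqrt s)) - 1)))"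
      by (rule Bochner_Integration.integral_cong[OF refl S])
    thus ?thesis using sums_integral[OF intf A1 A2] by (simp only: f_def J_int_def)
  qed
qed

lemma cbeta_kernel_times_sqrt:
  assumes "s \<in> {0<..<1}"
  shows "cbeta_kernel z \<beta> s * of_real (sqrt s) = cbeta_kernel (z + 1/2) \<beta> s"
  using cbeta_kernel_over_sqrt[OF assms, of "z + 1/2" \<beta>] assms by (simp add: field_simps)

text \<open>Each partial fraction of coth, integrated against the kernel, is an Euler integral with
  exponent 1 and parameters b = z + 1/2 and 1, hence a pure power.\<close>

lemma sum_partial_fraction_integrals:
  assumes x: "Re x > 0" and z: "0 < Re z" "Re z < 1/2" and \<beta>_def: "\<beta> = 1/2 - z"
  shows "(\<lambda>k. 4 / x * (Gamma (z + 1/2) * Gamma \<beta>) * (1 + 1 / (x / (2 * of_real pi * of_nat (Suc k)))\<^sup>2) powr (- (z + 1/2))) sums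
    (LINT s|I01. cbeta_kernel z \<beta> s * (2 / (exp (x / of_real (sqrt s)) - 1) + 1 - 2 / (x / of_real (sqrt s))))"
proof -
  define b where "b = z + 1/2"
  define y where "y k = x / (2 * of_real pi * of_nat (Suc k))" for k
  define \<xi> where "\<xi> k = - (1 / (y k)\<^sup>2)" for k
  have b: "0 < Re b" "Re b < 1" "1 - b = \<beta>" "Re \<beta> > 0" using z by (auto simp: b_def \<beta>_def)
  have yr: "y k = of_real (1 / (2 * pi * real (Suc k))) * x" for k
    by (simp add: y_def del: of_nat_Suc)
  have y: "Re (y k) > 0" for k unfolding yr using x by (simp del: of_nat_Suc)
  have \<xi>: "\<xi> k \<in> slit_plane" for k unfolding \<xi>_def by (rule slit_plane_neg_inverse_square[OF y])
  have x0: "x \<noteq> 0" using x by auto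
  define g where "g k s = 4 / x * (cbeta_kernel b \<beta> s * (1 - of_real s * \<xi> k) powr (- 1))" for k s
  have intg: "integrable I01 (g k)" for k
    unfolding g_def using integrable_euler[of b 1 "\<xi> k" 1] b \<xi> by (intro integrable_mult_right) simp
  have gval: "(LINT s|I01. g k s) = 4 / x * (Gamma b * Gamma \<beta>) * (1 - \<xi> k) powr (- b)" for k
  proof -
    have np: "b \<notin> \<int>\<^sub>\<le>\<^sub>0" "\<beta> \<notin> \<int>\<^sub>\<le>\<^sub>0" using b by (auto intro!: Re_pos_not_nonpos_Int)
    have E1: "1 / (Gamma b * Gamma \<beta>) * (LINT s|I01. cbeta_kernel b \<beta> s * (1 - of_real s * \<xi> k) powr (- 1)) = (1 - \<xi> k) powr (- b)"
      using euler_fun_binomial[OF b(1,2) \<xi>, of k] by (simp add: euler_fun_def b(3))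
    have E2: "Gamma b * Gamma \<beta> \<noteq> 0" using np by (simp add: Gamma_eq_zero_iff)
    have "(LINT s|I01. cbeta_kernel b \<beta> s * (1 - of_real s * \<xi> k) powr (- 1)) = (Gamma b * Gamma \<beta>) * (1 - \<xi> k) powr (- b)"
    proof -
      have "I = A * v" if "1 / A * I = v" "A \<noteq> 0" for I A v :: complex using that by auto
      from this[OF E1 E2] show ?thesis .
    qed
    thus ?thesis unfolding g_def by (simp only: integral_mult_right_zero mult.assoc)
  qed
  have geq: "g k s = cbeta_kernel z \<beta> s * (4 * (x / of_real (sqrt s)) / ((x / of_real (sqrt s))\<^sup>2 + 4 * of_real pi ^ 2 * of_nat (Suc k) ^ 2))"
    if s: "s \<in> {0<..<1}" for k s
  proof -
    define r where "r = complex_of_real (sqrt s)"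
    have r: "r \<noteq> 0" "of_real s = r\<^sup>2" using s by (auto simp: r_def simp flip: of_real_power)
    define P where "P = 4 * of_real pi ^ 2 * (of_nat (Suc k) :: complex) ^ 2"
    have \<xi>e: "\<xi> k = - (P / x\<^sup>2)"
      by (simp add: \<xi>_def y_def P_def power_divide power_mult_distrib)
    have nz: "1 - of_real s * \<xi> k \<noteq> 0"
      using slit_plane_scale[OF \<xi>, of s k] s by auto
    have e1: "1 - of_real s * \<xi> k = (x\<^sup>2 + P * r\<^sup>2) / x\<^sup>2"
      unfolding \<xi>e r(2) using x0 by (simp add: add_divide_distrib mult.commute)
    have "(1 - of_real s * \<xi> k) powr (- 1) = 1 / (1 - of_real s * \<xi> k)"
      using nz by (simp add: powr_minus inverse_eq_divide)
    from trans[OF this arg_cong[OF e1, of "\<lambda>t. 1 / t"]]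
    have e2: "(1 - of_real s * \<xi> k) powr (- 1) = 1 / ((x\<^sup>2 + P * r\<^sup>2) / x\<^sup>2)" .
    have g1: "g k s = cbeta_kernel z \<beta> s * (4 / x * r * (1 / ((x\<^sup>2 + P * r\<^sup>2) / x\<^sup>2)))"
      unfolding g_def b_def cbeta_kernel_times_sqrt[OF s, symmetric] e2 r_def[symmetric] by (simp only: mult_ac)
    have g2: "4 / x * r * (1 / (D / x\<^sup>2)) = 4 * (x / r) / (D / r\<^sup>2)" for D
      using x0 r(1) by (cases "D = 0") (simp_all add: power2_eq_square)
    have g3: "(x\<^sup>2 + P * r\<^sup>2) / r\<^sup>2 = (x / r)\<^sup>2 + P"
      using r(1) by (simp add: add_divide_distrib power_divide)
    show ?thesis unfolding P_def[symmetric] r_def[symmetric] by (simp only: g1 g2 g3)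
  qed
  define \<delta> where "\<delta> = Re x / norm x"
  define N where "N = (norm x)\<^sup>2"
  \<comment> \<open>The exponent exceeds 1/2, so k^(-2 \<theta>) is summable, and Re b - \<theta> =
    Re z / 2 is positive, so the kernel remains integrable after the loss of s^\<theta>.\<close>
  define \<theta> where "\<theta> = 1/2 + Re z / 2"
  have pos: "\<delta> > 0" "N > 0" "0 \<le> \<theta>" "\<theta> \<le> 1" using x x0 z by (auto simp: \<delta>_def N_def \<theta>_def)
  define D where "D = 4 / norm x * (N / (\<delta> * N powr (1 - \<theta>) * (4 * pi\<^sup>2) powr \<theta>))"
  have D: "D \<ge> 0" unfolding D_def using pos by simp
  have gb: "norm (g k s) \<le> D * real (Suc k) powr (- (2 * \<theta>)) * beta_kernel (Re z / 2) (Re \<beta>) s"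
    if s: "s \<in> {0<..<1}" for k s
  proof -
    define B where "B = 4 * pi\<^sup>2 * (real (Suc k))\<^sup>2 * s"
    have B: "B > 0" using s by (simp add: B_def del: of_nat_Suc)
    have Bp: "B powr \<theta> = (4 * pi\<^sup>2) powr \<theta> * real (Suc k) powr (2 * \<theta>) * s powr \<theta>"
    proof -
      have "(real (Suc k))\<^sup>2 = real (Suc k) powr 2" by (simp del: of_nat_Suc)
      hence "B = 4 * pi\<^sup>2 * real (Suc k) powr 2 * s" unfolding B_def by (simp only:)
      thus ?thesis using s by (simp add: powr_mult powr_powr del: of_nat_Suc powr_numeral)
    qed
    have "\<delta> * (N powr (1 - \<theta>) * B powr \<theta>) \<le> \<delta> * (1 * N + B)"
      using powr_interpolation_le_add[OF pos(2) B pos(3,4)] pos(1) by (intro mult_left_mono) auto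
    also have "\<dots> \<le> norm (of_real 1 * x\<^sup>2 + of_real B)"
      unfolding \<delta>_def N_def by (rule norm_sq_plus_ge) (use x B in auto)
    finally have low: "\<delta> * (N powr (1 - \<theta>) * B powr \<theta>) \<le> norm (x\<^sup>2 + of_real B)" by simp
    have "1 - of_real s * \<xi> k = (x\<^sup>2 + of_real B) / x\<^sup>2"
      using x0 by (simp add: \<xi>_def y_def B_def power_divide power_mult_distrib add_divide_distrib mult_ac del: of_nat_Suc)
    moreover have nz: "1 - of_real s * \<xi> k \<noteq> 0"
      using slit_plane_scale[OF \<xi>, of s k] s by auto
    ultimately have "norm ((1 - of_real s * \<xi> k) powr (- 1)) = N / norm (x\<^sup>2 + of_real B)"
      by (simp add: powr_minus inverse_eq_divide norm_divide norm_power N_def)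
    also have "\<dots> \<le> N / (\<delta> * (N powr (1 - \<theta>) * B powr \<theta>))"
    proof (rule divide_left_mono[OF low])
      have lp: "0 < \<delta> * (N powr (1 - \<theta>) * B powr \<theta>)" using pos B by simp
      thus "0 < norm (x\<^sup>2 + of_real B) * (\<delta> * (N powr (1 - \<theta>) * B powr \<theta>))"
        by (rule mult_pos_pos[OF less_le_trans[OF lp low]])
    qed (use pos in simp)
    also have "\<dots> = N / (\<delta> * N powr (1 - \<theta>) * (4 * pi\<^sup>2) powr \<theta>) * (real (Suc k) powr (- (2 * \<theta>)) * s powr (- \<theta>))"
      unfolding Bp by (simp add: powr_minus divide_inverse mult_ac)
    finally have e1: "norm ((1 - of_real s * \<xi> k) powr (- 1)) \<le> N / (\<delta> * N powr (1 - \<theta>) * (4 * pi\<^sup>2) powr \<theta>) * (real (Suc k) powr (- (2 * \<theta>)) * s powr (- \<theta>))" .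
    have "s powr (Re b - 1) * s powr (- \<theta>) = s powr (Re z / 2 - 1)"
    proof -
      have "Re b - 1 + - \<theta> = Re z / 2 - 1" by (simp add: b_def \<theta>_def)
      thus ?thesis by (simp only: powr_add[symmetric])
    qed
    hence e2: "beta_kernel (Re b) (Re \<beta>) s * s powr (- \<theta>) = beta_kernel (Re z / 2) (Re \<beta>) s"
      by (simp add: beta_kernel_def mult_ac)
    have "norm (g k s) = 4 / norm x * (beta_kernel (Re b) (Re \<beta>) s * norm ((1 - of_real s * \<xi> k) powr (- 1)))"
      unfolding g_def norm_mult norm_cbeta_kernel[OF s] by (simp add: norm_divide)
    also have "\<dots> \<le> 4 / norm x * (beta_kernel (Re b) (Re \<beta>) s * (N / (\<delta> * N powr (1 - \<theta>) * (4 * pi\<^sup>2) powr \<theta>) * (real (Suc k) powr (- (2 * \<theta>)) * s powr (- \<theta>))))"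
      by (intro mult_left_mono e1) auto
    also have "\<dots> = D * real (Suc k) powr (- (2 * \<theta>)) * (beta_kernel (Re b) (Re \<beta>) s * s powr (- \<theta>))"
      unfolding D_def by (simp only: mult_ac)
    finally show ?thesis unfolding e2 .
  qed
  have bk: "integrable I01 (beta_kernel (Re z / 2) (Re \<beta>))" using z b by (intro integrable_beta_kernel) auto
  have "(\<lambda>k. LINT s|I01. g k s) sums (LINT s|I01. (\<Sum>k. g k s))"
  proof (rule sums_integral[OF intg])
    show "AE s in I01. summable (\<lambda>k. norm (g k s))"
    proof (rule AE_I2)
      fix s assume "s \<in> space I01"
      hence s: "s \<in> {0<..<1}" by simp
      have "summable (\<lambda>k. D * real (Suc k) powr (- (2 * \<theta>)) * beta_kernel (Re z / 2) (Re \<beta>) s)"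
        using z by (intro summable_mult2 summable_mult summable_Suc_powr) (auto simp: \<theta>_def)
      thus "summable (\<lambda>k. norm (g k s))" by (rule summable_comparison_test'[of _ 0]) (use gb[OF s] in auto)
    qed
    show "summable (\<lambda>k. LINT s|I01. norm (g k s))"
    proof (rule summable_comparison_test'[of "\<lambda>k. D * real (Suc k) powr (- (2 * \<theta>)) * (LINT s|I01. beta_kernel (Re z / 2) (Re \<beta>) s)" 0])
      show "summable (\<lambda>k. D * real (Suc k) powr (- (2 * \<theta>)) * (LINT s|I01. beta_kernel (Re z / 2) (Re \<beta>) s))"
        using z by (intro summable_mult2 summable_mult summable_Suc_powr) (auto simp: \<theta>_def)
      fix k :: nat
      have "(LINT s|I01. norm (g k s)) \<le> (LINT s|I01. D * real (Suc k) powr (- (2 * \<theta>)) * beta_kernel (Re z / 2) (Re \<beta>) s)"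
        using gb by (intro integral_mono integrable_norm intg integrable_mult_right bk) simp
      also have "\<dots> = D * real (Suc k) powr (- (2 * \<theta>)) * (LINT s|I01. beta_kernel (Re z / 2) (Re \<beta>) s)" by simp
      finally show "norm (LINT s|I01. norm (g k s)) \<le> D * real (Suc k) powr (- (2 * \<theta>)) * (LINT s|I01. beta_kernel (Re z / 2) (Re \<beta>) s)"
        by (simp only: real_norm_def abs_of_nonneg integral_nonneg_AE norm_ge_zero AE_I2)
    qed
  qed
  also have "(LINT s|I01. (\<Sum>k. g k s)) = (LINT s|I01. cbeta_kernel z \<beta> s * (2 / (exp (x / of_real (sqrt s)) - 1) + 1 - 2 / (x / of_real (sqrt s))))"
  proof (rule Bochner_Integration.integral_cong[OF refl])
    fix s assume "s \<in> space I01"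
    hence s: "s \<in> {0<..<1}" by simp
    have "Re (x / of_real (sqrt s)) > 0" using x s by simp
    from sums_mult[OF coth_partial_fractions[OF this], of "cbeta_kernel z \<beta> s"]
    have "(\<lambda>k. g k s) sums (cbeta_kernel z \<beta> s * (2 / (exp (x / of_real (sqrt s)) - 1) + 1 - 2 / (x / of_real (sqrt s))))"
      unfolding geq[OF s] .
    thus "(\<Sum>k. g k s) = cbeta_kernel z \<beta> s * (2 / (exp (x / of_real (sqrt s)) - 1) + 1 - 2 / (x / of_real (sqrt s)))"
      by (rule sums_unique[symmetric])
  qed
  finally show ?thesis unfolding gval by (simp add: \<xi>_def y_def b_def)
qed

text \<open>The integral of 2 / (exp X - 1) + 1 - 2 / X with X = x / sqrt s is computed twice: by
  partial fractions, and as twice the sum of the kernel integrals corrected by two Beta integrals.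
  The corrections become the terms with Gamma z and 1 / x.\<close>

lemma kober:
  assumes x: "Re x > 0" and z: "0 < Re z" "Re z < 1/2"
  shows "(\<lambda>n. kfun z (of_nat (Suc n) * x)) sums
    (1 / of_real (sqrt pi) * (x / (2 * of_real pi)) powr (2 * z) * Gamma (z + 1/2) *
      (\<Sum>k. 1 / of_nat (Suc k) powr (2 * z + 1) * (1 + x\<^sup>2 / (4 * of_real pi ^ 2 * of_nat (Suc k) ^ 2)) powr (- (z + 1/2)))
      - Gamma z / 2 + of_real (sqrt pi) * Gamma (z + 1/2) / x)"
    and "summable (\<lambda>k. 1 / of_nat (Suc k) powr (2 * z + 1) * (1 + x\<^sup>2 / (4 * of_real pi ^ 2 * of_nat (Suc k) ^ 2)) powr (- (z + 1/2)))"
proof -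
  define \<beta> where "\<beta> = 1/2 - z"
  define b where "b = z + 1/2"
  define y where "y k = x / (2 * of_real pi * of_nat (Suc k))" for k
  define T where "T k = 1 / of_nat (Suc k) powr (2 * z + 1) * (1 + x\<^sup>2 / (4 * of_real pi ^ 2 * of_nat (Suc k) ^ 2)) powr (- b)" for k
  define L where "L = (LINT s|I01. cbeta_kernel z \<beta> s * (1 / (exp (x / of_real (sqrt s)) - 1)))"
  have b: "Re b > 0" "z + \<beta> = 1/2" "b + \<beta> = 1" "Re \<beta> > 0" using z by (auto simp: b_def \<beta>_def)
  have x0: "x \<noteq> 0" using x by auto
  have yr: "y k = of_real (1 / real (Suc k)) * (x / (2 * of_real pi))" for k
    by (simp add: y_def del: of_nat_Suc)
  have xp: "Re (x / (2 * of_real pi)) > 0" "x / (2 * of_real pi) \<noteq> 0"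
  proof -
    have "x / (2 * of_real pi) = of_real (1 / (2 * pi)) * x" by simp
    hence "Re (x / (2 * of_real pi)) = 1 / (2 * pi) * Re x" by (simp only: times_complex.sel Re_complex_of_real Im_complex_of_real mult_zero_left diff_zero)
    thus "Re (x / (2 * of_real pi)) > 0" using x by simp
  qed (use x0 in simp)
  have y: "Re (y k) > 0" for k
  proof -
    have "Re (y k) = 1 / real (Suc k) * Re (x / (2 * of_real pi))"
      by (simp only: yr times_complex.sel Re_complex_of_real Im_complex_of_real mult_zero_left diff_zero)
    moreover have "1 / real (Suc k) * Re (x / (2 * of_real pi)) > 0" by (intro mult_pos_pos xp) simp
    ultimately show ?thesis by simp
  qed
  \<comment> \<open>Extracting a power of y_k from (1 + y_k^(-2))^(-b) produces the weight k^(-2 z -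
    1) and leaves (1 + y_k^2)^(-b), which tends to 1 with growing k.\<close>
  have trm: "4 / x * (Gamma (z + 1/2) * Gamma \<beta>) * (1 + 1 / (x / (2 * of_real pi * of_nat (Suc k)))\<^sup>2) powr (- (z + 1/2))
     = 2 / of_real pi * (Gamma b * Gamma \<beta>) * (x / (2 * of_real pi)) powr (2 * z) * T k" for k
  proof -
    have "(1 + 1 / (y k)\<^sup>2) powr (- b) = y k powr (2 * b) * (1 + (y k)\<^sup>2) powr (- b)"
      using powr_one_plus_inverse_square[OF y, of k "- b"] by simp
    also have "y k powr (2 * b) = of_real (1 / real (Suc k)) powr (2 * b) * (x / (2 * of_real pi)) powr (2 * b)"
      unfolding yr by (rule powr_times_real_left) (auto simp del: of_nat_Suc)
    also have "of_real (1 / real (Suc k)) powr (2 * b) = 1 / of_nat (Suc k) powr (2 * b)"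
      by (rule of_real_inverse_powr) simp
    also have "2 * b = 2 * z + 1" by (simp add: b_def)
    also have "(x / (2 * of_real pi)) powr (2 * z + 1) = (x / (2 * of_real pi)) powr (2 * z) * (x / (2 * of_real pi))"
      using xp by (simp add: powr_add)
    finally have e: "(1 + 1 / (y k)\<^sup>2) powr (- b) = 1 / of_nat (Suc k) powr (2 * z + 1) *
       ((x / (2 * of_real pi)) powr (2 * z) * (x / (2 * of_real pi))) * (1 + (y k)\<^sup>2) powr (- b)" .
    have "(y k)\<^sup>2 = x\<^sup>2 / (4 * of_real pi ^ 2 * of_nat (Suc k) ^ 2)"
      by (simp add: y_def power_divide power_mult_distrib del: of_nat_Suc)
    hence "T k = 1 / of_nat (Suc k) powr (2 * z + 1) * (1 + (y k)\<^sup>2) powr (- b)" by (simp only: T_def)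
    with e have "(1 + 1 / (y k)\<^sup>2) powr (- b) = (x / (2 * of_real pi)) powr (2 * z) * (x / (2 * of_real pi)) * T k"
      by (simp only: mult_ac)
    thus ?thesis unfolding y_def b_def[symmetric] using x0 by simp
  qed
  have S: "(\<lambda>k. 2 / of_real pi * (Gamma b * Gamma \<beta>) * (x / (2 * of_real pi)) powr (2 * z) * T k) sums
     (LINT s|I01. cbeta_kernel z \<beta> s * (2 / (exp (x / of_real (sqrt s)) - 1) + 1 - 2 / (x / of_real (sqrt s))))"
    using sum_partial_fraction_integrals[OF x z \<beta>_def] unfolding trm .
  have I: "(LINT s|I01. cbeta_kernel z \<beta> s * (2 / (exp (x / of_real (sqrt s)) - 1) + 1 - 2 / (x / of_real (sqrt s))))
     = 2 * L + Gamma z * Gamma \<beta> / Gamma (1/2) - 2 / x * (Gamma b * Gamma \<beta>)"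
  proof -
    have i: "integrable I01 (\<lambda>s. 2 * (cbeta_kernel z \<beta> s * (1 / (exp (x / of_real (sqrt s)) - 1))))"
      "integrable I01 (cbeta_kernel z \<beta>)" "integrable I01 (\<lambda>s. 2 / x * cbeta_kernel b \<beta> s)"
      using b z by (intro integrable_mult_right sum_J_int(1) x integrable_cbeta_kernel; simp)+
    have "(LINT s|I01. cbeta_kernel z \<beta> s * (2 / (exp (x / of_real (sqrt s)) - 1) + 1 - 2 / (x / of_real (sqrt s))))
      = (LINT s|I01. 2 * (cbeta_kernel z \<beta> s * (1 / (exp (x / of_real (sqrt s)) - 1))) + cbeta_kernel z \<beta> s - 2 / x * cbeta_kernel b \<beta> s)"
    proof (rule Bochner_Integration.integral_cong[OF refl])
      fix s assume "s \<in> space I01"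
      hence s: "s \<in> {0<..<1}" by simp
      have "c * (2 / e + 1 - 2 / (x / r)) = 2 * (c * (1 / e)) + c - 2 / x * (c * r)" for c e r :: complex
        by (simp add: algebra_simps)
      thus "cbeta_kernel z \<beta> s * (2 / (exp (x / of_real (sqrt s)) - 1) + 1 - 2 / (x / of_real (sqrt s))) =
        2 * (cbeta_kernel z \<beta> s * (1 / (exp (x / of_real (sqrt s)) - 1))) + cbeta_kernel z \<beta> s - 2 / x * cbeta_kernel b \<beta> s"
        unfolding b_def cbeta_kernel_times_sqrt[OF s, symmetric] .
    qed
    also have "\<dots> = (LINT s|I01. 2 * (cbeta_kernel z \<beta> s * (1 / (exp (x / of_real (sqrt s)) - 1))) + cbeta_kernel z \<beta> s) - (LINT s|I01. 2 / x * cbeta_kernel b \<beta> s)"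
      by (intro Bochner_Integration.integral_diff Bochner_Integration.integrable_add i)
    also have "(LINT s|I01. 2 * (cbeta_kernel z \<beta> s * (1 / (exp (x / of_real (sqrt s)) - 1))) + cbeta_kernel z \<beta> s) = (LINT s|I01. 2 * (cbeta_kernel z \<beta> s * (1 / (exp (x / of_real (sqrt s)) - 1)))) + (LINT s|I01. cbeta_kernel z \<beta> s)"
      by (intro Bochner_Integration.integral_add i)
    also have "(LINT s|I01. 2 * (cbeta_kernel z \<beta> s * (1 / (exp (x / of_real (sqrt s)) - 1)))) = 2 * L" unfolding L_def by (rule integral_mult_right_zero)
    also have "(LINT s|I01. cbeta_kernel z \<beta> s) = Gamma z * Gamma \<beta> / Gamma (1/2)" using LINT_cbeta_kernel[OF z(1) b(4)] by (simp only: b)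
    also have "(LINT s|I01. 2 / x * cbeta_kernel b \<beta> s) = 2 / x * (Gamma b * Gamma \<beta>)"
      using LINT_cbeta_kernel[OF b(1,4)] by (simp only: b integral_mult_right_zero Gamma_1 div_by_1)
    finally show ?thesis .
  qed
  have G: "Gamma \<beta> \<noteq> 0" "Gamma b \<noteq> 0" using b by (auto simp: Gamma_eq_zero_iff dest: Re_pos_not_nonpos_Int)
  have cnz: "2 / of_real pi * (Gamma b * Gamma \<beta>) * (x / (2 * of_real pi)) powr (2 * z) \<noteq> 0" using G xp by simp
  have sumT: "summable T" using summable_mult_D[OF sums_summable[OF S] cnz] by simp
  thus "summable (\<lambda>k. 1 / of_nat (Suc k) powr (2 * z + 1) * (1 + x\<^sup>2 / (4 * of_real pi ^ 2 * of_nat (Suc k) ^ 2)) powr (- (z + 1/2)))"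
    by (simp add: T_def [abs_def] b_def)
  have eq: "2 / of_real pi * (Gamma b * Gamma \<beta>) * (x / (2 * of_real pi)) powr (2 * z) * suminf T = 2 * L + Gamma z * Gamma \<beta> / Gamma (1/2) - 2 / x * (Gamma b * Gamma \<beta>)"
    using sums_unique2[OF S sums_mult[OF summable_sums[OF sumT]]] unfolding I by simp
  have sp: "complex_of_real (sqrt pi) \<noteq> 0" "complex_of_real (sqrt pi) * complex_of_real (sqrt pi) = of_real pi"
    by (simp_all flip: of_real_mult)
  have fin: "of_real (sqrt pi) * rGamma \<beta> * L = 1 / of_real (sqrt pi) * P * Gb * S' - Gz / 2 + of_real (sqrt pi) * Gb / x"
    if "2 / of_real pi * (Gb * Gamma \<beta>) * P * S' = 2 * L + Gz * Gamma \<beta> / of_real (sqrt pi) - 2 / x * (Gb * Gamma \<beta>)" for P S' Gb Gz :: complex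
  proof -
    define q where "q = complex_of_real (sqrt pi)"
    have q: "q \<noteq> 0" "of_real pi = q * q" using sp by (simp_all add: q_def)
    have "L = (2 / (q * q) * (Gb * Gamma \<beta>) * P * S' - Gz * Gamma \<beta> / q + 2 / x * (Gb * Gamma \<beta>)) / 2"
      using that unfolding q_def[symmetric] q(2) by (simp add: algebra_simps)
    hence "q * rGamma \<beta> * L = q * (1 / Gamma \<beta>) * ((2 / (q * q) * (Gb * Gamma \<beta>) * P * S' - Gz * Gamma \<beta> / q + 2 / x * (Gb * Gamma \<beta>)) / 2)"
      by (simp only: rGamma_inverse_Gamma inverse_eq_divide)
    also have "\<dots> = 1 / q * P * Gb * S' - Gz / 2 + q * Gb / x"
      using q(1) G(1) x0 by (simp add: divide_simps) (simp add: algebra_simps)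
    finally show ?thesis unfolding q_def .
  qed
  have "(\<lambda>n. of_real (sqrt pi) * rGamma \<beta> * J_int z \<beta> (of_nat (Suc n) * x)) sums (of_real (sqrt pi) * rGamma \<beta> * L)"
    unfolding L_def using b z by (intro sums_mult sum_J_int(2) x)
  moreover have "of_real (sqrt pi) * rGamma \<beta> * J_int z \<beta> (of_nat (Suc n) * x) = kfun z (of_nat (Suc n) * x)" for n
    using z by (simp add: kfun_def \<beta>_def)
  ultimately have "(\<lambda>n. kfun z (of_nat (Suc n) * x)) sums (of_real (sqrt pi) * rGamma \<beta> * L)" by simp
  also have "of_real (sqrt pi) * rGamma \<beta> * L = 1 / of_real (sqrt pi) * (x / (2 * of_real pi)) powr (2 * z) * Gamma b * suminf T - Gamma z / 2 + of_real (sqrt pi) * Gamma b / x"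
    by (rule fin) (use eq in \<open>simp only: Gamma_one_half_complex\<close>)
  finally show "(\<lambda>n. kfun z (of_nat (Suc n) * x)) sums
    (1 / of_real (sqrt pi) * (x / (2 * of_real pi)) powr (2 * z) * Gamma (z + 1/2) *
      (\<Sum>k. 1 / of_nat (Suc k) powr (2 * z + 1) * (1 + x\<^sup>2 / (4 * of_real pi ^ 2 * of_nat (Suc k) ^ 2)) powr (- (z + 1/2)))
      - Gamma z / 2 + of_real (sqrt pi) * Gamma (z + 1/2) / x)"
    by (simp add: T_def [abs_def] b_def)
qed


section \<open>The generalized Bessel function\<close>

definition F12_coeff :: "complex \<Rightarrow> complex \<Rightarrow> complex \<Rightarrow> nat \<Rightarrow> complex" where
  "F12_coeff a b c n = Gamma (a + of_nat n) * rGamma (b + of_nat n) * rGamma (c + of_nat n) / fact n"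

text \<open>\<open>\<Gamma>(a) \<^sub>1F\<^sub>2(a; b, c; w) / (\<Gamma>(b) \<Gamma>(c))\<close>, entire in \<open>b\<close> and \<open>c\<close>.\<close>

definition F12 :: "complex \<Rightarrow> complex \<Rightarrow> complex \<Rightarrow> complex \<Rightarrow> complex" where
  "F12 a b c w = (\<Sum>n. F12_coeff a b c n * w ^ n)"

lemma norm_add_of_nat_ge:
  fixes b :: complex
  shows "real n - norm b \<le> norm (b + of_nat n)"
  using norm_triangle_ineq2[of "of_nat n" "- b"]
  by (simp only: norm_of_nat norm_minus_cancel diff_minus_eq_add add.commute[of b])

text \<open>The ratio of consecutive coefficients, cleared of denominators so that it holds also
  where b + n or c + n vanishes.\<close>

lemma F12_coeff_Suc:
  assumes a: "a \<notin> \<int>\<^sub>\<le>\<^sub>0"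
  shows "of_nat (Suc n) * (b + of_nat n) * (c + of_nat n) * F12_coeff a b c (Suc n) = (a + of_nat n) * F12_coeff a b c n"
proof -
  have an: "a + of_nat n \<notin> \<int>\<^sub>\<le>\<^sub>0" using a by (metis add_diff_cancel_right' nonpos_Ints_diff_Nats of_nat_in_Nats)
  have "Gamma (a + of_nat (Suc n)) = (a + of_nat n) * Gamma (a + of_nat n)"
    using Gamma_plus1[OF an] by (simp add: add_ac)
  moreover have "rGamma (b + of_nat n) = (b + of_nat n) * rGamma (b + of_nat (Suc n))" for b :: complex
    using rGamma_plus1[of "b + of_nat n"] by (simp add: add_ac)
  moreover have "k * B * C * (A * G * R * S / (k * F)) = A * (G * (B * R) * (C * S) / F)"
    if "k \<noteq> 0" for k A B C G R S F :: complex using that by simp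
  ultimately show ?thesis unfolding F12_coeff_def fact_Suc using of_nat_neq_0[of n, where ?'a = complex] by metis
qed

lemma F12_summable:
  assumes a: "a \<notin> \<int>\<^sub>\<le>\<^sub>0"
  shows "summable (\<lambda>n. F12_coeff a b c n * w ^ n)"
proof -
  \<comment> \<open>Beyond this index |b + n| \<ge> 1 and |c + n| \<ge> 2 |w| (|a| + 1); together
    with |a + n| \<le> (n + 1) (|a| + 1) the ratio of terms is at most 1/2.\<close>
  define M where "M = norm b + norm c + 1 + 2 * norm w * (norm a + 1)"
  obtain N where N: "real N \<ge> M" using real_arch_simple by blast
  show ?thesis
  proof (rule summable_ratio_test[of "1/2" N])
    fix n assume "N \<le> n"
    hence n: "real n \<ge> M" using N by linarith
    have w0: "2 * norm w * (norm a + 1) \<ge> 0" by simp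
    have b1: "norm (b + of_nat n) \<ge> 1" using norm_add_of_nat_ge[of n b] n w0 unfolding M_def by (smt (verit) norm_ge_zero)
    have c1: "norm (c + of_nat n) \<ge> 2 * norm w * (norm a + 1)" using norm_add_of_nat_ge[of n c] n unfolding M_def by (smt (verit) norm_ge_zero)
    have a1: "norm (a + of_nat n) \<le> real (Suc n) * (norm a + 1)"
    proof -
      have "norm (a + of_nat n) \<le> norm a + real n" using norm_triangle_ineq[of a "of_nat n"] by simp
      also have "\<dots> \<le> real (Suc n) * (norm a + 1)" by (simp add: algebra_simps)
      finally show ?thesis .
    qed
    define Q where "Q = real (Suc n) * norm (b + of_nat n) * norm (c + of_nat n)"
    have Qge: "Q \<ge> 2 * norm w * norm (a + of_nat n)"
    proof -
      have "2 * norm w * norm (a + of_nat n) \<le> 2 * norm w * (real (Suc n) * (norm a + 1))" by (intro mult_left_mono a1) auto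
      also have "\<dots> = real (Suc n) * 1 * (2 * norm w * (norm a + 1))" by (simp only: mult_ac mult_1)
      also have "\<dots> \<le> Q" unfolding Q_def by (intro mult_mono b1 c1) auto
      finally show ?thesis .
    qed
    have eq: "Q * norm (F12_coeff a b c (Suc n)) = norm (a + of_nat n) * norm (F12_coeff a b c n)"
      using arg_cong[OF F12_coeff_Suc[OF a, of n b c], of norm] unfolding Q_def norm_mult norm_of_nat .
    show "norm (F12_coeff a b c (Suc n) * w ^ Suc n) \<le> 1/2 * norm (F12_coeff a b c n * w ^ n)"
    proof (cases "w = 0")
      case False
      have an: "norm (a + of_nat n) > 0" using a by (auto simp: add_eq_0_iff2)
      have "2 * norm w * norm (a + of_nat n) * norm (F12_coeff a b c (Suc n)) \<le> norm (a + of_nat n) * norm (F12_coeff a b c n)"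
        unfolding eq[symmetric] by (intro mult_right_mono Qge) auto
      hence "norm (a + of_nat n) * (2 * norm w * norm (F12_coeff a b c (Suc n))) \<le> norm (a + of_nat n) * norm (F12_coeff a b c n)"
        by (simp only: mult_ac)
      hence "2 * norm w * norm (F12_coeff a b c (Suc n)) \<le> norm (F12_coeff a b c n)"
        using an by (simp only: mult_le_cancel_left_pos)
      hence "2 * norm w * norm (F12_coeff a b c (Suc n)) * norm w ^ n \<le> norm (F12_coeff a b c n) * norm w ^ n"
        by (intro mult_right_mono) auto
      thus ?thesis by (simp add: norm_mult norm_power mult_ac)
    qed simp
  qed simp
qed

lemma F12_coeff_shift:
  "F12_coeff a b (c - 1) n = (c - 1 + of_nat n) * F12_coeff a b c n"
  "F12_coeff a (b - 1) c n = (b - 1 + of_nat n) * F12_coeff a b c n"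
proof -
  have r: "rGamma (x - 1 + of_nat n) = (x - 1 + of_nat n) * rGamma (x + of_nat n)" for x :: complex
    using rGamma_plus1[of "x - 1 + of_nat n"] by (simp add: algebra_simps)
  show "F12_coeff a b (c - 1) n = (c - 1 + of_nat n) * F12_coeff a b c n"
    "F12_coeff a (b - 1) c n = (b - 1 + of_nat n) * F12_coeff a b c n"
    unfolding F12_coeff_def r by (simp_all only: mult_ac times_divide_eq_right times_divide_eq_left)
qed

lemma F12_coeff_shift_first:
  assumes a: "a \<notin> \<int>\<^sub>\<le>\<^sub>0"
  shows "F12_coeff (a + 1) b c n = (a + of_nat n) * F12_coeff a b c n"
proof -
  have an: "a + of_nat n \<notin> \<int>\<^sub>\<le>\<^sub>0" using a by (metis add_diff_cancel_right' nonpos_Ints_diff_Nats of_nat_in_Nats)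
  have "Gamma (a + 1 + of_nat n) = (a + of_nat n) * Gamma (a + of_nat n)"
    using Gamma_plus1[OF an] by (simp add: add_ac)
  thus ?thesis unfolding F12_coeff_def by (simp only: mult_ac times_divide_eq_right times_divide_eq_left)
qed

text \<open>The Euler operator w d/dw raises all three parameters. Each relation of
  \<open>F12_contiguous\<close> multiplies the coefficients by some k + n and is therefore k plus
  this operator.\<close>

lemma F12_theta_sums:
  assumes a: "a \<notin> \<int>\<^sub>\<le>\<^sub>0"
  shows "(\<lambda>n. of_nat n * F12_coeff a b c n * w ^ n) sums (w * F12 (a + 1) (b + 1) (c + 1) w)"
proof -
  have "(\<lambda>n. w * (F12_coeff (a + 1) (b + 1) (c + 1) n * w ^ n)) sums (w * F12 (a + 1) (b + 1) (c + 1) w)"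
    unfolding F12_def by (intro sums_mult summable_sums F12_summable nonpos_Ints_plus_one a)
  moreover have "w * (F12_coeff (a + 1) (b + 1) (c + 1) n * w ^ n) = of_nat (Suc n) * F12_coeff a b c (Suc n) * w ^ Suc n" for n
  proof -
    have "k * (X / (k * F)) = X / F" if "k \<noteq> 0" for k X F :: complex using that by simp
    from this[OF of_nat_neq_0[of n]] have "of_nat (Suc n) * F12_coeff a b c (Suc n) = F12_coeff (a + 1) (b + 1) (c + 1) n"
      unfolding F12_coeff_def fact_Suc by (simp add: add_ac)
    thus ?thesis by (simp only: power_Suc mult_ac)
  qed
  ultimately have "(\<lambda>n. of_nat (Suc n) * F12_coeff a b c (Suc n) * w ^ Suc n) sums (w * F12 (a + 1) (b + 1) (c + 1) w)" by simp
  from sums_Suc[OF this] show ?thesis by simp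
qed

lemma F12_contiguous:
  assumes a: "a \<notin> \<int>\<^sub>\<le>\<^sub>0"
  shows "F12 a b (c - 1) w = (c - 1) * F12 a b c w + w * F12 (a + 1) (b + 1) (c + 1) w"
    and "F12 a (b - 1) c w = (b - 1) * F12 a b c w + w * F12 (a + 1) (b + 1) (c + 1) w"
    and "F12 (a + 1) b c w = a * F12 a b c w + w * F12 (a + 1) (b + 1) (c + 1) w"
proof -
  have *: "(\<lambda>n. (k + of_nat n) * F12_coeff a b c n * w ^ n) sums (k * F12 a b c w + w * F12 (a + 1) (b + 1) (c + 1) w)" for k
  proof -
    have "(\<lambda>n. k * (F12_coeff a b c n * w ^ n) + of_nat n * F12_coeff a b c n * w ^ n) sums (k * F12 a b c w + w * F12 (a + 1) (b + 1) (c + 1) w)"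
      unfolding F12_def[of a b c w] by (intro sums_add F12_theta_sums a sums_mult summable_sums F12_summable)
    thus ?thesis by (simp only: ring_distribs mult.assoc)
  qed
  show "F12 a b (c - 1) w = (c - 1) * F12 a b c w + w * F12 (a + 1) (b + 1) (c + 1) w"
    using sums_unique[OF *[of "c - 1"]] by (simp only: F12_def[of a b "c - 1"] F12_coeff_shift)
  show "F12 a (b - 1) c w = (b - 1) * F12 a b c w + w * F12 (a + 1) (b + 1) (c + 1) w"
    using sums_unique[OF *[of "b - 1"]] by (simp only: F12_def[of a "b - 1" c] F12_coeff_shift)
  show "F12 (a + 1) b c w = a * F12 a b c w + w * F12 (a + 1) (b + 1) (c + 1) w"
    using sums_unique[OF *[of a]] by (simp only: F12_def[of "a + 1" b c] F12_coeff_shift_first[OF a])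
qed

text \<open>Up to elementary factors, the generalized Bessel function: with \<open>a = \<mu> + \<lambda> + 1/2\<close> and
  \<open>c = \<lambda> + 1/2 - z\<close>, it is \<open>x^\<lambda> 2^(\<mu>+z-1) (x/2)^(-z)\<close> times \<open>Phi a z c x\<close>.\<close>

definition Phi :: "complex \<Rightarrow> complex \<Rightarrow> complex \<Rightarrow> complex \<Rightarrow> complex" where
  "Phi a z c u = of_real pi / sin (of_real pi * z) *
     (F12 a (1 - z) c (u ^ 2 / 4) - (u / 2) powr (2 * z) * F12 (a + z) (1 + z) (c + z) (u ^ 2 / 4))"

text \<open>Raising z flips the sign of the sine and multiplies the power by u^2 / 4. The result is
  expressed by the functions in \<open>Phi a z c u\<close> and their images under the Euler
  operator, so that the two relations derived from it are linear algebra.\<close>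

lemma Phi_shift_z:
  assumes "a \<notin> \<int>\<^sub>\<le>\<^sub>0" "a + z \<notin> \<int>\<^sub>\<le>\<^sub>0" "Re u > 0"
  shows "Phi a (z + 1) c u = - (of_real pi / sin (of_real pi * z)) *
     (- z * F12 a (1 - z) c (u ^ 2 / 4) + u ^ 2 / 4 * F12 (a + 1) (1 - z + 1) (c + 1) (u ^ 2 / 4)
      - (u / 2) powr (2 * z) * (u ^ 2 / 4 * F12 (a + z + 1) (1 + z + 1) (c + z + 1) (u ^ 2 / 4)))"
proof -
  have s: "sin (of_real pi * (z + 1)) = - sin (of_real pi * z)"
    using sin_plus_pi[of "of_real pi * z"] by (simp add: ring_distribs)
  have u0: "u / 2 \<noteq> 0" using assms(3) by auto
  have p: "(u / 2) powr (2 * (z + 1)) = (u / 2) powr (2 * z) * (u ^ 2 / 4)"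
  proof -
    have "2 * (z + 1) = 2 * z + of_nat 2" by simp
    hence "(u / 2) powr (2 * (z + 1)) = (u / 2) powr (2 * z) * (u / 2) powr (of_nat 2)"
      by (simp only: powr_add)
    also have "(u / 2) powr (of_nat 2) = (u / 2) ^ 2" using u0 by (rule powr_complexpow)
    also have "\<dots> = u ^ 2 / 4" by (simp add: power_divide)
    finally show ?thesis .
  qed
  have e: "1 - (z + 1) = 1 - z - 1" "a + (z + 1) = a + z + 1" "1 + (z + 1) = 1 + z + 1" "c + (z + 1) = c + z + 1" "1 - z - 1 = - z" by simp_all
  have F: "F12 a (1 - z - 1) c (u ^ 2 / 4) = - z * F12 a (1 - z) c (u ^ 2 / 4) + u ^ 2 / 4 * F12 (a + 1) (1 - z + 1) (c + 1) (u ^ 2 / 4)"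
    using F12_contiguous(2)[OF assms(1), of "1 - z" c "u ^ 2 / 4"] by (simp only: e)
  show ?thesis unfolding Phi_def s p e(1-4) F by (simp only: minus_divide_right[symmetric] mult.assoc)
qed

text \<open>For c = d - z the coefficient c - 1 + z is d - 1; this drives the descent in d. At
  integer z the sine in the denominator is 0, so are the quotients by it, and the relation reads 0 =
  0.\<close>

lemma Phi_contiguous_c:
  assumes "a \<notin> \<int>\<^sub>\<le>\<^sub>0" "a + z \<notin> \<int>\<^sub>\<le>\<^sub>0" "Re u > 0"
  shows "Phi a z (c - 1) u = (c - 1 + z) * Phi a z c u - Phi a (z + 1) c u"
proof -
  define S where "S = of_real pi / sin (of_real pi * z)"
  have e: "c - 1 + z = c + z - 1" by simp
  show ?thesis
    unfolding Phi_shift_z[OF assms] unfolding Phi_def e F12_contiguous(1)[OF assms(1), of "1 - z"] F12_contiguous(1)[OF assms(2), of "1 + z"] S_def[symmetric]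
    by (simp add: algebra_simps)
qed

lemma Phi_contiguous_a:
  assumes "a \<notin> \<int>\<^sub>\<le>\<^sub>0" "a + z \<notin> \<int>\<^sub>\<le>\<^sub>0" "Re u > 0"
  shows "(a + z) * Phi a z c u = Phi (a + 1) z c u + Phi a (z + 1) c u"
proof -
  define S where "S = of_real pi / sin (of_real pi * z)"
  have e: "a + 1 + z = a + z + 1" by simp
  show ?thesis
    unfolding Phi_shift_z[OF assms] unfolding Phi_def e F12_contiguous(3)[OF assms(1), of "1 - z"] F12_contiguous(3)[OF assms(2), of "1 + z"] S_def[symmetric]
    by (simp add: algebra_simps)
qed

lemma of_real_sqrt_powr:
  assumes "y > 0"
  shows "complex_of_real (sqrt y) powr (2 * z) = of_real y powr z"
proof -
  have "(complex_of_real (sqrt y))\<^sup>2 powr z = complex_of_real (sqrt y) powr (2 * z)"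
    by (rule powr_square) (use assms in simp)
  thus ?thesis using assms by (simp flip: of_real_power)
qed

text \<open>Against the Beta kernel y^n integrates to a multiple of Gamma (a + n) / Gamma (c + n),
  which turns a Bessel series into \<open>F12\<close>. The second series carries an extra y^z,
  whence the condition on a + z and the parameters a + z and c + z.\<close>

lemma Phi_integral:
  assumes a: "Re a > 0" and c: "Re c > Re a" and az: "Re (a + z) > 0" and z: "z \<notin> \<int>" and u: "Re u > 0"
  shows "Phi a z c u = rGamma (c - a) * (LINT y|I01. cbeta_kernel a (c - a) y * kfun z (of_real (sqrt y) * u))"
proof -
  define w where "w = u ^ 2 / 4"
  define q where "q = c - a"
  have q: "Re q > 0" using c by (simp add: q_def)
  have Gq: "Gamma q \<noteq> 0" using Re_pos_not_nonpos_Int[OF q] by (simp add: Gamma_eq_zero_iff)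
  have ser: "integrable I01 (\<lambda>y. cbeta_kernel p q y * bser b (of_real y * w)) \<and>
     (LINT y|I01. cbeta_kernel p q y * bser b (of_real y * w)) = Gamma q * F12 p b (p + q) w" if p: "Re p > 0" for p b
  proof
    have sn: "summable (\<lambda>n. norm (rGamma (b + of_nat n) / fact n * w ^ n))" by (rule bser_summable_norm)
    have be: "(\<Sum>n. rGamma (b + of_nat n) / fact n * w ^ n * of_real y ^ n) = bser b (of_real y * w)" for y
      by (simp add: bser_def power_mult_distrib mult_ac)
    have "(\<lambda>n. rGamma (b + of_nat n) / fact n * w ^ n * (Gamma (p + of_nat n) * Gamma q / Gamma (p + q + of_nat n))) sums
       (LINT y|I01. cbeta_kernel p q y * bser b (of_real y * w))"
      using LINT_cbeta_kernel_power_series[OF p q sn] unfolding be .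
    moreover have "rGamma (b + of_nat n) / fact n * w ^ n * (Gamma (p + of_nat n) * Gamma q / Gamma (p + q + of_nat n)) = Gamma q * (F12_coeff p b (p + q) n * w ^ n)" for n
      by (simp add: F12_coeff_def rGamma_inverse_Gamma divide_inverse mult_ac)
    ultimately have "(\<lambda>n. Gamma q * (F12_coeff p b (p + q) n * w ^ n)) sums (LINT y|I01. cbeta_kernel p q y * bser b (of_real y * w))" by simp
    moreover have "(\<lambda>n. Gamma q * (F12_coeff p b (p + q) n * w ^ n)) sums (Gamma q * F12 p b (p + q) w)"
      unfolding F12_def using p by (intro sums_mult summable_sums F12_summable Re_pos_not_nonpos_Int)
    ultimately show "(LINT y|I01. cbeta_kernel p q y * bser b (of_real y * w)) = Gamma q * F12 p b (p + q) w" by (rule sums_unique2)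
    have cont: "continuous_on {0..1} (\<lambda>y::real. bser b (of_real y * w))"
    proof (rule continuous_on_compose2[of UNIV "bser b"])
      show "continuous_on UNIV (bser b)" using DERIV_isCont[OF bser_has_field_derivative] by (simp add: continuous_on_eq_continuous_at)
    qed (auto intro!: continuous_intros)
    have "bounded ((\<lambda>y::real. bser b (of_real y * w)) ` {0..1})"
      by (intro compact_imp_bounded compact_continuous_image cont) auto
    then obtain B where B: "\<And>y. y \<in> {0..1} \<Longrightarrow> norm (bser b (of_real y * w)) \<le> B" unfolding bounded_iff by blast
    show "integrable I01 (\<lambda>y. cbeta_kernel p q y * bser b (of_real y * w))"
    proof (rule Bochner_Integration.integrable_bound)
      show "integrable I01 (\<lambda>y. beta_kernel (Re p) (Re q) y * B)" using p q by (intro integrable_mult_left integrable_beta_kernel)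
      have "(\<lambda>y. bser b (of_real y * w)) \<in> borel_measurable I01"
        by (rule measurable_I01_continuous) (rule continuous_on_subset[OF cont], auto)
      thus "(\<lambda>y. cbeta_kernel p q y * bser b (of_real y * w)) \<in> borel_measurable I01" by measurable
      show "AE y in I01. norm (cbeta_kernel p q y * bser b (of_real y * w)) \<le> norm (beta_kernel (Re p) (Re q) y * B)"
      proof (rule AE_I2)
        fix y assume "y \<in> space I01"
        hence y: "y \<in> {0<..<1}" by simp
        hence "norm (bser b (of_real y * w)) \<le> \<bar>B\<bar>" using B[of y] by fastforce
        thus "norm (cbeta_kernel p q y * bser b (of_real y * w)) \<le> norm (beta_kernel (Re p) (Re q) y * B)"
          by (simp add: norm_mult norm_cbeta_kernel[OF y] abs_mult mult_left_mono)
      qed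
    qed
  qed
  define S where "S = of_real pi / sin (of_real pi * z)"
  define P where "P = (u / 2) powr (2 * z)"
  have "(LINT y|I01. cbeta_kernel a q y * kfun z (of_real (sqrt y) * u)) =
    (LINT y|I01. S * (cbeta_kernel a q y * bser (1 - z) (of_real y * w)) - S * P * (cbeta_kernel (a + z) q y * bser (1 + z) (of_real y * w)))"
  proof (rule Bochner_Integration.integral_cong[OF refl])
    fix y assume "y \<in> space I01"
    hence y: "y \<in> {0<..<1}" "y > 0" by auto
    have ru: "Re (of_real (sqrt y) * u) > 0" using y u by simp
    have w': "(of_real (sqrt y) * u) ^ 2 / 4 = of_real y * w"
      using y by (simp add: power_mult_distrib w_def flip: of_real_power)
    have "(of_real (sqrt y) * u / 2) powr (2 * z) = (of_real (sqrt y) * (u / 2)) powr (2 * z)" by simp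
    also have "\<dots> = of_real (sqrt y) powr (2 * z) * P"
      unfolding P_def by (rule powr_times_real_left) (use y in auto)
    also have "of_real (sqrt y) powr (2 * z) = of_real y powr z" by (rule of_real_sqrt_powr[OF y(2)])
    finally have pw: "(of_real (sqrt y) * u / 2) powr (2 * z) = of_real y powr z * P" .
    have "of_real y powr (a - 1) * of_real y powr z = complex_of_real y powr (a + z - 1)"
      by (simp add: powr_add[symmetric] algebra_simps)
    hence ck: "cbeta_kernel a q y * of_real y powr z = cbeta_kernel (a + z) q y"
      by (simp add: cbeta_kernel_def mult_ac)
    have "cbeta_kernel a q y * kfun z (of_real (sqrt y) * u) = S * (cbeta_kernel a q y * bser (1 - z) (of_real y * w)) - S * P * ((cbeta_kernel a q y * of_real y powr z) * bser (1 + z) (of_real y * w))"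
      unfolding kfun_eq_kser[OF z ru] kser_def w' pw S_def[symmetric] by (simp add: algebra_simps)
    thus "cbeta_kernel a q y * kfun z (of_real (sqrt y) * u) = S * (cbeta_kernel a q y * bser (1 - z) (of_real y * w)) - S * P * (cbeta_kernel (a + z) q y * bser (1 + z) (of_real y * w))"
      unfolding ck .
  qed
  also have "\<dots> = (LINT y|I01. S * (cbeta_kernel a q y * bser (1 - z) (of_real y * w))) - (LINT y|I01. S * P * (cbeta_kernel (a + z) q y * bser (1 + z) (of_real y * w)))"
    using ser[OF a] ser[OF az] by (intro Bochner_Integration.integral_diff integrable_mult_right) blast+
  also have "\<dots> = S * (Gamma q * F12 a (1 - z) (a + q) w) - S * P * (Gamma q * F12 (a + z) (1 + z) (a + z + q) w)"
    using ser[OF a] ser[OF az] by (simp only: integral_mult_right_zero)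
  also have "\<dots> = Gamma q * Phi a z c u"
    unfolding Phi_def S_def[symmetric] P_def[symmetric] w_def[symmetric] by (simp add: q_def algebra_simps)
  finally show ?thesis using Gq by (simp add: q_def[symmetric] rGamma_inverse_Gamma)
qed


section \<open>Locally uniform decay and continuation across the integers\<close>

text \<open>A continuation \<open>\<Psi>\<close> in \<open>z\<close> of \<open>\<Phi>\<close> across the integers, with decay along the ray of \<open>x\<close> fast
  enough to be summable there.\<close>

definition Phi_family ::
  "complex \<Rightarrow> complex \<Rightarrow> nat \<Rightarrow> complex \<Rightarrow> complex set \<Rightarrow> (complex \<Rightarrow> real \<Rightarrow> complex) \<Rightarrow> bool" where
  "Phi_family x a j e U \<Psi> \<longleftrightarrow>
     (\<forall>r\<ge>1. (\<lambda>z. \<Psi> z r) holomorphic_on U) \<and>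
     (\<forall>z\<in>U. z \<notin> \<int> \<longrightarrow> (\<forall>r\<ge>1. \<Psi> z r = Phi a (z + of_nat j) (e - z) (of_real r * x))) \<and>
     (\<exists>C \<sigma>. \<sigma> > 1/2 \<and> C \<ge> 0 \<and> (\<forall>z\<in>U. \<forall>r\<ge>1. norm (\<Psi> z r) \<le> C * r powr (- 2 * \<sigma>)))"

text \<open>The shift \<open>j\<close> is carried along because the contiguous relations raise the
  index of \<open>Phi\<close> by one while its lower parameter e - z stays the same function of
  z.\<close>

definition Phi_local :: "complex \<Rightarrow> complex \<Rightarrow> nat \<Rightarrow> complex \<Rightarrow> complex \<Rightarrow> bool" where
  "Phi_local x a j e z0 \<longleftrightarrow> (\<exists>\<delta>>0. \<exists>\<Psi>. Phi_family x a j e (ball z0 \<delta>) \<Psi>)"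

lemma Phi_family_subset: "Phi_family x a j e U \<Psi> \<Longrightarrow> V \<subseteq> U \<Longrightarrow> Phi_family x a j e V \<Psi>"
  unfolding Phi_family_def by (meson holomorphic_on_subset subset_iff)

lemma bounded_near:
  fixes f :: "complex \<Rightarrow> complex"
  assumes "f holomorphic_on V" "cball z0 \<delta> \<subseteq> V"
  shows "\<exists>B\<ge>0. \<forall>z\<in>ball z0 \<delta>. norm (f z) \<le> B"
proof -
  have "compact (f ` cball z0 \<delta>)"
    by (intro compact_continuous_image) (use assms holomorphic_on_imp_continuous_on continuous_on_subset in blast, simp)
  from compact_imp_bounded[OF this] obtain B where B: "\<And>z. z \<in> cball z0 \<delta> \<Longrightarrow> norm (f z) \<le> B"
    unfolding bounded_iff by blast
  have "norm (f z) \<le> max B 0" if "z \<in> ball z0 \<delta>" for z using B[of z] that by simp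
  thus ?thesis by (intro exI[of _ "max B 0"]) simp
qed

text \<open>Contiguous relations pass from \<open>Phi\<close> to local families: coefficients
  holomorphic near z0 are bounded on a smaller disc, and the decay exponent becomes the smaller of
  the two.\<close>

lemma Phi_local_combine:
  assumes x: "Re x > 0" and L1: "Phi_local x a1 j1 e1 z0" and L2: "Phi_local x a2 j2 e2 z0"
    and V: "open V" "z0 \<in> V" and f: "f holomorphic_on V" and g: "g holomorphic_on V"
    and eq: "\<And>z u. z \<in> V \<Longrightarrow> z \<notin> \<int> \<Longrightarrow> Re u > 0 \<Longrightarrow>
        Phi a (z + of_nat j) (e - z) u = f z * Phi a1 (z + of_nat j1) (e1 - z) u + g z * Phi a2 (z + of_nat j2) (e2 - z) u"
  shows "Phi_local x a j e z0"
proof -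
  obtain \<delta>1 \<Psi>1 where 1: "\<delta>1 > 0" "Phi_family x a1 j1 e1 (ball z0 \<delta>1) \<Psi>1" using L1 unfolding Phi_local_def by blast
  obtain \<delta>2 \<Psi>2 where 2: "\<delta>2 > 0" "Phi_family x a2 j2 e2 (ball z0 \<delta>2) \<Psi>2" using L2 unfolding Phi_local_def by blast
  obtain \<delta>3 where 3: "\<delta>3 > 0" "cball z0 \<delta>3 \<subseteq> V" using V open_contains_cball by blast
  define \<delta> where "\<delta> = min \<delta>1 (min \<delta>2 \<delta>3)"
  define U where "U = ball z0 \<delta>"
  have \<delta>: "\<delta> > 0" "U \<subseteq> ball z0 \<delta>1" "U \<subseteq> ball z0 \<delta>2" "U \<subseteq> ball z0 \<delta>3" using 1 2 3 by (auto simp: \<delta>_def U_def)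
  have UV: "U \<subseteq> V" using \<delta>(4) 3 ball_subset_cball by blast
  have F1: "Phi_family x a1 j1 e1 U \<Psi>1" by (rule Phi_family_subset[OF 1(2) \<delta>(2)])
  have F2: "Phi_family x a2 j2 e2 U \<Psi>2" by (rule Phi_family_subset[OF 2(2) \<delta>(3)])
  obtain Bf where Bf0: "Bf \<ge> 0" "\<And>z. z \<in> ball z0 \<delta>3 \<Longrightarrow> norm (f z) \<le> Bf" using bounded_near[OF f 3(2)] by blast
  note Bf = Bf0(1) Bf0(2)[OF subsetD[OF \<delta>(4)]]
  obtain Bg where Bg0: "Bg \<ge> 0" "\<And>z. z \<in> ball z0 \<delta>3 \<Longrightarrow> norm (g z) \<le> Bg" using bounded_near[OF g 3(2)] by blast
  note Bg = Bg0(1) Bg0(2)[OF subsetD[OF \<delta>(4)]]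
  from F1 obtain C1 \<sigma>1 where C1: "\<sigma>1 > 1/2" "C1 \<ge> 0" "\<And>z r. z \<in> U \<Longrightarrow> r \<ge> 1 \<Longrightarrow> norm (\<Psi>1 z r) \<le> C1 * r powr (- 2 * \<sigma>1)"
    unfolding Phi_family_def by blast
  from F2 obtain C2 \<sigma>2 where C2: "\<sigma>2 > 1/2" "C2 \<ge> 0" "\<And>z r. z \<in> U \<Longrightarrow> r \<ge> 1 \<Longrightarrow> norm (\<Psi>2 z r) \<le> C2 * r powr (- 2 * \<sigma>2)"
    unfolding Phi_family_def by blast
  define \<sigma> where "\<sigma> = min \<sigma>1 \<sigma>2"
  define \<Psi> where "\<Psi> z r = f z * \<Psi>1 z r + g z * \<Psi>2 z r" for z r
  have "Phi_family x a j e U \<Psi>"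
    unfolding Phi_family_def
  proof (intro conjI allI impI ballI)
    show "(\<lambda>z. \<Psi> z r) holomorphic_on U" if "r \<ge> 1" for r
    proof -
      have "(\<lambda>z. \<Psi>1 z r) holomorphic_on U" "(\<lambda>z. \<Psi>2 z r) holomorphic_on U"
        using F1 F2 that unfolding Phi_family_def by blast+
      thus ?thesis unfolding \<Psi>_def using f g UV by (intro holomorphic_intros) (auto intro: holomorphic_on_subset)
    qed
    show "\<Psi> z r = Phi a (z + of_nat j) (e - z) (of_real r * x)" if z: "z \<in> U" "z \<notin> \<int>" and r: "r \<ge> 1" for z r
    proof -
      have "\<Psi>1 z r = Phi a1 (z + of_nat j1) (e1 - z) (of_real r * x)" "\<Psi>2 z r = Phi a2 (z + of_nat j2) (e2 - z) (of_real r * x)"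
        using F1 F2 z r unfolding Phi_family_def by blast+
      moreover have "Re (of_real r * x) > 0" using r x by simp
      ultimately show ?thesis unfolding \<Psi>_def using eq[of z "of_real r * x"] z UV by auto
    qed
    show "\<exists>C \<sigma>. \<sigma> > 1/2 \<and> C \<ge> 0 \<and> (\<forall>z\<in>U. \<forall>r\<ge>1. norm (\<Psi> z r) \<le> C * r powr (- 2 * \<sigma>))"
    proof (rule exI[of _ "Bf * C1 + Bg * C2"], rule exI[of _ \<sigma>], intro conjI ballI allI impI)
      show "\<sigma> > 1/2" using C1 C2 by (simp add: \<sigma>_def)
      show "Bf * C1 + Bg * C2 \<ge> 0" using C1 C2 Bf Bg by simp
      fix z r assume z: "z \<in> U" and r: "(r::real) \<ge> 1"
      have "norm (\<Psi>1 z r) \<le> C1 * r powr (- 2 * \<sigma>)"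
      proof (rule order_trans[OF C1(3)[OF z r]])
        have "r powr (- 2 * \<sigma>1) \<le> r powr (- 2 * \<sigma>)" using r by (intro powr_mono) (auto simp: \<sigma>_def)
        thus "C1 * r powr (- 2 * \<sigma>1) \<le> C1 * r powr (- 2 * \<sigma>)" using C1(2) by (rule mult_left_mono)
      qed
      hence t1: "norm (f z) * norm (\<Psi>1 z r) \<le> Bf * (C1 * r powr (- 2 * \<sigma>))"
        using Bf z by (intro mult_mono) auto
      have "norm (\<Psi>2 z r) \<le> C2 * r powr (- 2 * \<sigma>)"
      proof (rule order_trans[OF C2(3)[OF z r]])
        have "r powr (- 2 * \<sigma>2) \<le> r powr (- 2 * \<sigma>)" using r by (intro powr_mono) (auto simp: \<sigma>_def)
        thus "C2 * r powr (- 2 * \<sigma>2) \<le> C2 * r powr (- 2 * \<sigma>)" using C2(2) by (rule mult_left_mono)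
      qed
      hence t2: "norm (g z) * norm (\<Psi>2 z r) \<le> Bg * (C2 * r powr (- 2 * \<sigma>))"
        using Bg z by (intro mult_mono) auto
      have "norm (\<Psi> z r) \<le> norm (f z) * norm (\<Psi>1 z r) + norm (g z) * norm (\<Psi>2 z r)"
        unfolding \<Psi>_def by (metis norm_mult norm_triangle_ineq)
      also have "\<dots> \<le> (Bf * C1 + Bg * C2) * r powr (- 2 * \<sigma>)" using t1 t2 by (simp add: ring_distribs mult.assoc)
      finally show "norm (\<Psi> z r) \<le> (Bf * C1 + Bg * C2) * r powr (- 2 * \<sigma>)" .
    qed
  qed
  thus ?thesis unfolding Phi_local_def U_def using \<delta>(1) by blast
qed

lemma kfun_holomorphic_comp:
  assumes "f holomorphic_on U" "Re u > 0"
  shows "(\<lambda>z. kfun (f z) u) holomorphic_on U"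
  using holomorphic_on_compose_gen[OF assms(1) kfun_holomorphic[OF assms(2)]] by (simp add: o_def)

lemma measurable_kfun_sqrt:
  assumes "Re u > 0"
  shows "(\<lambda>y. kfun z (of_real (sqrt y) * u)) \<in> borel_measurable I01"
proof (rule measurable_I01_continuous)
  have "continuous_on right_half (kfun z)" by (rule holomorphic_on_imp_continuous_on[OF kfun_holomorphic_arg])
  thus "continuous_on {0<..<1} (\<lambda>y. kfun z (of_real (sqrt y) * u))"
    by (rule continuous_on_compose2) (use assms in \<open>auto intro!: continuous_intros simp: right_half_def\<close>)
qed

lemma beta_kernel_times_powr:
  "beta_kernel p q y * y powr s = beta_kernel (p + s) q y"
proof -
  have "y powr (p - 1) * y powr s = y powr (p + s - 1)" by (simp add: powr_add[symmetric] algebra_simps)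
  thus ?thesis by (simp add: beta_kernel_def mult_ac)
qed

lemma sqrt_powr: "y > 0 \<Longrightarrow> sqrt y powr (- 2 * s) = y powr (- s)"
  using powr_powr[of y "1/2" "- 2 * s"] by (simp add: powr_half_sqrt)

lemma Phi_local_base:
  assumes x: "Re x > 0" and a: "Re a > 1/2" and az: "Re (a + z0 + of_nat j) > 0" and e: "Re (e - z0) > Re a"
  shows "Phi_local x a j e z0"
proof -
  define m where "m = max (1/2) (- Re (z0 + of_nat j))"
  \<comment> \<open>Midway between \<open>m\<close> and Re a: above 1/2 for summability over n,
    above - Re (z0 + j) for \<open>kfun_bound\<close>, and below Re a so that y^(-\<sigma>) is
    integrable against the Beta kernel.\<close>
  define \<sigma> where "\<sigma> = (m + Re a) / 2"
  have mRa: "m < Re a" using a az by (simp add: m_def)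
  have mge: "m \<ge> 1/2" "m \<ge> - Re (z0 + of_nat j)" unfolding m_def by simp_all
  have \<sigma>: "\<sigma> > 1/2" "\<sigma> + Re (z0 + of_nat j) > 0" "\<sigma> < Re a"
  proof -
    have "m < \<sigma>" "\<sigma> < Re a" using mRa by (simp_all add: \<sigma>_def)
    thus "\<sigma> > 1/2" "\<sigma> + Re (z0 + of_nat j) > 0" "\<sigma> < Re a" using mge by linarith+
  qed
  have "\<sigma> > 0" using \<sigma> by simp
  then obtain C \<delta>1 where C: "\<delta>1 > 0" "C \<ge> 0"
    "\<And>z r. z \<in> ball (z0 + of_nat j) \<delta>1 \<Longrightarrow> r > 0 \<Longrightarrow> norm (kfun z (of_real r * x)) \<le> C * r powr (- 2 * \<sigma>)"
    using kfun_bound[OF x _ \<sigma>(2)] by metis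
  \<comment> \<open>Half of the slack in Re (e - z0) > Re a, a lower bound for the second Beta
    exponent on the whole disc.\<close>
  define \<eta> where "\<eta> = (Re (e - z0) - Re a) / 2"
  have \<eta>: "\<eta> > 0" using e by (simp add: \<eta>_def)
  define \<delta> where "\<delta> = min \<delta>1 (min \<eta> (Re (a + z0 + of_nat j)))"
  have \<delta>: "\<delta> > 0" "\<delta> \<le> \<delta>1" "\<delta> \<le> \<eta>" "\<delta> \<le> Re (a + z0 + of_nat j)" using C(1) \<eta> az by (simp_all add: \<delta>_def)
  define U where "U = ball z0 \<delta>"
  have near: "\<bar>Re z - Re z0\<bar> < \<delta>" if "z \<in> U" for z
    using that abs_Re_le_cmod[of "z0 - z"] by (auto simp: dist_norm abs_minus_commute U_def)
  have Ue: "Re (e - z - a) > \<eta>" "Re (a + (z + of_nat j)) > 0" "z + of_nat j \<in> ball (z0 + of_nat j) \<delta>1" if "z \<in> U" for z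
  proof -
    show "Re (e - z - a) > \<eta>" "Re (a + (z + of_nat j)) > 0" using near[OF that] \<delta>(3,4) unfolding \<eta>_def by (auto simp: abs_if split: if_splits)
    show "z + of_nat j \<in> ball (z0 + of_nat j) \<delta>1" using that \<delta>(2) by (auto simp: U_def dist_norm)
  qed
  define I where "I z r = (LINT y|I01. cbeta_kernel a (e - z - a) y * kfun (z + of_nat j) (of_real (sqrt y) * (of_real r * x)))" for z r
  define G where "G r y = C * r powr (- 2 * \<sigma>) * beta_kernel (Re a - \<sigma>) \<eta> y" for r y
  have Gi: "integrable I01 (G r)" for r
    unfolding G_def using \<sigma> \<eta> by (intro integrable_mult_right integrable_beta_kernel) auto
  have bd: "norm (cbeta_kernel a (e - z - a) y * kfun (z + of_nat j) (of_real (sqrt y) * (of_real r * x))) \<le> G r y"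
    if z: "z \<in> U" and y: "y \<in> {0<..<1}" and r: "r > 0" for z y r
  proof -
    have eq: "complex_of_real (sqrt y) * (of_real r * x) = of_real (sqrt y * r) * x" by simp
    have "norm (kfun (z + of_nat j) (of_real (sqrt y * r) * x)) \<le> C * (sqrt y * r) powr (- 2 * \<sigma>)"
      using y r by (intro C(3)[OF Ue(3)[OF z]]) simp
    also have "(sqrt y * r) powr (- 2 * \<sigma>) = y powr (- \<sigma>) * r powr (- 2 * \<sigma>)"
      using y r sqrt_powr[of y \<sigma>] by (simp add: powr_mult)
    finally have k: "norm (kfun (z + of_nat j) (of_real (sqrt y * r) * x)) \<le> C * (y powr (- \<sigma>) * r powr (- 2 * \<sigma>))" .
    have "beta_kernel (Re a) (Re (e - z - a)) y \<le> beta_kernel (Re a) \<eta> y"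
      using Ue(1)[OF z] by (intro beta_kernel_mono[OF y]) auto
    hence "beta_kernel (Re a) (Re (e - z - a)) y * norm (kfun (z + of_nat j) (of_real (sqrt y * r) * x))
       \<le> beta_kernel (Re a) \<eta> y * (C * (y powr (- \<sigma>) * r powr (- 2 * \<sigma>)))"
      using k by (intro mult_mono) auto
    also have "\<dots> = C * r powr (- 2 * \<sigma>) * (beta_kernel (Re a) \<eta> y * y powr (- \<sigma>))" by (simp only: mult_ac)
    also have "beta_kernel (Re a) \<eta> y * y powr (- \<sigma>) = beta_kernel (Re a - \<sigma>) \<eta> y"
      using beta_kernel_times_powr[of "Re a" \<eta> y "- \<sigma>"] by simp
    finally show ?thesis unfolding eq norm_mult norm_cbeta_kernel[OF y] G_def .
  qed
  have Rr: "Re (of_real r * x) > 0" if "r \<ge> 1" for r using that x by simp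
  have ms: "(\<lambda>y. cbeta_kernel a (e - z - a) y * kfun (z + of_nat j) (of_real (sqrt y) * (of_real r * x))) \<in> borel_measurable I01"
    if "r \<ge> 1" for z r using measurable_kfun_sqrt[OF Rr[OF that]] by measurable
  have Ihol: "(\<lambda>z. I z r) holomorphic_on U" if r: "r \<ge> 1" for r
    unfolding I_def
  proof (rule LINT_holomorphic_on)
    show "open U" by (simp add: U_def)
    show "(\<lambda>z. cbeta_kernel a (e - z - a) y * kfun (z + of_nat j) (of_real (sqrt y) * (of_real r * x))) holomorphic_on U"
      if y: "y \<in> space I01" for y
      using y r x by (intro holomorphic_intros cbeta_kernel_holomorphic kfun_holomorphic_comp) auto
    show "\<exists>\<rho>>0. \<exists>g. integrable I01 g \<and> (\<forall>w\<in>ball z \<rho> \<inter> U. \<forall>y\<in>space I01.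
        norm (cbeta_kernel a (e - w - a) y * kfun (w + of_nat j) (of_real (sqrt y) * (of_real r * x))) \<le> g y)" for z
      using bd r Gi[of r] by (intro exI[of _ 1] exI[of _ "G r"] conjI) auto
  qed (rule ms[OF r])
  have Ibd: "norm (I z r) \<le> C * Beta (Re a - \<sigma>) \<eta> * r powr (- 2 * \<sigma>)" if z: "z \<in> U" and r: "r \<ge> 1" for z r
  proof -
    have r0: "r > 0" using r by simp
    have ii: "integrable I01 (\<lambda>y. cbeta_kernel a (e - z - a) y * kfun (z + of_nat j) (of_real (sqrt y) * (of_real r * x)))"
      by (rule Bochner_Integration.integrable_bound[OF Gi[of r] ms[OF r]], rule AE_I2, rule order_trans[OF bd[OF z _ r0]]) auto
    have "norm (I z r) \<le> (LINT y|I01. G r y)"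
      unfolding I_def by (rule order_trans[OF integral_norm_bound integral_mono[OF integrable_norm[OF ii] Gi]]) (rule bd[OF z _ r0], simp)
    also have "\<dots> = C * r powr (- 2 * \<sigma>) * Beta (Re a - \<sigma>) \<eta>"
      unfolding G_def using \<sigma> \<eta> by (simp add: LINT_beta_kernel)
    finally show ?thesis by (simp only: mult_ac)
  qed
  have rG: "(\<lambda>z. rGamma (e - z - a)) holomorphic_on UNIV" by (intro holomorphic_intros)
  obtain B where B: "B \<ge> 0" "\<And>z. z \<in> ball z0 \<delta> \<Longrightarrow> norm (rGamma (e - z - a)) \<le> B" using bounded_near[OF rG, of z0 \<delta>] by auto
  have "Phi_family x a j e U (\<lambda>z r. rGamma (e - z - a) * I z r)"
    unfolding Phi_family_def
  proof (intro conjI allI impI ballI)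
    show "(\<lambda>z. rGamma (e - z - a) * I z r) holomorphic_on U" if "r \<ge> 1" for r
      using Ihol[OF that] by (intro holomorphic_intros) auto
    show "rGamma (e - z - a) * I z r = Phi a (z + of_nat j) (e - z) (of_real r * x)" if z: "z \<in> U" "z \<notin> \<int>" and r: "r \<ge> 1" for z r
    proof -
      have "z + of_nat j \<notin> \<int>" using z(2) by (metis Ints_diff Ints_of_nat add_diff_cancel_right')
      moreover have "Re (e - z) > Re a" using Ue(1)[OF z(1)] \<eta> by simp
      ultimately show ?thesis
        unfolding I_def using a Ue(2)[OF z(1)] Rr[OF r] by (subst Phi_integral) auto
    qed
    show "\<exists>C \<sigma>. \<sigma> > 1/2 \<and> C \<ge> 0 \<and> (\<forall>z\<in>U. \<forall>r\<ge>1. norm (rGamma (e - z - a) * I z r) \<le> C * r powr (- 2 * \<sigma>))"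
    proof (rule exI[of _ "B * (C * Beta (Re a - \<sigma>) \<eta>)"], rule exI[of _ \<sigma>], intro conjI ballI allI impI)
      show "B * (C * Beta (Re a - \<sigma>) \<eta>) \<ge> 0" using B C \<sigma> \<eta> by (intro mult_nonneg_nonneg) (auto simp: Beta_def)
      fix z r assume z: "z \<in> U" and r: "(r::real) \<ge> 1"
      show "norm (rGamma (e - z - a) * I z r) \<le> B * (C * Beta (Re a - \<sigma>) \<eta>) * r powr (- 2 * \<sigma>)"
        unfolding norm_mult mult.assoc[of B] using B z Ibd[OF z r] by (intro mult_mono) (auto simp: U_def)
    qed (rule \<sigma>)
  qed
  thus ?thesis unfolding Phi_local_def U_def using \<delta>(1) by blast
qed

lemma open_shifted_compl_nonpos_Ints:
  "open {z. a + z + of_nat j \<notin> (\<int>\<^sub>\<le>\<^sub>0 :: complex set)}"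
proof -
  have "open ((\<lambda>z. a + z + of_nat j) -` (- \<int>\<^sub>\<le>\<^sub>0))"
    by (intro open_vimage open_compl_nonpos_Ints continuous_intros)
  thus ?thesis by (simp add: vimage_def Compl_eq)
qed

lemma Phi_local_step_c:
  assumes "Re x > 0" "Re a > 0" "a + z0 + of_nat j \<notin> \<int>\<^sub>\<le>\<^sub>0"
    and "Phi_local x a j (e + 1) z0" "Phi_local x a (Suc j) (e + 1) z0"
  shows "Phi_local x a j e z0"
proof (rule Phi_local_combine[OF assms(1,4,5) open_shifted_compl_nonpos_Ints, of a j "\<lambda>z. e + of_nat j" "\<lambda>z. -1"])
  fix z u assume z: "z \<in> {z. a + z + of_nat j \<notin> \<int>\<^sub>\<le>\<^sub>0}" and u: "Re u > 0"
  have "a \<notin> \<int>\<^sub>\<le>\<^sub>0" "a + (z + of_nat j) \<notin> \<int>\<^sub>\<le>\<^sub>0"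
    using Re_pos_not_nonpos_Int[OF assms(2)] z by (simp_all add: add.assoc)
  from Phi_contiguous_c[OF this u, of "e + 1 - z"]
  show "Phi a (z + of_nat j) (e - z) u = (e + of_nat j) * Phi a (z + of_nat j) (e + 1 - z) u + -1 * Phi a (z + of_nat (Suc j)) (e + 1 - z) u"
    by (simp add: algebra_simps)
qed (use assms in auto)

lemma Phi_local_step_a:
  assumes "Re x > 0" "Re a > 0" "a + z0 + of_nat j \<notin> \<int>\<^sub>\<le>\<^sub>0"
    and "Phi_local x (a + 1) j e z0" "Phi_local x a (Suc j) e z0"
  shows "Phi_local x a j e z0"
proof (rule Phi_local_combine[OF assms(1,4,5) open_shifted_compl_nonpos_Ints, of a j "\<lambda>z. 1 / (a + z + of_nat j)" "\<lambda>z. 1 / (a + z + of_nat j)"])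
  fix z u assume z: "z \<in> {z. a + z + of_nat j \<notin> \<int>\<^sub>\<le>\<^sub>0}" and u: "Re u > 0"
  have h: "a \<notin> \<int>\<^sub>\<le>\<^sub>0" "a + (z + of_nat j) \<notin> \<int>\<^sub>\<le>\<^sub>0" "a + (z + of_nat j) \<noteq> 0"
    using Re_pos_not_nonpos_Int[OF assms(2)] z by (auto simp: add.assoc)
  have "(a + (z + of_nat j)) * Phi a (z + of_nat j) (e - z) u = Phi (a + 1) (z + of_nat j) (e - z) u + Phi a (z + of_nat (Suc j)) (e - z) u"
    using Phi_contiguous_a[OF h(1,2) u, of "e - z"] by (simp add: add_ac)
  hence "Phi a (z + of_nat j) (e - z) u = (Phi (a + 1) (z + of_nat j) (e - z) u + Phi a (z + of_nat (Suc j)) (e - z) u) / (a + (z + of_nat j))"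
    using h(3) by (simp add: eq_divide_eq mult.commute)
  thus "Phi a (z + of_nat j) (e - z) u = 1 / (a + z + of_nat j) * Phi (a + 1) (z + of_nat j) (e - z) u + 1 / (a + z + of_nat j) * Phi a (z + of_nat (Suc j)) (e - z) u"
    by (simp add: add_divide_distrib add.assoc)
qed (use assms in \<open>auto intro!: holomorphic_intros\<close>)

text \<open>Two nested descents to the range of the Beta average: \<open>m\<close> counts raisings
  of \<open>e\<close> until Re (e - z0) exceeds Re a, and \<open>k\<close> counts raisings of
  \<open>a\<close> or \<open>j\<close> until Re (a + z0 + j) > 0. The first is proved for all
  \<open>a\<close> and \<open>j\<close>, since the second alters them and with them the required
  \<open>m\<close>.\<close>

lemma Phi_local_exists:
  assumes x: "Re x > 0" and a: "Re a > 1/2" and az: "a + z0 + of_nat j \<notin> \<int>\<^sub>\<le>\<^sub>0"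
  shows "Phi_local x a j e z0"
proof -
  have 1: "Phi_local x a j e z0" if "Re a > 1/2" "Re (a + z0 + of_nat j) > 0" "Re (e - z0) + real m > Re a" for a j e m
    using that
  proof (induction m arbitrary: j e)
    case 0
    thus ?case using Phi_local_base[OF x] by simp
  next
    case (Suc m)
    have L: "Phi_local x a j (e + 1) z0" "Phi_local x a (Suc j) (e + 1) z0"
      by (rule Suc.IH; use Suc.prems in simp)+
    have np: "a + z0 + of_nat j \<notin> \<int>\<^sub>\<le>\<^sub>0" by (rule Re_pos_not_nonpos_Int) (use Suc.prems in simp)
    have "Re a > 0" using Suc.prems(1) by simp
    from Phi_local_step_c[OF x this np L] show ?case .
  qed
  have 2: "Phi_local x a j e z0" if "Re a > 1/2" "Re (a + z0 + of_nat j) + real k > 0" "a + z0 + of_nat j \<notin> \<int>\<^sub>\<le>\<^sub>0" for a j e k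
    using that
  proof (induction k arbitrary: a j)
    case 0
    obtain m where "real m > Re a - Re (e - z0)" using reals_Archimedean2 by blast
    thus ?case using 1[of a j e m] 0 by simp
  next
    case (Suc k)
    have e: "a + 1 + z0 + of_nat j = a + z0 + of_nat j + 1" "a + z0 + of_nat (Suc j) = a + z0 + of_nat j + 1" by simp_all
    have np: "a + 1 + z0 + of_nat j \<notin> \<int>\<^sub>\<le>\<^sub>0" "a + z0 + of_nat (Suc j) \<notin> \<int>\<^sub>\<le>\<^sub>0"
      unfolding e by (rule nonpos_Ints_plus_one[OF Suc.prems(3)])+
    have L1: "Phi_local x (a + 1) j e z0" by (rule Suc.IH[OF _ _ np(1)]) (use Suc.prems(1,2) in simp_all)
    have L2: "Phi_local x a (Suc j) e z0" by (rule Suc.IH[OF _ _ np(2)]) (use Suc.prems(1,2) in simp_all)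
    have "Re a > 0" using Suc.prems(1) by simp
    from Phi_local_step_a[OF x this Suc.prems(3) L1 L2] show ?case .
  qed
  obtain k where "real k > - Re (a + z0 + of_nat j)" using reals_Archimedean2 by blast
  thus ?thesis using 2[OF a _ az, of k] by simp
qed

section \<open>Return to the generalized Bessel function as defined\<close>

lemma F12_eq_hyp1F2:
  assumes "a \<notin> \<int>\<^sub>\<le>\<^sub>0" "b \<notin> \<int>\<^sub>\<le>\<^sub>0" "c \<notin> \<int>\<^sub>\<le>\<^sub>0"
  shows "F12 a b c w = Gamma a / (Gamma b * Gamma c) * hyp1F2 a b c w"
proof -
  have G: "Gamma a \<noteq> 0" "Gamma b \<noteq> 0" "Gamma c \<noteq> 0" using assms by (simp_all add: Gamma_eq_zero_iff)
  have e: "F12_coeff a b c n * w ^ n = Gamma a / (Gamma b * Gamma c) * (pochhammer a n / (pochhammer b n * pochhammer c n) * (w ^ n / fact n))" for n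
    unfolding F12_coeff_def pochhammer_Gamma[OF assms(1)] pochhammer_Gamma[OF assms(2)] pochhammer_Gamma[OF assms(3)] rGamma_inverse_Gamma
  proof -
    have "X * inverse Y * inverse Z / F * W = A / (B * C) * (X / A / (Y / B * (Z / C)) * (W / F))"
      if "A \<noteq> 0" "B \<noteq> 0" "C \<noteq> 0" for A B C X Y Z F W :: complex
      using that by (cases "Y = 0 \<or> Z = 0 \<or> F = 0") (auto simp: divide_simps)
    from this[OF G] show "Gamma (a + of_nat n) * inverse (Gamma (b + of_nat n)) * inverse (Gamma (c + of_nat n)) / fact n * w ^ n =
      Gamma a / (Gamma b * Gamma c) * (Gamma (a + of_nat n) / Gamma a / (Gamma (b + of_nat n) / Gamma b * (Gamma (c + of_nat n) / Gamma c)) * (w ^ n / fact n))" .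
  qed
  \<comment> \<open>\<open>hyp1F2\<close> is a bare infinite sum; its convergence, under which a
    factor may be pulled out, is inherited from \<open>F12\<close>.\<close>
  have s: "summable (\<lambda>n. Gamma a / (Gamma b * Gamma c) * (pochhammer a n / (pochhammer b n * pochhammer c n) * (w ^ n / fact n)))"
    using F12_summable[OF assms(1), of b c w] unfolding e .
  have nz: "Gamma a / (Gamma b * Gamma c) \<noteq> 0" using G by simp
  show ?thesis unfolding F12_def hyp1F2_def e
    by (rule suminf_mult[OF summable_mult_D[OF s nz]])
qed

lemma gen_bessel_K_formula_eq:
  assumes x: "Re x > 0" and z: "z \<notin> \<int>" "1/2 + l - z \<notin> \<int>\<^sub>\<le>\<^sub>0" and l: "1/2 + l \<notin> \<int>\<^sub>\<le>\<^sub>0"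
    and a: "1/2 + l + \<mu> \<notin> \<int>\<^sub>\<le>\<^sub>0" "1/2 + l + \<mu> + z \<notin> \<int>\<^sub>\<le>\<^sub>0"
  shows "gen_bessel_K_formula \<mu> z x l = x powr l * 2 powr (\<mu> + z - 1) * (x / 2) powr (- z) * Phi (1/2 + l + \<mu>) z (1/2 + l - z) x"
proof -
  have zi: "1 - z \<notin> \<int>\<^sub>\<le>\<^sub>0" "1 + z \<notin> \<int>\<^sub>\<le>\<^sub>0"
  proof -
    have "1 - z \<notin> \<int>" "1 + z \<notin> \<int>" using z(1) by (metis Ints_1 Ints_diff diff_diff_eq2 add_diff_cancel_left') (metis Ints_1 Ints_diff z(1) add_diff_cancel_left')
    thus "1 - z \<notin> \<int>\<^sub>\<le>\<^sub>0" "1 + z \<notin> \<int>\<^sub>\<le>\<^sub>0" using nonpos_Ints_Int by blast+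
  qed
  have e: "\<mu> + l + 1/2 = 1/2 + l + \<mu>" "l + 1/2 - z = 1/2 + l - z" "l + 1/2 = 1/2 + l" "\<mu> + z + l + 1/2 = 1/2 + l + \<mu> + z" "z * of_real pi = of_real pi * z"
    by simp_all
  \<comment> \<open>\<open>F12\<close> and \<open>hyp1F2\<close> list the two lower parameters in
    opposite order; the coefficients are symmetric in them.\<close>
  have F1: "F12 (1/2 + l + \<mu>) (1 - z) (1/2 + l - z) (x ^ 2 / 4) = Gamma (1/2 + l + \<mu>) / (Gamma (1 - z) * Gamma (1/2 + l - z)) * hyp1F2 (1/2 + l + \<mu>) (1/2 + l - z) (1 - z) (x ^ 2 / 4)"
    unfolding F12_eq_hyp1F2[OF a(1) zi(1) z(2)] by (simp add: hyp1F2_def mult_ac)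
  have F2: "F12 (1/2 + l + \<mu> + z) (1 + z) (1/2 + l - z + z) (x ^ 2 / 4) = Gamma (1/2 + l + \<mu> + z) / (Gamma (1 + z) * Gamma (1/2 + l)) * hyp1F2 (1/2 + l + \<mu> + z) (1/2 + l) (1 + z) (x ^ 2 / 4)"
  proof -
    have e': "1/2 + l - z + z = 1/2 + l" by simp
    show ?thesis unfolding e' F12_eq_hyp1F2[OF a(2) zi(2) l] by (simp add: hyp1F2_def mult_ac)
  qed
  have p: "(x / 2) powr z = (x / 2) powr (- z) * (x / 2) powr (2 * z)" by (simp add: powr_add[symmetric])
  define P where "P = of_real pi / sin (of_real pi * z)"
  have "C / S * (A - B) = C / S * A - C / S * B" for A B C S :: complex by (simp add: ring_distribs)
  show ?thesis
    unfolding gen_bessel_K_formula_def Phi_def F1 F2 e p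
    by (simp add: algebra_simps diff_divide_distrib)
qed


lemma eventually_avoids_Ints:
  fixes z :: complex
  shows "eventually (\<lambda>w. w \<notin> \<int>) (at z)"
proof -
  have "\<exists>\<epsilon>>0. \<forall>w\<in>ball z \<epsilon>. w \<in> \<int> \<longrightarrow> w = z"
  proof (cases "z \<in> \<int>")
    case True
    then obtain m where m: "z = of_int m" by (auto elim: Ints_cases)
    have "w = z" if w: "w \<in> ball z 1" "w \<in> \<int>" for w
    proof -
      obtain n where n: "w = of_int n" using w(2) by (auto elim: Ints_cases)
      have "norm (of_int (m - n) :: complex) < 1" using w(1) by (simp add: m n dist_norm)
      hence "\<bar>m - n\<bar> < 1" by (simp only: norm_of_int of_int_abs[symmetric] of_int_less_1_iff)
      hence "m = n" by linarith
      thus ?thesis by (simp add: m n)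
    qed
    thus ?thesis by (intro exI[of _ 1]) auto
  next
    case False
    have "open (UNIV - \<int> :: complex set)" by (rule open_diff_Ints[OF open_UNIV])
    moreover have "z \<in> UNIV - \<int>" using False by simp
    ultimately obtain \<epsilon> where "\<epsilon> > 0" "ball z \<epsilon> \<subseteq> UNIV - \<int>" by (rule openE)
    thus ?thesis by (intro exI[of _ \<epsilon>]) auto
  qed
  then obtain \<epsilon> where \<epsilon>: "\<epsilon> > 0" "\<forall>w\<in>ball z \<epsilon>. w \<in> \<int> \<longrightarrow> w = z" by blast
  show ?thesis unfolding eventually_at
    using \<epsilon> by (intro exI[of _ \<epsilon>]) (auto simp: dist_commute)
qed

lemma eventually_shift_avoids_nonpos_Ints:
  fixes z c :: complex
  shows "eventually (\<lambda>w. c - w \<notin> \<int>\<^sub>\<le>\<^sub>0) (at z)"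
proof -
  have "eventually (\<lambda>v. v \<notin> \<int>) (at (c - z))" by (rule eventually_avoids_Ints)
  moreover have "filterlim (\<lambda>w. c - w) (at (c - z)) (at z)"
    by (intro filterlim_atI tendsto_intros) (auto simp: eventually_at_filter)
  ultimately have "eventually (\<lambda>w. c - w \<notin> \<int>) (at z)" by (rule eventually_compose_filterlim)
  thus ?thesis by eventually_elim (use nonpos_Ints_Int in blast)
qed

text \<open>On a punctured neighbourhood of \<open>z\<close> the explicit formula applies and equals
  a function continuous at \<open>z\<close>, so the limit in the definition and the literal value
  lead to the same expression.\<close>

lemma gen_bessel_K_eq:
  assumes x: "Re x > 0" and a: "Re (1/2 + l + \<mu>) > 1/2" and l: "1/2 + l \<notin> \<int>\<^sub>\<le>\<^sub>0"
    and U: "open U" "z \<in> U" "\<And>w. w \<in> U \<Longrightarrow> 1/2 + l + \<mu> + w \<notin> \<int>\<^sub>\<le>\<^sub>0"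
    and \<Psi>: "\<Psi> holomorphic_on U" "\<And>w. w \<in> U \<Longrightarrow> w \<notin> \<int> \<Longrightarrow> \<Psi> w = Phi (1/2 + l + \<mu>) w (1/2 + l - w) x"
  shows "gen_bessel_K \<mu> z x l = x powr l * 2 powr (\<mu> + z - 1) * (x / 2) powr (- z) * \<Psi> z"
proof -
  define g where "g w = x powr l * 2 powr (\<mu> + w - 1) * (x / 2) powr (- w) * \<Psi> w" for w
  have a0: "1/2 + l + \<mu> \<notin> \<int>\<^sub>\<le>\<^sub>0" using a by (intro Re_pos_not_nonpos_Int) simp
  have f: "gen_bessel_K_formula \<mu> w x l = g w" if "w \<in> U" "w \<notin> \<int>" "1/2 + l - w \<notin> \<int>\<^sub>\<le>\<^sub>0" for w
    unfolding g_def \<Psi>(2)[OF that(1,2)] by (rule gen_bessel_K_formula_eq[OF x that(2,3) l a0 U(3)[OF that(1)]])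
  have "g holomorphic_on U" unfolding g_def [abs_def] using right_half_nonpos[OF x] by (intro holomorphic_intros \<Psi>) auto
  hence "isCont g z" using U holomorphic_on_imp_continuous_on continuous_on_eq_continuous_at by blast
  hence lim: "(g \<longlongrightarrow> g z) (at z)" by (simp add: isCont_def)
  have "eventually (\<lambda>w. w \<in> U) (at z)" using U(1,2) by (intro eventually_at_in_open')
  hence "eventually (\<lambda>w. g w = gen_bessel_K_formula \<mu> w x l) (at z)"
    using eventually_avoids_Ints[of z] eventually_shift_avoids_nonpos_Ints[of "1/2 + l" z]
    by eventually_elim (use f in auto)
  hence "((\<lambda>w. gen_bessel_K_formula \<mu> w x l) \<longlongrightarrow> g z) (at z)"
    using lim by (rule Lim_transform_eventually[rotated])
  hence L: "Lim (at z) (\<lambda>w. gen_bessel_K_formula \<mu> w x l) = g z" by (intro tendsto_Lim) auto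
  have e: "l + 1/2 - z = 1/2 + l - z" by simp
  have "gen_bessel_K \<mu> z x l = g z"
    unfolding gen_bessel_K_def L e using f[OF U(2)] by auto
  thus ?thesis by (simp add: g_def)
qed

section \<open>The terms and the sum of the series on the left\<close>

definition K_term :: "complex \<Rightarrow> complex \<Rightarrow> complex \<Rightarrow> complex \<Rightarrow> nat \<Rightarrow> complex" where
  "K_term \<mu> l x z n = (of_nat n * x / 2) powr (z - l) * gen_bessel_K \<mu> z (of_nat n * x) l"

lemma K_term_eq:
  assumes x: "Re x > 0" and a: "Re (1/2 + l + \<mu>) > 1/2" and l: "1/2 + l \<notin> \<int>\<^sub>\<le>\<^sub>0"
    and U: "open U" "z \<in> U" "\<And>w. w \<in> U \<Longrightarrow> 1/2 + l + \<mu> + w \<notin> \<int>\<^sub>\<le>\<^sub>0"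
    and \<Psi>: "Phi_family x (1/2 + l + \<mu>) 0 (1/2 + l) U \<Psi>"
  shows "K_term \<mu> l x z (Suc n) = 2 powr (\<mu> + l + z - 1) * \<Psi> z (real (Suc n))"
proof -
  define X where "X = of_nat (Suc n) * x"
  have X: "Re X > 0" using x by (simp add: X_def del: of_nat_Suc)
  have r: "real (Suc n) \<ge> 1" by simp
  have Xr: "complex_of_real (real (Suc n)) * x = X" by (simp add: X_def)
  have g1: "gen_bessel_K \<mu> z X l = X powr l * 2 powr (\<mu> + z - 1) * (X / 2) powr (- z) * \<Psi> z (real (Suc n))"
  proof (rule gen_bessel_K_eq[OF X a l U])
    show "(\<lambda>w. \<Psi> w (real (Suc n))) holomorphic_on U" using \<Psi> r unfolding Phi_family_def by blast
    show "\<Psi> w (real (Suc n)) = Phi (1/2 + l + \<mu>) w (1/2 + l - w) X" if "w \<in> U" "w \<notin> \<int>" for w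
    proof -
      have "\<Psi> w (real (Suc n)) = Phi (1/2 + l + \<mu>) (w + of_nat 0) (1/2 + l - w) (of_real (real (Suc n)) * x)"
        using \<Psi> that r unfolding Phi_family_def by blast
      thus ?thesis unfolding Xr by simp
    qed
  qed
  \<comment> \<open>Rewriting X^\<lambda> in the variable X / 2 lets all powers of X cancel; only a
    power of 2 survives.\<close>
  have g2: "X powr l = 2 powr l * (X / 2) powr l"
    using powr_times_real_left[of 2 "X / 2" l] by simp
  have g3: "(X / 2) powr (z - l) * ((X / 2) powr l * (X / 2) powr (- z)) = 1"
  proof -
    have "(X / 2) powr (z - l) * ((X / 2) powr l * (X / 2) powr (- z)) = (X / 2) powr (z - l + (l + - z))"
      by (simp only: powr_add)
    thus ?thesis using X by auto
  qed
  have g4: "(2::complex) powr l * 2 powr (\<mu> + z - 1) = 2 powr (\<mu> + l + z - 1)"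
    by (simp add: powr_add[symmetric] algebra_simps)
  have gen: "A * ((T * L) * P * N * Q) = (A * (L * N)) * ((T * P) * Q)" for A T L P N Q :: complex
    by (simp only: mult_ac)
  have "(X / 2) powr (z - l) * gen_bessel_K \<mu> z X l = 2 powr (\<mu> + l + z - 1) * \<Psi> z (real (Suc n))"
    unfolding g1 g2 gen g3 g4 by (rule mult_1)
  thus ?thesis unfolding K_term_def X_def .
qed

text \<open>One disc and one majorant for all n, from which convergence, the formula off the
  integers and holomorphy of the sum are drawn in turn.\<close>

lemma K_term_local:
  assumes x: "Re x > 0" and a: "Re (1/2 + l + \<mu>) > 1/2" and l: "1/2 + l \<notin> \<int>\<^sub>\<le>\<^sub>0"
    and z0: "1/2 + l + \<mu> + z0 \<notin> \<int>\<^sub>\<le>\<^sub>0"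
  shows "\<exists>\<delta>>0. \<exists>g. summable g \<and> (\<forall>n. (\<lambda>z. K_term \<mu> l x z (Suc n)) holomorphic_on ball z0 \<delta>) \<and>
     (\<forall>z\<in>ball z0 \<delta>. \<forall>n. norm (K_term \<mu> l x z (Suc n)) \<le> g n) \<and>
     (\<forall>z\<in>ball z0 \<delta>. z \<notin> \<int> \<longrightarrow> (\<forall>n. K_term \<mu> l x z (Suc n) = 2 powr (\<mu> + l + z - 1) * Phi (1/2 + l + \<mu>) z (1/2 + l - z) (of_nat (Suc n) * x)))"
proof -
  define a where "a = 1/2 + l + \<mu>"
  have "a + z0 + of_nat 0 \<notin> \<int>\<^sub>\<le>\<^sub>0" using z0 by (simp add: a_def)
  from Phi_local_exists[OF x _ this, of "1/2 + l"] a
  obtain \<delta>1 \<Psi> where 1: "\<delta>1 > 0" "Phi_family x a 0 (1/2 + l) (ball z0 \<delta>1) \<Psi>"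
    unfolding Phi_local_def a_def by auto
  have "open {z. a + z + of_nat 0 \<notin> \<int>\<^sub>\<le>\<^sub>0}" by (rule open_shifted_compl_nonpos_Ints)
  then obtain \<delta>2 where 2: "\<delta>2 > 0" "ball z0 \<delta>2 \<subseteq> {z. a + z + of_nat 0 \<notin> \<int>\<^sub>\<le>\<^sub>0}"
    using z0 open_contains_ball by (metis (mono_tags, lifting) a_def add_0_right mem_Collect_eq of_nat_0)
  define \<delta> where "\<delta> = min (min \<delta>1 \<delta>2) 1"
  have \<delta>: "\<delta> > 0" "ball z0 \<delta> \<subseteq> ball z0 \<delta>1" "ball z0 \<delta> \<subseteq> ball z0 \<delta>2" using 1 2 by (auto simp: \<delta>_def)
  have F: "Phi_family x a 0 (1/2 + l) (ball z0 \<delta>) \<Psi>" by (rule Phi_family_subset[OF 1(2) \<delta>(2)])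
  have K: "K_term \<mu> l x z (Suc n) = 2 powr (\<mu> + l + z - 1) * \<Psi> z (real (Suc n))" if "z \<in> ball z0 \<delta>" for z n
  proof (rule K_term_eq[OF x assms(2) l open_ball that _ F[unfolded a_def]])
    fix w assume "w \<in> ball z0 \<delta>"
    thus "1/2 + l + \<mu> + w \<notin> \<int>\<^sub>\<le>\<^sub>0" using \<delta>(3) 2(2) by (auto simp: a_def)
  qed
  have "(\<lambda>z. 2 powr (\<mu> + l + z - 1)) holomorphic_on UNIV" by (intro holomorphic_intros)
  from bounded_near[OF this, of z0 \<delta>] obtain B where
    B: "B \<ge> 0" "\<And>z. z \<in> ball z0 \<delta> \<Longrightarrow> norm ((2::complex) powr (\<mu> + l + z - 1)) \<le> B" by auto
  from F obtain C \<sigma> where C: "\<sigma> > 1/2" "C \<ge> 0" "\<And>z r. z \<in> ball z0 \<delta> \<Longrightarrow> r \<ge> 1 \<Longrightarrow> norm (\<Psi> z r) \<le> C * r powr (- 2 * \<sigma>)"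
    unfolding Phi_family_def by blast
  show ?thesis
  proof (rule exI[of _ \<delta>], intro conjI, rule \<delta>(1), rule exI[of _ "\<lambda>n. B * (C * real (Suc n) powr (- 2 * \<sigma>))"], intro conjI ballI allI impI)
    show "summable (\<lambda>n. B * (C * real (Suc n) powr (- 2 * \<sigma>)))"
      using C(1) by (intro summable_mult summable_Suc_powr) simp
    show "(\<lambda>z. K_term \<mu> l x z (Suc n)) holomorphic_on ball z0 \<delta>" for n
    proof (rule holomorphic_transform[OF _ K[symmetric]])
      have "(\<lambda>z. \<Psi> z (real (Suc n))) holomorphic_on ball z0 \<delta>" using F unfolding Phi_family_def by auto
      thus "(\<lambda>z. 2 powr (\<mu> + l + z - 1) * \<Psi> z (real (Suc n))) holomorphic_on ball z0 \<delta>" by (intro holomorphic_intros)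
    qed
    show "norm (K_term \<mu> l x z (Suc n)) \<le> B * (C * real (Suc n) powr (- 2 * \<sigma>))" if "z \<in> ball z0 \<delta>" for z n
      unfolding K[OF that] norm_mult using B that C by (intro mult_mono) auto
    show "K_term \<mu> l x z (Suc n) = 2 powr (\<mu> + l + z - 1) * Phi (1/2 + l + \<mu>) z (1/2 + l - z) (of_nat (Suc n) * x)"
      if z: "z \<in> ball z0 \<delta>" "z \<notin> \<int>" for z n
    proof -
      have "real (Suc n) \<ge> 1" by simp
      hence "\<Psi> z (real (Suc n)) = Phi a (z + of_nat 0) (1/2 + l - z) (of_real (real (Suc n)) * x)"
        using F z unfolding Phi_family_def by blast
      thus ?thesis unfolding K[OF z(1)] a_def by simp
    qed
  qed
qed

lemma K_term_summable:
  assumes "Re x > 0" "Re (1/2 + l + \<mu>) > 1/2" "1/2 + l \<notin> \<int>\<^sub>\<le>\<^sub>0" "1/2 + l + \<mu> + z \<notin> \<int>\<^sub>\<le>\<^sub>0"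
  shows "summable (\<lambda>n. K_term \<mu> l x z (Suc n))"
proof -
  from K_term_local[OF assms] obtain \<delta> g where
    g: "\<delta> > 0" "summable g" "\<forall>w\<in>ball z \<delta>. \<forall>n. norm (K_term \<mu> l x w (Suc n)) \<le> g n" by (elim exE conjE) (rule that)
  have "z \<in> ball z \<delta>" using g(1) by simp
  from bspec[OF g(3) this] have "\<forall>n. norm (K_term \<mu> l x z (Suc n)) \<le> g n" .
  hence "\<And>n. 0 \<le> n \<Longrightarrow> norm (K_term \<mu> l x z (Suc n)) \<le> g n" by (rule spec)
  with g(2) show ?thesis by (rule summable_comparison_test')
qed

lemma K_term_eq_Phi:
  assumes "Re x > 0" "Re (1/2 + l + \<mu>) > 1/2" "1/2 + l \<notin> \<int>\<^sub>\<le>\<^sub>0" "1/2 + l + \<mu> + z \<notin> \<int>\<^sub>\<le>\<^sub>0" "z \<notin> \<int>"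
  shows "K_term \<mu> l x z (Suc n) = 2 powr (\<mu> + l + z - 1) * Phi (1/2 + l + \<mu>) z (1/2 + l - z) (of_nat (Suc n) * x)"
proof -
  from K_term_local[OF assms(1-4)] obtain \<delta> where \<delta>: "\<delta> > 0" and
    K: "\<forall>w\<in>ball z \<delta>. w \<notin> \<int> \<longrightarrow> (\<forall>n. K_term \<mu> l x w (Suc n) = 2 powr (\<mu> + l + w - 1) * Phi (1/2 + l + \<mu>) w (1/2 + l - w) (of_nat (Suc n) * x))"
    by (elim exE conjE) (rule that)
  have "z \<in> ball z \<delta>" using \<delta> by simp
  from K[rule_format, OF this assms(5)] show ?thesis .
qed

lemma K_sum_holomorphic:
  assumes "Re x > 0" "Re (1/2 + l + \<mu>) > 1/2" "1/2 + l \<notin> \<int>\<^sub>\<le>\<^sub>0" "\<And>z. z \<in> U \<Longrightarrow> 1/2 + l + \<mu> + z \<notin> \<int>\<^sub>\<le>\<^sub>0"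
  shows "(\<lambda>z. \<Sum>n. K_term \<mu> l x z (Suc n)) holomorphic_on U"
proof (rule holomorphic_onI)
  fix z assume "z \<in> U"
  from K_term_local[OF assms(1-3) assms(4)[OF this]] obtain \<delta> g where
    g: "\<delta> > 0" "summable g" "\<And>n. (\<lambda>z. K_term \<mu> l x z (Suc n)) holomorphic_on ball z \<delta>"
      "\<forall>w\<in>ball z \<delta>. \<forall>n. norm (K_term \<mu> l x w (Suc n)) \<le> g n" proof (elim exE conjE)
      fix \<delta> g assume h: "\<delta> > 0" "summable g" "\<forall>n. (\<lambda>z. K_term \<mu> l x z (Suc n)) holomorphic_on ball z \<delta>"
        "\<forall>w\<in>ball z \<delta>. \<forall>n. norm (K_term \<mu> l x w (Suc n)) \<le> g n"
      show ?thesis by (rule that[OF h(1,2) spec[OF h(3)] h(4)])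
    qed
  have "(\<lambda>z. \<Sum>n. K_term \<mu> l x z (Suc n)) holomorphic_on ball z \<delta>"
  proof (rule suminf_holomorphic_on[OF open_ball g(3)])
    show "\<exists>r>0. \<exists>h. summable h \<and> (\<forall>w\<in>ball y r \<inter> ball z \<delta>. \<forall>n. norm (K_term \<mu> l x w (Suc n)) \<le> h n)" for y
      by (rule exI[of _ 1], rule conjI, simp, rule exI[of _ g]) (use g(2,4) in simp)
  qed
  moreover have "z \<in> ball z \<delta>" using g(1) by simp
  ultimately have "(\<lambda>z. \<Sum>n. K_term \<mu> l x z (Suc n)) field_differentiable at z"
    using holomorphic_on_imp_differentiable_at open_ball by blast
  thus "(\<lambda>z. \<Sum>n. K_term \<mu> l x z (Suc n)) field_differentiable at z within U"
    by (rule field_differentiable_at_within)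
qed


section \<open>Averaging against the Beta kernel\<close>

definition xi :: "complex \<Rightarrow> nat \<Rightarrow> complex" where
  "xi x n = - (x ^ 2) / (4 * of_real pi ^ 2 * of_nat n ^ 2)"

lemma xi_in_slit_plane:
  assumes "Re x > 0" "0 \<le> t" "t \<le> 1"
  shows "of_real t * xi x (Suc n) \<in> slit_plane"
proof -
  define y where "y = of_real (1 / (2 * pi * real (Suc n))) * x"
  have y: "Re y > 0" unfolding y_def using assms by (simp del: of_nat_Suc)
  have x: "xi x (Suc n) = - (y\<^sup>2)"
    unfolding xi_def y_def by (simp add: power_mult_distrib power_divide del: of_nat_Suc)
  have "1 - xi x (Suc n) \<notin> \<real>\<^sub>\<le>\<^sub>0" unfolding x using inverse_square_plus_one_nonpos[OF y] by simp
  hence "xi x (Suc n) \<in> slit_plane" by (simp add: slit_plane_def)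
  from slit_plane_scale[OF this assms(2,3)] show ?thesis by (simp add: slit_plane_def)
qed

lemma xi_Suc: "xi x (Suc n) = of_real (1 / (real (Suc n))\<^sup>2) * xi x 1"
  by (simp add: xi_def power_divide)

definition hyp_sum :: "complex \<Rightarrow> complex \<Rightarrow> complex \<Rightarrow> complex \<Rightarrow> complex" where
  "hyp_sum x a d z = (\<Sum>n. 1 / of_nat (Suc n) powr (2 * z + 1) * hyp (1/2 + z) (a + z) d (xi x (Suc n)))"

text \<open>The assertion for Re z > 0 before any Taylor terms are subtracted, stripped of powers of
  2, with d = 1/2 + \<lambda> and a = d + \<mu>. \<open>rGamma\<close> makes the right side regular
  where Gamma (d - z) or Gamma (d - 1/2 - z) has a pole.\<close>

definition main_identity :: "complex \<Rightarrow> complex \<Rightarrow> complex \<Rightarrow> complex \<Rightarrow> bool" where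
  "main_identity x a d z \<longleftrightarrow>
     (\<lambda>n. Phi a z (d - z) (of_nat (Suc n) * x)) sums
       (1 / of_real (sqrt pi) * (x / (2 * of_real pi)) powr (2 * z) * (Gamma (z + 1/2) * Gamma (a + z) * rGamma d) * hyp_sum x a d z
        - Gamma z * Gamma a * rGamma (d - z) / 2
        + of_real (sqrt pi) * Gamma (a - 1/2) * Gamma (z + 1/2) * rGamma (d - 1/2 - z) / x)"

lemma norm_of_nat_powr: "norm (of_nat (Suc n) powr c :: complex) = real (Suc n) powr Re c"
  using norm_powr_real_powr[of "of_nat (Suc n)" c] by (simp del: of_nat_Suc)

text \<open>Termwise, the Beta average of (1 - y \<xi>)^(-(1/2 + z)) is Euler's integral for the
  2F1; the weights k^(-2 Re z - 1) justify the interchange.\<close>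

lemma hyp_integral_sum:
  assumes x: "Re x > 0" and z: "Re z > 0" and a: "Re (a + z) > 0" and d: "Re d > Re (a + z)"
  shows "(\<lambda>k. 1 / of_nat (Suc k) powr (2 * z + 1) * (Gamma (a + z) * Gamma (d - (a + z)) * rGamma d * hyp (1/2 + z) (a + z) d (xi x (Suc k)))) sums
    (LINT y|I01. cbeta_kernel (a + z) (d - (a + z)) y *
       (\<Sum>k. 1 / of_nat (Suc k) powr (2 * z + 1) * (1 - of_real y * xi x (Suc k)) powr (- (1/2 + z))))"
    and "integrable I01 (\<lambda>y. cbeta_kernel (a + z) (d - (a + z)) y *
       (\<Sum>k. 1 / of_nat (Suc k) powr (2 * z + 1) * (1 - of_real y * xi x (Suc k)) powr (- (1/2 + z))))"
proof -
  define b where "b = a + z"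
  define f where "f k y = cbeta_kernel b (d - b) y * (1 / of_nat (Suc k) powr (2 * z + 1) * (1 - of_real y * xi x (Suc k)) powr (- (1/2 + z)))" for k y
  have bd: "Re b > 0" "Re d > Re b" "Re (d - b) > 0" using a d by (auto simp: b_def)
  have xs: "xi x (Suc k) \<in> slit_plane" for k using xi_in_slit_plane[OF x, of 1 k] by simp
  have fe: "f k y = 1 / of_nat (Suc k) powr (2 * z + 1) * (cbeta_kernel b (d - b) y * (1 - of_real y * xi x (Suc k)) powr (- (1/2 + z)))" for k y
    unfolding f_def by (simp only: mult_ac)
  have intf: "integrable I01 (f k)" for k
    unfolding fe by (intro integrable_mult_right integrable_euler bd xs)
  have val: "(LINT y|I01. f k y) = 1 / of_nat (Suc k) powr (2 * z + 1) * (Gamma b * Gamma (d - b) * rGamma d * hyp (1/2 + z) b d (xi x (Suc k)))" for k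
  proof -
    have "Re d > 0" using bd by linarith
    hence "Gamma d \<noteq> 0" "Gamma b \<noteq> 0" "Gamma (d - b) \<noteq> 0" using bd using bd by (simp_all only: Gamma_eq_zero_iff Re_pos_not_nonpos_Int not_False_eq_True)
    hence "(LINT y|I01. cbeta_kernel b (d - b) y * (1 - of_real y * xi x (Suc k)) powr (- (1/2 + z))) = Gamma b * Gamma (d - b) * rGamma d * euler_fun (1/2 + z) b d (xi x (Suc k))"
      by (simp add: euler_fun_def rGamma_inverse_Gamma)
    thus ?thesis unfolding fe hyp_eq_euler_fun[OF bd(1,2) xs] by (simp only: integral_mult_right_zero)
  qed
  obtain B where B: "\<And>t. t \<in> {0..1} \<Longrightarrow> norm ((1 - of_real t * xi x 1) powr (- (1/2 + z))) \<le> B"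
    using euler_factor_bounded[of "xi x 1" "1/2 + z"] xs[of 0] unfolding One_nat_def[symmetric] by blast
  have nf: "norm (f k y) \<le> B * beta_kernel (Re b) (Re (d - b)) y * real (Suc k) powr (- (2 * Re z + 1))" if y: "y \<in> {0<..<1}" for k y
  proof -
    \<comment> \<open>Since y / k^2 lies in [0,1], all arguments lie on the segment from 0 to the
      first \<xi>, where the single bound \<open>B\<close> holds.\<close>
    have eq: "of_real y * xi x (Suc k) = of_real (y / (real (Suc k))\<^sup>2) * xi x 1"
      unfolding xi_Suc[of x k] by (simp del: of_nat_Suc)
    have "real (Suc k) \<ge> 1" by simp
    hence "(real (Suc k))\<^sup>2 \<ge> 1" by (rule one_le_power)
    moreover have "y / q \<in> {0..1}" if "q \<ge> 1" for q :: real using y that by simp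
    ultimately have "y / (real (Suc k))\<^sup>2 \<in> {0..1}" by blast
    hence n1: "norm ((1 - of_real y * xi x (Suc k)) powr (- (1/2 + z))) \<le> B" unfolding eq by (rule B)
    have re: "Re (2 * z + 1) = 2 * Re z + 1" by simp
    have n2: "norm (1 / of_nat (Suc k) powr (2 * z + 1) :: complex) = real (Suc k) powr (- (2 * Re z + 1))"
      by (simp only: norm_divide norm_one norm_of_nat_powr powr_minus inverse_eq_divide re)
    have "norm (f k y) = beta_kernel (Re b) (Re (d - b)) y * (real (Suc k) powr (- (2 * Re z + 1)) * norm ((1 - of_real y * xi x (Suc k)) powr (- (1/2 + z))))"
      unfolding f_def norm_mult norm_cbeta_kernel[OF y] n2 ..
    also have "\<dots> \<le> beta_kernel (Re b) (Re (d - b)) y * (real (Suc k) powr (- (2 * Re z + 1)) * B)"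
      by (intro mult_left_mono n1 powr_ge_zero beta_kernel_nonneg)
    finally show ?thesis by (simp only: mult_ac)
  qed
  have bki: "integrable I01 (beta_kernel (Re b) (Re (d - b)))" using bd by (intro integrable_beta_kernel) auto
  have A1: "AE y in I01. summable (\<lambda>k. norm (f k y))"
  proof (rule AE_I2)
    fix y assume "y \<in> space I01"
    hence y: "y \<in> {0<..<1}" by simp
    have "summable (\<lambda>k. B * beta_kernel (Re b) (Re (d - b)) y * real (Suc k) powr (- (2 * Re z + 1)))"
      using z by (intro summable_mult summable_Suc_powr) simp
    thus "summable (\<lambda>k. norm (f k y))" by (rule summable_comparison_test'[of _ 0]) (use nf[OF y] in simp)
  qed
  have A2: "summable (\<lambda>k. LINT y|I01. norm (f k y))"
  proof (rule summable_comparison_test'[of "\<lambda>k. B * (LINT y|I01. beta_kernel (Re b) (Re (d - b)) y) * real (Suc k) powr (- (2 * Re z + 1))" 0])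
    show "summable (\<lambda>k. B * (LINT y|I01. beta_kernel (Re b) (Re (d - b)) y) * real (Suc k) powr (- (2 * Re z + 1)))"
      using z by (intro summable_mult summable_Suc_powr) simp
    fix k :: nat
    have "(LINT y|I01. norm (f k y)) \<le> (LINT y|I01. B * beta_kernel (Re b) (Re (d - b)) y * real (Suc k) powr (- (2 * Re z + 1)))"
      using nf by (intro integral_mono integrable_norm intf integrable_mult_left integrable_mult_right bki) simp
    also have "\<dots> = B * (LINT y|I01. beta_kernel (Re b) (Re (d - b)) y) * real (Suc k) powr (- (2 * Re z + 1))" by simp
    finally show "norm (LINT y|I01. norm (f k y)) \<le> B * (LINT y|I01. beta_kernel (Re b) (Re (d - b)) y) * real (Suc k) powr (- (2 * Re z + 1))"
      by (simp only: real_norm_def abs_of_nonneg integral_nonneg_AE norm_ge_zero AE_I2)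
  qed
  have S: "(\<Sum>k. f k y) = cbeta_kernel b (d - b) y * (\<Sum>k. 1 / of_nat (Suc k) powr (2 * z + 1) * (1 - of_real y * xi x (Suc k)) powr (- (1/2 + z)))"
    if "y \<in> space I01" for y
  proof -
    have y: "y \<in> {0<..<1}" using that by simp
    \<comment> \<open>The kernel has no zero in (0,1), so it can be divided out of the convergent
      series.\<close>
    have nz: "cbeta_kernel b (d - b) y \<noteq> 0"
    proof -
      have "1 - complex_of_real y \<noteq> 0" using y by (metis eq_iff_diff_eq_0 greaterThanLessThan_iff less_irrefl of_real_eq_1_iff)
      thus ?thesis using y by (simp add: cbeta_kernel_def)
    qed
    have "summable (\<lambda>k. norm (f k y))"
    proof (rule summable_comparison_test'[of _ 0])
      show "summable (\<lambda>k. B * beta_kernel (Re b) (Re (d - b)) y * real (Suc k) powr (- (2 * Re z + 1)))"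
        using z by (intro summable_mult summable_Suc_powr) simp
    qed (use nf[OF y] in simp)
    hence "summable (\<lambda>k. f k y)" by (rule summable_norm_cancel)
    hence "summable (\<lambda>k. 1 / of_nat (Suc k) powr (2 * z + 1) * (1 - of_real y * xi x (Suc k)) powr (- (1/2 + z)))"
      unfolding f_def by (rule summable_mult_D[OF _ nz])
    thus ?thesis unfolding f_def by (rule suminf_mult)
  qed
  define R where "R y = cbeta_kernel b (d - b) y * (\<Sum>k. 1 / of_nat (Suc k) powr (2 * z + 1) * (1 - of_real y * xi x (Suc k)) powr (- (1/2 + z)))" for y
  have S': "(\<Sum>k. f k y) = R y" if "y \<in> space I01" for y unfolding R_def by (rule S[OF that])
  have iR: "integrable I01 R"
    by (rule Bochner_Integration.integrable_cong[OF refl S', THEN iffD1, OF _ integrable_suminf[OF intf A1 A2]])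
  have LR: "(LINT y|I01. (\<Sum>k. f k y)) = (LINT y|I01. R y)"
    by (rule Bochner_Integration.integral_cong[OF refl S'])
  have "(\<lambda>k. LINT y|I01. f k y) sums (LINT y|I01. R y)"
    using sums_integral[OF intf A1 A2] by (simp only: LR)
  hence sR: "(\<lambda>k. 1 / of_nat (Suc k) powr (2 * z + 1) * (Gamma b * Gamma (d - b) * rGamma d * hyp (1/2 + z) b d (xi x (Suc k)))) sums (LINT y|I01. R y)"
    by (simp only: val)
  show "(\<lambda>k. 1 / of_nat (Suc k) powr (2 * z + 1) * (Gamma (a + z) * Gamma (d - (a + z)) * rGamma d * hyp (1/2 + z) (a + z) d (xi x (Suc k)))) sums
    (LINT y|I01. cbeta_kernel (a + z) (d - (a + z)) y *
       (\<Sum>k. 1 / of_nat (Suc k) powr (2 * z + 1) * (1 - of_real y * xi x (Suc k)) powr (- (1/2 + z))))"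
    using sR unfolding R_def b_def .
  show "integrable I01 (\<lambda>y. cbeta_kernel (a + z) (d - (a + z)) y *
       (\<Sum>k. 1 / of_nat (Suc k) powr (2 * z + 1) * (1 - of_real y * xi x (Suc k)) powr (- (1/2 + z))))"
    using iR unfolding R_def [abs_def] b_def .
qed

text \<open>\<open>kober\<close> at sqrt y x is averaged over y. The first term brings y^z and moves
  the Beta exponent from a to a + z; the term in 1 / x brings y^(-1/2) and moves it to a - 1/2,
  whose real part is positive by hypothesis.\<close>

lemma main_identity_on_strip:
  assumes x: "Re x > 0" and a: "Re a > 1/2" and z: "0 < Re z" "Re z < 1/2" and d: "Re (d - z) > Re a"
  shows "main_identity x a d z"
proof -
  define c where "c = d - z"
  define q where "q = c - a"
  define b where "b = a + z"
  have q: "Re q > 0" using d by (simp add: q_def c_def)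
  have re: "Re a > 0" "Re b > 0" "Re (a - 1/2) > 0" "Re c > Re a" "Re d > Re b" "Re d > 0" using a z d by (auto simp: b_def c_def)
  have qd: "q = d - b" by (simp add: q_def c_def b_def)
  have zi: "z \<notin> \<int>"
  proof
    assume "z \<in> \<int>"
    then obtain k where "z = of_int k" by (auto elim: Ints_cases)
    with z have "0 < real_of_int k" "real_of_int k < 1/2" by auto
    hence "k \<ge> 1" by simp
    hence "real_of_int k \<ge> 1" by simp
    with \<open>real_of_int k < 1/2\<close> show False by simp
  qed
  have Gq: "Gamma q \<noteq> 0" using Re_pos_not_nonpos_Int[OF q] by (simp add: Gamma_eq_zero_iff)
  have Gb: "Gamma b \<noteq> 0" using Re_pos_not_nonpos_Int[OF re(2)] by (simp add: Gamma_eq_zero_iff)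
  have Gd: "rGamma d \<noteq> 0" using Re_pos_not_nonpos_Int[OF re(6)] by (simp add: rGamma_eq_zero_iff)
  \<comment> \<open>Above 1/2 for summability over n, below Re a for integrability at y = 0.\<close>
  define \<sigma> where "\<sigma> = (Re a + 1/2) / 2"
  have \<sigma>: "\<sigma> > 1/2" "\<sigma> < Re a" using a by (auto simp: \<sigma>_def)
  have \<sigma>0: "\<sigma> > 0" "\<sigma> + Re z > 0" using \<sigma>(1) z(1) by linarith+
  obtain C \<delta> where C: "\<delta> > 0" "C \<ge> 0"
    "\<And>w r. w \<in> ball z \<delta> \<Longrightarrow> r > 0 \<Longrightarrow> norm (kfun w (of_real r * x)) \<le> C * r powr (- 2 * \<sigma>)"
    using kfun_bound[OF x \<sigma>0] by metis
  have kb: "norm (kfun z (of_real r * x)) \<le> C * r powr (- 2 * \<sigma>)" if "r > 0" for r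
    by (rule C(3)) (use C(1) that in simp_all)
  define f where "f n y = cbeta_kernel a q y * kfun z (of_real (sqrt y) * (of_nat (Suc n) * x))" for n y
  have nf: "norm (f n y) \<le> C * real (Suc n) powr (- 2 * \<sigma>) * beta_kernel (Re a - \<sigma>) (Re q) y" if y: "y \<in> {0<..<1}" for n y
  proof -
    have eq: "of_real (sqrt y) * (of_nat (Suc n) * x) = of_real (sqrt y * real (Suc n)) * x"
      by (simp only: of_real_mult of_real_of_nat_eq mult_ac)
    have "sqrt y * real (Suc n) > 0" using y by simp
    hence "norm (kfun z (of_real (sqrt y) * (of_nat (Suc n) * x))) \<le> C * (sqrt y * real (Suc n)) powr (- 2 * \<sigma>)"
      unfolding eq by (rule kb)
    also have "(sqrt y * real (Suc n)) powr (- 2 * \<sigma>) = y powr (- \<sigma>) * real (Suc n) powr (- 2 * \<sigma>)"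
      using y sqrt_powr[of y \<sigma>] by (subst powr_mult) auto
    finally have k: "norm (kfun z (of_real (sqrt y) * (of_nat (Suc n) * x))) \<le> C * (y powr (- \<sigma>) * real (Suc n) powr (- 2 * \<sigma>))" .
    have "norm (f n y) \<le> beta_kernel (Re a) (Re q) y * (C * (y powr (- \<sigma>) * real (Suc n) powr (- 2 * \<sigma>)))"
      unfolding f_def norm_mult norm_cbeta_kernel[OF y] by (intro mult_left_mono k beta_kernel_nonneg)
    also have "\<dots> = C * real (Suc n) powr (- 2 * \<sigma>) * (beta_kernel (Re a) (Re q) y * y powr (- \<sigma>))" by (simp only: mult_ac)
    also have "beta_kernel (Re a) (Re q) y * y powr (- \<sigma>) = beta_kernel (Re a - \<sigma>) (Re q) y"
      using beta_kernel_times_powr[of "Re a" "Re q" y "- \<sigma>"] by simp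
    finally show ?thesis .
  qed
  have bki: "integrable I01 (beta_kernel (Re a - \<sigma>) (Re q))" using \<sigma> q by (intro integrable_beta_kernel) auto
  have ser: "summable (\<lambda>n. C * real (Suc n) powr (- 2 * \<sigma>) * B)" for B
    using \<sigma> by (intro summable_mult summable_mult2 summable_Suc_powr) simp
  have intf: "integrable I01 (f n)" for n
  proof (rule Bochner_Integration.integrable_bound)
    show "integrable I01 (\<lambda>y. C * real (Suc n) powr (- 2 * \<sigma>) * beta_kernel (Re a - \<sigma>) (Re q) y)"
      by (intro integrable_mult_right bki)
    have "Re (of_nat (Suc n) * x) > 0" using x by (simp del: of_nat_Suc)
    thus "f n \<in> borel_measurable I01" unfolding f_def
      by (intro borel_measurable_times measurable_cbeta_kernel measurable_kfun_sqrt)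
    show "AE y in I01. norm (f n y) \<le> norm (C * real (Suc n) powr (- 2 * \<sigma>) * beta_kernel (Re a - \<sigma>) (Re q) y)"
    proof (rule AE_I2)
      fix y assume "y \<in> space I01"
      hence "y \<in> {0<..<1}" by simp
      from nf[OF this] show "norm (f n y) \<le> norm (C * real (Suc n) powr (- 2 * \<sigma>) * beta_kernel (Re a - \<sigma>) (Re q) y)"
        unfolding real_norm_def by (rule order_trans[OF _ abs_ge_self])
    qed
  qed
  have A1: "AE y in I01. summable (\<lambda>n. norm (f n y))"
  proof (rule AE_I2)
    fix y assume "y \<in> space I01"
    hence "y \<in> {0<..<1}" by simp
    from nf[OF this] show "summable (\<lambda>n. norm (f n y))"
      by (intro summable_comparison_test'[OF ser[of "beta_kernel (Re a - \<sigma>) (Re q) y"], of 0]) simp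
  qed
  have A2: "summable (\<lambda>n. LINT y|I01. norm (f n y))"
  proof (rule summable_comparison_test'[OF ser[of "LINT y|I01. beta_kernel (Re a - \<sigma>) (Re q) y"], of 0])
    fix n :: nat
    have "(LINT y|I01. norm (f n y)) \<le> (LINT y|I01. C * real (Suc n) powr (- 2 * \<sigma>) * beta_kernel (Re a - \<sigma>) (Re q) y)"
      using nf by (intro integral_mono integrable_norm intf integrable_mult_right bki) simp
    also have "\<dots> = C * real (Suc n) powr (- 2 * \<sigma>) * (LINT y|I01. beta_kernel (Re a - \<sigma>) (Re q) y)" by (rule integral_mult_right_zero)
    finally show "norm (LINT y|I01. norm (f n y)) \<le> C * real (Suc n) powr (- 2 * \<sigma>) * (LINT y|I01. beta_kernel (Re a - \<sigma>) (Re q) y)"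
      by (simp only: real_norm_def abs_of_nonneg integral_nonneg_AE norm_ge_zero AE_I2)
  qed
  define S where "S y = (\<Sum>k. 1 / of_nat (Suc k) powr (2 * z + 1) * (1 - of_real y * xi x (Suc k)) powr (- (1/2 + z)))" for y
  define P where "P = 1 / of_real (sqrt pi) * (x / (2 * of_real pi)) powr (2 * z) * Gamma (z + 1/2)"
  define Q where "Q = of_real (sqrt pi) * Gamma (z + 1/2) / x"
  have S: "(\<Sum>n. f n y) = P * (cbeta_kernel b q y * S y) - Gamma z / 2 * cbeta_kernel a q y + Q * cbeta_kernel (a - 1/2) q y"
    if "y \<in> space I01" for y
  proof -
    have y: "y > 0" "y < 1" using that by auto
    define u where "u = of_real (sqrt y) * x"
    have u: "Re u > 0" using x y by (simp add: u_def)
    have "complex_of_real (sqrt y) ^ 2 = of_real y" using y by (simp only: of_real_power[symmetric] real_sqrt_pow2 less_imp_le)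
    hence u2: "u\<^sup>2 = of_real y * x\<^sup>2" by (simp only: u_def power_mult_distrib)
    have ue: "1 + u\<^sup>2 / (4 * of_real pi ^ 2 * of_nat (Suc k) ^ 2) = 1 - of_real y * xi x (Suc k)" for k
      unfolding u2 xi_def by (simp only: minus_divide_left[symmetric] mult_minus_right diff_minus_eq_add times_divide_eq_right)
    have ze: "z + 1/2 = 1/2 + z" by simp
    have fu: "f n y = cbeta_kernel a q y * kfun z (of_nat (Suc n) * u)" for n
      unfolding f_def u_def by (simp only: mult_ac)
    have us: "u / (2 * of_real pi) = of_real (sqrt y) * (x / (2 * of_real pi))" by (simp add: u_def)
    have up: "(u / (2 * of_real pi)) powr (2 * z) = of_real y powr z * (x / (2 * of_real pi)) powr (2 * z)"
      unfolding us using y of_real_sqrt_powr[of y z] by (subst powr_times_real_left) auto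
    have ck1: "cbeta_kernel a q y * of_real y powr z = cbeta_kernel b q y"
    proof -
      have "of_real y powr (a - 1) * of_real y powr z = (of_real y :: complex) powr (b - 1)"
        unfolding powr_add[symmetric] b_def by (simp add: algebra_simps)
      moreover have "A * Q * Z = (A * Z) * Q" for A Q Z :: complex by (simp only: mult_ac)
      ultimately show ?thesis unfolding cbeta_kernel_def by metis
    qed
    have ck2: "cbeta_kernel a q y / of_real (sqrt y) = cbeta_kernel (a - 1/2) q y"
    proof -
      have "of_real y powr (a - 1/2 - 1) * of_real y powr (1/2) = (of_real y :: complex) powr (a - 1)"
        unfolding powr_add[symmetric] by (simp add: algebra_simps)
      moreover have "of_real y powr (1/2) = complex_of_real (sqrt y)"
        using of_real_sqrt_powr[of y "1/2"] y by simp
      ultimately have e: "of_real y powr (a - 1) = of_real y powr (a - 1/2 - 1) * complex_of_real (sqrt y)" by simp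
      have s: "complex_of_real (sqrt y) \<noteq> 0" using y by simp
      have "A * R * B / R = A * B" if "R \<noteq> 0" for A B R :: complex using that by simp
      thus ?thesis unfolding cbeta_kernel_def e using s by blast
    qed
    have "(\<lambda>n. cbeta_kernel a q y * kfun z (of_nat (Suc n) * u)) sums (cbeta_kernel a q y *
      (1 / of_real (sqrt pi) * (of_real y powr z * (x / (2 * of_real pi)) powr (2 * z)) * Gamma (z + 1/2) * S y
       - Gamma z / 2 + of_real (sqrt pi) * Gamma (z + 1/2) / u))"
      using sums_mult[OF kober(1)[OF u z]] unfolding ue up S_def ze .
    hence "(\<Sum>n. f n y) = cbeta_kernel a q y *
      (1 / of_real (sqrt pi) * (of_real y powr z * (x / (2 * of_real pi)) powr (2 * z)) * Gamma (z + 1/2) * S y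
       - Gamma z / 2 + of_real (sqrt pi) * Gamma (z + 1/2) / u)"
      unfolding fu by (simp only: sums_iff)
    also have "\<dots> = P * ((cbeta_kernel a q y * of_real y powr z) * S y) - Gamma z / 2 * cbeta_kernel a q y + Q * (cbeta_kernel a q y / of_real (sqrt y))"
    proof -
      have "k * (h * (Y * X) * G * s - w + p * G / (r * x)) = (h * X * G) * ((k * Y) * s) - w * k + (p * G / x) * (k / r)"
        for k h Y X G s w p r :: complex by (simp add: algebra_simps)
      thus ?thesis unfolding P_def Q_def u_def .
    qed
    finally show ?thesis unfolding ck1 ck2 .
  qed
  define I where "I = (LINT y|I01. cbeta_kernel b q y * S y)"
  have bz: "Re (a + z) > 0" "Re d > Re (a + z)" using re by (auto simp: b_def)
  have hi: "(\<lambda>k. 1 / of_nat (Suc k) powr (2 * z + 1) * (Gamma b * Gamma q * rGamma d * hyp (1/2 + z) b d (xi x (Suc k)))) sums I"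
      "integrable I01 (\<lambda>y. cbeta_kernel b q y * S y)"
    using hyp_integral_sum[OF x z(1) bz] unfolding I_def S_def qd b_def by blast+
  have I: "I = Gamma b * Gamma q * rGamma d * hyp_sum x a d z"
  proof -
    define G where "G = Gamma b * Gamma q * rGamma d"
    have G: "G \<noteq> 0" using Gq Gb Gd by (simp add: G_def)
    have "(\<lambda>k. G * (1 / of_nat (Suc k) powr (2 * z + 1) * hyp (1/2 + z) b d (xi x (Suc k)))) sums I"
      using hi(1) unfolding G_def[symmetric] by (simp only: mult.left_commute[of _ G])
    hence "(\<lambda>k. G * (1 / of_nat (Suc k) powr (2 * z + 1) * hyp (1/2 + z) b d (xi x (Suc k)))) sums (G * (I / G))"
      using G by simp
    hence "(\<lambda>k. 1 / of_nat (Suc k) powr (2 * z + 1) * hyp (1/2 + z) b d (xi x (Suc k))) sums (I / G)"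
      using sums_mult_iff[OF G] by blast
    hence "hyp_sum x a d z = I / G" unfolding hyp_sum_def b_def by (simp only: sums_iff)
    thus ?thesis using G by (simp add: G_def)
  qed
  have "(LINT y|I01. (\<Sum>n. f n y)) = (LINT y|I01. P * (cbeta_kernel b q y * S y) - Gamma z / 2 * cbeta_kernel a q y + Q * cbeta_kernel (a - 1/2) q y)"
    by (rule Bochner_Integration.integral_cong[OF refl S])
  also have "\<dots> = P * I - Gamma z / 2 * (Gamma a * Gamma q / Gamma c) + Q * (Gamma (a - 1/2) * Gamma q / Gamma (d - 1/2 - z))"
  proof -
    have ce: "a + q = c" "a - 1/2 + q = d - 1/2 - z" by (auto simp: q_def c_def)
    have i: "integrable I01 (cbeta_kernel a q)" "integrable I01 (cbeta_kernel (a - 1/2) q)"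
      using re q by (auto intro!: integrable_cbeta_kernel)
    show ?thesis
      by (simp only: Bochner_Integration.integral_add Bochner_Integration.integral_diff integrable_mult_right integrable_diff i hi(2)
          Bochner_Integration.integrable_diff integral_mult_right_zero LINT_cbeta_kernel[OF re(1) q] LINT_cbeta_kernel[OF re(3) q] ce I_def[symmetric])
  qed
  finally have L: "(LINT y|I01. (\<Sum>n. f n y)) = P * I - Gamma z / 2 * (Gamma a * Gamma q / Gamma c) + Q * (Gamma (a - 1/2) * Gamma q / Gamma (d - 1/2 - z))" .
  have "(\<lambda>n. rGamma q * (LINT y|I01. f n y)) sums (rGamma q * (P * I - Gamma z / 2 * (Gamma a * Gamma q / Gamma c) + Q * (Gamma (a - 1/2) * Gamma q / Gamma (d - 1/2 - z))))"
    using sums_mult[OF sums_integral[OF intf A1 A2], of "rGamma q"] unfolding L .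
  moreover have "rGamma q * (LINT y|I01. f n y) = Phi a z (d - z) (of_nat (Suc n) * x)" for n
  proof -
    have "Re (of_nat (Suc n) * x) > 0" using x by (simp del: of_nat_Suc)
    from Phi_integral[OF re(1,4) bz(1) zi this] show ?thesis unfolding f_def q_def c_def by simp
  qed
  moreover have "rGamma q * (P * I - Gamma z / 2 * (Gamma a * Gamma q / Gamma c) + Q * (Gamma (a - 1/2) * Gamma q / Gamma (d - 1/2 - z))) =
     1 / of_real (sqrt pi) * (x / (2 * of_real pi)) powr (2 * z) * (Gamma (z + 1/2) * Gamma (a + z) * rGamma d) * hyp_sum x a d z
        - Gamma z * Gamma a * rGamma (d - z) / 2
        + of_real (sqrt pi) * Gamma (a - 1/2) * Gamma (z + 1/2) * rGamma (d - 1/2 - z) / x"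
  proof -
    have "r * (h * X * G1 * (Gb * g * rd * H) - Gz / 2 * (Ga * g * rc) + p * G1 / x * (Gh * g * re)) =
       h * X * (G1 * Gb * rd) * H - Gz * Ga * rc / 2 + p * Gh * G1 * re / x" if "r * g = 1"
      for r h X G1 Gb g rd H Gz Ga rc p Gh re :: complex
    proof -
      have "r * (h * X * G1 * (Gb * g * rd * H) - Gz / 2 * (Ga * g * rc) + p * G1 / x * (Gh * g * re)) =
         (r * g) * (h * X * G1 * (Gb * rd * H) - Gz / 2 * (Ga * rc) + p * G1 / x * (Gh * re))" by (simp add: algebra_simps)
      thus ?thesis unfolding that by (simp add: algebra_simps)
    qed
    moreover have "rGamma q * Gamma q = 1" using Gq by (simp add: rGamma_inverse_Gamma)
    ultimately show ?thesis unfolding I P_def Q_def b_def c_def divide_inverse[of _ "Gamma (d - 1/2 - z)"] divide_inverse[of _ "Gamma (d - z)"] rGamma_inverse_Gamma[symmetric]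
      by blast
  qed
  ultimately show ?thesis unfolding main_identity_def by simp
qed


section \<open>Continuation of the zeta function\<close>

text \<open>Termwise |\<xi>|^(n + M) \<le> (|\<xi>| / r)^M r^(n + M). The bound serves both the
  binomial series behind zeta and the Gauss series.\<close>

lemma power_series_remainder_bound:
  fixes c :: "nat \<Rightarrow> complex"
  assumes S: "(\<lambda>n. c n * \<xi> ^ n) sums S" and g: "\<And>n. norm (c n) \<le> g n"
    and sg: "summable (\<lambda>n. g n * r ^ n)" and r: "norm \<xi> \<le> r" "r > 0"
  shows "norm (S - (\<Sum>m<M. c m * \<xi> ^ m)) \<le> (norm \<xi> / r) ^ M * (\<Sum>n. g n * r ^ n)"
proof -
  define q where "q = (norm \<xi> / r) ^ M"
  have q: "q \<ge> 0" using r by (simp add: q_def)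
  have g0: "g n \<ge> 0" for n using norm_ge_zero g by (rule order_trans)
  have 1: "(\<lambda>n. c (n + M) * \<xi> ^ (n + M)) sums (S - (\<Sum>m<M. c m * \<xi> ^ m))"
    by (rule sums_split_initial_segment[OF S])
  have b: "norm (c (n + M) * \<xi> ^ (n + M)) \<le> q * (g (n + M) * r ^ (n + M))" for n
  proof -
    have "norm \<xi> ^ n * norm \<xi> ^ M \<le> r ^ n * norm \<xi> ^ M" using r by (intro mult_right_mono power_mono) auto
    also have "\<dots> = q * r ^ (n + M)" using r by (simp add: q_def power_add power_divide)
    finally have "norm \<xi> ^ (n + M) \<le> q * r ^ (n + M)" by (simp add: power_add)
    hence "norm (c (n + M)) * norm \<xi> ^ (n + M) \<le> g (n + M) * (q * r ^ (n + M))"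
      using g g0 by (intro mult_mono) auto
    thus ?thesis by (simp add: norm_mult norm_power mult_ac)
  qed
  have s: "summable (\<lambda>n. g (n + M) * r ^ (n + M))" by (rule summable_ignore_initial_segment[OF sg])
  have "norm (S - (\<Sum>m<M. c m * \<xi> ^ m)) = norm (\<Sum>n. c (n + M) * \<xi> ^ (n + M))" using sums_unique[OF 1] by simp
  also have "\<dots> \<le> (\<Sum>n. q * (g (n + M) * r ^ (n + M)))" by (rule norm_suminf_le[OF b summable_mult[OF s]])
  also have "\<dots> = q * ((\<Sum>n. g n * r ^ n) - (\<Sum>n<M. g n * r ^ n))"
    by (simp only: suminf_mult[OF s] suminf_minus_initial_segment[OF sg])
  also have "\<dots> \<le> q * (\<Sum>n. g n * r ^ n)"
    using q g0 r by (intro mult_left_mono) (auto intro!: sum_nonneg)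
  finally show ?thesis unfolding q_def .
qed

lemma norm_pochhammer_le:
  fixes a :: complex
  assumes "norm a \<le> A"
  shows "norm (pochhammer a n) \<le> pochhammer A n"
proof -
  have "norm (a + of_nat i) \<le> A + real i" for i
    using norm_triangle_ineq[of a "of_nat i"] assms by simp
  thus ?thesis unfolding pochhammer_prod prod_norm[symmetric] by (intro prod_mono) simp
qed

lemma norm_gbinomial_le:
  fixes a :: complex
  assumes "norm a \<le> A"
  shows "norm (a gchoose n) \<le> pochhammer A n / fact n"
proof -
  have "norm (a gchoose n) = norm (pochhammer (- a) n) / fact n"
    by (simp add: gbinomial_pochhammer norm_mult norm_divide norm_power)
  also have "\<dots> \<le> pochhammer A n / fact n"
    using assms by (intro divide_right_mono norm_pochhammer_le) auto
  finally show ?thesis .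
qed

lemma summable_pochhammer_half:
  "summable (\<lambda>n. pochhammer A n / fact n * (1/2 :: real) ^ n)"
proof -
  have "(\<lambda>n. ((- A) gchoose n) * (- (1/2)) ^ n) sums (1 + - (1/2)) powr (- A)"
    by (rule gen_binomial_real) simp
  moreover have "((- A) gchoose n) * (- (1/2)) ^ n = pochhammer A n / fact n * (1/2 :: real) ^ n" for n
  proof -
    have "(- 1 :: real) ^ n * (- (1/2)) ^ n = (1/2) ^ n" unfolding power_mult_distrib[symmetric] by simp
    thus ?thesis by (simp add: gbinomial_pochhammer mult_ac)
  qed
  ultimately show ?thesis by (simp add: sums_iff)
qed

text \<open>The sum starts at 2 so that 1 / (n + 2) \<le> 1/2 lies well inside the disc of
  convergence of the binomial series.\<close>

definition zeta_tail :: "complex \<Rightarrow> complex" where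
  "zeta_tail s = (\<Sum>n. 1 / of_nat (n + 2) powr s)"

lemma norm_inverse_of_nat_powr: "norm (1 / of_nat (n + 2) powr s :: complex) = real (n + 2) powr (- Re s)"
proof -
  have "norm (of_nat (n + 2) powr s :: complex) = real (n + 2) powr Re s"
    using norm_of_nat_powr[of "Suc n" s] by simp
  thus ?thesis by (simp only: norm_divide norm_one powr_minus inverse_eq_divide)
qed

lemma summable_shift2_powr:
  assumes "c < -1" shows "summable (\<lambda>n. real (n + 2) powr c)"
proof -
  have "Suc (n + 1) = n + 2" for n by simp
  with summable_ignore_initial_segment[OF summable_Suc_powr[OF assms], of 1] show ?thesis by (simp only:)
qed

lemma zeta_tail_sums:
  assumes "Re s > 1" shows "(\<lambda>n. 1 / of_nat (n + 2) powr s) sums zeta_tail s"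
proof -
  have "summable (\<lambda>n. real (n + 2) powr (- Re s))" by (rule summable_shift2_powr) (use assms in simp)
  hence "summable (\<lambda>n. norm (1 / of_nat (n + 2) powr s :: complex))" by (simp only: norm_inverse_of_nat_powr)
  thus ?thesis unfolding zeta_tail_def by (rule summable_sums[OF summable_norm_cancel])
qed

text \<open>The Taylor remainder of order K of (N + 1)^(1 - s) about N = n + 2; it has size N^(1 -
  Re s - K).\<close>

definition zeta_rem :: "nat \<Rightarrow> complex \<Rightarrow> nat \<Rightarrow> complex" where
  "zeta_rem K s n = of_nat (n + 2) powr (1 - s) *
     ((1 + 1 / of_nat (n + 2)) powr (1 - s) - (\<Sum>m<K. ((1 - s) gchoose m) * (1 / of_nat (n + 2)) ^ m))"

lemma zeta_rem_bound:
  assumes "norm (1 - s) \<le> A"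
  shows "norm (zeta_rem K s n) \<le> 2 ^ K * (\<Sum>n. pochhammer A n / fact n * (1/2) ^ n) * real (n + 2) powr (1 - Re s - real K)"
proof -
  define N where "N = real (n + 2)"
  have N: "N \<ge> 2" by (simp add: N_def)
  have Nc: "of_nat (n + 2) = complex_of_real N" by (simp add: N_def)
  define \<xi> where "\<xi> = 1 / complex_of_real N"
  define B where "B = (\<Sum>n. pochhammer A n / fact n * (1/2 :: real) ^ n)"
  have nx: "norm \<xi> = 1 / N" using N by (simp add: \<xi>_def norm_divide)
  have x: "norm \<xi> \<le> 1/2" "norm \<xi> < 1" unfolding nx using N by (auto simp: field_simps)
  have h: "(1/2 :: real) > 0" by simp
  note power_series_remainder_bound[OF gen_binomial_complex[OF x(2), of "1 - s"] norm_gbinomial_le[OF assms] summable_pochhammer_half x(1) h, of K]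
  also have "(norm \<xi> / (1/2)) ^ K = 2 ^ K * N powr (- real K)"
  proof -
    have "norm \<xi> / (1/2) = 2 * inverse N" by (simp add: nx inverse_eq_divide)
    moreover have "N powr (- real K) = inverse N ^ K" using powr_realpow[of N K] N by (simp only: powr_minus power_inverse)
    ultimately show ?thesis by (simp only: power_mult_distrib)
  qed
  also note B_def[symmetric]
  finally have b: "norm ((1 + \<xi>) powr (1 - s) - (\<Sum>m<K. ((1 - s) gchoose m) * \<xi> ^ m)) \<le> 2 ^ K * N powr (- real K) * B" .
  have p: "norm (complex_of_real N powr (1 - s)) = N powr (1 - Re s)"
    using norm_of_nat_powr[of "Suc n" "1 - s"] by (simp add: N_def)
  have "norm (zeta_rem K s n) \<le> N powr (1 - Re s) * (2 ^ K * N powr (- real K) * B)"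
    unfolding zeta_rem_def Nc \<xi>_def[symmetric] norm_mult p by (intro mult_left_mono b) simp
  also have "\<dots> = 2 ^ K * B * (N powr (1 - Re s) * N powr (- real K))" by (simp only: mult_ac)
  also have "N powr (1 - Re s) * N powr (- real K) = N powr (1 - Re s - real K)"
    by (simp add: powr_add[symmetric])
  finally show ?thesis by (simp add: N_def B_def)
qed

lemma holomorphic_on_gbinomial [holomorphic_intros]:
  fixes f :: "complex \<Rightarrow> complex"
  assumes "f holomorphic_on U" shows "(\<lambda>s. f s gchoose m) holomorphic_on U"
  unfolding gbinomial_prod_rev using assms by (intro holomorphic_intros) auto

lemma zeta_rem_sum_holomorphic:
  "(\<lambda>s. \<Sum>n. zeta_rem K s n) holomorphic_on {s. Re s > 2 - real K}"
proof (rule suminf_holomorphic_on)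
  show "open {s. Re s > 2 - real K}" by (rule open_halfspace_Re_gt)
  fix n
  have "1 + 1 / complex_of_nat (n + 2) = complex_of_real (1 + 1 / real (n + 2))" by simp
  moreover have "1 + 1 / real (n + 2) > 0" by (simp add: add_pos_nonneg)
  ultimately have n: "1 + 1 / complex_of_nat (n + 2) \<noteq> 0" by (metis less_irrefl of_real_eq_0_iff)
  have n2: "complex_of_nat (n + 2) \<noteq> 0" by (simp only: of_nat_eq_0_iff)
  show "(\<lambda>s. zeta_rem K s n) holomorphic_on {s. Re s > 2 - real K}"
    unfolding zeta_rem_def using n n2 by (intro holomorphic_intros) auto
next
  fix z assume "z \<in> {s. Re s > 2 - real K}"
  hence z: "Re z > 2 - real K" by simp
  \<comment> \<open>Half the distance to the boundary line, so that the exponent \<open>e\<close>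
    stays below -1 on the whole disc.\<close>
  define r where "r = (Re z - (2 - real K)) / 2"
  have r: "r > 0" using z by (simp add: r_def)
  define A where "A = norm (1 - z) + r"
  define B where "B = 2 ^ K * (\<Sum>n. pochhammer A n / fact n * (1/2 :: real) ^ n)"
  have pA: "pochhammer A n \<ge> 0" for n using norm_pochhammer_le[of 0 A n] r norm_ge_zero order_trans
    by (metis A_def add_nonneg_nonneg less_imp_le norm_zero)
  have B: "B \<ge> 0" unfolding B_def using pA by (intro mult_nonneg_nonneg suminf_nonneg summable_pochhammer_half) auto
  define e where "e = 1 - (Re z - r) - real K"
  have e: "e < -1" using z unfolding e_def r_def by (simp add: field_simps)
  show "\<exists>r>0. \<exists>g. summable g \<and> (\<forall>w\<in>ball z r \<inter> {s. Re s > 2 - real K}. \<forall>n. norm (zeta_rem K w n) \<le> g n)"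
  proof (rule exI[of _ r], intro conjI r, rule exI[of _ "\<lambda>n. B * real (n + 2) powr e"], intro conjI ballI allI)
    show "summable (\<lambda>n. B * real (n + 2) powr e)" by (intro summable_mult summable_shift2_powr e)
    fix w n assume w: "w \<in> ball z r \<inter> {s. Re s > 2 - real K}"
    hence d: "norm (z - w) < r" by (simp add: dist_norm)
    have "norm (1 - w) \<le> norm (1 - z) + norm (z - w)" using norm_triangle_ineq[of "1 - z" "z - w"] by simp
    hence "norm (1 - w) \<le> A" using d by (simp add: A_def)
    hence "norm (zeta_rem K w n) \<le> B * real (n + 2) powr (1 - Re w - real K)" unfolding B_def by (rule zeta_rem_bound)
    also have "\<dots> \<le> B * real (n + 2) powr e"
    proof (intro mult_left_mono B powr_mono)
      show "1 - Re w - real K \<le> e" using abs_Re_le_cmod[of "z - w"] d by (simp add: e_def)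
    qed simp
    finally show "norm (zeta_rem K w n) \<le> B * real (n + 2) powr e" .
  qed
qed

lemma gbinomial_Suc_eq:
  fixes a :: complex
  shows "a gchoose Suc k = (a gchoose k) * (a - of_nat k) / of_nat (Suc k)"
  by (simp add: gbinomial_prod_rev field_simps del: of_nat_Suc)

text \<open>Telescope N^(1 - s) and expand each difference. Order 1 gives (s - 1)
  \<open>zeta_tail s\<close>, and the higher orders give tails at s + 1, s + 2 and so on, each
  grouped with the factor that makes it again of the form (t - 1)
  \<open>zeta_tail t\<close>.\<close>

lemma zeta_tail_recurrence:
  assumes s: "Re s > 1"
  shows "(s - 1) * zeta_tail s = 2 powr (1 - s) + (\<Sum>n. zeta_rem (K + 2) s n)
     - (\<Sum>i<K. ((1 - s) gchoose Suc i) / of_nat (i + 2) * ((s + of_nat i) * zeta_tail (s + of_nat i + 1)))"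
proof -
  define G where "G n = complex_of_nat (n + 2) powr (1 - s)" for n
  define u where "u n = - G n" for n
  have lim: "G \<longlonglongrightarrow> 0"
  proof (rule tendsto_norm_zero_cancel)
    have "norm (G n) = real (n + 2) powr (1 - Re s)" for n
      unfolding G_def using norm_of_nat_powr[of "Suc n" "1 - s"] by simp
    moreover have "(\<lambda>n. real (n + 2) powr (1 - Re s)) \<longlonglongrightarrow> 0"
      using s by (intro tendsto_neg_powr filterlim_compose[OF filterlim_real_sequentially] filterlim_add_const_nat_at_top) simp
    ultimately show "(\<lambda>n. norm (G n)) \<longlonglongrightarrow> 0" by simp
  qed
  have "(\<lambda>n. G (Suc n) - G n) sums (0 - G 0)" by (rule telescope_sums[OF lim])
  hence t: "(\<lambda>n. G (Suc n) - G n) sums (- (2 powr (1 - s)))" by (simp add: G_def)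
  have e1: "G n * (1 + 1 / of_nat (n + 2)) powr (1 - s) = G (Suc n)" for n
  proof -
    define N where "N = real (n + 2)"
    have N: "N > 0" by (simp add: N_def)
    have Nc: "of_nat (n + 2) = complex_of_real N" by (simp add: N_def)
    have "complex_of_real N powr (1 - s) * (1 + 1 / complex_of_real N) powr (1 - s) = (complex_of_real N * (1 + 1 / complex_of_real N)) powr (1 - s)"
      by (rule powr_times_real_left[symmetric]) (use N in auto)
    also have "complex_of_real N * (1 + 1 / complex_of_real N) = of_nat (Suc n + 2)"
    proof -
      have "complex_of_real N * (1 + 1 / complex_of_real N) = complex_of_real N + 1" using N by (simp add: distrib_left)
      thus ?thesis by (simp add: N_def)
    qed
    finally show ?thesis unfolding G_def Nc .
  qed
  have e2: "G n * (1 / of_nat (n + 2)) ^ m = 1 / of_nat (n + 2) powr (s + of_nat m - 1)" for n m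
  proof -
    have n2: "complex_of_nat (n + 2) \<noteq> 0" by (simp only: of_nat_eq_0_iff)
    have "of_nat (n + 2) powr (1 - s) = of_nat (n + 2) powr (of_nat m - (s + of_nat m - 1))" by simp
    also have "\<dots> = complex_of_nat (n + 2) ^ m / of_nat (n + 2) powr (s + of_nat m - 1)"
      unfolding powr_diff using n2 by (simp only: powr_nat' simp_thms)
    finally have g: "G n = complex_of_nat (n + 2) ^ m / of_nat (n + 2) powr (s + of_nat m - 1)" unfolding G_def .
    have "(A::complex) ^ m / P * (1 / A) ^ m = 1 / P" if "A \<noteq> 0" for A P using that by (simp add: power_divide)
    from this[OF n2] show ?thesis unfolding g .
  qed
  have zr: "zeta_rem (K + 2) s n = (G (Suc n) - G n) - (\<Sum>j<Suc K. ((1 - s) gchoose Suc j) * (1 / of_nat (n + 2) powr (s + of_nat j)))" for n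
  proof -
    have "(\<Sum>m<K + 2. ((1 - s) gchoose m) * (1 / of_nat (n + 2)) ^ m) = 1 + (\<Sum>j<Suc K. ((1 - s) gchoose Suc j) * (1 / of_nat (n + 2)) ^ Suc j)"
      unfolding add_2_eq_Suc' by (subst sum.lessThan_Suc_shift) simp
    hence "zeta_rem (K + 2) s n = G n * (1 + 1 / of_nat (n + 2)) powr (1 - s) - G n - (\<Sum>j<Suc K. ((1 - s) gchoose Suc j) * (G n * (1 / of_nat (n + 2)) ^ Suc j))"
      unfolding zeta_rem_def G_def[symmetric] by (simp only: right_diff_distrib distrib_left sum_distrib_left mult_1_right mult.left_commute[of "G n"] diff_diff_eq)
    thus ?thesis unfolding e1 e2 by simp
  qed
  have js: "(\<lambda>n. \<Sum>j<Suc K. ((1 - s) gchoose Suc j) * (1 / of_nat (n + 2) powr (s + of_nat j))) sums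
     (\<Sum>j<Suc K. ((1 - s) gchoose Suc j) * zeta_tail (s + of_nat j))"
    using s by (intro sums_sum sums_mult zeta_tail_sums) simp
  have "(\<lambda>n. zeta_rem (K + 2) s n) sums (- (2 powr (1 - s)) - (\<Sum>j<Suc K. ((1 - s) gchoose Suc j) * zeta_tail (s + of_nat j)))"
    unfolding zr by (rule sums_diff[OF t js])
  hence S: "(\<Sum>n. zeta_rem (K + 2) s n) = - (2 powr (1 - s)) - (\<Sum>j<Suc K. ((1 - s) gchoose Suc j) * zeta_tail (s + of_nat j))"
    by (rule sums_unique[symmetric])
  have "(\<Sum>j<Suc K. ((1 - s) gchoose Suc j) * zeta_tail (s + of_nat j)) =
     (1 - s) * zeta_tail s + (\<Sum>i<K. ((1 - s) gchoose Suc (Suc i)) * zeta_tail (s + of_nat (Suc i)))"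
    by (subst sum.lessThan_Suc_shift) simp
  also have "(\<Sum>i<K. ((1 - s) gchoose Suc (Suc i)) * zeta_tail (s + of_nat (Suc i))) =
     (\<Sum>i<K. - (((1 - s) gchoose Suc i) / of_nat (i + 2) * ((s + of_nat i) * zeta_tail (s + of_nat i + 1))))"
  proof (rule sum.cong[OF refl])
    fix i
    \<comment> \<open>The last factor of the binomial coefficient supplies s + i, which is t - 1 for
      t = s + i + 1.\<close>
    have "1 - s - of_nat (Suc i) = - (s + of_nat i)" "s + of_nat (Suc i) = s + of_nat i + 1" "Suc (Suc i) = i + 2" by simp_all
    thus "((1 - s) gchoose Suc (Suc i)) * zeta_tail (s + of_nat (Suc i)) = - (((1 - s) gchoose Suc i) / of_nat (i + 2) * ((s + of_nat i) * zeta_tail (s + of_nat i + 1)))"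
      unfolding gbinomial_Suc_eq[of "1 - s" "Suc i"] by (simp only: mult_minus_right mult_minus_left divide_minus_left times_divide_eq_left times_divide_eq_right mult_ac minus_divide_left[symmetric])
  qed
  finally have J: "(\<Sum>j<Suc K. ((1 - s) gchoose Suc j) * zeta_tail (s + of_nat j)) = (1 - s) * zeta_tail s
      - (\<Sum>i<K. ((1 - s) gchoose Suc i) / of_nat (i + 2) * ((s + of_nat i) * zeta_tail (s + of_nat i + 1)))"
    by (simp only: sum_negf) simp
  show ?thesis unfolding S J by (simp add: algebra_simps)
qed

text \<open>The product (s - 1) \<open>zeta_tail s\<close> has no pole, so the recurrence can be
  iterated: its right side needs the product only at the points s + i + 1, and each round gains one
  unit to the left.\<close>

lemma zeta_tail_continuation_halfplane:
  "\<exists>h. h holomorphic_on {s. Re s > 1 - real K} \<and> (\<forall>s. Re s > 1 \<longrightarrow> h s = (s - 1) * zeta_tail s)"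
proof (induction K)
  case 0
  have "(\<lambda>s. 2 powr (1 - s) + (\<Sum>n. zeta_rem 2 s n)) holomorphic_on {s. Re s > 1}"
    using zeta_rem_sum_holomorphic[of 2] by (intro holomorphic_intros holomorphic_on_subset[OF zeta_rem_sum_holomorphic[of 2]]) auto
  moreover have "2 powr (1 - s) + (\<Sum>n. zeta_rem 2 s n) = (s - 1) * zeta_tail s" if "Re s > 1" for s
    using zeta_tail_recurrence[OF that, of 0] by (simp only: add_0 lessThan_0 sum.empty diff_zero)
  ultimately show ?case by (intro exI[of _ "\<lambda>s. 2 powr (1 - s) + (\<Sum>n. zeta_rem 2 s n)"]) simp
next
  case (Suc K)
  then obtain h where h: "h holomorphic_on {s. Re s > 1 - real K}" "\<And>s. Re s > 1 \<Longrightarrow> h s = (s - 1) * zeta_tail s" by blast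
  define k where "k s = 2 powr (1 - s) + (\<Sum>n. zeta_rem (K + 2) s n)
     - (\<Sum>i<K. ((1 - s) gchoose Suc i) / of_nat (i + 2) * h (s + of_nat i + 1))" for s
  have hs: "(\<lambda>s. h (s + of_nat i + 1)) holomorphic_on {s. Re s > 1 - real (Suc K)}" for i
    by (rule holomorphic_on_compose_gen[OF _ h(1), unfolded o_def]) (auto intro!: holomorphic_intros)
  have "(\<lambda>s. \<Sum>n. zeta_rem (K + 2) s n) holomorphic_on {s. Re s > 1 - real (Suc K)}"
    by (rule holomorphic_on_subset[OF zeta_rem_sum_holomorphic]) auto
  moreover have "complex_of_nat (i + 2) \<noteq> 0" for i by (simp only: of_nat_eq_0_iff)
  ultimately have "k holomorphic_on {s. Re s > 1 - real (Suc K)}"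
    unfolding k_def [abs_def] by (intro holomorphic_intros hs) auto
  moreover have "k s = (s - 1) * zeta_tail s" if s: "Re s > 1" for s
  proof -
    have "h (s + of_nat i + 1) = (s + of_nat i) * zeta_tail (s + of_nat i + 1)" for i
      using h(2)[of "s + of_nat i + 1"] s by simp
    thus ?thesis unfolding k_def zeta_tail_recurrence[OF s, of K] by simp
  qed
  ultimately show ?case by (intro exI[of _ k]) simp
qed

lemma zeta_continuation:
  "\<exists>f. f holomorphic_on (- {1}) \<and> (\<forall>s. Re s > 1 \<longrightarrow> (\<lambda>n. 1 / of_nat (Suc n) powr s) sums f s)"
proof -
  obtain H where H: "\<And>K. H K holomorphic_on {s. Re s > 1 - real K}" "\<And>K s. Re s > 1 \<Longrightarrow> H K s = (s - 1) * zeta_tail s"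
    using zeta_tail_continuation_halfplane by metis
  have agree: "H K s = H L s" if "K \<le> L" "Re s > 1 - real K" for K L s
  proof (rule analytic_continuation_open[where s = "{s. Re s > 1}" and s' = "{s. Re s > 1 - real K}" and f = "H K" and g = "H L"])
    show "H L holomorphic_on {s. Re s > 1 - real K}" by (rule holomorphic_on_subset[OF H(1)]) (use that in auto)
    have "(2::complex) \<in> {s. Re s > 1}" by simp
    thus "{s::complex. Re s > 1} \<noteq> {}" by blast
  qed (use that H in \<open>auto intro: open_halfspace_Re_gt convex_connected convex_halfspace_Re_gt\<close>)
  \<comment> \<open>This index puts s strictly inside the half-plane; by \<open>agree\<close> every
    other admissible index gives the same value.\<close>
  define h where "h s = H (nat \<lceil>2 - Re s\<rceil>) s" for s
  have hH: "h s = H K s" if "Re s > 1 - real K" for s K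
  proof -
    have "Re s > 1 - real (nat \<lceil>2 - Re s\<rceil>)" by linarith
    thus ?thesis unfolding h_def using agree that by (metis nle_le)
  qed
  have "h field_differentiable at s" for s
  proof -
    define K where "K = nat \<lceil>2 - Re s\<rceil>"
    have K: "s \<in> {s. Re s > 1 - real K}" unfolding K_def by simp linarith
    have "h holomorphic_on {s. Re s > 1 - real K}"
      by (rule holomorphic_transform[OF H(1)[of K]]) (simp add: hH)
    thus ?thesis using K open_halfspace_Re_gt holomorphic_on_imp_differentiable_at by blast
  qed
  hence "h field_differentiable at s within U" for s U by (rule field_differentiable_at_within)
  hence hol: "h holomorphic_on U" for U by (rule holomorphic_onI)
  \<comment> \<open>The summand 1 restores the first term of the Dirichlet series, and division by s
    - 1 confines the singularity to 1.\<close>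
  have "(\<lambda>s. 1 + h s / (s - 1)) holomorphic_on (- {1})"
    by (intro holomorphic_intros hol) auto
  moreover have "(\<lambda>n. 1 / of_nat (Suc n) powr s) sums (1 + h s / (s - 1))" if s: "Re s > 1" for s
  proof -
    have "s \<noteq> 1" using s by auto
    moreover have "h s = (s - 1) * zeta_tail s" using hH[of 0 s] H(2)[OF s] s by simp
    ultimately have "h s / (s - 1) = zeta_tail s" by simp
    moreover have "(\<lambda>n. 1 / of_nat (Suc (Suc n)) powr s) sums zeta_tail s" using zeta_tail_sums[OF s] by simp
    hence "(\<lambda>n. 1 / of_nat (Suc n) powr s) sums (zeta_tail s + 1 / of_nat (Suc 0) powr s)" by (rule sums_Suc)
    ultimately show ?thesis by (simp add: add.commute)
  qed
  ultimately show ?thesis by blast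
qed

lemma riemann_zeta_holomorphic: "riemann_zeta holomorphic_on (- {1})"
  and riemann_zeta_sums: "Re s > 1 \<Longrightarrow> (\<lambda>n. 1 / of_nat (Suc n) powr s) sums riemann_zeta s"
  using someI_ex[OF zeta_continuation] unfolding riemann_zeta_def[symmetric] by blast+


section \<open>Remainders of the hypergeometric series\<close>

definition F_term :: "complex \<Rightarrow> complex \<Rightarrow> complex \<Rightarrow> nat \<Rightarrow> complex \<Rightarrow> nat \<Rightarrow> complex" where
  "F_term x a d M w n = 1 / of_nat n powr (2 * w + 1) *
     (hyp (1/2 + w) (a + w) d (xi x n) - (\<Sum>m<M. hyp_coeff (1/2 + w) (a + w) d m * xi x n ^ m))"

lemma summable_norm_hyp_coeff_half:
  assumes "d \<notin> \<int>\<^sub>\<le>\<^sub>0"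
  shows "summable (\<lambda>n. norm (hyp_coeff \<alpha> b d n) * (1/2) ^ n)"
proof -
  \<comment> \<open>Convergence at 3/4, inside the unit disc, gives absolute convergence at
    1/2.\<close>
  have "summable (\<lambda>n. hyp_coeff \<alpha> b d n * (3/4) ^ n)"
    using hyp_sums[OF assms, of "3/4" \<alpha> b] by (auto simp: sums_iff)
  hence "summable (\<lambda>n. norm (hyp_coeff \<alpha> b d n * (1/2) ^ n))" by (rule powser_insidea) simp
  thus ?thesis by (simp add: norm_mult norm_power)
qed

text \<open>One real bound for both upper parameters gives a majorant independent of w on a disc,
  while the lower parameter stays fixed.\<close>

lemma norm_hyp_coeff_le:
  assumes "norm \<alpha> \<le> A" "norm b \<le> A"
  shows "norm (hyp_coeff \<alpha> b d n) \<le> norm (hyp_coeff (of_real A) (of_real A) d n)"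
proof -
  have A: "A \<ge> 0" using assms(1) norm_ge_zero order_trans by blast
  have pn: "pochhammer A n \<ge> 0" unfolding pochhammer_prod using A by (intro prod_nonneg) simp
  have p: "norm (pochhammer (complex_of_real A) n) = pochhammer A n"
    using pn by (simp add: pochhammer_of_real)
  show ?thesis unfolding hyp_coeff_def norm_divide norm_mult p
    using norm_pochhammer_le[OF assms(1), of n] norm_pochhammer_le[OF assms(2), of n] pn
    by (intro divide_right_mono mult_mono) auto
qed

lemma norm_xi_Suc: "norm (xi x (Suc n)) = norm (xi x 1) / (real (Suc n))\<^sup>2"
  unfolding xi_Suc[of x n] norm_mult norm_of_real by simp

text \<open>Subtracting M Taylor terms gains the factor |\<xi>_n|^M, that is n^(-2 M). The total
  exponent -2 Re w - 1 - 2 M is below -1 exactly when Re w > -M.\<close>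

lemma F_term_bound:
  assumes d: "d \<notin> \<int>\<^sub>\<le>\<^sub>0" and A: "norm (1/2 + w) \<le> A" "norm (a + w) \<le> A" and n: "norm (xi x (Suc n)) \<le> 1/2"
  shows "norm (F_term x a d M w (Suc n)) \<le> (2 * norm (xi x 1)) ^ M *
     (\<Sum>n. norm (hyp_coeff (of_real A) (of_real A) d n) * (1/2) ^ n) * real (Suc n) powr (- (2 * Re w + 1) - 2 * real M)"
proof -
  define G where "G = (\<Sum>n. norm (hyp_coeff (of_real A) (of_real A) d n) * (1/2 :: real) ^ n)"
  define N where "N = real (Suc n)"
  have N: "N > 0" by (simp add: N_def)
  define D where "D = hyp (1/2 + w) (a + w) d (xi x (Suc n)) - (\<Sum>m<M. hyp_coeff (1/2 + w) (a + w) d m * xi x (Suc n) ^ m)"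
  have "norm (xi x (Suc n)) < 1" using n by simp
  from power_series_remainder_bound[OF hyp_sums[OF d this] norm_hyp_coeff_le[OF A] summable_norm_hyp_coeff_half[OF d] n half_gt_zero[OF zero_less_one], of M]
  have b: "norm D \<le> (norm (xi x (Suc n)) / (1/2)) ^ M * G" unfolding D_def G_def .
  have e: "(norm (xi x (Suc n)) / (1/2)) ^ M = (2 * norm (xi x 1)) ^ M * N powr (- 2 * real M)"
  proof -
    have "(X / N\<^sup>2 / (1/2)) ^ M = (2 * X) ^ M * inverse (N ^ (2 * M))" for X
    proof -
      have "u / v / (1/2) = (2 * u) * inverse v" for u v :: real
      proof -
        have "u / v / (1/2) = (2 * u) / v" by simp
        thus ?thesis unfolding divide_inverse[of "2 * u"] .
      qed
      hence "X / N\<^sup>2 / (1/2) = (2 * X) * inverse (N\<^sup>2)" .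
      thus ?thesis by (simp only: power_mult_distrib power_inverse power_mult)
    qed
    moreover have "N powr (- 2 * real M) = inverse (N ^ (2 * M))"
    proof -
      have "- 2 * real M = - real (2 * M)" by simp
      thus ?thesis using powr_realpow[OF N, of "2 * M"] by (simp only: powr_minus)
    qed
    ultimately show ?thesis unfolding norm_xi_Suc[of x n] N_def[symmetric] by (simp only:)
  qed
  have b': "norm D \<le> (2 * norm (xi x 1)) ^ M * N powr (- 2 * real M) * G" using b unfolding e .
  have p: "norm (1 / of_nat (Suc n) powr (2 * w + 1) :: complex) = N powr (- (2 * Re w + 1))"
  proof -
    have "Re (2 * w + 1) = 2 * Re w + 1" by simp
    thus ?thesis by (simp only: N_def norm_divide norm_one norm_of_nat_powr powr_minus inverse_eq_divide)
  qed
  have "norm (F_term x a d M w (Suc n)) \<le> N powr (- (2 * Re w + 1)) * ((2 * norm (xi x 1)) ^ M * N powr (- 2 * real M) * G)"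
    unfolding F_term_def D_def[symmetric] norm_mult p by (intro mult_left_mono b') simp
  also have "\<dots> = (2 * norm (xi x 1)) ^ M * G * (N powr (- (2 * Re w + 1)) * N powr (- 2 * real M))" by (simp only: mult_ac)
  also have "N powr (- (2 * Re w + 1)) * N powr (- 2 * real M) = N powr (- (2 * Re w + 1) - 2 * real M)"
    unfolding powr_add[symmetric] by simp
  finally show ?thesis by (simp add: N_def G_def)
qed

lemma F_term_local:
  assumes d: "d \<notin> \<int>\<^sub>\<le>\<^sub>0" and w: "Re w > - real M"
  shows "\<exists>r>0. \<exists>g. summable g \<and> (\<forall>v\<in>ball w r. \<forall>n. norm (xi x (Suc n)) \<le> 1/2 \<longrightarrow> norm (F_term x a d M v (Suc n)) \<le> g n)"
proof -
  \<comment> \<open>Half the distance to the line Re w = -M, which keeps the exponent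
    \<open>e\<close> below -1 on the disc.\<close>
  define r where "r = (Re w + real M) / 2"
  have r: "r > 0" using w by (simp add: r_def)
  define A where "A = norm (1/2 + w) + norm (a + w) + r"
  define B where "B = (2 * norm (xi x 1)) ^ M * (\<Sum>n. norm (hyp_coeff (of_real A) (of_real A) d n) * (1/2 :: real) ^ n)"
  define e where "e = - (2 * (Re w - r) + 1) - 2 * real M"
  have e: "e < -1" using w unfolding e_def r_def by simp
  have B: "B \<ge> 0" unfolding B_def by (intro mult_nonneg_nonneg zero_le_power suminf_nonneg summable_norm_hyp_coeff_half d) auto
  show ?thesis
  proof (rule exI[of _ r], intro conjI r, rule exI[of _ "\<lambda>n. B * real (Suc n) powr e"], intro conjI ballI allI impI)
    show "summable (\<lambda>n. B * real (Suc n) powr e)" by (intro summable_mult summable_Suc_powr e)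
    fix v n assume v: "v \<in> ball w r" and n: "norm (xi x (Suc n)) \<le> 1/2"
    have dv: "norm (v - w) < r" using v by (simp add: dist_norm norm_minus_commute)
    have "norm (1/2 + v) \<le> norm (1/2 + w) + norm (v - w)" using norm_triangle_ineq[of "1/2 + w" "v - w"] by simp
    hence A1: "norm (1/2 + v) \<le> A" using dv norm_ge_zero[of "a + w"] unfolding A_def by linarith
    have "norm (a + v) \<le> norm (a + w) + norm (v - w)" using norm_triangle_ineq[of "a + w" "v - w"] by simp
    hence A2: "norm (a + v) \<le> A" using dv norm_ge_zero[of "1/2 + w"] unfolding A_def by linarith
    have "norm (F_term x a d M v (Suc n)) \<le> B * real (Suc n) powr (- (2 * Re v + 1) - 2 * real M)"
      unfolding B_def by (rule F_term_bound[OF d A1 A2 n])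
    also have "\<dots> \<le> B * real (Suc n) powr e"
    proof (intro mult_left_mono B powr_mono)
      have Re_v: "Re w - r \<le> Re v" using abs_Re_le_cmod[of "v - w"] dv by simp
      show "- (2 * Re v + 1) - 2 * real M \<le> e"
        unfolding e_def by (intro diff_right_mono le_imp_neg_le add_right_mono mult_left_mono Re_v) simp
    qed simp
    finally show "norm (F_term x a d M v (Suc n)) \<le> B * real (Suc n) powr e" .
  qed
qed

lemma xi_eventually_small: "\<exists>N. \<forall>n\<ge>N. norm (xi x (Suc n)) \<le> 1/2"
proof -
  have "(\<lambda>n. norm (xi x 1) * inverse (real (Suc n)) ^ 2) \<longlonglongrightarrow> norm (xi x 1) * 0 ^ 2"
    by (intro tendsto_mult tendsto_const tendsto_power LIMSEQ_inverse_real_of_nat)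
  moreover have "norm (xi x (Suc n)) = norm (xi x 1) * inverse (real (Suc n)) ^ 2" for n
    unfolding norm_xi_Suc[of x n] divide_inverse power_inverse ..
  ultimately have "(\<lambda>n. norm (xi x (Suc n))) \<longlonglongrightarrow> 0" by (simp only: zero_power2 mult_zero_right)
  hence "eventually (\<lambda>n. norm (xi x (Suc n)) < 1/2) sequentially" by (rule order_tendstoD) simp
  thus ?thesis unfolding eventually_sequentially by (meson less_imp_le)
qed

lemma F_term_summable:
  assumes d: "d \<notin> \<int>\<^sub>\<le>\<^sub>0" and w: "Re w > - real M"
  shows "summable (\<lambda>n. F_term x a d M w (Suc n))"
proof -
  obtain N where N: "\<forall>n\<ge>N. norm (xi x (Suc n)) \<le> 1/2" using xi_eventually_small by blast
  from F_term_local[OF d w, of x a] obtain r g where g: "r > 0" "summable g"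
    "\<forall>v\<in>ball w r. \<forall>n. norm (xi x (Suc n)) \<le> 1/2 \<longrightarrow> norm (F_term x a d M v (Suc n)) \<le> g n" by (elim exE conjE) (rule that)
  have "w \<in> ball w r" using g(1) by simp
  from bspec[OF g(3) this] have "norm (F_term x a d M w (Suc n)) \<le> g n" if "n \<ge> N" for n using N that by blast
  with g(2) show ?thesis by (rule summable_comparison_test')
qed

lemma F_term_holomorphic:
  assumes x: "Re x > 0" and d: "d \<notin> \<int>\<^sub>\<le>\<^sub>0"
  shows "(\<lambda>w. F_term x a d M w (Suc n)) holomorphic_on UNIV"
proof -
  have xs: "xi x (Suc n) \<in> slit_plane" using xi_in_slit_plane[OF x, of 1 n] by simp
  have pd: "pochhammer d m \<noteq> 0" for m using d by (auto simp: pochhammer_eq_0_iff)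
  have poch: "(\<lambda>w. pochhammer (c + w) m) holomorphic_on UNIV" for c :: complex and m
    unfolding pochhammer_prod by (intro holomorphic_intros)
  have "(\<lambda>w. hyp (1/2 + w) (a + w) d (xi x (Suc n))) holomorphic_on UNIV"
    by (rule hyp_holomorphic_params[OF open_UNIV _ _ _ d xs]) (intro holomorphic_intros)+
  moreover have "complex_of_nat (Suc n) \<noteq> 0" by (rule of_nat_neq_0)
  ultimately show ?thesis unfolding F_term_def hyp_coeff_def
    using pd by (intro holomorphic_intros poch) auto
qed

text \<open>The Taylor estimate only reaches indices with |\<xi>_n| \<le> 1/2. The first N terms
  form a finite holomorphic sum, and the tail is dominated locally uniformly.\<close>

lemma F_term_sum_holomorphic:
  assumes x: "Re x > 0" and d: "d \<notin> \<int>\<^sub>\<le>\<^sub>0"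
  shows "(\<lambda>w. \<Sum>n. F_term x a d M w (Suc n)) holomorphic_on {w. Re w > - real M}"
proof -
  obtain N where N: "\<forall>n\<ge>N. norm (xi x (Suc n)) \<le> 1/2" using xi_eventually_small by blast
  have o: "open {w. Re w > - real M}" by (rule open_halfspace_Re_gt)
  have h: "(\<lambda>w. F_term x a d M w (Suc n)) holomorphic_on {w. Re w > - real M}" for n
    by (rule holomorphic_on_subset[OF F_term_holomorphic[OF assms]]) simp
  have t: "(\<lambda>w. \<Sum>n. F_term x a d M w (Suc (n + N))) holomorphic_on {w. Re w > - real M}"
  proof (rule suminf_holomorphic_on[OF o h])
    fix w assume "w \<in> {w. Re w > - real M}"
    hence "Re w > - real M" by simp
    from F_term_local[OF d this, of x a] obtain r g where g: "r > 0" "summable g"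
      "\<forall>v\<in>ball w r. \<forall>n. norm (xi x (Suc n)) \<le> 1/2 \<longrightarrow> norm (F_term x a d M v (Suc n)) \<le> g n" by (elim exE conjE) (rule that)
    show "\<exists>r>0. \<exists>g. summable g \<and> (\<forall>v\<in>ball w r \<inter> {w. Re w > - real M}. \<forall>n. norm (F_term x a d M v (Suc (n + N))) \<le> g n)"
      by (rule exI[of _ r], intro conjI g(1), rule exI[of _ "\<lambda>n. g (n + N)"])
         (use N g(3) summable_ignore_initial_segment[OF g(2)] in auto)
  qed
  have "(\<lambda>w. (\<Sum>n. F_term x a d M w (Suc (n + N))) + (\<Sum>n<N. F_term x a d M w (Suc n))) holomorphic_on {w. Re w > - real M}"
    by (intro holomorphic_on_add holomorphic_on_sum t h)
  thus ?thesis
  proof (rule holomorphic_transform)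
    fix w assume "w \<in> {w. Re w > - real M}"
    hence "Re w > - real M" by simp
    from suminf_split_initial_segment[OF F_term_summable[OF d this, of x a], of N]
    show "(\<Sum>n. F_term x a d M w (Suc (n + N))) + (\<Sum>n<N. F_term x a d M w (Suc n)) = (\<Sum>n. F_term x a d M w (Suc n))"
      by (rule sym)
  qed
qed

section \<open>The right side as a holomorphic function of z\<close>

definition regular_part :: "complex \<Rightarrow> complex \<Rightarrow> complex \<Rightarrow> nat \<Rightarrow> complex \<Rightarrow> complex" where
  "regular_part x a d M w = 1 / of_real (sqrt pi) * (x / (2 * of_real pi)) powr (2 * w) *
     (Gamma (w + 1/2) * Gamma (a + w) * rGamma d * (\<Sum>n. F_term x a d M w (Suc n))
      + (\<Sum>m<M. Gamma (w + 1/2 + of_nat m) * Gamma (a + w + of_nat m) * rGamma (d + of_nat m) *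
            riemann_zeta (2 * w + 2 * of_nat m + 1) / fact m * xi x 1 ^ m))"

text \<open>The first removed set covers the poles of Gamma w, of Gamma (w + 1/2) and of the zeta
  factors, which lie at w = -m; the second covers those of Gamma (a + w). Both are countable, so
  connectedness survives.\<close>

definition identity_domain :: "complex \<Rightarrow> nat \<Rightarrow> complex set" where
  "identity_domain a M = {w. Re w > - real M} - ({w. 2 * w \<in> \<int>\<^sub>\<le>\<^sub>0} \<union> {w. a + w \<in> \<int>\<^sub>\<le>\<^sub>0})"

lemma open_identity_domain: "open (identity_domain a M)"
proof -
  have "open ((\<lambda>w. 2 * w) -` (- \<int>\<^sub>\<le>\<^sub>0 :: complex set))" "open ((\<lambda>w. a + w) -` (- \<int>\<^sub>\<le>\<^sub>0))"
    by (intro open_vimage open_compl_nonpos_Ints continuous_intros)+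
  hence "open ({w. Re w > - real M} \<inter> ((\<lambda>w. 2 * w) -` (- \<int>\<^sub>\<le>\<^sub>0) \<inter> (\<lambda>w. a + w) -` (- \<int>\<^sub>\<le>\<^sub>0)))"
    by (intro open_Int open_halfspace_Re_gt)
  moreover have "identity_domain a M = {w. Re w > - real M} \<inter> ((\<lambda>w. 2 * w) -` (- \<int>\<^sub>\<le>\<^sub>0) \<inter> (\<lambda>w. a + w) -` (- \<int>\<^sub>\<le>\<^sub>0))"
    unfolding identity_domain_def by blast
  ultimately show ?thesis by simp
qed

lemma connected_identity_domain: "connected (identity_domain a M)"
  unfolding identity_domain_def
proof (rule connected_open_diff_countable)
  have "countable ((\<lambda>k. k / 2) ` (\<int>\<^sub>\<le>\<^sub>0 :: complex set) \<union> (\<lambda>k. k - a) ` \<int>\<^sub>\<le>\<^sub>0)"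
    by (intro countable_Un countable_image countable_nonpos_Ints)
  moreover have "{w. 2 * w \<in> \<int>\<^sub>\<le>\<^sub>0} \<union> {w. a + w \<in> \<int>\<^sub>\<le>\<^sub>0} \<subseteq> (\<lambda>k. k / 2) ` (\<int>\<^sub>\<le>\<^sub>0 :: complex set) \<union> (\<lambda>k. k - a) ` \<int>\<^sub>\<le>\<^sub>0"
  proof
    fix w assume "w \<in> {w. 2 * w \<in> \<int>\<^sub>\<le>\<^sub>0} \<union> {w. a + w \<in> \<int>\<^sub>\<le>\<^sub>0}"
    moreover have "w = 2 * w / 2" "w = a + w - a" by simp_all
    ultimately show "w \<in> (\<lambda>k. k / 2) ` (\<int>\<^sub>\<le>\<^sub>0 :: complex set) \<union> (\<lambda>k. k - a) ` \<int>\<^sub>\<le>\<^sub>0" by blast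
  qed
  ultimately show "countable ({w. 2 * w \<in> \<int>\<^sub>\<le>\<^sub>0} \<union> {w. a + w \<in> \<int>\<^sub>\<le>\<^sub>0})" by (rule countable_subset[rotated])
qed (auto intro: open_halfspace_Re_gt convex_connected convex_halfspace_Re_gt)

lemma nonpos_Int_add_nat:
  fixes c :: complex
  assumes "c + of_nat m \<in> \<int>\<^sub>\<le>\<^sub>0" shows "c \<in> \<int>\<^sub>\<le>\<^sub>0"
proof -
  from assms obtain k :: int where k: "c + of_nat m = of_int k" "k \<le> 0" by (auto elim!: nonpos_Ints_cases)
  have "c = of_int k - of_nat m" using k(1) by (rule add_implies_diff)
  hence "c = of_int (k - int m)" by simp
  moreover have "k - int m \<le> 0" using k(2) by simp
  ultimately show ?thesis by (metis nonpos_Ints_of_int)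
qed

lemma identity_domainD:
  assumes "w \<in> identity_domain a M"
  shows "Re w > - real M" "a + w + of_nat m \<notin> \<int>\<^sub>\<le>\<^sub>0" "a + w \<notin> \<int>\<^sub>\<le>\<^sub>0" "w \<notin> \<int>\<^sub>\<le>\<^sub>0" "w + 1/2 + of_nat m \<notin> \<int>\<^sub>\<le>\<^sub>0" "w + 1/2 \<notin> \<int>\<^sub>\<le>\<^sub>0"
    "2 * w + 2 * of_nat m + 1 \<noteq> 1"
proof -
  have w: "2 * w \<notin> \<int>\<^sub>\<le>\<^sub>0" "a + w \<notin> \<int>\<^sub>\<le>\<^sub>0" "Re w > - real M" using assms by (auto simp: identity_domain_def)
  show "Re w > - real M" "a + w \<notin> \<int>\<^sub>\<le>\<^sub>0" by fact+
  show "a + w + of_nat m \<notin> \<int>\<^sub>\<le>\<^sub>0" using w nonpos_Int_add_nat by blast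
  show "w \<notin> \<int>\<^sub>\<le>\<^sub>0"
  proof
    assume "w \<in> \<int>\<^sub>\<le>\<^sub>0"
    then obtain k :: int where k: "w = of_int k" "k \<le> 0" by (auto elim!: nonpos_Ints_cases)
    have "2 * w = of_int (2 * k)" using k by simp
    with w(1) k(2) show False by (metis nonpos_Ints_of_int mult_nonneg_nonpos zero_le_numeral)
  qed
  have h: "w + 1/2 + of_nat m \<notin> \<int>\<^sub>\<le>\<^sub>0" for m
  proof
    assume "w + 1/2 + of_nat m \<in> \<int>\<^sub>\<le>\<^sub>0"
    then obtain k :: int where k: "w + 1/2 + of_nat m = of_int k" "k \<le> 0" by (auto elim!: nonpos_Ints_cases)
    have "2 * w = 2 * (w + 1/2 + of_nat m) - 1 - 2 * of_nat m" by (simp add: algebra_simps)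
    also have "\<dots> = of_int (2 * k - 1 - 2 * int m)" unfolding k(1) by simp
    finally have "2 * w = of_int (2 * k - 1 - 2 * int m)" .
    moreover have "2 * k - 1 - 2 * int m \<le> 0" using k(2) by simp
    ultimately show False using w(1) by (metis nonpos_Ints_of_int)
  qed
  show "w + 1/2 + of_nat m \<notin> \<int>\<^sub>\<le>\<^sub>0" by (rule h)
  show "w + 1/2 \<notin> \<int>\<^sub>\<le>\<^sub>0" using h[of 0] by simp
  show "2 * w + 2 * of_nat m + 1 \<noteq> 1"
  proof
    assume e: "2 * w + 2 * of_nat m + 1 = 1"
    hence "2 * w = of_int (- (2 * int m))" by (simp add: eq_neg_iff_add_eq_0)
    moreover have "- (2 * int m) \<le> 0" by simp
    ultimately show False using w(1) by (metis nonpos_Ints_of_int)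
  qed
qed

lemma regular_part_holomorphic:
  assumes x: "Re x > 0" and d: "d \<notin> \<int>\<^sub>\<le>\<^sub>0"
  shows "regular_part x a d M holomorphic_on identity_domain a M"
proof -
  note D = identity_domainD[where a = a and M = M]
  have z: "(\<lambda>w. riemann_zeta (2 * w + 2 * of_nat m + 1)) holomorphic_on identity_domain a M" for m
  proof (rule holomorphic_on_compose_gen[OF _ riemann_zeta_holomorphic, unfolded o_def])
    show "(\<lambda>w. 2 * w + 2 * of_nat m + 1) ` identity_domain a M \<subseteq> - {1}"
    proof (rule image_subsetI)
      fix w assume "w \<in> identity_domain a M"
      from D(7)[OF this, of m] show "2 * w + 2 * of_nat m + 1 \<in> - {1}" by blast
    qed
  qed (intro holomorphic_intros)
  have F: "(\<lambda>w. \<Sum>n. F_term x a d M w (Suc n)) holomorphic_on identity_domain a M"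
    by (rule holomorphic_on_subset[OF F_term_sum_holomorphic[OF assms]]) (use D(1) in blast)
  have x0: "x / (2 * of_real pi) \<noteq> 0" using x by auto
  show ?thesis unfolding regular_part_def [abs_def]
    by (intro holomorphic_intros z F D(2,3,5,6)) (use x0 in simp_all)
qed

text \<open>The m-th subtracted term is a constant times n^(-(2 w + 2 m + 1)); for Re w > 0 its sum
  over n converges to that constant times a zeta value.\<close>

lemma F_term_sum_split:
  assumes x: "Re x > 0" and w: "Re w > 0" and d: "d \<notin> \<int>\<^sub>\<le>\<^sub>0"
  shows "(\<Sum>n. F_term x a d M w (Suc n)) = hyp_sum x a d w -
     (\<Sum>m<M. hyp_coeff (1/2 + w) (a + w) d m * xi x 1 ^ m * riemann_zeta (2 * w + 2 * of_nat m + 1))"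
proof -
  have "summable (\<lambda>n. F_term x a d 0 w (Suc n))" using w by (intro F_term_summable[OF d]) simp
  hence h: "(\<lambda>n. 1 / of_nat (Suc n) powr (2 * w + 1) * hyp (1/2 + w) (a + w) d (xi x (Suc n))) sums hyp_sum x a d w"
    unfolding hyp_sum_def F_term_def by (intro summable_sums) simp
  have z: "(\<lambda>n. hyp_coeff (1/2 + w) (a + w) d m * xi x 1 ^ m * (1 / of_nat (Suc n) powr (2 * w + 2 * of_nat m + 1))) sums
     (hyp_coeff (1/2 + w) (a + w) d m * xi x 1 ^ m * riemann_zeta (2 * w + 2 * of_nat m + 1))" for m
    using w by (intro sums_mult riemann_zeta_sums) simp
  have t: "F_term x a d M w (Suc n) = 1 / of_nat (Suc n) powr (2 * w + 1) * hyp (1/2 + w) (a + w) d (xi x (Suc n)) -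
     (\<Sum>m<M. hyp_coeff (1/2 + w) (a + w) d m * xi x 1 ^ m * (1 / of_nat (Suc n) powr (2 * w + 2 * of_nat m + 1)))" for n
  proof -
    define N where "N = complex_of_nat (Suc n)"
    have N: "N \<noteq> 0" unfolding N_def by (rule of_nat_neq_0)
    have xe: "xi x (Suc n) = xi x 1 / N ^ 2" by (simp add: xi_def N_def)
    have "1 / N powr (2 * w + 1) * (C * xi x (Suc n) ^ m) = C * xi x 1 ^ m * (1 / N powr (2 * w + 2 * of_nat m + 1))" for C m
    proof -
      have "N powr (2 * w + 2 * of_nat m + 1) = N powr (2 * w + 1 + of_nat (2 * m))" by (simp add: algebra_simps)
      also have "\<dots> = N powr (2 * w + 1) * N ^ (2 * m)" unfolding powr_add using N by (simp only: powr_nat' simp_thms)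
      finally have p: "N powr (2 * w + 2 * of_nat m + 1) = N powr (2 * w + 1) * N ^ (2 * m)" .
      show ?thesis unfolding p xe power_divide power_mult[symmetric] by simp
    qed
    thus ?thesis unfolding F_term_def N_def[symmetric] right_diff_distrib sum_distrib_left by simp
  qed
  have "(\<lambda>n. F_term x a d M w (Suc n)) sums (hyp_sum x a d w -
     (\<Sum>m<M. hyp_coeff (1/2 + w) (a + w) d m * xi x 1 ^ m * riemann_zeta (2 * w + 2 * of_nat m + 1)))"
    unfolding t by (intro sums_diff sums_sum h z)
  thus ?thesis by (rule sums_unique[symmetric])
qed

lemma Gamma_hyp_coeff:
  assumes "1/2 + w \<notin> \<int>\<^sub>\<le>\<^sub>0" "a + w \<notin> \<int>\<^sub>\<le>\<^sub>0" "d \<notin> \<int>\<^sub>\<le>\<^sub>0"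
  shows "Gamma (w + 1/2) * Gamma (a + w) * rGamma d * hyp_coeff (1/2 + w) (a + w) d m =
     Gamma (w + 1/2 + of_nat m) * Gamma (a + w + of_nat m) * rGamma (d + of_nat m) / fact m"
proof -
  have c: "1/2 + w = w + 1/2" by simp
  have 1: "pochhammer (w + 1/2) m * Gamma (w + 1/2) = Gamma (w + 1/2 + of_nat m)"
    using assms(1) pochhammer_Gamma[of "w + 1/2" m] by (simp add: c Gamma_eq_zero_iff)
  have 2: "pochhammer (a + w) m * Gamma (a + w) = Gamma (a + w + of_nat m)"
    using assms(2) pochhammer_Gamma[of "a + w" m] by (simp add: Gamma_eq_zero_iff)
  have 3: "rGamma d / pochhammer d m = rGamma (d + of_nat m)"
    using assms(3) pochhammer_rGamma[of d m] by (auto simp: pochhammer_eq_0_iff)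
  have "G * H * r * (p * q / (s * f)) = (p * G) * (q * H) * (r / s) / f" for G H r p q s f :: complex by simp
  from this[of "Gamma (w + 1/2)"] show ?thesis unfolding hyp_coeff_def c 1[symmetric] 2[symmetric] 3[symmetric] by blast
qed

text \<open>For Re w > 0 the zeta terms restore exactly what was subtracted, so the value is the
  same for every M. This ties the continued form to \<open>main_identity\<close>.\<close>

lemma regular_part_eq:
  assumes x: "Re x > 0" and w: "Re w > 0" "a + w \<notin> \<int>\<^sub>\<le>\<^sub>0" and d: "d \<notin> \<int>\<^sub>\<le>\<^sub>0"
  shows "regular_part x a d M w = 1 / of_real (sqrt pi) * (x / (2 * of_real pi)) powr (2 * w) *
     (Gamma (w + 1/2) * Gamma (a + w) * rGamma d) * hyp_sum x a d w"
proof -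
  have h: "1/2 + w \<notin> \<int>\<^sub>\<le>\<^sub>0" using w by (intro Re_pos_not_nonpos_Int) simp
  define g where "g = Gamma (w + 1/2) * Gamma (a + w) * rGamma d"
  have E: "g * (\<Sum>m<M. hyp_coeff (1/2 + w) (a + w) d m * xi x 1 ^ m * riemann_zeta (2 * w + 2 * of_nat m + 1)) =
     (\<Sum>m<M. Gamma (w + 1/2 + of_nat m) * Gamma (a + w + of_nat m) * rGamma (d + of_nat m) *
            riemann_zeta (2 * w + 2 * of_nat m + 1) / fact m * xi x 1 ^ m)"
    unfolding sum_distrib_left
  proof (rule sum.cong[OF refl])
    fix m
    have "g * (c * X * Z) = (g * c) * X * Z" for c X Z by simp
    from this[of "hyp_coeff (1/2 + w) (a + w) d m"]
    show "g * (hyp_coeff (1/2 + w) (a + w) d m * xi x 1 ^ m * riemann_zeta (2 * w + 2 * of_nat m + 1)) =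
      Gamma (w + 1/2 + of_nat m) * Gamma (a + w + of_nat m) * rGamma (d + of_nat m) *
            riemann_zeta (2 * w + 2 * of_nat m + 1) / fact m * xi x 1 ^ m"
      unfolding g_def Gamma_hyp_coeff[OF h w(2) d] by simp
  qed
  have "regular_part x a d M w = 1 / of_real (sqrt pi) * (x / (2 * of_real pi)) powr (2 * w) *
     (g * (hyp_sum x a d w - (\<Sum>m<M. hyp_coeff (1/2 + w) (a + w) d m * xi x 1 ^ m * riemann_zeta (2 * w + 2 * of_nat m + 1)))
      + g * (\<Sum>m<M. hyp_coeff (1/2 + w) (a + w) d m * xi x 1 ^ m * riemann_zeta (2 * w + 2 * of_nat m + 1)))"
    unfolding regular_part_def F_term_sum_split[OF x w(1) d] g_def[symmetric] E ..
  also have "\<dots> = 1 / of_real (sqrt pi) * (x / (2 * of_real pi)) powr (2 * w) * g * hyp_sum x a d w"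
  proof -
    have "c * (g * (h - s) + g * s) = c * g * h" for c h s :: complex by (simp add: algebra_simps)
    thus ?thesis .
  qed
  finally show ?thesis by (simp add: g_def)
qed


section \<open>Contiguity and analytic continuation\<close>

text \<open>The counterpart of \<open>Phi_contiguous_c\<close> for the right side. Coefficients are
  compared in the unit disc, the factor \<xi> shifting the index, and uniqueness of the continuation
  does the rest.\<close>

lemma hyp_lower_c:
  assumes d1: "d - 1 \<notin> \<int>\<^sub>\<le>\<^sub>0" and \<xi>: "\<xi> \<in> slit_plane"
  shows "(d - 1) * hyp \<alpha> b (d - 1) \<xi> = (d - 1) * hyp \<alpha> b d \<xi> + \<xi> * (\<alpha> * b / d) * hyp (\<alpha> + 1) (b + 1) (d + 1) \<xi>"
proof -
  have d: "d \<notin> \<int>\<^sub>\<le>\<^sub>0" "d + 1 \<notin> \<int>\<^sub>\<le>\<^sub>0" and nz: "d - 1 \<noteq> 0" "d \<noteq> 0"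
    using d1 nonpos_Int_add_nat[of "d - 1" 1] nonpos_Int_add_nat[of "d - 1" 2] by (auto simp: add.commute[of 1 d])
  define f where "f \<zeta> = hyp \<alpha> b d \<zeta> + \<zeta> * (\<alpha> * b / d) / (d - 1) * hyp (\<alpha> + 1) (b + 1) (d + 1) \<zeta>" for \<zeta>
  have "is_hyp \<alpha> b (d - 1) f" unfolding is_hyp_def
  proof (intro conjI allI impI)
    show "f holomorphic_on slit_plane" unfolding f_def [abs_def] using nz hyp_is_hyp[OF d(1)] hyp_is_hyp[OF d(2)]
      unfolding is_hyp_def by (intro holomorphic_intros) auto
    fix \<zeta> :: complex assume \<zeta>: "norm \<zeta> < 1"
    have F: "(\<lambda>n. hyp_coeff \<alpha> b d (Suc n) * \<zeta> ^ Suc n) sums (hyp \<alpha> b d \<zeta> - 1)"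
      using hyp_sums[OF d(1) \<zeta>, of \<alpha> b] by (subst sums_Suc_iff) (auto simp: hyp_coeff_def)
    have "(\<lambda>n. hyp_coeff \<alpha> b d (Suc n) * \<zeta> ^ Suc n + \<zeta> * (\<alpha> * b / d) / (d - 1) * (hyp_coeff (\<alpha> + 1) (b + 1) (d + 1) n * \<zeta> ^ n))
        sums (hyp \<alpha> b d \<zeta> - 1 + \<zeta> * (\<alpha> * b / d) / (d - 1) * hyp (\<alpha> + 1) (b + 1) (d + 1) \<zeta>)"
      by (intro sums_add sums_mult F hyp_sums d \<zeta>)
    moreover have "hyp_coeff \<alpha> b d (Suc n) * \<zeta> ^ Suc n + \<zeta> * (\<alpha> * b / d) / (d - 1) * (hyp_coeff (\<alpha> + 1) (b + 1) (d + 1) n * \<zeta> ^ n)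
        = hyp_coeff \<alpha> b (d - 1) (Suc n) * \<zeta> ^ Suc n" for n
    proof -
      define p where "p = pochhammer (\<alpha> + 1) n * pochhammer (b + 1) n * \<alpha> * b"
      define q where "q = pochhammer (d + 1) n"
      have q: "q \<noteq> 0" unfolding q_def using d(2) by (auto simp: pochhammer_eq_0_iff)
      have dn: "d + of_nat n \<noteq> 0" using nonpos_Int_add_nat[of d n] d(1) by auto
      have c1: "hyp_coeff \<alpha> b d (Suc n) = p / (d * q * (of_nat (Suc n) * fact n))"
        unfolding hyp_coeff_def p_def q_def pochhammer_rec fact_Suc by (simp only: mult_ac of_nat_Suc of_nat_add of_nat_1)
      have c2: "hyp_coeff (\<alpha> + 1) (b + 1) (d + 1) n * (\<alpha> * b) = p / (q * fact n)"
        unfolding hyp_coeff_def p_def q_def by simp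
      have "pochhammer (d - 1) (Suc n) * (d + of_nat n) = (d - 1) * (d * q)"
      proof -
        have "pochhammer (d - 1) (Suc n) = (d - 1) * pochhammer d n" by (simp add: pochhammer_rec)
        moreover have "pochhammer d n * (d + of_nat n) = d * q" using pochhammer_rec[of d n] pochhammer_rec'[of d n] by (simp add: q_def mult_ac)
        ultimately show ?thesis by (simp only: mult.assoc)
      qed
      hence "pochhammer (d - 1) (Suc n) = (d - 1) * (d * q) / (d + of_nat n)" using dn by (simp add: field_simps)
      hence c3: "hyp_coeff \<alpha> b (d - 1) (Suc n) = p * (d + of_nat n) / ((d - 1) * d * q * (of_nat (Suc n) * fact n))"
        unfolding hyp_coeff_def p_def pochhammer_rec[of \<alpha>] pochhammer_rec[of b] fact_Suc by (simp only: mult_ac divide_divide_eq_right times_divide_eq_right times_divide_eq_left of_nat_Suc of_nat_add of_nat_1 divide_divide_eq_left)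
      have g: "P / (D * Q * (N * F)) * (Z * X) + Z * (B / D) / E * (H * X) = P * (E + N) / (E * D * Q * (N * F)) * (Z * X)"
        if "H * B = P / (Q * F)" "D \<noteq> 0" "Q \<noteq> 0" "N \<noteq> 0" "F \<noteq> 0" "E \<noteq> 0" for P D Q N F Z X B E H :: complex
      proof -
        have "Z * (B / D) / E * (H * X) = (H * B) * Z * X / (D * E)" by simp
        also have "\<dots> = P / (Q * F) * Z * X / (D * E)" unfolding that(1) ..
        finally show ?thesis using that(2-) by (simp add: field_simps)
      qed
      have N: "of_nat (Suc n) \<noteq> (0::complex)" by (rule of_nat_neq_0)
      have dN: "d + of_nat n = d - 1 + of_nat (Suc n)" by simp
      show ?thesis unfolding c1 c3 power_Suc dN by (rule g[OF c2 nz(2) q N _ nz(1)]) simp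
    qed
    ultimately have "(\<lambda>n. hyp_coeff \<alpha> b (d - 1) (Suc n) * \<zeta> ^ Suc n) sums (f \<zeta> - 1)" by (simp add: f_def algebra_simps)
    thus "(\<lambda>n. hyp_coeff \<alpha> b (d - 1) n * \<zeta> ^ n) sums f \<zeta>"
      by (subst (asm) sums_Suc_iff) (auto simp: hyp_coeff_def)
  qed
  from hyp_eqI[OF this \<xi>] show ?thesis using nz by (simp add: f_def distrib_left)
qed

lemma hyp_sum_sums:
  assumes "d \<notin> \<int>\<^sub>\<le>\<^sub>0" "Re z > 0"
  shows "(\<lambda>n. 1 / of_nat (Suc n) powr (2 * z + 1) * hyp (1/2 + z) (a + z) d (xi x (Suc n))) sums hyp_sum x a d z"
proof -
  have "summable (\<lambda>n. F_term x a d 0 z (Suc n))" using assms by (intro F_term_summable) auto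
  thus ?thesis unfolding hyp_sum_def F_term_def by (intro summable_sums) simp
qed

text \<open>The factor \<xi>_n equals -(x / (2 pi))^2 / n^2, and n^(-2) changes the weight n^(-2 z -
  1) into that of z + 1, in step with the parameters 1/2 + z and a + z.\<close>

lemma hyp_sum_lower_c:
  assumes x: "Re x > 0" and d1: "d - 1 \<notin> \<int>\<^sub>\<le>\<^sub>0" and z: "Re z > 0"
  shows "(d - 1) * hyp_sum x a (d - 1) z = (d - 1) * hyp_sum x a d z
     - (x / (2 * of_real pi))\<^sup>2 * ((z + 1/2) * (a + z) / d) * hyp_sum x a (d + 1) (z + 1)"
proof -
  have d: "d \<notin> \<int>\<^sub>\<le>\<^sub>0" "d + 1 \<notin> \<int>\<^sub>\<le>\<^sub>0"
    using d1 nonpos_Int_add_nat[of "d - 1" 1] nonpos_Int_add_nat[of "d - 1" 2] by (auto simp: add.commute[of 1 d])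
  define h where "h d z n = hyp (1/2 + z) (a + z) d (xi x (Suc n))" for d z n
  define N where "N n = complex_of_nat (Suc n)" for n
  have N: "N n \<noteq> 0" for n unfolding N_def by (rule of_nat_neq_0)
  have S: "(\<lambda>n. 1 / N n powr (2 * z + 1) * h d z n) sums hyp_sum x a d z" if "d \<notin> \<int>\<^sub>\<le>\<^sub>0" "Re z > 0" for d z
    unfolding N_def h_def by (rule hyp_sum_sums[OF that])
  have z1: "Re (z + 1) > 0" using z by simp
  have xs: "xi x (Suc n) \<in> slit_plane" for n using xi_in_slit_plane[OF x, of 1 n] by simp
  have e: "(d - 1) * (1 / N n powr (2 * z + 1) * h (d - 1) z n) = (d - 1) * (1 / N n powr (2 * z + 1) * h d z n)
     - (x / (2 * of_real pi))\<^sup>2 * ((z + 1/2) * (a + z) / d) * (1 / N n powr (2 * (z + 1) + 1) * h (d + 1) (z + 1) n)" for n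
  proof -
    have s: "1/2 + (z + 1) = 1/2 + z + 1" "a + (z + 1) = a + z + 1" "z + 1/2 = 1/2 + z" by simp_all
    have L: "(d - 1) * h (d - 1) z n = (d - 1) * h d z n + xi x (Suc n) * ((1/2 + z) * (a + z) / d) * h (d + 1) (z + 1) n"
      unfolding h_def s by (rule hyp_lower_c[OF d1 xs])
    have "N n powr (2 * (z + 1) + 1) = N n powr (2 * z + 1 + of_nat 2)" by (simp add: algebra_simps)
    also have "\<dots> = N n powr (2 * z + 1) * N n ^ 2" unfolding powr_add using N by (simp only: powr_nat' simp_thms)
    finally have p: "N n powr (2 * (z + 1) + 1) = N n powr (2 * z + 1) * N n ^ 2" .
    have X: "xi x (Suc n) = - ((x / (2 * of_real pi))\<^sup>2 / N n ^ 2)"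
      unfolding xi_def N_def[symmetric] by (simp add: power_divide power_mult_distrib)
    have "D * (1 / P * A) = D * (1 / P * B) - X * C * (1 / (P * M) * E)" if "D * A = D * B + - (X / M) * C * E"
      for D P A B X C M E :: complex
    proof -
      have "D * (1 / P * A) = 1 / P * (D * A)" by simp
      also have "\<dots> = 1 / P * (D * B + - (X / M) * C * E)" unfolding that ..
      finally show ?thesis by (simp add: divide_inverse algebra_simps)
    qed
    from this[OF L[unfolded X]] show ?thesis unfolding p s .
  qed
  have "(\<lambda>n. (d - 1) * (1 / N n powr (2 * z + 1) * h (d - 1) z n)) sums
     ((d - 1) * hyp_sum x a d z - (x / (2 * of_real pi))\<^sup>2 * ((z + 1/2) * (a + z) / d) * hyp_sum x a (d + 1) (z + 1))"
    unfolding e by (intro sums_diff sums_mult S d z z1)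
  moreover have "(\<lambda>n. (d - 1) * (1 / N n powr (2 * z + 1) * h (d - 1) z n)) sums ((d - 1) * hyp_sum x a (d - 1) z)"
    by (intro sums_mult S d1 z)
  ultimately show ?thesis by (rule sums_unique2[symmetric])
qed

text \<open>Both sides obey the same three-term relation. For the two elementary terms the
  coefficients combine to (d - 1) - z and (d - 1) - (z + 1/2), the very factors that
  \<open>rGamma\<close> acquires when its argument is lowered.\<close>

lemma main_identity_lower_c:
  assumes x: "Re x > 0" and a: "Re a > 1/2" and z: "Re z > 0" and d1: "d - 1 \<notin> \<int>\<^sub>\<le>\<^sub>0"
    and 1: "main_identity x a d z" and 2: "main_identity x a (d + 1) (z + 1)"
  shows "main_identity x a (d - 1) z"
proof -
  have np: "a \<notin> \<int>\<^sub>\<le>\<^sub>0" "a + z \<notin> \<int>\<^sub>\<le>\<^sub>0" using a z by (auto intro!: Re_pos_not_nonpos_Int)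
  have nz: "d \<noteq> 0" using d1 nonpos_Int_add_nat[of "d - 1" 1] by auto
  have x0: "x / (2 * of_real pi) \<noteq> 0" using x by auto
  define H where "H = hyp_sum x a d z"
  define H1 where "H1 = hyp_sum x a (d + 1) (z + 1)"
  define P where "P = (x / (2 * of_real pi)) powr (2 * z)"
  define r where "r = complex_of_real (sqrt pi)"
  define G where "G = Gamma (z + 1/2)"
  define B where "B = Gamma (a + z)"
  define R where "R = rGamma d"
  define A where "A = Gamma a"
  define A' where "A' = Gamma (a - 1/2)"
  define R0 where "R0 = rGamma (d - z)"
  define R1 where "R1 = rGamma (d - 1/2 - z)"
  define Y where "Y = (x / (2 * of_real pi))\<^sup>2"
  define Gz where "Gz = Gamma z"
  have g1: "Gamma (z + 1 + 1/2) = (z + 1/2) * G"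
    using Gamma_plus1[of "z + 1/2"] z Re_pos_not_nonpos_Int[of "z + 1/2"] by (simp add: G_def add_ac)
  have g2: "Gamma (a + (z + 1)) = (a + z) * B"
    using Gamma_plus1[OF np(2)] by (simp add: B_def add_ac)
  have g3: "Gamma (z + 1) = z * Gz" using Gamma_plus1[of z] Re_pos_not_nonpos_Int[OF z] by (simp add: Gz_def)
  have r1: "rGamma (d + 1) = R / d" using rGamma_plus1[of d] nz by (simp add: R_def eq_divide_eq mult.commute)
  have r2: "rGamma (d - 1) = (d - 1) * R" using rGamma_plus1[of "d - 1"] by (simp add: R_def)
  have r3: "rGamma (d + 1 - (z + 1)) = R0" by (simp add: R0_def)
  have r4: "rGamma (d - 1 - z) = (d - 1 - z) * R0" using rGamma_plus1[of "d - 1 - z"] by (simp add: R0_def algebra_simps)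
  have r5: "rGamma (d + 1 - 1/2 - (z + 1)) = R1" by (simp add: R1_def algebra_simps)
  have r6: "rGamma (d - 1 - 1/2 - z) = (d - 1 - 1/2 - z) * R1"
  proof -
    have "d - 1 - 1/2 - z + 1 = d - 1/2 - z" by simp
    with rGamma_plus1[of "d - 1 - 1/2 - z"] show ?thesis by (simp only: R1_def)
  qed
  have p1: "(x / (2 * of_real pi)) powr (2 * (z + 1)) = P * Y"
  proof -
    have "(x / (2 * of_real pi)) powr (2 * (z + 1)) = (x / (2 * of_real pi)) powr (2 * z + of_nat 2)" by (simp add: algebra_simps)
    also have "\<dots> = P * Y" unfolding powr_add P_def Y_def using x0 by (simp only: powr_nat' simp_thms)
    finally show ?thesis .
  qed
  have L: "(d - 1) * hyp_sum x a (d - 1) z = (d - 1) * H - Y * ((z + 1/2) * (a + z) / d) * H1"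
    unfolding H_def H1_def Y_def by (rule hyp_sum_lower_c[OF x d1 z])
  have S1: "(\<lambda>n. Phi a z (d - z) (of_nat (Suc n) * x)) sums (1 / r * P * (G * B * R) * H - Gz * A * R0 / 2 + r * A' * G * R1 / x)"
    using 1 unfolding main_identity_def H_def P_def r_def G_def B_def R_def A_def A'_def R0_def R1_def Gz_def .
  have S2: "(\<lambda>n. Phi a (z + 1) (d + 1 - (z + 1)) (of_nat (Suc n) * x)) sums
     (1 / r * (P * Y) * ((z + 1/2) * G * ((a + z) * B) * (R / d)) * H1 - z * Gz * A * R0 / 2 + r * A' * ((z + 1/2) * G) * R1 / x)"
    using 2 unfolding main_identity_def g1 g2 g3 r1 r3 r5 p1 H1_def[symmetric] r_def[symmetric] A_def[symmetric] A'_def[symmetric] .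
  have "Phi a z (d - 1 - z) (of_nat (Suc n) * x) = (d - 1) * Phi a z (d - z) (of_nat (Suc n) * x) - Phi a (z + 1) (d + 1 - (z + 1)) (of_nat (Suc n) * x)" for n
  proof -
    have "Re (of_nat (Suc n) * x) > 0" using x by (simp del: of_nat_Suc)
    from Phi_contiguous_c[OF np this, of "d - z"]
    have "Phi a z (d - z - 1) (of_nat (Suc n) * x) = (d - z - 1 + z) * Phi a z (d - z) (of_nat (Suc n) * x) - Phi a (z + 1) (d - z) (of_nat (Suc n) * x)" .
    moreover have "d - z - 1 = d - 1 - z" "d - 1 - z + z = d - 1" "d + 1 - (z + 1) = d - z" by simp_all
    ultimately show ?thesis by (simp only:)
  qed
  hence "(\<lambda>n. Phi a z (d - 1 - z) (of_nat (Suc n) * x)) sums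
     ((d - 1) * (1 / r * P * (G * B * R) * H - Gz * A * R0 / 2 + r * A' * G * R1 / x) -
      (1 / r * (P * Y) * ((z + 1/2) * G * ((a + z) * B) * (R / d)) * H1 - z * Gz * A * R0 / 2 + r * A' * ((z + 1/2) * G) * R1 / x))"
    using sums_diff[OF sums_mult[OF S1, of "d - 1"] S2] by (simp only:)
  also have "(d - 1) * (1 / r * P * (G * B * R) * H - Gz * A * R0 / 2 + r * A' * G * R1 / x) -
      (1 / r * (P * Y) * ((z + 1/2) * G * ((a + z) * B) * (R / d)) * H1 - z * Gz * A * R0 / 2 + r * A' * ((z + 1/2) * G) * R1 / x) =
     1 / r * P * (G * B * R) * ((d - 1) * H - Y * ((z + 1/2) * (a + z) / d) * H1) - Gz * A * ((d - 1 - z) * R0) / 2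
       + r * A' * G * ((d - 1 - 1/2 - z) * R1) / x"
  proof -
    \<comment> \<open>Naming the reciprocals turns the claim into a polynomial identity.\<close>
    define v where "v = 1 / r"
    define w where "w = 1 / x"
    define e where "e = 1 / d"
    define h where "h = (1 :: complex) / 2"
    have t: "T / x = T * w" "T / d = T * e" "T / 2 = T * h" for T by (simp_all add: w_def e_def h_def)
    show ?thesis unfolding v_def[symmetric] t by (simp add: algebra_simps)
  qed
  also have "1 / r * P * (G * B * R) * ((d - 1) * H - Y * ((z + 1/2) * (a + z) / d) * H1) = 1 / r * P * (G * B * ((d - 1) * R)) * hyp_sum x a (d - 1) z"
    unfolding L[symmetric] by (simp only: mult_ac)
  finally show ?thesis unfolding main_identity_def r2 r4 r6 r_def P_def G_def B_def A_def A'_def Gz_def .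
qed

section \<open>Passage between the two forms and continuation to Re z > -M\<close>

definition K_identity :: "complex \<Rightarrow> complex \<Rightarrow> complex \<Rightarrow> nat \<Rightarrow> complex \<Rightarrow> bool" where
  "K_identity x a d M w \<longleftrightarrow> 2 * (\<Sum>n. K_term (a - d) (d - 1/2) x w (Suc n)) = 2 powr (a - 1/2 + w) *
     (regular_part x a d M w - Gamma w * Gamma a * rGamma (d - w) / 2
      + of_real (sqrt pi) * Gamma (a - 1/2) * Gamma (w + 1/2) * rGamma (d - 1/2 - w) / x)"

text \<open>For Re z > 0 the regular part is the same for every M, so identities with different
  truncations, including M = 0, can be exchanged through \<open>main_identity\<close>. The 2 in
  front of the sum completes the power of 2 from \<open>K_term_eq_Phi\<close>.\<close>

lemma main_identity_iff:
  assumes x: "Re x > 0" and a: "Re a > 1/2" and d: "d \<notin> \<int>\<^sub>\<le>\<^sub>0" and z: "Re z > 0" "z \<notin> \<int>"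
  shows "main_identity x a d z \<longleftrightarrow> K_identity x a d M z"
proof -
  have az: "a + z \<notin> \<int>\<^sub>\<le>\<^sub>0" using a z by (intro Re_pos_not_nonpos_Int) simp
  define p where "p = (2::complex) powr (a - 1/2 + z)"
  have p: "p \<noteq> 0" by (simp add: p_def)
  define V where "V = regular_part x a d M z - Gamma z * Gamma a * rGamma (d - z) / 2
      + of_real (sqrt pi) * Gamma (a - 1/2) * Gamma (z + 1/2) * rGamma (d - 1/2 - z) / x"
  have e: "1/2 + (d - 1/2) = d" "d + (a - d) = a" "(a - d) + (d - 1/2) = a - 1/2" by simp_all
  have K: "2 * K_term (a - d) (d - 1/2) x z (Suc n) = p * Phi a z (d - z) (of_nat (Suc n) * x)" for n
  proof -
    have "K_term (a - d) (d - 1/2) x z (Suc n) = 2 powr (a - 1/2 + z - 1) * Phi a z (d - z) (of_nat (Suc n) * x)"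
      by (rule K_term_eq_Phi[of x "d - 1/2" "a - d" z n, unfolded e, OF x a d az z(2)])
    moreover have "2 * 2 powr (a - 1/2 + z - 1) = p" unfolding p_def powr_diff by simp
    ultimately show ?thesis by (simp only: mult.assoc[symmetric])
  qed
  have s: "summable (\<lambda>n. K_term (a - d) (d - 1/2) x z (Suc n))"
    by (rule K_term_summable[of x "d - 1/2" "a - d" z, unfolded e, OF x a d az])
  have "summable (\<lambda>n. p * Phi a z (d - z) (of_nat (Suc n) * x))" using summable_mult[OF s, of 2] unfolding K .
  hence sp: "summable (\<lambda>n. Phi a z (d - z) (of_nat (Suc n) * x))" using p by (rule summable_mult_D)
  have "2 * (\<Sum>n. K_term (a - d) (d - 1/2) x z (Suc n)) = p * (\<Sum>n. Phi a z (d - z) (of_nat (Suc n) * x))"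
    unfolding suminf_mult[OF s, symmetric] suminf_mult[OF sp, symmetric] K ..
  hence "K_identity x a d M z \<longleftrightarrow> (\<Sum>n. Phi a z (d - z) (of_nat (Suc n) * x)) = V"
    unfolding K_identity_def V_def[symmetric] p_def[symmetric] using p by simp
  also have "\<dots> \<longleftrightarrow> main_identity x a d z"
    unfolding main_identity_def V_def regular_part_eq[OF x z(1) az d] using sp by (simp only: sums_iff simp_thms)
  finally show ?thesis by blast
qed

text \<open>Both sides of \<open>K_identity\<close> are holomorphic on the connected
  \<open>identity_domain\<close>, so equality on some nonempty open subset of the right half-plane
  spreads to all of it.\<close>

lemma main_identity_imp_K_identity:
  assumes x: "Re x > 0" and a: "Re a > 1/2" and d: "d \<notin> \<int>\<^sub>\<le>\<^sub>0"
    and S: "open S" "S \<noteq> {}" "\<And>w. w \<in> S \<Longrightarrow> Re w > 0 \<and> w \<notin> \<int> \<and> main_identity x a d w"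
    and w: "w \<in> identity_domain a M"
  shows "K_identity x a d M w"
proof -
  note D = identity_domainD[where a = a and M = M]
  define f where "f w = 2 * (\<Sum>n. K_term (a - d) (d - 1/2) x w (Suc n))" for w
  define g where "g w = 2 powr (a - 1/2 + w) *
     (regular_part x a d M w - Gamma w * Gamma a * rGamma (d - w) / 2
      + of_real (sqrt pi) * Gamma (a - 1/2) * Gamma (w + 1/2) * rGamma (d - 1/2 - w) / x)" for w
  have e: "1/2 + (d - 1/2) + (a - d) = a" "1/2 + (d - 1/2) = d" by simp_all
  have "f w = g w"
  proof (rule analytic_continuation_open[where s = S and s' = "identity_domain a M" and f = f and g = g])
    show "S \<subseteq> identity_domain a M"
    proof
      fix v assume "v \<in> S"
      hence v: "Re v > 0" using S(3) by blast
      have "2 * v \<notin> \<int>\<^sub>\<le>\<^sub>0" "a + v \<notin> \<int>\<^sub>\<le>\<^sub>0" using v a by (auto intro!: Re_pos_not_nonpos_Int)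
      thus "v \<in> identity_domain a M" using v by (simp add: identity_domain_def)
    qed
    have "(\<lambda>z. \<Sum>n. K_term (a - d) (d - 1/2) x z (Suc n)) holomorphic_on identity_domain a M"
      by (rule K_sum_holomorphic) (use x a d D(3) in \<open>simp_all add: e\<close>)
    thus "f holomorphic_on identity_domain a M" unfolding f_def [abs_def] by (intro holomorphic_intros)
    have x0: "x \<noteq> 0" using x by auto
    show "g holomorphic_on identity_domain a M" unfolding g_def [abs_def]
      by (intro holomorphic_intros regular_part_holomorphic x d D(4,6)) (use x0 in simp_all)
    show "f v = g v" if "v \<in> S" for v
      using S(3)[OF that] main_identity_iff[OF x a d, of v M] unfolding K_identity_def f_def g_def by blast
  qed (use S w open_identity_domain connected_identity_domain in auto)
  thus ?thesis by (simp add: K_identity_def f_def g_def)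
qed

text \<open>\<open>N\<close> bounds the number of lowerings of \<open>d\<close>. A step at z uses
  the identities at z and at z + 1, so the induction has to run over the whole right half-plane; the
  base case therefore leaves the strip by continuation first.\<close>

lemma main_identity_right_half_plane:
  assumes x: "Re x > 0" and a: "Re a > 1/2"
  shows "d \<notin> \<int>\<^sub>\<le>\<^sub>0 \<Longrightarrow> Re d + real N > Re a + 1/2 \<Longrightarrow> Re z > 0 \<Longrightarrow> z \<notin> \<int> \<Longrightarrow> main_identity x a d z"
proof (induction N arbitrary: d z)
  case 0
  define S where "S = {w. 0 < Re w} \<inter> {w. Re w < 1/2}"
  have S: "open S" unfolding S_def by (intro open_Int open_halfspace_Re_gt open_halfspace_Re_lt)
  have "(1/4 :: complex) \<in> S" by (simp add: S_def)
  hence ne: "S \<noteq> {}" by blast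
  have "Re w > 0 \<and> w \<notin> \<int> \<and> main_identity x a d w" if "w \<in> S" for w
  proof (intro conjI)
    have w: "0 < Re w" "Re w < 1/2" using that by (auto simp: S_def)
    show "Re w > 0" by fact
    show "w \<notin> \<int>"
    proof
      assume "w \<in> \<int>"
      then obtain k where "w = of_int k" by (auto elim: Ints_cases)
      with w have k: "0 < real_of_int k" "real_of_int k < 1/2" by auto
      hence "k \<ge> 1" by simp
      hence "real_of_int k \<ge> 1" by simp
      with k(2) show False by simp
    qed
    \<comment> \<open>Re d > Re a + 1/2 and Re w < 1/2 give Re (d - w) > Re a, the condition for the
      Beta average.\<close>
    show "main_identity x a d w" using w 0(2) by (intro main_identity_on_strip x a) auto
  qed
  moreover have "z \<in> identity_domain a 0"
  proof -
    have "2 * z \<notin> \<int>\<^sub>\<le>\<^sub>0" "a + z \<notin> \<int>\<^sub>\<le>\<^sub>0" using 0(3) a by (auto intro!: Re_pos_not_nonpos_Int)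
    thus ?thesis using 0(3) by (simp add: identity_domain_def)
  qed
  ultimately have "K_identity x a d 0 z" by (intro main_identity_imp_K_identity[OF x a 0(1) S ne])
  thus ?case using main_identity_iff[OF x a 0(1,3,4)] by blast
next
  case (Suc N)
  have d: "d + 1 \<notin> \<int>\<^sub>\<le>\<^sub>0" "d + 1 + 1 \<notin> \<int>\<^sub>\<le>\<^sub>0"
    using Suc.prems(1) nonpos_Int_add_nat[of d 1] nonpos_Int_add_nat[of d 2] by (auto simp: add.assoc)
  have z1: "z + 1 \<notin> \<int>" using Suc.prems(4) by (metis Ints_1 Ints_diff add_diff_cancel_right')
  have "main_identity x a (d + 1) z" using Suc.prems by (intro Suc.IH d) auto
  moreover have "main_identity x a (d + 1 + 1) (z + 1)" using Suc.prems by (intro Suc.IH d z1) auto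
  moreover have "d + 1 - 1 \<notin> \<int>\<^sub>\<le>\<^sub>0" using Suc.prems(1) by simp
  ultimately have "main_identity x a (d + 1 - 1) z" by (intro main_identity_lower_c[OF x a Suc.prems(3)])
  thus ?case by simp
qed

lemma K_identity_on_domain:
  assumes x: "Re x > 0" and a: "Re a > 1/2" and d: "d \<notin> \<int>\<^sub>\<le>\<^sub>0" and w: "w \<in> identity_domain a M"
  shows "K_identity x a d M w"
proof -
  define S where "S = {w. 0 < Re w} - (\<int> :: complex set)"
  have S: "open S" unfolding S_def by (rule open_diff_Ints[OF open_halfspace_Re_gt])
  have "(1/2 :: complex) \<notin> \<int>"
  proof
    assume "(1/2 :: complex) \<in> \<int>"
    then obtain k where k: "(1/2 :: complex) = of_int k" by (auto elim: Ints_cases)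
    hence "(of_int (2 * k) :: complex) = of_int 1" by (simp flip: k)
    hence "2 * k = 1" by (simp only: of_int_eq_iff)
    thus False by presburger
  qed
  hence "(1/2 :: complex) \<in> S" by (simp add: S_def)
  hence ne: "S \<noteq> {}" by blast
  obtain N :: nat where N: "real N > Re a + 1/2 - Re d" using reals_Archimedean2 by blast
  have "Re v > 0 \<and> v \<notin> \<int> \<and> main_identity x a d v" if "v \<in> S" for v
    using that N by (auto simp: S_def intro!: main_identity_right_half_plane[OF x a d, of N])
  thus ?thesis by (rule main_identity_imp_K_identity[OF x a d S ne _ w])
qed

theorem theorem1p7:
  fixes x \<mu> l z :: complex and M :: nat
  assumes "Re x > 0" and "Re (\<mu> + l) > 0" and "M > 0" and "Re z > - real M"
    and "1/2 + l \<notin> \<int>\<^sub>\<le>\<^sub>0" and "1/2 + l + \<mu> + z \<notin> \<int>\<^sub>\<le>\<^sub>0"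
  shows
    "let
       \<xi> = (\<lambda>n::nat. - (x ^ 2) / (4 * of_real pi ^ 2 * of_nat n ^ 2));
       Kterm = (\<lambda>n::nat. (of_nat n * x / 2) powr (z - l) * gen_bessel_K \<mu> z (of_nat n * x) l);
       A = (\<lambda>w. 2 powr (w + \<mu> + l - 1) * Gamma w * Gamma (1/2 + l + \<mu>) / Gamma (1/2 + l - w));
       B = (\<lambda>w. of_real (sqrt pi) * 2 powr (\<mu> + w + l) * Gamma (l + \<mu>) * Gamma (w + 1/2)
                  / (x * Gamma (l - w)));
       Fterm = (\<lambda>w (n::nat). 1 / of_nat n powr (2 * w + 1) *
                  (hyp2F1 (1/2 + w) (1/2 + l + \<mu> + w) (1/2 + l) (\<xi> n)
                   - (\<Sum>m<M. pochhammer (1/2 + w) m * pochhammer (1/2 + l + \<mu> + w) m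
                             / (fact m * pochhammer (1/2 + l) m) * \<xi> n ^ m)));
       R = (\<lambda>w. 2 powr (\<mu> + l - w) / of_real (sqrt pi) * (x / of_real pi) powr (2 * w)
                  * (Gamma (w + 1/2) * Gamma (1/2 + l + \<mu> + w) / Gamma (1/2 + l))
                  * (\<Sum>n. Fterm w (Suc n))
                + 2 powr (\<mu> + l - w) / of_real (sqrt pi) * (x / of_real pi) powr (2 * w)
                  * (\<Sum>m<M. Gamma (w + 1/2 + of_nat m) * Gamma (1/2 + l + \<mu> + w + of_nat m)
                            * riemann_zeta (2 * w + 2 * of_nat m + 1)
                            / (fact m * Gamma (1/2 + l + of_nat m))
                            * (- (x ^ 2) / (4 * of_real pi ^ 2)) ^ m))
     in summable (\<lambda>n. Kterm (Suc n)) \<and> summable (\<lambda>n. Fterm z (Suc n)) \<and>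
        (if z \<in> (\<lambda>k. - of_nat k / 2) ` {..<2 * M}
         then ((\<lambda>w. R w - A w + B w) \<longlongrightarrow> 2 * (\<Sum>n. Kterm (Suc n))) (at z)
         else 2 * (\<Sum>n. Kterm (Suc n)) + A z - B z = R z)"
  proof -
  define a where "a = 1/2 + l + \<mu>"
  define d where "d = 1/2 + l"
  have x: "Re x > 0" by fact
  have a: "Re a > 1/2" "Re (1/2 + l + \<mu>) > 1/2" using assms(2) by (simp_all add: a_def)
  have d: "d \<notin> \<int>\<^sub>\<le>\<^sub>0" using assms(5) by (simp add: d_def)
  have az: "a + z \<notin> \<int>\<^sub>\<le>\<^sub>0" using assms(6) by (simp add: a_def)
  have ad: "a - d = \<mu>" "d - 1/2 = l" "a - 1/2 = l + \<mu>" by (simp_all add: a_def d_def)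
  define \<xi> where "\<xi> = (\<lambda>n::nat. - (x ^ 2) / (4 * of_real pi ^ 2 * of_nat n ^ 2))"
  define Kterm where "Kterm = (\<lambda>n::nat. (of_nat n * x / 2) powr (z - l) * gen_bessel_K \<mu> z (of_nat n * x) l)"
  define A where "A = (\<lambda>w. 2 powr (w + \<mu> + l - 1) * Gamma w * Gamma (1/2 + l + \<mu>) / Gamma (1/2 + l - w))"
  define B where "B = (\<lambda>w. of_real (sqrt pi) * 2 powr (\<mu> + w + l) * Gamma (l + \<mu>) * Gamma (w + 1/2) / (x * Gamma (l - w)))"
  define Fterm where "Fterm = (\<lambda>w (n::nat). 1 / of_nat n powr (2 * w + 1) *
    (hyp2F1 (1/2 + w) (1/2 + l + \<mu> + w) (1/2 + l) (\<xi> n)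
     - (\<Sum>m<M. pochhammer (1/2 + w) m * pochhammer (1/2 + l + \<mu> + w) m / (fact m * pochhammer (1/2 + l) m) * \<xi> n ^ m)))"
  define R where "R = (\<lambda>w. 2 powr (\<mu> + l - w) / of_real (sqrt pi) * (x / of_real pi) powr (2 * w)
      * (Gamma (w + 1/2) * Gamma (1/2 + l + \<mu> + w) / Gamma (1/2 + l)) * (\<Sum>n. Fterm w (Suc n))
    + 2 powr (\<mu> + l - w) / of_real (sqrt pi) * (x / of_real pi) powr (2 * w)
      * (\<Sum>m<M. Gamma (w + 1/2 + of_nat m) * Gamma (1/2 + l + \<mu> + w + of_nat m)
                * riemann_zeta (2 * w + 2 * of_nat m + 1) / (fact m * Gamma (1/2 + l + of_nat m))
                * (- (x ^ 2) / (4 * of_real pi ^ 2)) ^ m))"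
  have \<xi>: "\<xi> n = xi x n" for n by (simp add: \<xi>_def xi_def)
  have xs: "xi x (Suc n) \<in> slit_plane" for n using xi_in_slit_plane[OF x, of 1 n] by simp
  have F: "Fterm w (Suc n) = F_term x a d M w (Suc n)" for w n
    unfolding Fterm_def F_term_def \<xi> hyp_coeff_def a_def[symmetric] unfolding d_def[symmetric] hyp2F1_eq_hyp[OF xs d]
    by (simp only: mult.commute[of "fact _" "pochhammer d _"])
  have K: "Kterm n = K_term \<mu> l x z n" for n by (simp add: Kterm_def K_term_def)
  \<comment> \<open>At a pole of Gamma both sides are 0: there the value of Gamma is 0 by
    convention, and so is the quotient by it.\<close>
  have q: "u / Gamma v = u * rGamma v" for u v :: complex by (simp add: rGamma_inverse_Gamma divide_inverse)
  have A: "A w = 2 powr (l + \<mu> + w) * (Gamma w * Gamma a * rGamma (d - w) / 2)" for w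
  proof -
    have e: "2 powr (w + \<mu> + l - 1) = (2::complex) powr (l + \<mu> + w) / 2"
      using powr_diff[of 2 "l + \<mu> + w" 1] by (simp add: add_ac)
    have "p / 2 * G * H * r = p * (G * H * r / 2)" for p G H r :: complex by simp
    thus ?thesis unfolding A_def q a_def[symmetric] unfolding d_def[symmetric] e .
  qed
  have B: "B w = 2 powr (l + \<mu> + w) * (of_real (sqrt pi) * Gamma (a - 1/2) * Gamma (w + 1/2) * rGamma (d - 1/2 - w) / x)" for w
  proof -
    have e: "\<mu> + w + l = l + \<mu> + w" by simp
    have "r * p * G * H / (x * g) = p * (r * G * H * inverse g / x)" for r p G H g :: complex by (simp add: divide_inverse)
    thus ?thesis unfolding B_def e ad rGamma_inverse_Gamma .
  qed
  have R: "R w = 2 powr (l + \<mu> + w) * regular_part x a d M w" for w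
  proof -
    have "x / of_real pi = 2 * (x / (2 * of_real pi))" by simp
    hence X: "(x / of_real pi) powr (2 * w) = 2 powr (2 * w) * (x / (2 * of_real pi)) powr (2 * w)"
      using powr_times_real_left[of 2 "x / (2 * of_real pi)" "2 * w"] by simp
    have T: "(2::complex) powr (\<mu> + l - w) * 2 powr (2 * w) = 2 powr (l + \<mu> + w)"
      unfolding powr_add[symmetric] by (simp add: algebra_simps)
    have "u / r * (v * y) = (u * v) * (1 / r * y)" for u v r y :: complex by simp
    hence P: "2 powr (\<mu> + l - w) / of_real (sqrt pi) * (x / of_real pi) powr (2 * w) =
       2 powr (l + \<mu> + w) * (1 / of_real (sqrt pi) * (x / (2 * of_real pi)) powr (2 * w))"
      unfolding X T[symmetric] .
    have x1: "xi x 1 = - (x ^ 2) / (4 * of_real pi ^ 2)" by (simp add: xi_def)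
    have t: "u * v * t / (f * g) * y = u * v * inverse g * t / f * y" for u v t f g y :: complex
      by (simp add: divide_inverse)
    have s: "(\<Sum>m<M. Gamma (w + 1/2 + of_nat m) * Gamma (a + w + of_nat m) * riemann_zeta (2 * w + 2 * of_nat m + 1)
        / (fact m * Gamma (d + of_nat m)) * (- (x ^ 2) / (4 * of_real pi ^ 2)) ^ m) =
       (\<Sum>m<M. Gamma (w + 1/2 + of_nat m) * Gamma (a + w + of_nat m) * rGamma (d + of_nat m) *
            riemann_zeta (2 * w + 2 * of_nat m + 1) / fact m * xi x 1 ^ m)"
      unfolding x1 rGamma_inverse_Gamma by (intro sum.cong refl t)
    have "p * c * g * S + p * c * U = p * (c * (g * S + U))" for p c g S U :: complex by (simp add: algebra_simps)
    thus ?thesis unfolding R_def regular_part_def F a_def[symmetric] unfolding d_def[symmetric] s P q .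
  qed
  have RAB: "R w - A w + B w = 2 * (\<Sum>n. K_term \<mu> l x w (Suc n))" if "w \<in> identity_domain a M" for w
  proof -
    have g: "p * r - p * u + p * v = p * (r - u + v)" for p r u v :: complex by (simp add: algebra_simps)
    show ?thesis unfolding R A B ad g by (rule K_identity_on_domain[OF x a(1) d that, unfolded K_identity_def ad, symmetric])
  qed
  \<comment> \<open>Since Re z > -M, a non-positive integer 2 z must be one of the finitely many
    listed points; at every other z the equation itself is available.\<close>
  have pole: "z \<in> (\<lambda>k. - of_nat k / 2) ` {..<2 * M}" if "2 * z \<in> \<int>\<^sub>\<le>\<^sub>0"
  proof -
    from that obtain k :: int where k: "2 * z = of_int k" "k \<le> 0" by (auto elim!: nonpos_Ints_cases)
    define j where "j = nat (- k)"
    have j: "complex_of_nat j = - of_int k" using k(2) by (simp add: j_def of_nat_nat)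
    have z: "z = - of_nat j / 2" unfolding j using k(1) by (simp add: field_simps)
    hence "Re z = - (real j / 2)" by simp
    hence "j < 2 * M" using assms(4) by simp
    thus ?thesis using z by blast
  qed
  have "summable (\<lambda>n. Kterm (Suc n))"
    unfolding K using K_term_summable[OF x a(2) assms(5,6)] .
  moreover have "summable (\<lambda>n. Fterm z (Suc n))" unfolding F by (rule F_term_summable[OF d assms(4)])
  \<comment> \<open>The sum on the left is continuous at z even where single terms of the right side
    have poles, so it is the limit of the right side through nearby points of the domain.\<close>
  moreover have "((\<lambda>w. R w - A w + B w) \<longlongrightarrow> 2 * (\<Sum>n. Kterm (Suc n))) (at z)"
  proof -
    define U where "U = {w. a + w + of_nat 0 \<notin> (\<int>\<^sub>\<le>\<^sub>0 :: complex set)}"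
    have U: "open U" "z \<in> U" using open_shifted_compl_nonpos_Ints[of a 0] az by (auto simp: U_def)
    have "(\<lambda>w. \<Sum>n. K_term \<mu> l x w (Suc n)) holomorphic_on U"
      by (rule K_sum_holomorphic[OF x a(2) assms(5)]) (simp add: U_def a_def)
    hence "isCont (\<lambda>w. \<Sum>n. K_term \<mu> l x w (Suc n)) z"
      using U holomorphic_on_imp_continuous_on continuous_on_eq_continuous_at by blast
    hence lim: "((\<lambda>w. 2 * (\<Sum>n. K_term \<mu> l x w (Suc n))) \<longlongrightarrow> 2 * (\<Sum>n. Kterm (Suc n))) (at z)"
      unfolding K by (intro tendsto_mult tendsto_const) (simp add: isCont_def)
    have "eventually (\<lambda>w. w \<in> U) (at z)" by (rule eventually_at_in_open'[OF U])
    moreover have "eventually (\<lambda>w. w \<in> {w. Re w > - real M}) (at z)"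
      using assms(4) by (intro eventually_at_in_open' open_halfspace_Re_gt) simp
    \<comment> \<open>Keeping 2 w off all integers, which is possible on a punctured neighbourhood,
      avoids every pole of Gamma w, Gamma (w + 1/2) and the zeta factors at once.\<close>
    moreover have "eventually (\<lambda>w. 2 * w \<notin> \<int>) (at z)"
    proof -
      have "filterlim (\<lambda>w. 2 * w) (at (2 * z)) (at z)"
        by (intro filterlim_atI tendsto_intros) (simp add: eventually_at_filter)
      with eventually_avoids_Ints show ?thesis by (rule eventually_compose_filterlim)
    qed
    ultimately have "eventually (\<lambda>w. 2 * (\<Sum>n. K_term \<mu> l x w (Suc n)) = R w - A w + B w) (at z)"
    proof eventually_elim
      case (elim w)
      hence "w \<in> identity_domain a M" using nonpos_Ints_Int by (auto simp: identity_domain_def U_def)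
      from RAB[OF this] show ?case by (rule sym)
    qed
    with lim show ?thesis by (rule Lim_transform_eventually)
  qed
  moreover have "2 * (\<Sum>n. Kterm (Suc n)) + A z - B z = R z" if "z \<notin> (\<lambda>k. - of_nat k / 2) ` {..<2 * M}"
  proof -
    have "z \<in> identity_domain a M" using pole that az assms(4) by (auto simp: identity_domain_def)
    from RAB[OF this] show ?thesis unfolding K by (simp add: algebra_simps)
  qed
  ultimately have "summable (\<lambda>n. Kterm (Suc n)) \<and> summable (\<lambda>n. Fterm z (Suc n)) \<and>
    (if z \<in> (\<lambda>k. - of_nat k / 2) ` {..<2 * M} then ((\<lambda>w. R w - A w + B w) \<longlongrightarrow> 2 * (\<Sum>n. Kterm (Suc n))) (at z)
     else 2 * (\<Sum>n. Kterm (Suc n)) + A z - B z = R z)" by simp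
  thus ?thesis unfolding Let_def Kterm_def A_def B_def R_def Fterm_def \<xi>_def .
qed


end
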